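(* Let $n\ge1$. The set of ordered Kostant monomials is a $\mathbb Z$-basis for $R_{\mathbb Z}$ and a $\Bbbk$-basis for $R$, and the map $\rho:R\to U(\mathfrak p(n))$ is an isomorphism of $\Bbbk$-superalgebras.
   Context: $\Bbbk$ is an algebraically closed field of characteristic zero; everything is $\mathbb Z_2$-graded, and $[x,y]=xy-(-1)^{|x||y|}yx$ for homogeneous $x,y$ in an associative superalgebra. $\mathfrak p(n)\subset\mathfrak{gl}(n|n)$ is the Lie superalgebra of matrices $\begin{bmatrix}A&B\\C&-A^T\end{bmatrix}$ with $n\times n$ blocks, $B$ symmetric, $C$ skew-symmetric, rows and columns indexed by $1,\dots,n,-1,\dots,-n$. Basis: $a_{i,j}=E_{i,j}-E_{-j,-i}$ ($1\le i,j\le n$), $b_{i,j}=2^{-\delta_{i,j}}(E_{i,-j}+E_{j,-i})$ ($i\le j$), $c_{i,j}=E_{-i,j}-E_{-j,i}$ ($i<j$). Put $\mathfrak g_0=\mathrm{span}(a_{i,j})\cong\mathfrak{gl}(n)$, $\mathfrak g_1=\mathrm{span}(b_{i,j})$, $\mathfrak g_{-1}=\mathrm{span}(c_{i,j})$. On $\bigoplus_{i=1}^n\mathbb Z\varepsilon_i$ let $(\varepsilon_i,\varepsilon_j)=\delta_{i,j}$; $\alpha_i=\varepsilon_i-\varepsilon_{i+1}$, $\beta_i=\varepsilon_i+\varepsilon_{i+1}$, $\gamma_i=-(\varepsilon_i+\varepsilon_{i+1})$, $\beta_{1,1}=2\varepsilon_1$. $R=R_n$ is the associative unital $\Bbbk$-superalgebra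 with even generators $E_1,\dots,E_{n-1},F_1,\dots,F_{n-1},H_1,\dots,H_n$, odd generators $B_{1,1},B_1,\dots,B_{n-1},C_1,\dots,C_{n-1}$, and relations (for all admissible indices): $[H_i,H_j]=0$; $[H_i,E_j]=(\varepsilon_i,\alpha_j)E_j$; $[H_i,F_j]=-(\varepsilon_i,\alpha_j)F_j$; $[E_i,F_j]=\delta_{i,j}(H_i-H_{i+1})$; $[E_i,E_j]=[F_i,F_j]=0$ if $j\ne i\pm1$; $[E_i,[E_i,E_j]]=[F_i,[F_i,F_j]]=0$ if $j=i\pm1$; $[B_i,B_j]=[C_i,C_j]=0$; $[H_i,B_j]=(\varepsilon_i,\beta_j)B_j$; $[H_i,C_j]=(\varepsilon_i,\gamma_j)C_j$; $[B_i,C_j]=-H_i+H_{i+1}$ if $j=i$, $=[F_{i-1},F_i]$ if $j=i-1$, $=[E_i,E_{i+1}]$ if $j=i+1$, $=0$ otherwise; $[B_i,F_j]=0$ if $j\ne i,i+1$; $[B_i,E_j]=0$ if $j\ne i,i-1$; $[B_i,F_i]=[B_{i+1},E_{i+1}]$; $[B_i,F_{i+1}]=[B_{i+1},E_i]$; $[F_j,C_i]=0$ if $j\ne i-1$; $[E_j,C_i]=0$ if $j\ne i+1$; $[F_i,C_{i+1}]=[E_{i+1},C_i]$; $[[B_i,F_i],F_j]=2B_{i+1}$ if $j=i+1$ and $0$ otherwise; $[[B_1,F_1],E_1]=2B_1$; $[[B_1,E_1],E_j]=0$; $[[C_{i+1},F_i],F_j]=C_i$ if $j=i+1$ and $0$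 if $j\ne i-1,i+1$; $2B_{1,1}=[E_1,B_1]$; $[H_i,B_{1,1}]=(\varepsilon_i,\beta_{1,1})B_{1,1}$; $B_{1,1}^2=0$. $\rho:R\to U(\mathfrak p(n))$ is the superalgebra homomorphism with $E_i\mapsto a_{i,i+1}$, $F_i\mapsto a_{i+1,i}$, $H_i\mapsto a_{i,i}$, $B_{1,1}\mapsto b_{1,1}$, $B_i\mapsto b_{i,i+1}$, $C_i\mapsto c_{i,i+1}$. Root vectors in $R$: let $R^0$ be the subalgebra generated by all $E_i,F_i,H_i$; $\rho$ restricts to an isomorphism $R^0\cong U(\mathfrak g_0)$, and $A_{i,j}\in R^0$ is the element with $\rho(A_{i,j})=a_{i,j}$. Let $R^1$ (resp. $R^{-1}$) be the smallest subspace of $R$ containing $B_{1,1}$ (resp. $C_{n-1}$; $R^{-1}=0$ if $n=1$) and stable under $[A_{i,j},-]$ for all $i,j$; $\rho$ restricts to linear isomorphisms $R^1\cong\mathfrak g_1$, $R^{-1}\cong\mathfrak g_{-1}$, and $B_{i,j}\in R^1$ ($i\le j$), $C_{i,j}\in R^{-1}$ ($i<j$) are the elements with $\rho(B_{i,j})=b_{i,j}$, $\rho(C_{i,j})=c_{i,j}$. Roots: $\Phi_0^{+}=\{\varepsilon_i-\varepsilon_j: i<j\}$, $\Phi_0^-=-\Phi_0^+$, $\Phi_0=\Phi_0^+\sqcup\Phi_0^-$, $\Phi_{-1}=\{\varepsilon_i+\varepsilon_j: i\le j\}$, $\Phi_1=\{-(\varepsilon_i+\varepsilon_j): i<j\}$.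 Put $X_{\varepsilon_i-\varepsilon_j}=A_{i,j}$, $X_{\varepsilon_i+\varepsilon_j}=B_{i,j}$ $(i\le j)$, $X_{-(\varepsilon_i+\varepsilon_j)}=C_{i,j}$ $(i<j)$. Write $X^{(k)}=X^k/k!$ and $\binom{H_i}{k}=H_i(H_i-1)\cdots(H_i-k+1)/k!$. A Kostant monomial is any finite product (in any order) of elements $X_\delta^{d}$ ($\delta\in\Phi_{-1}\cup\Phi_1$, $d\in\{0,1\}$), $X_\alpha^{(r)}$ ($\alpha\in\Phi_0$, $r\ge0$), $\binom{H_i}{s}$ ($s\ge0$). $R_{\mathbb Z}$ is the $\mathbb Z$-span of all Kostant monomials. Fix total orders on $\Phi_{-1},\Phi_0^-,\Phi_0^+,\Phi_1$. An ordered Kostant monomial is $$\prod_{\beta\in\Phi_{-1}}X_\beta^{d_\beta}\prod_{\alpha\in\Phi_0^-}X_\alpha^{(r_\alpha)}\prod_{i=1}^n\binom{H_i}{s_i}\prod_{\alpha'\in\Phi_0^+}X_{\alpha'}^{(r_{\alpha'})}\prod_{\gamma\in\Phi_1}X_\gamma^{d_\gamma}$$ with $d_\beta,d_\gamma\in\{0,1\}$, $r_\alpha,r_{\alpha'},s_i\in\mathbb Z_{\ge0}$, products taken in the fixed orders. *)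

theory Defs
  imports
    "HOL-Library.Poly_Mapping"
    "HOL-Library.Z2"
    "HOL-Library.Cardinality"
    "HOL-Computational_Algebra.Polynomial"
begin

section \<open>Free associative algebras and presentations\<close>

text \<open>
  The free monoid on \<open>'g\<close>, written additively. A copy of the list type is used so that no
  arithmetic class instance is imposed on lists themselves. The type
  \<open>'g fmon \<Rightarrow>\<^sub>0 'k\<close> with its convolution product is then the free associative unital
  algebra on \<open>'g\<close> over \<open>'k\<close>.
\<close>

datatype 'g fmon = Fmon (letters: "'g list")

instantiation fmon :: (type) monoid_add
begin

definition zero_fmon :: "'a fmon" where "0 = Fmon []"

definition plus_fmon :: "'a fmon \<Rightarrow> 'a fmon \<Rightarrow> 'a fmon"
  where "u + v = Fmon (letters u @ letters v)"

instance
  by standard (simp_all add: zero_fmon_def plus_fmon_def)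

end

lemma letters_zero [simp]: "letters 0 = []"
  by (simp add: zero_fmon_def)

lemma letters_plus [simp]: "letters (u + v) = letters u @ letters v"
  by (simp add: plus_fmon_def)

definition fgen :: "'g \<Rightarrow> ('g fmon \<Rightarrow>\<^sub>0 'k::ring_1)"
  where "fgen g = Poly_Mapping.single (Fmon [g]) 1"

definition fconst :: "'k::ring_1 \<Rightarrow> ('g fmon \<Rightarrow>\<^sub>0 'k)"
  where "fconst c = Poly_Mapping.single 0 c"

definition free_alg :: "'g set \<Rightarrow> ('g fmon \<Rightarrow>\<^sub>0 'k::ring_1) set"
  where "free_alg S = {f. \<forall>w\<in>Poly_Mapping.keys f. set (letters w) \<subseteq> S}"

text \<open>The two-sided ideal of \<^term>\<open>free_alg S\<close> generated by \<open>Q\<close>.\<close>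

inductive_set pres_ideal :: "'g set \<Rightarrow> ('g fmon \<Rightarrow>\<^sub>0 'k::ring_1) set \<Rightarrow> ('g fmon \<Rightarrow>\<^sub>0 'k) set"
  for S Q where
  zero: "0 \<in> pres_ideal S Q"
| add: "x \<in> pres_ideal S Q \<Longrightarrow> q \<in> Q \<Longrightarrow> a \<in> free_alg S \<Longrightarrow> b \<in> free_alg S
    \<Longrightarrow> x + a * q * b \<in> pres_ideal S Q"

definition pres_rel ::
    "'g set \<Rightarrow> ('g fmon \<Rightarrow>\<^sub>0 'k::ring_1) set \<Rightarrow> ('g fmon \<Rightarrow>\<^sub>0 'k) \<Rightarrow> ('g fmon \<Rightarrow>\<^sub>0 'k) \<Rightarrow> bool"
  where "pres_rel S Q x y \<longleftrightarrow> x \<in> free_alg S \<and> y \<in> free_alg S \<and> x - y \<in> pres_ideal S Q"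

lemma free_alg_0 [simp]: "0 \<in> free_alg S"
  by (simp add: free_alg_def)

lemma free_alg_fconst [simp]: "fconst c \<in> free_alg S"
  by (simp add: free_alg_def fconst_def)

lemma fconst_1: "fconst 1 = 1"
  by (simp add: fconst_def single_one)

lemma free_alg_1 [simp]: "1 \<in> free_alg S"
  using free_alg_fconst[of 1 S] by (simp add: fconst_1)

lemma free_alg_add: "x \<in> free_alg S \<Longrightarrow> y \<in> free_alg S \<Longrightarrow> x + y \<in> free_alg S"
  unfolding free_alg_def using keys_add[of x y] by blast

lemma free_alg_uminus: "x \<in> free_alg S \<Longrightarrow> - x \<in> free_alg S"
  unfolding free_alg_def by simp

lemma free_alg_diff: "x \<in> free_alg S \<Longrightarrow> y \<in> free_alg S \<Longrightarrow> x - y \<in> free_alg S"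
  using free_alg_add[of x S "- y"] free_alg_uminus[of y S] by simp

lemma free_alg_mult:
  assumes "x \<in> free_alg S" "y \<in> free_alg S" shows "x * y \<in> free_alg S"
proof -
  have "set (letters w) \<subseteq> S" if "w \<in> Poly_Mapping.keys (x * y)" for w
  proof -
    from that obtain u v where "u \<in> Poly_Mapping.keys x" "v \<in> Poly_Mapping.keys y" "w = u + v"
      using keys_mult[of x y] by blast
    with assms show ?thesis by (simp add: free_alg_def)
  qed
  then show ?thesis by (simp add: free_alg_def)
qed

lemma pres_ideal_add:
  assumes "x \<in> pres_ideal S Q" "y \<in> pres_ideal S Q" shows "x + y \<in> pres_ideal S Q"
  using assms(2)
proof induction
  case zero then show ?case using assms(1) by simp
next
  case (add y q a b) then show ?case
    using pres_ideal.add[of "x + y" S Q q a b] by (simp add: add.assoc)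
qed

lemma pres_ideal_mult:
  assumes "x \<in> pres_ideal S Q" "c \<in> free_alg S" "d \<in> free_alg S"
  shows "c * x * d \<in> pres_ideal S Q"
  using assms(1)
proof induction
  case zero then show ?case by (simp add: pres_ideal.zero)
next
  case (add y q a b)
  then show ?case
    using pres_ideal.add[OF add.IH add.hyps(2), of "c * a" "b * d"] assms(2,3)
    by (simp add: free_alg_mult algebra_simps)
qed

lemma pres_ideal_uminus: "x \<in> pres_ideal S Q \<Longrightarrow> - x \<in> pres_ideal S Q"
  using pres_ideal_mult[of x S Q "- 1" 1] by (simp add: free_alg_uminus)

lemma pres_rel_refl: "pres_rel S Q x x \<longleftrightarrow> x \<in> free_alg S"
  by (simp add: pres_rel_def pres_ideal.zero)

lemma pres_rel_sym: "pres_rel S Q x y \<Longrightarrow> pres_rel S Q y x"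
  unfolding pres_rel_def using pres_ideal_uminus[of "x - y" S Q] by simp

lemma pres_rel_trans: "pres_rel S Q x y \<Longrightarrow> pres_rel S Q y z \<Longrightarrow> pres_rel S Q x z"
  unfolding pres_rel_def using pres_ideal_add[of "x - y" S Q "y - z"] by simp

text \<open>
  The quotient of \<^term>\<open>free_alg S\<close> by the ideal, as a set of cosets. It serves as the
  representing set of the algebras presented below.
\<close>

definition pres_cosets ::
    "'g set \<Rightarrow> ('g fmon \<Rightarrow>\<^sub>0 'k::ring_1) set \<Rightarrow> ('g fmon \<Rightarrow>\<^sub>0 'k) set set"
  where "pres_cosets S Q = (\<lambda>x. Collect (pres_rel S Q x)) ` free_alg S"

lemma pres_cosetsI: "x \<in> free_alg S \<Longrightarrow> Collect (pres_rel S Q x) \<in> pres_cosets S Q"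
  unfolding pres_cosets_def by (rule imageI)

lemma pres_cosetsE:
  assumes "c \<in> pres_cosets S Q"
  obtains x where "x \<in> free_alg S" "c = Collect (pres_rel S Q x)"
  using assms unfolding pres_cosets_def by (elim imageE) (rule that)

lemma Collect_pres_rel_eq_iff:
  assumes "x \<in> free_alg S" "y \<in> free_alg S"
  shows "Collect (pres_rel S Q x) = Collect (pres_rel S Q y) \<longleftrightarrow> pres_rel S Q x y"
proof
  assume "Collect (pres_rel S Q x) = Collect (pres_rel S Q y)"
  then show "pres_rel S Q x y" using assms(2) pres_rel_refl[of S Q y] by blast
next
  assume "pres_rel S Q x y"
  then show "Collect (pres_rel S Q x) = Collect (pres_rel S Q y)"
    using pres_rel_trans pres_rel_sym by blast
qed

lemma pres_rel_add:
  "pres_rel S Q x x' \<Longrightarrow> pres_rel S Q y y' \<Longrightarrow> pres_rel S Q (x + y) (x' + y')"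
  unfolding pres_rel_def using pres_ideal_add[of "x - x'" S Q "y - y'"]
  by (auto simp: free_alg_add algebra_simps)

lemma pres_rel_uminus: "pres_rel S Q x x' \<Longrightarrow> pres_rel S Q (- x) (- x')"
  unfolding pres_rel_def using pres_ideal_uminus[of "x - x'" S Q]
  by (auto simp: free_alg_uminus)

lemma pres_rel_diff:
  "pres_rel S Q x x' \<Longrightarrow> pres_rel S Q y y' \<Longrightarrow> pres_rel S Q (x - y) (x' - y')"
  using pres_rel_add[of S Q x x' "- y" "- y'"] pres_rel_uminus[of S Q y y'] by simp

lemma pres_rel_mult:
  assumes "pres_rel S Q x x'" "pres_rel S Q y y'" shows "pres_rel S Q (x * y) (x' * y')"
proof -
  have "(x - x') * y \<in> pres_ideal S Q"
    using assms pres_ideal_mult[of "x - x'" S Q 1 y] by (auto simp: pres_rel_def)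
  moreover have "x' * (y - y') \<in> pres_ideal S Q"
    using assms pres_ideal_mult[of "y - y'" S Q x' 1] by (auto simp: pres_rel_def)
  ultimately have "(x - x') * y + x' * (y - y') \<in> pres_ideal S Q"
    by (rule pres_ideal_add)
  then show ?thesis
    using assms by (auto simp: pres_rel_def free_alg_mult algebra_simps)
qed

lemma fconst_add: "fconst (a + b) = fconst a + fconst b"
  by (simp add: fconst_def single_add)

lemma fconst_mult: "fconst (a * b) = fconst a * fconst b"
  by (simp add: fconst_def mult_single)

lemma lookup_mult_0:
  fixes x y :: "'g fmon \<Rightarrow>\<^sub>0 'k::ring_1"
  shows "Poly_Mapping.lookup (x * y) 0 = Poly_Mapping.lookup x 0 * Poly_Mapping.lookup y 0"
proof -
  have z: "0 = l + q \<longleftrightarrow> q = 0 \<and> l = 0" for l q :: "'g fmon"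
    by (cases l; cases q) (auto simp: zero_fmon_def plus_fmon_def)
  have "Sum_any (\<lambda>q. Poly_Mapping.lookup y q when 0 = l + q) = (Poly_Mapping.lookup y 0 when l = 0)"
    for l :: "'g fmon"
    by (cases "l = 0") (simp_all add: z)
  then show ?thesis
    by (simp add: lookup_mult mult_when)
qed

lemma lookup_fgen_0 [simp]: "Poly_Mapping.lookup (fgen g) 0 = 0"
  by (simp add: fgen_def lookup_single zero_fmon_def)

lemma lookup_fconst_0 [simp]: "Poly_Mapping.lookup (fconst c) 0 = c"
  by (simp add: fconst_def)

lemma not_pres_rel_0_1:
  assumes "\<And>q. q \<in> Q \<Longrightarrow> Poly_Mapping.lookup q 0 = 0"
  shows "\<not> pres_rel S Q (0 :: 'g fmon \<Rightarrow>\<^sub>0 'k::ring_1) 1"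
proof
  have *: "Poly_Mapping.lookup x 0 = 0" if "x \<in> pres_ideal S Q" for x
    using that by induction (simp_all add: lookup_add lookup_mult_0 assms)
  assume "pres_rel S Q (0 :: 'g fmon \<Rightarrow>\<^sub>0 'k) 1"
  then have "Poly_Mapping.lookup (- 1 :: 'g fmon \<Rightarrow>\<^sub>0 'k) 0 = 0"
    by (intro *) (simp add: pres_rel_def)
  then show False by simp
qed


section \<open>Gradings and homomorphisms of superalgebras\<close>

text \<open>The Koszul sign $(-1)^{pq}$ for parities \<open>p\<close>, \<open>q\<close>.\<close>

definition koszul :: "bit \<Rightarrow> bit \<Rightarrow> 'a::ring_1"
  where "koszul p q = (if p = 1 \<and> q = 1 then - 1 else 1)"

definition superalg_hom ::
    "('k::field \<Rightarrow> 'a::ring_1 \<Rightarrow> 'a) \<Rightarrow> (bit \<Rightarrow> 'a set) \<Rightarrow>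
     ('k \<Rightarrow> 'b::ring_1 \<Rightarrow> 'b) \<Rightarrow> (bit \<Rightarrow> 'b set) \<Rightarrow> ('a \<Rightarrow> 'b) \<Rightarrow> bool"
  where "superalg_hom sa ga sb gb f \<longleftrightarrow>
    Vector_Spaces.linear sa sb f \<and> f 1 = 1 \<and> (\<forall>x y. f (x * y) = f x * f y) \<and>
    (\<forall>p. f ` ga p \<subseteq> gb p)"

definition superalg_iso ::
    "('k::field \<Rightarrow> 'a::ring_1 \<Rightarrow> 'a) \<Rightarrow> (bit \<Rightarrow> 'a set) \<Rightarrow>
     ('k \<Rightarrow> 'b::ring_1 \<Rightarrow> 'b) \<Rightarrow> (bit \<Rightarrow> 'b set) \<Rightarrow> ('a \<Rightarrow> 'b) \<Rightarrow> bool"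
  where "superalg_iso sa ga sb gb f \<longleftrightarrow>
    superalg_hom sa ga sb gb f \<and> bij f \<and> superalg_hom sb gb sa ga (inv f)"


section \<open>The Lie superalgebra $\mathfrak p(n)$\<close>

text \<open>
  Matrices in $\mathfrak{gl}(n|n)$ are functions on pairs of integers that vanish outside the
  index set $\{1,\dots,n,-1,\dots,-n\}$; positive indices are even, negative ones odd.
\<close>

type_synonym 'k smat = "int \<Rightarrow> int \<Rightarrow> 'k"

definition idx :: "nat \<Rightarrow> int set"
  where "idx n = {1..int n} \<union> {- int n..-1}"

definition mat_add :: "'k::ring_1 smat \<Rightarrow> 'k smat \<Rightarrow> 'k smat"
  where "mat_add X Y = (\<lambda>r s. X r s + Y r s)"

definition mat_scale :: "'k::ring_1 \<Rightarrow> 'k smat \<Rightarrow> 'k smat"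
  where "mat_scale c X = (\<lambda>r s. c * X r s)"

definition mat_mult :: "nat \<Rightarrow> 'k::ring_1 smat \<Rightarrow> 'k smat \<Rightarrow> 'k smat"
  where "mat_mult n X Y = (\<lambda>r s. \<Sum>t\<in>idx n. X r t * Y t s)"

definition pn :: "nat \<Rightarrow> 'k::ring_1 smat set"
  where "pn n = {X.
    (\<forall>r s. r \<notin> idx n \<or> s \<notin> idx n \<longrightarrow> X r s = 0) \<and>
    (\<forall>i\<in>{1..int n}. \<forall>j\<in>{1..int n}.
       X (- i) (- j) = - X j i \<and> X i (- j) = X j (- i) \<and> X (- i) j = - X (- j) i)}"

definition pn_part :: "nat \<Rightarrow> bit \<Rightarrow> 'k::ring_1 smat set"
  where "pn_part n p =
    {X \<in> pn n. \<forall>r s. (if (r > 0) = (s > 0) then 0 else 1) \<noteq> p \<longrightarrow> X r s = 0}"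

definition mat_bracket :: "nat \<Rightarrow> bit \<Rightarrow> bit \<Rightarrow> 'k::ring_1 smat \<Rightarrow> 'k smat \<Rightarrow> 'k smat"
  where "mat_bracket n p q X Y =
    mat_add (mat_mult n X Y) (mat_scale (- koszul p q) (mat_mult n Y X))"

definition mat_unit :: "int \<Rightarrow> int \<Rightarrow> 'k::ring_1 smat"
  where "mat_unit i j = (\<lambda>r s. if r = i \<and> s = j then 1 else 0)"

definition pa :: "nat \<Rightarrow> nat \<Rightarrow> 'k::field smat"
  where "pa i j = mat_add (mat_unit (int i) (int j))
    (mat_scale (- 1) (mat_unit (- int j) (- int i)))"

definition pb :: "nat \<Rightarrow> nat \<Rightarrow> 'k::field smat"
  where "pb i j = mat_scale (if i = j then 1 / 2 else 1)
    (mat_add (mat_unit (int i) (- int j)) (mat_unit (int j) (- int i)))"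

definition pc :: "nat \<Rightarrow> nat \<Rightarrow> 'k::field smat"
  where "pc i j = mat_add (mat_unit (- int i) (int j))
    (mat_scale (- 1) (mat_unit (- int j) (int i)))"


section \<open>The enveloping superalgebra $U(\mathfrak p(n))$\<close>

text \<open>
  The free algebra on the underlying set of $\mathfrak p(n)$ modulo the relations \<open>add\<close> and
  \<open>scale\<close> is the tensor algebra of the vector space $\mathfrak p(n)$; the relations \<open>bracket\<close>
  cut it down to the universal enveloping superalgebra.
\<close>

inductive_set upn_rels :: "nat \<Rightarrow> ('k smat fmon \<Rightarrow>\<^sub>0 'k::field_char_0) set" for n where
  add: "X \<in> pn n \<Longrightarrow> Y \<in> pn n \<Longrightarrow> fgen (mat_add X Y) - (fgen X + fgen Y) \<in> upn_rels n"
| scale: "X \<in> pn n \<Longrightarrow> fgen (mat_scale c X) - fconst c * fgen X \<in> upn_rels n"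
| bracket: "X \<in> pn_part n p \<Longrightarrow> Y \<in> pn_part n q \<Longrightarrow>
    fgen X * fgen Y - koszul p q * (fgen Y * fgen X) - fgen (mat_bracket n p q X Y) \<in> upn_rels n"

lemma upn_aug: "q \<in> upn_rels n \<Longrightarrow> Poly_Mapping.lookup q 0 = 0"
  by (induction rule: upn_rels.induct)
    (simp_all add: lookup_minus lookup_add lookup_mult_0)

text \<open>
  Throughout, the positive integer $n$ is the cardinality of the finite type \<open>'n\<close>.
\<close>

typedef (overloaded) ('k, 'n) upn = "pres_cosets (pn CARD('n::finite)) (upn_rels CARD('n)) :: ('k smat fmon \<Rightarrow>\<^sub>0 'k::field_char_0) set set"
  using pres_cosetsI[OF free_alg_0] by blast

definition abs_upn :: "('k smat fmon \<Rightarrow>\<^sub>0 'k) \<Rightarrow> ('k::field_char_0, 'n::finite) upn"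
  where "abs_upn x = Abs_upn (Collect (pres_rel (pn CARD('n)) (upn_rels CARD('n)) x))"

definition rep_upn :: "('k::field_char_0, 'n::finite) upn \<Rightarrow> ('k smat fmon \<Rightarrow>\<^sub>0 'k)"
  where "rep_upn u = (SOME x. x \<in> Rep_upn u)"

lemma abs_upn_eq_iff:
  assumes "x \<in> free_alg (pn CARD('n))" "y \<in> free_alg (pn CARD('n))"
  shows "(abs_upn x :: ('k::field_char_0, 'n::finite) upn) = abs_upn y \<longleftrightarrow>
    pres_rel (pn CARD('n)) (upn_rels CARD('n)) x y"
proof -
  have "(abs_upn x :: ('k, 'n) upn) = abs_upn y \<longleftrightarrow>
      Collect (pres_rel (pn CARD('n)) (upn_rels CARD('n)) x) = Collect (pres_rel (pn CARD('n)) (upn_rels CARD('n)) y)"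
    unfolding abs_upn_def by (rule Abs_upn_inject) (rule pres_cosetsI assms)+
  also have "\<dots> \<longleftrightarrow> pres_rel (pn CARD('n)) (upn_rels CARD('n)) x y"
    using assms by (rule Collect_pres_rel_eq_iff)
  finally show ?thesis .
qed

lemma rep_upn:
  fixes u :: "('k::field_char_0, 'n::finite) upn"
  shows rep_upn_in: "rep_upn u \<in> free_alg (pn CARD('n))" and abs_rep_upn: "abs_upn (rep_upn u) = u"
proof -
  obtain x where x: "x \<in> free_alg (pn CARD('n))" "Rep_upn u = Collect (pres_rel (pn CARD('n)) (upn_rels CARD('n)) x)"
    using Rep_upn[of u] by (rule pres_cosetsE)
  then have "rep_upn u \<in> Rep_upn u"
    unfolding rep_upn_def by - (rule someI[of _ x], simp add: pres_rel_refl)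
  with x have r: "pres_rel (pn CARD('n)) (upn_rels CARD('n)) x (rep_upn u)" by simp
  then show 1: "rep_upn u \<in> free_alg (pn CARD('n))" by (simp add: pres_rel_def)
  have "abs_upn x = u" unfolding abs_upn_def x(2)[symmetric] by (rule Rep_upn_inverse)
  with iffD2[OF abs_upn_eq_iff[OF x(1) 1] r] show "abs_upn (rep_upn u) = u" by simp
qed

lemma rep_abs_upn:
  "x \<in> free_alg (pn CARD('n)) \<Longrightarrow> pres_rel (pn CARD('n)) (upn_rels CARD('n))
    (rep_upn (abs_upn x :: ('k::field_char_0, 'n::finite) upn)) x"
  by (rule iffD1[OF abs_upn_eq_iff[OF rep_upn_in] abs_rep_upn])

lemma upn_exhaust:
  fixes u :: "('k::field_char_0, 'n::finite) upn"
  obtains x where "x \<in> free_alg (pn CARD('n))" "u = abs_upn x"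
  using that[OF rep_upn_in abs_rep_upn[symmetric]] .

instantiation upn :: (field_char_0, finite) ring_1
begin

definition zero_upn :: "('a, 'b) upn" where "0 = abs_upn 0"
definition one_upn :: "('a, 'b) upn" where "1 = abs_upn 1"
definition plus_upn :: "('a, 'b) upn \<Rightarrow> ('a, 'b) upn \<Rightarrow> ('a, 'b) upn"
  where "u + v = abs_upn (rep_upn u + rep_upn v)"
definition minus_upn :: "('a, 'b) upn \<Rightarrow> ('a, 'b) upn \<Rightarrow> ('a, 'b) upn"
  where "u - v = abs_upn (rep_upn u - rep_upn v)"
definition uminus_upn :: "('a, 'b) upn \<Rightarrow> ('a, 'b) upn"
  where "- u = abs_upn (- rep_upn u)"
definition times_upn :: "('a, 'b) upn \<Rightarrow> ('a, 'b) upn \<Rightarrow> ('a, 'b) upn"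
  where "u * v = abs_upn (rep_upn u * rep_upn v)"

context
  fixes x y :: "'a smat fmon \<Rightarrow>\<^sub>0 'a"
  assumes x: "x \<in> free_alg (pn CARD('b))" and y: "y \<in> free_alg (pn CARD('b))"
begin

lemma abs_upn_add: "(abs_upn x :: ('a, 'b) upn) + abs_upn y = abs_upn (x + y)"
  unfolding plus_upn_def using x y
  by (subst abs_upn_eq_iff) (auto intro!: pres_rel_add rep_abs_upn free_alg_add rep_upn_in)

lemma abs_upn_diff: "(abs_upn x :: ('a, 'b) upn) - abs_upn y = abs_upn (x - y)"
  unfolding minus_upn_def using x y
  by (subst abs_upn_eq_iff) (auto intro!: pres_rel_diff rep_abs_upn free_alg_diff rep_upn_in)

lemma abs_upn_uminus: "- (abs_upn x :: ('a, 'b) upn) = abs_upn (- x)"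
  unfolding uminus_upn_def using x
  by (subst abs_upn_eq_iff) (auto intro!: pres_rel_uminus rep_abs_upn free_alg_uminus rep_upn_in)

lemma abs_upn_mult: "(abs_upn x :: ('a, 'b) upn) * abs_upn y = abs_upn (x * y)"
  unfolding times_upn_def using x y
  by (subst abs_upn_eq_iff) (auto intro!: pres_rel_mult rep_abs_upn free_alg_mult rep_upn_in)

end

lemmas abs_upn_ops = zero_upn_def one_upn_def abs_upn_add abs_upn_diff abs_upn_uminus abs_upn_mult
  free_alg_0 free_alg_1 free_alg_add free_alg_diff free_alg_uminus free_alg_mult

instance
proof
  fix a b c :: "('a, 'b) upn"
  obtain x where x: "x \<in> free_alg (pn CARD('b))" "a = abs_upn x" by (rule upn_exhaust)
  obtain y where y: "y \<in> free_alg (pn CARD('b))" "b = abs_upn y" by (rule upn_exhaust)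
  obtain z where z: "z \<in> free_alg (pn CARD('b))" "c = abs_upn z" by (rule upn_exhaust)
  note xyz = x y z
  show "a + b + c = a + (b + c)" using xyz by (simp add: abs_upn_ops add.assoc)
  show "a + b = b + a" using xyz by (simp add: abs_upn_ops add.commute)
  show "0 + a = a" using xyz by (simp add: abs_upn_ops)
  show "- a + a = 0" using xyz by (simp add: abs_upn_ops)
  show "a - b = a + - b" using xyz by (simp add: abs_upn_ops)
  show "a * b * c = a * (b * c)" using xyz by (simp add: abs_upn_ops mult.assoc)
  show "1 * a = a" using xyz by (simp add: abs_upn_ops)
  show "a * 1 = a" using xyz by (simp add: abs_upn_ops)
  show "(a + b) * c = a * c + b * c" using xyz by (simp add: abs_upn_ops distrib_right)
  show "a * (b + c) = a * b + a * c" using xyz by (simp add: abs_upn_ops distrib_left)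
  have "\<not> pres_rel (pn CARD('b)) (upn_rels CARD('b)) (0 :: 'a smat fmon \<Rightarrow>\<^sub>0 'a) 1"
    by (rule not_pres_rel_0_1) (rule upn_aug)
  then show "(0::('a, 'b) upn) \<noteq> 1"
    unfolding zero_upn_def one_upn_def by (simp add: abs_upn_eq_iff)
qed

end

definition scale_upn :: "'k \<Rightarrow> ('k::field_char_0, 'n::finite) upn \<Rightarrow> ('k, 'n) upn"
  where "scale_upn c u = abs_upn (fconst c) * u"

global_interpretation upn: vector_space "scale_upn :: 'k \<Rightarrow> ('k::field_char_0, 'n::finite) upn \<Rightarrow> ('k, 'n) upn"
proof
  fix a b :: 'k and u v :: "('k, 'n) upn"
  show "scale_upn a (u + v) = scale_upn a u + scale_upn a v"
    by (simp add: scale_upn_def distrib_left)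
  show "scale_upn (a + b) u = scale_upn a u + scale_upn b u"
    by (simp add: scale_upn_def fconst_add abs_upn_add[symmetric] distrib_right)
  show "scale_upn a (scale_upn b u) = scale_upn (a * b) u"
    by (simp add: scale_upn_def fconst_mult abs_upn_mult[symmetric] mult.assoc)
  show "scale_upn 1 u = u"
    by (simp add: scale_upn_def fconst_1 one_upn_def[symmetric])
qed

definition upn_iota :: "'k smat \<Rightarrow> ('k::field_char_0, 'n::finite) upn"
  where "upn_iota X = abs_upn (fgen X)"

definition grade_upn :: "bit \<Rightarrow> ('k::field_char_0, 'n::finite) upn set"
  where "grade_upn p = upn.span {prod_list (map upn_iota Xs) | Xs ps.
    list_all2 (\<lambda>X q. X \<in> pn_part CARD('n) q) Xs ps \<and> sum_list ps = p}"


section \<open>The superalgebra $R_n$\<close>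

text \<open>
  \<open>GE i\<close>, \<open>GF i\<close>, \<open>GB i\<close>, \<open>GC i\<close> are the generators $E_i$, $F_i$, $B_i$, $C_i$, \<open>GH i\<close> is $H_i$ and
  \<open>GB11\<close> is $B_{1,1}$.
\<close>

datatype rgen = GE nat | GF nat | GH nat | GB11 | GB nat | GC nat

definition rgens :: "nat \<Rightarrow> rgen set"
  where "rgens n = GE ` {1..<n} \<union> GF ` {1..<n} \<union> GH ` {1..n} \<union> {GB11} \<union> GB ` {1..<n} \<union> GC ` {1..<n}"

fun rpar :: "rgen \<Rightarrow> bit" where
  "rpar (GE i) = 0"
| "rpar (GF i) = 0"
| "rpar (GH i) = 0"
| "rpar GB11 = 1"
| "rpar (GB i) = 1"
| "rpar (GC i) = 1"

text \<open>
  Parity of a homogeneous element of the free superalgebra (on non-homogeneous elements and on 0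
  the value is irrelevant), and the superbracket of homogeneous elements.
\<close>

definition fdeg :: "(rgen fmon \<Rightarrow>\<^sub>0 'k::ring_1) \<Rightarrow> bit"
  where "fdeg f = (if \<forall>w\<in>Poly_Mapping.keys f. sum_list (map rpar (letters w)) = 1 then 1 else 0)"

definition sbr :: "(rgen fmon \<Rightarrow>\<^sub>0 'k::ring_1) \<Rightarrow> (rgen fmon \<Rightarrow>\<^sub>0 'k) \<Rightarrow> (rgen fmon \<Rightarrow>\<^sub>0 'k)"
  where "sbr x y = x * y - koszul (fdeg x) (fdeg y) * (y * x)"

text \<open>Weights $\sum_k u_k\varepsilon_k$ are represented by their coefficient functions.\<close>

definition eps :: "nat \<Rightarrow> nat \<Rightarrow> int"
  where "eps i = (\<lambda>k. if k = i then 1 else 0)"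

definition ip :: "nat \<Rightarrow> (nat \<Rightarrow> int) \<Rightarrow> (nat \<Rightarrow> int) \<Rightarrow> int"
  where "ip n u v = (\<Sum>k=1..n. u k * v k)"

definition alpha :: "nat \<Rightarrow> nat \<Rightarrow> int"
  where "alpha i = (\<lambda>k. eps i k - eps (i + 1) k)"

definition beta :: "nat \<Rightarrow> nat \<Rightarrow> int"
  where "beta i = (\<lambda>k. eps i k + eps (i + 1) k)"

definition gamma :: "nat \<Rightarrow> nat \<Rightarrow> int"
  where "gamma i = (\<lambda>k. - (eps i k + eps (i + 1) k))"

definition beta11 :: "nat \<Rightarrow> int"
  where "beta11 = (\<lambda>k. 2 * eps 1 k)"

abbreviation "fE i \<equiv> fgen (GE i)"
abbreviation "fF i \<equiv> fgen (GF i)"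
abbreviation "fH i \<equiv> fgen (GH i)"
abbreviation "fB11 \<equiv> fgen GB11"
abbreviation "fB i \<equiv> fgen (GB i)"
abbreviation "fC i \<equiv> fgen (GC i)"

text \<open>A defining relation $x = y$ is listed as the element $x - y$ of the free algebra.\<close>

inductive_set ralg_rels :: "nat \<Rightarrow> (rgen fmon \<Rightarrow>\<^sub>0 'k::field_char_0) set" for n where
  HH: "\<lbrakk>i \<in> {1..n}; j \<in> {1..n}\<rbrakk> \<Longrightarrow> sbr (fH i) (fH j) \<in> ralg_rels n"
| HE: "\<lbrakk>i \<in> {1..n}; j \<in> {1..<n}\<rbrakk> \<Longrightarrow>
    sbr (fH i) (fE j) - of_int (ip n (eps i) (alpha j)) * fE j \<in> ralg_rels n"
| HF: "\<lbrakk>i \<in> {1..n}; j \<in> {1..<n}\<rbrakk> \<Longrightarrow>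
    sbr (fH i) (fF j) - of_int (- ip n (eps i) (alpha j)) * fF j \<in> ralg_rels n"
| EF: "\<lbrakk>i \<in> {1..<n}; j \<in> {1..<n}\<rbrakk> \<Longrightarrow>
    sbr (fE i) (fF j) - (if i = j then fH i - fH (i + 1) else 0) \<in> ralg_rels n"
| EE: "\<lbrakk>i \<in> {1..<n}; j \<in> {1..<n}; j \<noteq> i + 1; i \<noteq> j + 1\<rbrakk> \<Longrightarrow> sbr (fE i) (fE j) \<in> ralg_rels n"
| FF: "\<lbrakk>i \<in> {1..<n}; j \<in> {1..<n}; j \<noteq> i + 1; i \<noteq> j + 1\<rbrakk> \<Longrightarrow> sbr (fF i) (fF j) \<in> ralg_rels n"
| EEE: "\<lbrakk>i \<in> {1..<n}; j \<in> {1..<n}; j = i + 1 \<or> i = j + 1\<rbrakk> \<Longrightarrow>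
    sbr (fE i) (sbr (fE i) (fE j)) \<in> ralg_rels n"
| FFF: "\<lbrakk>i \<in> {1..<n}; j \<in> {1..<n}; j = i + 1 \<or> i = j + 1\<rbrakk> \<Longrightarrow>
    sbr (fF i) (sbr (fF i) (fF j)) \<in> ralg_rels n"
| BB: "\<lbrakk>i \<in> {1..<n}; j \<in> {1..<n}\<rbrakk> \<Longrightarrow> sbr (fB i) (fB j) \<in> ralg_rels n"
| CC: "\<lbrakk>i \<in> {1..<n}; j \<in> {1..<n}\<rbrakk> \<Longrightarrow> sbr (fC i) (fC j) \<in> ralg_rels n"
| HB: "\<lbrakk>i \<in> {1..n}; j \<in> {1..<n}\<rbrakk> \<Longrightarrow>
    sbr (fH i) (fB j) - of_int (ip n (eps i) (beta j)) * fB j \<in> ralg_rels n"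
| HC: "\<lbrakk>i \<in> {1..n}; j \<in> {1..<n}\<rbrakk> \<Longrightarrow>
    sbr (fH i) (fC j) - of_int (ip n (eps i) (gamma j)) * fC j \<in> ralg_rels n"
| BC_eq: "i \<in> {1..<n} \<Longrightarrow> sbr (fB i) (fC i) - (- fH i + fH (i + 1)) \<in> ralg_rels n"
| BC_pred: "\<lbrakk>i \<in> {1..<n}; j \<in> {1..<n}; i = j + 1\<rbrakk> \<Longrightarrow>
    sbr (fB i) (fC j) - sbr (fF (i - 1)) (fF i) \<in> ralg_rels n"
| BC_succ: "\<lbrakk>i \<in> {1..<n}; j \<in> {1..<n}; j = i + 1\<rbrakk> \<Longrightarrow>
    sbr (fB i) (fC j) - sbr (fE i) (fE (i + 1)) \<in> ralg_rels n"
| BC_other: "\<lbrakk>i \<in> {1..<n}; j \<in> {1..<n}; j \<noteq> i; i \<noteq> j + 1; j \<noteq> i + 1\<rbrakk> \<Longrightarrow>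
    sbr (fB i) (fC j) \<in> ralg_rels n"
| BF: "\<lbrakk>i \<in> {1..<n}; j \<in> {1..<n}; j \<noteq> i; j \<noteq> i + 1\<rbrakk> \<Longrightarrow> sbr (fB i) (fF j) \<in> ralg_rels n"
| BE: "\<lbrakk>i \<in> {1..<n}; j \<in> {1..<n}; j \<noteq> i; i \<noteq> j + 1\<rbrakk> \<Longrightarrow> sbr (fB i) (fE j) \<in> ralg_rels n"
| BF_BE: "\<lbrakk>i \<in> {1..<n}; i + 1 \<in> {1..<n}\<rbrakk> \<Longrightarrow>
    sbr (fB i) (fF i) - sbr (fB (i + 1)) (fE (i + 1)) \<in> ralg_rels n"
| BF_BE': "\<lbrakk>i \<in> {1..<n}; i + 1 \<in> {1..<n}\<rbrakk> \<Longrightarrow>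
    sbr (fB i) (fF (i + 1)) - sbr (fB (i + 1)) (fE i) \<in> ralg_rels n"
| FC: "\<lbrakk>i \<in> {1..<n}; j \<in> {1..<n}; i \<noteq> j + 1\<rbrakk> \<Longrightarrow> sbr (fF j) (fC i) \<in> ralg_rels n"
| EC: "\<lbrakk>i \<in> {1..<n}; j \<in> {1..<n}; j \<noteq> i + 1\<rbrakk> \<Longrightarrow> sbr (fE j) (fC i) \<in> ralg_rels n"
| FC_EC: "\<lbrakk>i \<in> {1..<n}; i + 1 \<in> {1..<n}\<rbrakk> \<Longrightarrow>
    sbr (fF i) (fC (i + 1)) - sbr (fE (i + 1)) (fC i) \<in> ralg_rels n"
| BFF: "\<lbrakk>i \<in> {1..<n}; j \<in> {1..<n}\<rbrakk> \<Longrightarrow>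
    sbr (sbr (fB i) (fF i)) (fF j) - (if j = i + 1 then 2 * fB (i + 1) else 0) \<in> ralg_rels n"
| BFE: "1 \<in> {1..<n} \<Longrightarrow> sbr (sbr (fB 1) (fF 1)) (fE 1) - 2 * fB 1 \<in> ralg_rels n"
| BEE: "\<lbrakk>1 \<in> {1..<n}; j \<in> {1..<n}\<rbrakk> \<Longrightarrow> sbr (sbr (fB 1) (fE 1)) (fE j) \<in> ralg_rels n"
| CFF: "\<lbrakk>i \<in> {1..<n}; j \<in> {1..<n}; i + 1 \<in> {1..<n}; j = i + 1\<rbrakk> \<Longrightarrow>
    sbr (sbr (fC (i + 1)) (fF i)) (fF j) - fC i \<in> ralg_rels n"
| CFF_0: "\<lbrakk>i \<in> {1..<n}; j \<in> {1..<n}; i + 1 \<in> {1..<n}; i \<noteq> j + 1; j \<noteq> i + 1\<rbrakk> \<Longrightarrow>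
    sbr (sbr (fC (i + 1)) (fF i)) (fF j) \<in> ralg_rels n"
| B11: "1 \<in> {1..<n} \<Longrightarrow> 2 * fB11 - sbr (fE 1) (fB 1) \<in> ralg_rels n"
| HB11: "i \<in> {1..n} \<Longrightarrow> sbr (fH i) fB11 - of_int (ip n (eps i) beta11) * fB11 \<in> ralg_rels n"
| B11_sq: "fB11 ^ 2 \<in> ralg_rels n"

lemma lookup_sbr_0 [simp]:
  "Poly_Mapping.lookup (sbr x y) 0 = Poly_Mapping.lookup x 0 * Poly_Mapping.lookup y 0 -
    (if fdeg x = 1 \<and> fdeg y = 1 then - 1 else 1) * (Poly_Mapping.lookup y 0 * Poly_Mapping.lookup x 0)"
  by (simp add: sbr_def koszul_def lookup_minus lookup_mult_0)

lemma ralg_aug: "q \<in> ralg_rels n \<Longrightarrow> Poly_Mapping.lookup q 0 = 0"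
  by (induction rule: ralg_rels.induct)
    (simp_all add: lookup_minus lookup_add lookup_mult_0 power2_eq_square)

typedef (overloaded) ('k, 'n) ralg = "pres_cosets (rgens CARD('n::finite)) (ralg_rels CARD('n)) :: (rgen fmon \<Rightarrow>\<^sub>0 'k::field_char_0) set set"
  using pres_cosetsI[OF free_alg_0] by blast

definition abs_ralg :: "(rgen fmon \<Rightarrow>\<^sub>0 'k) \<Rightarrow> ('k::field_char_0, 'n::finite) ralg"
  where "abs_ralg x = Abs_ralg (Collect (pres_rel (rgens CARD('n)) (ralg_rels CARD('n)) x))"

definition rep_ralg :: "('k::field_char_0, 'n::finite) ralg \<Rightarrow> (rgen fmon \<Rightarrow>\<^sub>0 'k)"
  where "rep_ralg u = (SOME x. x \<in> Rep_ralg u)"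

lemma abs_ralg_eq_iff:
  assumes "x \<in> free_alg (rgens CARD('n))" "y \<in> free_alg (rgens CARD('n))"
  shows "(abs_ralg x :: ('k::field_char_0, 'n::finite) ralg) = abs_ralg y \<longleftrightarrow>
    pres_rel (rgens CARD('n)) (ralg_rels CARD('n)) x y"
proof -
  have "(abs_ralg x :: ('k, 'n) ralg) = abs_ralg y \<longleftrightarrow>
      Collect (pres_rel (rgens CARD('n)) (ralg_rels CARD('n)) x) = Collect (pres_rel (rgens CARD('n)) (ralg_rels CARD('n)) y)"
    unfolding abs_ralg_def by (rule Abs_ralg_inject) (rule pres_cosetsI assms)+
  also have "\<dots> \<longleftrightarrow> pres_rel (rgens CARD('n)) (ralg_rels CARD('n)) x y"
    using assms by (rule Collect_pres_rel_eq_iff)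
  finally show ?thesis .
qed

lemma rep_ralg:
  fixes u :: "('k::field_char_0, 'n::finite) ralg"
  shows rep_ralg_in: "rep_ralg u \<in> free_alg (rgens CARD('n))" and abs_rep_ralg: "abs_ralg (rep_ralg u) = u"
proof -
  obtain x where x: "x \<in> free_alg (rgens CARD('n))" "Rep_ralg u = Collect (pres_rel (rgens CARD('n)) (ralg_rels CARD('n)) x)"
    using Rep_ralg[of u] by (rule pres_cosetsE)
  then have "rep_ralg u \<in> Rep_ralg u"
    unfolding rep_ralg_def by - (rule someI[of _ x], simp add: pres_rel_refl)
  with x have r: "pres_rel (rgens CARD('n)) (ralg_rels CARD('n)) x (rep_ralg u)" by simp
  then show 1: "rep_ralg u \<in> free_alg (rgens CARD('n))" by (simp add: pres_rel_def)
  have "abs_ralg x = u" unfolding abs_ralg_def x(2)[symmetric] by (rule Rep_ralg_inverse)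
  with iffD2[OF abs_ralg_eq_iff[OF x(1) 1] r] show "abs_ralg (rep_ralg u) = u" by simp
qed

lemma rep_abs_ralg:
  "x \<in> free_alg (rgens CARD('n)) \<Longrightarrow> pres_rel (rgens CARD('n)) (ralg_rels CARD('n))
    (rep_ralg (abs_ralg x :: ('k::field_char_0, 'n::finite) ralg)) x"
  by (rule iffD1[OF abs_ralg_eq_iff[OF rep_ralg_in] abs_rep_ralg])

lemma ralg_exhaust:
  fixes u :: "('k::field_char_0, 'n::finite) ralg"
  obtains x where "x \<in> free_alg (rgens CARD('n))" "u = abs_ralg x"
  using that[OF rep_ralg_in abs_rep_ralg[symmetric]] .

instantiation ralg :: (field_char_0, finite) ring_1
begin

definition zero_ralg :: "('a, 'b) ralg" where "0 = abs_ralg 0"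
definition one_ralg :: "('a, 'b) ralg" where "1 = abs_ralg 1"
definition plus_ralg :: "('a, 'b) ralg \<Rightarrow> ('a, 'b) ralg \<Rightarrow> ('a, 'b) ralg"
  where "u + v = abs_ralg (rep_ralg u + rep_ralg v)"
definition minus_ralg :: "('a, 'b) ralg \<Rightarrow> ('a, 'b) ralg \<Rightarrow> ('a, 'b) ralg"
  where "u - v = abs_ralg (rep_ralg u - rep_ralg v)"
definition uminus_ralg :: "('a, 'b) ralg \<Rightarrow> ('a, 'b) ralg"
  where "- u = abs_ralg (- rep_ralg u)"
definition times_ralg :: "('a, 'b) ralg \<Rightarrow> ('a, 'b) ralg \<Rightarrow> ('a, 'b) ralg"
  where "u * v = abs_ralg (rep_ralg u * rep_ralg v)"

context
  fixes x y :: "rgen fmon \<Rightarrow>\<^sub>0 'a"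
  assumes x: "x \<in> free_alg (rgens CARD('b))" and y: "y \<in> free_alg (rgens CARD('b))"
begin

lemma abs_ralg_add: "(abs_ralg x :: ('a, 'b) ralg) + abs_ralg y = abs_ralg (x + y)"
  unfolding plus_ralg_def using x y
  by (subst abs_ralg_eq_iff) (auto intro!: pres_rel_add rep_abs_ralg free_alg_add rep_ralg_in)

lemma abs_ralg_diff: "(abs_ralg x :: ('a, 'b) ralg) - abs_ralg y = abs_ralg (x - y)"
  unfolding minus_ralg_def using x y
  by (subst abs_ralg_eq_iff) (auto intro!: pres_rel_diff rep_abs_ralg free_alg_diff rep_ralg_in)

lemma abs_ralg_uminus: "- (abs_ralg x :: ('a, 'b) ralg) = abs_ralg (- x)"
  unfolding uminus_ralg_def using x
  by (subst abs_ralg_eq_iff) (auto intro!: pres_rel_uminus rep_abs_ralg free_alg_uminus rep_ralg_in)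

lemma abs_ralg_mult: "(abs_ralg x :: ('a, 'b) ralg) * abs_ralg y = abs_ralg (x * y)"
  unfolding times_ralg_def using x y
  by (subst abs_ralg_eq_iff) (auto intro!: pres_rel_mult rep_abs_ralg free_alg_mult rep_ralg_in)

end

lemmas abs_ralg_ops = zero_ralg_def one_ralg_def abs_ralg_add abs_ralg_diff abs_ralg_uminus abs_ralg_mult
  free_alg_0 free_alg_1 free_alg_add free_alg_diff free_alg_uminus free_alg_mult

instance
proof
  fix a b c :: "('a, 'b) ralg"
  obtain x where x: "x \<in> free_alg (rgens CARD('b))" "a = abs_ralg x" by (rule ralg_exhaust)
  obtain y where y: "y \<in> free_alg (rgens CARD('b))" "b = abs_ralg y" by (rule ralg_exhaust)
  obtain z where z: "z \<in> free_alg (rgens CARD('b))" "c = abs_ralg z" by (rule ralg_exhaust)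
  note xyz = x y z
  show "a + b + c = a + (b + c)" using xyz by (simp add: abs_ralg_ops add.assoc)
  show "a + b = b + a" using xyz by (simp add: abs_ralg_ops add.commute)
  show "0 + a = a" using xyz by (simp add: abs_ralg_ops)
  show "- a + a = 0" using xyz by (simp add: abs_ralg_ops)
  show "a - b = a + - b" using xyz by (simp add: abs_ralg_ops)
  show "a * b * c = a * (b * c)" using xyz by (simp add: abs_ralg_ops mult.assoc)
  show "1 * a = a" using xyz by (simp add: abs_ralg_ops)
  show "a * 1 = a" using xyz by (simp add: abs_ralg_ops)
  show "(a + b) * c = a * c + b * c" using xyz by (simp add: abs_ralg_ops distrib_right)
  show "a * (b + c) = a * b + a * c" using xyz by (simp add: abs_ralg_ops distrib_left)
  have "\<not> pres_rel (rgens CARD('b)) (ralg_rels CARD('b)) (0 :: rgen fmon \<Rightarrow>\<^sub>0 'a) 1"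
    by (rule not_pres_rel_0_1) (rule ralg_aug)
  then show "(0::('a, 'b) ralg) \<noteq> 1"
    unfolding zero_ralg_def one_ralg_def by (simp add: abs_ralg_eq_iff)
qed

end

definition scale_ralg :: "'k \<Rightarrow> ('k::field_char_0, 'n::finite) ralg \<Rightarrow> ('k, 'n) ralg"
  where "scale_ralg c u = abs_ralg (fconst c) * u"

global_interpretation ralg: vector_space "scale_ralg :: 'k \<Rightarrow> ('k::field_char_0, 'n::finite) ralg \<Rightarrow> ('k, 'n) ralg"
proof
  fix a b :: 'k and u v :: "('k, 'n) ralg"
  show "scale_ralg a (u + v) = scale_ralg a u + scale_ralg a v"
    by (simp add: scale_ralg_def distrib_left)
  show "scale_ralg (a + b) u = scale_ralg a u + scale_ralg b u"
    by (simp add: scale_ralg_def fconst_add abs_ralg_add[symmetric] distrib_right)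
  show "scale_ralg a (scale_ralg b u) = scale_ralg (a * b) u"
    by (simp add: scale_ralg_def fconst_mult abs_ralg_mult[symmetric] mult.assoc)
  show "scale_ralg 1 u = u"
    by (simp add: scale_ralg_def fconst_1 one_ralg_def[symmetric])
qed

definition ralg_gen :: "rgen \<Rightarrow> ('k::field_char_0, 'n::finite) ralg"
  where "ralg_gen g = abs_ralg (fgen g)"

definition grade_ralg :: "bit \<Rightarrow> ('k::field_char_0, 'n::finite) ralg set"
  where "grade_ralg p = ralg.span {prod_list (map ralg_gen gs) | gs.
    set gs \<subseteq> rgens CARD('n) \<and> sum_list (map rpar gs) = p}"

definition rho :: "('k::field_char_0, 'n::finite) ralg \<Rightarrow> ('k, 'n) upn"
  where "rho = (THE f. superalg_hom scale_ralg grade_ralg scale_upn grade_upn f \<and>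
    (\<forall>i\<in>{1..<CARD('n)}.
       f (ralg_gen (GE i)) = upn_iota (pa i (i + 1)) \<and>
       f (ralg_gen (GF i)) = upn_iota (pa (i + 1) i) \<and>
       f (ralg_gen (GB i)) = upn_iota (pb i (i + 1)) \<and>
       f (ralg_gen (GC i)) = upn_iota (pc i (i + 1))) \<and>
    (\<forall>i\<in>{1..CARD('n)}. f (ralg_gen (GH i)) = upn_iota (pa i i)) \<and>
    f (ralg_gen GB11) = upn_iota (pb 1 1))"


section \<open>Root vectors\<close>

definition ralg_0 :: "('k::field_char_0, 'n::finite) ralg set"
  where "ralg_0 = (\<lambda>V. ralg.subspace V \<and> 1 \<in> V \<and> (\<forall>x\<in>V. \<forall>y\<in>V. x * y \<in> V)) hull
    (ralg_gen ` (GE ` {1..<CARD('n)} \<union> GF ` {1..<CARD('n)} \<union> GH ` {1..CARD('n)}))"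

definition vec_A :: "nat \<Rightarrow> nat \<Rightarrow> ('k::field_char_0, 'n::finite) ralg"
  where "vec_A i j = (THE x. x \<in> ralg_0 \<and> rho x = upn_iota (pa i j))"

text \<open>As $A_{i,j}$ is even, its superbracket with any element is the ordinary commutator.\<close>

definition ad_stable :: "('k::field_char_0, 'n::finite) ralg set \<Rightarrow> bool"
  where "ad_stable V \<longleftrightarrow>
    (\<forall>i\<in>{1..CARD('n)}. \<forall>j\<in>{1..CARD('n)}. \<forall>x\<in>V. vec_A i j * x - x * vec_A i j \<in> V)"

definition ralg_1 :: "('k::field_char_0, 'n::finite) ralg set"
  where "ralg_1 = (\<lambda>V. ralg.subspace V \<and> ad_stable V) hull {ralg_gen GB11}"

definition ralg_m1 :: "('k::field_char_0, 'n::finite) ralg set"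
  where "ralg_m1 = (\<lambda>V. ralg.subspace V \<and> ad_stable V) hull
    (if CARD('n) = 1 then {} else {ralg_gen (GC (CARD('n) - 1))})"

definition vec_B :: "nat \<Rightarrow> nat \<Rightarrow> ('k::field_char_0, 'n::finite) ralg"
  where "vec_B i j = (THE x. x \<in> ralg_1 \<and> rho x = upn_iota (pb i j))"

definition vec_C :: "nat \<Rightarrow> nat \<Rightarrow> ('k::field_char_0, 'n::finite) ralg"
  where "vec_C i j = (THE x. x \<in> ralg_m1 \<and> rho x = upn_iota (pc i j))"

text \<open>
  The constructors stand for the roots $\varepsilon_i-\varepsilon_j$ ($i \ne j$),
  $\varepsilon_i+\varepsilon_j$ ($i \le j$) and $-(\varepsilon_i+\varepsilon_j)$ ($i < j$).
\<close>

datatype root = Diff nat nat | Plus nat nat | Minus nat nat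

definition Phi_0p :: "nat \<Rightarrow> root set"
  where "Phi_0p n = {Diff i j | i j. 1 \<le> i \<and> i < j \<and> j \<le> n}"

definition Phi_0m :: "nat \<Rightarrow> root set"
  where "Phi_0m n = {Diff j i | i j. 1 \<le> i \<and> i < j \<and> j \<le> n}"

definition Phi_m1 :: "nat \<Rightarrow> root set"
  where "Phi_m1 n = {Plus i j | i j. 1 \<le> i \<and> i \<le> j \<and> j \<le> n}"

definition Phi_1 :: "nat \<Rightarrow> root set"
  where "Phi_1 n = {Minus i j | i j. 1 \<le> i \<and> i < j \<and> j \<le> n}"

fun root_vec :: "root \<Rightarrow> ('k::field_char_0, 'n::finite) ralg" where
  "root_vec (Diff i j) = vec_A i j"
| "root_vec (Plus i j) = vec_B i j"
| "root_vec (Minus i j) = vec_C i j"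


section \<open>Kostant monomials\<close>

definition divpow :: "('k::field_char_0, 'n::finite) ralg \<Rightarrow> nat \<Rightarrow> ('k, 'n) ralg"
  where "divpow x r = scale_ralg (1 / fact r) (x ^ r)"

definition hbinom :: "('k::field_char_0, 'n::finite) ralg \<Rightarrow> nat \<Rightarrow> ('k, 'n) ralg"
  where "hbinom h s = scale_ralg (1 / fact s) (prod_list (map (\<lambda>m. h - of_nat m) [0..<s]))"

definition kostant_factors :: "('k::field_char_0, 'n::finite) ralg set"
  where "kostant_factors =
    {root_vec \<delta> ^ d | \<delta> d. \<delta> \<in> Phi_m1 CARD('n) \<union> Phi_1 CARD('n) \<and> d \<in> {0, 1}} \<union>
    {divpow (root_vec \<alpha>) r | \<alpha> r. \<alpha> \<in> Phi_0p CARD('n) \<union> Phi_0m CARD('n)} \<union>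
    {hbinom (ralg_gen (GH i)) s | i s. i \<in> {1..CARD('n)}}"

definition kostant_monomials :: "('k::field_char_0, 'n::finite) ralg set"
  where "kostant_monomials = {prod_list xs | xs. set xs \<subseteq> kostant_factors}"

global_interpretation int_module: module "\<lambda>(m::int) (x::'a::ring_1). of_int m * x"
  by standard (simp_all add: distrib_left distrib_right mult.assoc)

definition ralg_Z :: "('k::field_char_0, 'n::finite) ralg set"
  where "ralg_Z = int_module.span kostant_monomials"

text \<open>
  A total order on a finite set of roots is given as a repetition-free list enumerating that set
  in increasing order.
\<close>

definition enumerates :: "'a list \<Rightarrow> 'a set \<Rightarrow> bool"
  where "enumerates xs A \<longleftrightarrow> distinct xs \<and> set xs = A"

definition ordered_monomial ::
    "root list \<Rightarrow> root list \<Rightarrow> root list \<Rightarrow> root list \<Rightarrow>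
     (root \<Rightarrow> nat) \<Rightarrow> (root \<Rightarrow> nat) \<Rightarrow> (nat \<Rightarrow> nat) \<Rightarrow> ('k::field_char_0, 'n::finite) ralg"
  where "ordered_monomial om1 o0m o0p o1 d r s =
    prod_list (map (\<lambda>\<beta>. root_vec \<beta> ^ d \<beta>) om1) *
    prod_list (map (\<lambda>\<alpha>. divpow (root_vec \<alpha>) (r \<alpha>)) o0m) *
    prod_list (map (\<lambda>i. hbinom (ralg_gen (GH i)) (s i)) [1..<CARD('n) + 1]) *
    prod_list (map (\<lambda>\<alpha>. divpow (root_vec \<alpha>) (r \<alpha>)) o0p) *
    prod_list (map (\<lambda>\<gamma>. root_vec \<gamma> ^ d \<gamma>) o1)"

definition ordered_monomials ::
    "root list \<Rightarrow> root list \<Rightarrow> root list \<Rightarrow> root list \<Rightarrow> ('k::field_char_0, 'n::finite) ralg set"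
  where "ordered_monomials om1 o0m o0p o1 =
    {ordered_monomial om1 o0m o0p o1 d r s | d r s. \<forall>\<delta>. d \<delta> \<in> {0, 1}}"

end

theory Submission
  imports Defs "HOL-Library.Function_Algebras"
begin

text \<open>
  The proof compares $R$ with $U(\mathfrak p(n))$ from both sides: ordered Kostant monomials span
  $R_{\mathbb Z}$ over $\mathbb Z$ and hence $R$ over the field, since the generators are Kostant monomials,
  and their images in $U(\mathfrak p(n))$ are linearly independent.
  Together these facts give both bases and the injectivity of $\rho$ at one stroke.

  For the spanning part, $R$ has to contain a copy of $\mathfrak p(n)$.  A copy is recorded as
  a \<open>pn_family\<close>: elements $A_{ij}$, $S_{ij}$, $T_{ij}$ satisfying the brackets of
  $E_{i,j}-E_{-j,-i}$, $E_{i,-j}+E_{j,-i}$, $E_{-i,j}-E_{-j,i}$.  Here $S_{ii}$ is twice the root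
  vector of $2\varepsilon_i$, so that the structure constants need no fractions.  The
  even part is built one row and column at a time from the Serre relations (\<open>gl_family_chevalley\<close>).
  With respect to it, $B_{1,1}$ and $C_{n-1}$ are extremal weight vectors, and a few of the
  relations suffice to show that they generate the symmetric square of the natural representation
  and the exterior square of its dual.  The brackets of odd elements are equivariant, hence
  determined by very few of them.  The outcome is \<open>exists_pn_family\<close>.

  Modulo terms of lower degree, Kostant letters commute up to sign, and two letters of the same root
  merge with an integral coefficient; this is a finite list of identities for divided powers and
  binomials, the hardest being Kostant's formula for $\mathfrak{sl}_2$ (\<open>divpow_sl2\<close>).
  An abstract straightening argument (\<open>word_in_ordered_span\<close>) then writes every product of
  letters as an integral combination of ordered ones.

  Independence is a Poincare-Birkhoff-Witt theorem for $\mathfrak p(n)$.  It is proved through the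
  defining representation $V$: the space $V\otimes U(\mathfrak p(n))$ is again a representation, which
  amounts to a homomorphism from $U(\mathfrak p(n))$ to $\mathrm{End}(V)\otimes U(\mathfrak p(n))$.
  Suitable matrix coefficients of it behave on leading terms like the partial derivatives with
  respect to the root vectors, because $V$ is faithful (\<open>root_deriv_lin_sorted_word\<close>).
  Differentiating a linear relation lowers its degree, so induction on the degree shows that
  it is trivial (\<open>sorted_words_independent\<close>).

  The image of $\rho$ contains the root basis of $\mathfrak p(n)$, so $\rho$ is onto; the
  preimages of homogeneous elements of $\mathfrak p(n)$ are homogeneous because $A_{ij}$ is
  obtained from even generators, and $S_{ij}$, $T_{ij}$ from odd ones by commutators with the
  $A_{ij}$.  The same remark places these elements in the subalgebra and in the stable subspaces by
  which the root vectors of $R$ are defined, and so identifies them with the root vectors.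
\<close>


section \<open>A copy of $\mathfrak{gl}(n)$ from Chevalley generators\<close>

definition com :: "'a::ring_1 \<Rightarrow> 'a \<Rightarrow> 'a" where "com x y = x * y - y * x"

definition acom :: "'a::ring_1 \<Rightarrow> 'a \<Rightarrow> 'a" where "acom x y = x * y + y * x"

lemma com_0 [simp]: "com x 0 = 0" "com 0 x = 0"
  and acom_0 [simp]: "acom x 0 = 0" "acom 0 x = 0"
  and com_self [simp]: "com x x = 0"
  by (simp_all add: com_def acom_def)

lemma com_add: "com x (y + z) = com x y + com x z" "com (x + y) z = com x z + com y z"
  and com_diff: "com x (y - z) = com x y - com x z" "com (x - y) z = com x z - com y z"
  and com_minus: "com x (- y) = - com x y" "com (- x) y = - com x y"
  and acom_add: "acom x (y + z) = acom x y + acom x z" "acom (x + y) z = acom x z + acom y z"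
  and acom_diff: "acom x (y - z) = acom x y - acom x z" "acom (x - y) z = acom x z - acom y z"
  and acom_minus: "acom x (- y) = - acom x y" "acom (- x) y = - acom x y"
  by (simp_all add: com_def acom_def algebra_simps)

lemmas com_linear = com_add com_diff com_minus

lemma com_anti: "com y x = - com x y"
  and acom_commute: "acom y x = acom x y"
  by (simp_all add: com_def acom_def)

lemma com_antiD: "com x y = z \<Longrightarrow> com y x = - z"
  using com_anti[of y x] by simp

lemma com_of_nat: "com x (of_nat m * y) = of_nat m * com x y"
  by (simp add: com_def algebra_simps mult_of_nat_commute)

lemma com_jacobi: "com (com x y) z = com x (com y z) - com y (com x z)"
  by (simp add: com_def algebra_simps)

lemma com_com: "com x (com y z) = com (com x y) z + com y (com x z)"
  by (simp add: com_def algebra_simps)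

lemma com_acom: "com x (acom y z) = acom (com x y) z + acom y (com x z)"
  by (simp add: com_def acom_def algebra_simps)

lemma com_if: "com x (if P then y else z) = (if P then com x y else com x z)"
  "com (if P then y else z) x = (if P then com y x else com z x)"
  by auto

text \<open>
  The commutators of the matrix units of $\mathfrak{gl}(n)$.
\<close>

definition gl_family :: "nat \<Rightarrow> (nat \<Rightarrow> nat \<Rightarrow> 'a::ring_1) \<Rightarrow> bool"
  where "gl_family n A \<longleftrightarrow> (\<forall>i\<in>{1..n}. \<forall>j\<in>{1..n}. \<forall>k\<in>{1..n}. \<forall>l\<in>{1..n}.
    com (A i j) (A k l) = (if j = k then A i l else 0) - (if i = l then A k j else 0))"

lemma gl_familyD:
  "gl_family n A \<Longrightarrow> i \<in> {1..n} \<Longrightarrow> j \<in> {1..n} \<Longrightarrow> k \<in> {1..n} \<Longrightarrow> l \<in> {1..n} \<Longrightarrow>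
    com (A i j) (A k l) = (if j = k then A i l else 0) - (if i = l then A k j else 0)"
  unfolding gl_family_def by blast

text \<open>
  Upper matrix units are iterated commutators of the simple ones.
\<close>

lemma gl_family_upper:
  assumes gl: "gl_family n A" and "1 \<le> k" "k < l" "l \<le> n"
    and simple: "\<And>i. k \<le> i \<Longrightarrow> i < l \<Longrightarrow> P (A i (i + 1))"
    and closed: "\<And>x y. P x \<Longrightarrow> P y \<Longrightarrow> P (com x y)"
  shows "P (A k l)"
  using \<open>k < l\<close> \<open>l \<le> n\<close> simple
proof (induction l)
  case (Suc l)
  show ?case
  proof (cases "k = l")
    case True then show ?thesis using Suc.prems(3)[of l] by simp
  next
    case False
    have "P (A k l)" using Suc False by simp
    moreover have "P (A l (Suc l))" using Suc.prems(3)[of l] Suc.prems(1) by simp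
    moreover have "A k (Suc l) = com (A k l) (A l (Suc l))"
      using gl_familyD[OF gl, of k l l "Suc l"] Suc.prems(1,2) False \<open>1 \<le> k\<close> by simp
    ultimately show ?thesis using closed by simp
  qed
qed simp

text \<open>
  Minus transposition is an automorphism of $\mathfrak{gl}(n)$; it exchanges statements about upper and lower matrix units.
\<close>

lemma gl_family_transpose: "gl_family n A \<Longrightarrow> gl_family n (\<lambda>i j. - A j i)"
  unfolding gl_family_def by (simp add: com_minus)

lemma gl_family_lower:
  assumes gl: "gl_family n A" and "1 \<le> l" "l < k" "k \<le> n"
    and simple: "\<And>i. l \<le> i \<Longrightarrow> i < k \<Longrightarrow> P (A (i + 1) i)"
    and closed: "\<And>x y. P x \<Longrightarrow> P y \<Longrightarrow> P (com x y)"
  shows "P (A k l)"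
proof -
  have neg: "- com x y = com (- y) (- x)" for x y :: 'a
    by (simp add: com_minus) (simp add: com_def)
  have "P (- (- A k l))"
    by (rule gl_family_upper[OF gl_family_transpose[OF gl] assms(2-4), of "\<lambda>x. P (- x)"])
      (use simple closed neg in auto)
  then show ?thesis by simp
qed

lemma gl_family_generated:
  assumes gl: "gl_family n A" and "k \<in> {1..n}" "l \<in> {1..n}"
    and "\<And>i. i \<in> {1..n} \<Longrightarrow> P (A i i)"
    and "\<And>i. 1 \<le> i \<Longrightarrow> i < n \<Longrightarrow> P (A i (i + 1)) \<and> P (A (i + 1) i)"
    and "\<And>x y. P x \<Longrightarrow> P y \<Longrightarrow> P (com x y)"
  shows "P (A k l)"
  using gl_family_upper[OF gl, of k l P] gl_family_lower[OF gl, of l k P] assms(2-6)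
  by (cases k l rule: linorder_cases) auto

lemma com_killed: "com x z = 0 \<Longrightarrow> com y z = 0 \<Longrightarrow> com (com x y) z = 0"
  by (simp add: com_jacobi)

text \<open>
  All divisions in the construction of root vectors are by integers; they are justified by this property, which $k$-algebras in characteristic zero have.
\<close>

definition torsion_free :: "'a::ring_1 itself \<Rightarrow> bool"
  where "torsion_free _ \<longleftrightarrow> (\<forall>m (x::'a). m > 0 \<longrightarrow> of_nat m * x = 0 \<longrightarrow> x = 0)"

lemma torsion_freeD2: "torsion_free TYPE('a::ring_1) \<Longrightarrow> (x::'a) + x = 0 \<Longrightarrow> x = 0"
  unfolding torsion_free_def by (metis mult_2 of_nat_numeral zero_less_numeral)

lemma torsion_freeD3: "torsion_free TYPE('a::ring_1) \<Longrightarrow> (x::'a) + x + x = 0 \<Longrightarrow> x = 0"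
proof -
  assume "torsion_free TYPE('a)" and *: "x + x + x = 0"
  have "of_nat 3 * x = (1 + 1 + 1) * x" by simp
  also have "\<dots> = 0" using * by (simp only: distrib_right mult_1_left)
  finally show "x = 0" using \<open>torsion_free TYPE('a)\<close> unfolding torsion_free_def by (metis zero_less_numeral of_nat_numeral)
qed

text \<open>
  The vector $e$, of the weight of $E_{m,m+1}$, is the last basis vector of a natural representation of $\mathfrak{gl}(m)$
  consisting of the future column $E_{i,m+1}$: the weights together with the simple relations show that
  every $A_{kl}$ with $l\neq m$ kills $e$.  The Serre relations then make the elements $A_{im}$ act on the column
  as square-zero operators and make the column commutative.
\<close>

lemma gl_family_column:
  fixes A :: "nat \<Rightarrow> nat \<Rightarrow> 'a::ring_1"
  assumes tf: "torsion_free TYPE('a)" and gl: "gl_family m A" and m: "1 \<le> m"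
    and hw: "\<And>i. i \<in> {1..m} \<Longrightarrow> com (A i i) e = (if i = m then e else 0)"
    and low: "\<And>i. 1 \<le> i \<Longrightarrow> i < m \<Longrightarrow> com (A (i + 1) i) e = 0"
    and up: "\<And>i. 1 \<le> i \<Longrightarrow> i + 1 < m \<Longrightarrow> com (A i (i + 1)) e = 0"
    and serre1: "m \<ge> 2 \<Longrightarrow> com (A (m - 1) m) (com (A (m - 1) m) e) = 0"
    and serre2: "m \<ge> 2 \<Longrightarrow> com e (com e (A (m - 1) m)) = 0"
    and a_def: "\<And>i. a i = (if i = m then e else com (A i m) e)"
  shows "k \<in> {1..m} \<Longrightarrow> l \<in> {1..m} \<Longrightarrow> i \<in> {1..m} \<Longrightarrow> com (A k l) (a i) = (if l = i then a k else 0)"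
    and "i \<in> {1..m} \<Longrightarrow> j \<in> {1..m} \<Longrightarrow> com (a i) (a j) = 0"
proof -
  note AA = gl_familyD[OF gl]
  have kill: "com (A k l) e = 0" if "k \<in> {1..m}" "l \<in> {1..m}" "l \<noteq> m" for k l
  proof (cases k l rule: linorder_cases)
    case less
    then show ?thesis
      using that up com_killed by (intro gl_family_upper[OF gl, of k l "\<lambda>x. com x e = 0"]) auto
  next
    case equal then show ?thesis using that hw by simp
  next
    case greater
    then show ?thesis
      using that low com_killed by (intro gl_family_lower[OF gl, of l k "\<lambda>x. com x e = 0"]) auto
  qed
  have Ae: "com (A k l) e = (if l = m then a k else 0)" if "k \<in> {1..m}" "l \<in> {1..m}" for k l
    using that kill hw[of m] unfolding a_def by auto
  \<comment> \<open>The Serre relation, with the index $m-1$ of one factor changed by a commutator; two equal terms appear.\<close>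
  have s1: "com (A k m) (com (A (m - 1) m) e) = 0" if "k \<in> {1..m}" "k \<noteq> m" for k
  proof (cases "k = m - 1")
    case True then show ?thesis using serre1 that by auto
  next
    case False
    have "com (A k (m - 1)) (com (A (m - 1) m) (com (A (m - 1) m) e)) = 0" using serre1 that by auto
    moreover have "com (A k (m - 1)) (A (m - 1) m) = A k m" "com (A k (m - 1)) e = 0"
      using that False AA[of k "m - 1" "m - 1" m] kill[of k "m - 1"] by auto
    ultimately have "com (A k m) (com (A (m - 1) m) e) + com (A (m - 1) m) (com (A k m) e) = 0"
      by (simp add: com_com[of "A k (m - Suc 0)"])
    moreover have "com (A (m - 1) m) (A k m) = 0"
      using that AA[of "m - 1" m k m] by auto
    then have "com (A (m - 1) m) (com (A k m) e) = com (A k m) (com (A (m - 1) m) e)"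
      by (simp add: com_com[of "A (m - Suc 0) m"])
    ultimately show ?thesis using torsion_freeD2[OF tf] by metis
  qed
  have s2: "com (A k m) (com (A i m) e) = 0" if "k \<in> {1..m}" "k \<noteq> m" "i \<in> {1..m}" "i \<noteq> m" for k i
  proof (cases "i = m - 1")
    case True then show ?thesis using s1 that by auto
  next
    case False
    have "com (A i (m - 1)) (com (A k m) (com (A (m - 1) m) e)) = 0" using s1 that by auto
    moreover have "com (A i (m - 1)) (A (m - 1) m) = A i m" "com (A i (m - 1)) e = 0"
      using that False AA[of i "m - 1" "m - 1" m] kill[of i "m - 1"] by auto
    moreover have "com (A i (m - 1)) (A k m) = (if k = m - 1 then A i m else 0)"
      using that AA[of i "m - 1" k m] by auto
    ultimately have *: "com (if k = m - 1 then A i m else 0) (com (A (m - 1) m) e) + com (A k m) (com (A i m) e) = 0"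
      by (simp add: com_com[of "A i (m - Suc 0)"])
    show ?thesis using * s1[of i] that by (auto split: if_splits)
  qed
  have am: "a m = e" by (simp add: a_def)
  have s2': "com (A i m) (a k) = 0" if "k \<in> {1..m}" "k \<noteq> m" "i \<in> {1..m}" "i \<noteq> m" for k i
    using s2[of i k] that by (simp add: a_def)
  show c1: "com (A k l) (a i) = (if l = i then a k else 0)" if "k \<in> {1..m}" "l \<in> {1..m}" "i \<in> {1..m}" for k l i
  proof (cases "i = m")
    case True then show ?thesis using Ae[OF that(1,2)] by (simp add: a_def)
  next
    case False
    then have ai: "a i = com (A i m) e" by (simp add: a_def)
    have "com (A k l) (a i) = com ((if l = i then A k m else 0) - (if k = m then A i l else 0)) e
        + com (A i m) (if l = m then a k else 0)"
      unfolding ai com_com[of "A k l"] using AA[of k l i m] Ae[of k l] that m by simp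
    also have "\<dots> = (if l = i then a k else 0)"
      using that m False s2' Ae[of k m] Ae[of i l] Ae[of i m] am by (auto simp: com_linear)
    finally show ?thesis .
  qed
  have e2: "com e (a j) = 0" if "j \<in> {1..m}" for j
  proof -
    have *: "com e (a (m - 1)) = 0" if "m \<ge> 2"
      using serre2 that by (simp add: a_def com_anti[of e "A (m - Suc 0) m"] com_minus)
    consider "j = m" | "j = m - 1" "m \<ge> 2" | "j < m - 1" "m \<ge> 2" using \<open>j \<in> {1..m}\<close> by fastforce
    then show ?thesis
    proof cases
      case 3
      have "com (A j (m - 1)) (com e (a (m - 1))) = 0" using * 3 by simp
      then show ?thesis
        using c1[of j "m - 1" "m - 1"] kill[of j "m - 1"] that 3 by (simp add: com_com[of "A j (m - Suc 0)"])
    qed (use * in \<open>auto simp: a_def\<close>)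
  qed
  show "com (a i) (a j) = 0" if "i \<in> {1..m}" "j \<in> {1..m}" for i j
  proof -
    consider "i = m" | "j = m" | "i \<noteq> m" "j \<noteq> m" by blast
    then show ?thesis
    proof cases
      case 1 then show ?thesis using e2 that am by simp
    next
      case 2 then show ?thesis using e2[of i] that am com_anti[of e "a i"] by simp
    next
      case 3
      have "com (A i m) (com e (a j)) = 0" using e2 that by simp
      then show ?thesis using c1[of i m j] that 3 m by (simp add: com_com[of "A i m"] a_def)
    qed
  qed
qed

text \<open>
  Enlarges $\mathfrak{gl}(m)$ to $\mathfrak{gl}(m+1)$.  The new column comes from $e$ and the new row from $f$ by
  the preceding lemma (for the row, applied to minus the transposed family); the mixed brackets follow from
  $[e,f]$ by the action of $\mathfrak{gl}(m)$.
\<close>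

lemma gl_family_extend:
  fixes A :: "nat \<Rightarrow> nat \<Rightarrow> 'a::ring_1"
  assumes tf: "torsion_free TYPE('a)" and gl: "gl_family m A" and m: "1 \<le> m"
    and he: "\<And>i. i \<in> {1..m} \<Longrightarrow> com (A i i) e = (if i = m then e else 0)"
    and le: "\<And>i. 1 \<le> i \<Longrightarrow> i < m \<Longrightarrow> com (A (i + 1) i) e = 0"
    and ue: "\<And>i. 1 \<le> i \<Longrightarrow> i + 1 < m \<Longrightarrow> com (A i (i + 1)) e = 0"
    and s1e: "m \<ge> 2 \<Longrightarrow> com (A (m - 1) m) (com (A (m - 1) m) e) = 0"
    and s2e: "m \<ge> 2 \<Longrightarrow> com e (com e (A (m - 1) m)) = 0"
    and hf: "\<And>i. i \<in> {1..m} \<Longrightarrow> com (A i i) f = - (if i = m then f else 0)"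
    and lf: "\<And>i. 1 \<le> i \<Longrightarrow> i < m \<Longrightarrow> com (A i (i + 1)) f = 0"
    and uf: "\<And>i. 1 \<le> i \<Longrightarrow> i + 1 < m \<Longrightarrow> com (A (i + 1) i) f = 0"
    and s1f: "m \<ge> 2 \<Longrightarrow> com (A m (m - 1)) (com (A m (m - 1)) f) = 0"
    and s2f: "m \<ge> 2 \<Longrightarrow> com f (com f (A m (m - 1))) = 0"
    and ef: "com e f = A m m - h"
    and hA: "\<And>i. i \<in> {1..m} \<Longrightarrow> com h (A i i) = 0"
      "\<And>i. 1 \<le> i \<Longrightarrow> i < m \<Longrightarrow> com h (A i (i + 1)) = 0 \<and> com h (A (i + 1) i) = 0"
    and hhe: "com h e = - e" and hhf: "com h f = f"
  obtains A' where "gl_family (Suc m) A'" "\<And>i j. i \<in> {1..m} \<Longrightarrow> j \<in> {1..m} \<Longrightarrow> A' i j = A i j"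
    "A' m (Suc m) = e" "A' (Suc m) m = f" "A' (Suc m) (Suc m) = h"
proof -
  note AA = gl_familyD[OF gl]
  define a where "a i = (if i = m then e else com (A i m) e)" for i
  define b where "b i = (if i = m then f else - com (A m i) f)" for i
  note cola = gl_family_column[OF tf gl m he le ue s1e s2e a_def]
  have Aa: "com (A k l) (a i) = (if l = i then a k else 0)" if "k \<in> {1..m}" "l \<in> {1..m}" "i \<in> {1..m}" for k l i
    using cola(1) that by blast
  have aa: "com (a i) (a j) = 0" if "i \<in> {1..m}" "j \<in> {1..m}" for i j
    using cola(2) that by blast
  have b_alt: "- b i = (if i = m then - f else com (- A m i) (- f))" for i
    by (simp add: b_def com_minus)
  note col = gl_family_column[OF tf gl_family_transpose[OF gl] m, of "- f" "\<lambda>i. - b i", OF _ _ _ _ _ b_alt]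
  have Ab: "com (A k l) (b i) = - (if k = i then b l else 0)" if "k \<in> {1..m}" "l \<in> {1..m}" "i \<in> {1..m}" for k l i
    using col(1)[of l k i] hf lf uf s1f s2f that by (simp add: com_minus split: if_splits)
  have bb: "com (b i) (b j) = 0" if "i \<in> {1..m}" "j \<in> {1..m}" for i j
    using col(2)[of i j] hf lf uf s1f s2f that by (simp add: com_minus)
  have mem: "m \<in> {1..m}" using m by simp
  have am: "a m = e" and bm: "b m = f" by (simp_all add: a_def b_def)
  have "com x h = 0 \<longleftrightarrow> com h x = 0" for x using com_anti[of h x] by auto
  then have Ah: "com (A k l) h = 0" if "k \<in> {1..m}" "l \<in> {1..m}" for k l
    using gl_family_generated[OF gl that, of "\<lambda>x. com h x = 0"] hA by (auto simp: com_com[of h])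
  have ha: "com h (a i) = - a i" if "i \<in> {1..m}" for i
    using Ah[of i m] that mem com_anti[of "A i m" h]
    by (simp add: a_def com_com[of h] hhe com_minus)
  have hb: "com h (b i) = b i" if "i \<in> {1..m}" for i
    using Ah[of m i] that mem com_anti[of "A m i" h]
    by (simp add: b_def com_com[of h] hhf com_minus)
  have ab_m: "com (a i) (b m) = A i m - (if i = m then h else 0)" if "i \<in> {1..m}" for i
  proof (cases "i = m")
    case True then show ?thesis by (simp add: am bm ef)
  next
    case False
    then have "com (a i) (b m) = com (com (A i m) (a m)) (b m)" using Aa[of i m m] that mem by simp
    also have "\<dots> = com (A i m) (A m m - h)"
      using Ab[of i m m] that mem False unfolding com_jacobi by (simp add: am bm ef)
    also have "\<dots> = A i m" using AA[of i m m m] that mem False Ah by (simp add: com_linear)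
    finally show ?thesis using False by simp
  qed
  have ab: "com (a i) (b j) = A i j - (if i = j then h else 0)" if "i \<in> {1..m}" "j \<in> {1..m}" for i j
  proof (cases "j = m")
    case True then show ?thesis using ab_m that by simp
  next
    case False
    have "b j = - com (A m j) (b m)" using Ab[of m j m] that mem by simp
    then have "com (a i) (b j) = - (com (com (a i) (A m j)) (b m) + com (A m j) (com (a i) (b m)))"
      by (simp add: com_minus com_com[of "a i"])
    also have "com (a i) (A m j) = - (if j = i then a m else 0)"
      by (rule com_antiD, rule Aa) (use that mem in auto)
    finally show ?thesis
      using False that mem Ah[of m j] AA[of m j i m] ab_m[OF that(1)] ab_m[OF mem]
      by (auto simp: com_linear)
  qed
  define A' where "A' = (\<lambda>i j. if i = Suc m then (if j = Suc m then h else b j) else if j = Suc m then a i else A i j)"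
  have anti: "com y x = - z" if "com x y = z" for x y z :: 'a using that com_anti by metis
  have "gl_family (Suc m) A'"
    unfolding gl_family_def
  proof (intro ballI)
    fix i j k l assume "i \<in> {1..Suc m}" "j \<in> {1..Suc m}" "k \<in> {1..Suc m}" "l \<in> {1..Suc m}"
    then have "i = Suc m \<or> (i \<in> {1..m} \<and> i \<noteq> Suc m)" "j = Suc m \<or> (j \<in> {1..m} \<and> j \<noteq> Suc m)"
      "k = Suc m \<or> (k \<in> {1..m} \<and> k \<noteq> Suc m)" "l = Suc m \<or> (l \<in> {1..m} \<and> l \<noteq> Suc m)" by auto
    then show "com (A' i j) (A' k l) = (if j = k then A' i l else 0) - (if i = l then A' k j else 0)"
      unfolding A'_def
      by (elim disjE conjE)
        (simp_all add: AA Aa aa Ab bb ab ha hb Ah anti[OF Aa] anti[OF ab] anti[OF Ab] anti[OF ha] anti[OF hb] anti[OF Ah])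
  qed
  then show thesis using mem by (intro that[of A']) (auto simp: A'_def am bm)
qed

text \<open>
  Serre presentation of $\mathfrak{gl}(n)$, in the form of an induction over the corner subalgebras $\mathfrak{gl}(m)$.
\<close>

lemma gl_family_chevalley:
  fixes E F H :: "nat \<Rightarrow> 'a::ring_1"
  assumes tf: "torsion_free TYPE('a)"
    and HH: "\<And>i j. i \<in> {1..n} \<Longrightarrow> j \<in> {1..n} \<Longrightarrow> com (H i) (H j) = 0"
    and HE: "\<And>i j. i \<in> {1..n} \<Longrightarrow> j \<in> {1..<n} \<Longrightarrow>
      com (H i) (E j) = (if i = j then E j else 0) - (if i = j + 1 then E j else 0)"
    and HF: "\<And>i j. i \<in> {1..n} \<Longrightarrow> j \<in> {1..<n} \<Longrightarrow>
      com (H i) (F j) = (if i = j + 1 then F j else 0) - (if i = j then F j else 0)"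
    and EF: "\<And>i j. i \<in> {1..<n} \<Longrightarrow> j \<in> {1..<n} \<Longrightarrow>
      com (E i) (F j) = (if i = j then H i - H (i + 1) else 0)"
    and EE: "\<And>i j. i \<in> {1..<n} \<Longrightarrow> j \<in> {1..<n} \<Longrightarrow> j \<noteq> i + 1 \<Longrightarrow> i \<noteq> j + 1 \<Longrightarrow> com (E i) (E j) = 0"
    and FF: "\<And>i j. i \<in> {1..<n} \<Longrightarrow> j \<in> {1..<n} \<Longrightarrow> j \<noteq> i + 1 \<Longrightarrow> i \<noteq> j + 1 \<Longrightarrow> com (F i) (F j) = 0"
    and EEE: "\<And>i j. i \<in> {1..<n} \<Longrightarrow> j \<in> {1..<n} \<Longrightarrow> j = i + 1 \<or> i = j + 1 \<Longrightarrow> com (E i) (com (E i) (E j)) = 0"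
    and FFF: "\<And>i j. i \<in> {1..<n} \<Longrightarrow> j \<in> {1..<n} \<Longrightarrow> j = i + 1 \<or> i = j + 1 \<Longrightarrow> com (F i) (com (F i) (F j)) = 0"
  obtains A where "gl_family n A" "\<And>i. i \<in> {1..n} \<Longrightarrow> A i i = H i"
    "\<And>i. i \<in> {1..<n} \<Longrightarrow> A i (i + 1) = E i \<and> A (i + 1) i = F i"
proof -
  have "\<exists>A. gl_family m A \<and> (\<forall>i\<in>{1..m}. A i i = H i) \<and>
    (\<forall>i\<in>{1..<m}. A i (i + 1) = E i \<and> A (i + 1) i = F i)" if "m \<le> n" for m
    using that
  proof (induction m)
    case 0 show ?case by (simp add: gl_family_def)
  next
    case (Suc m)
    then obtain A where A: "gl_family m A" "\<And>i. i \<in> {1..m} \<Longrightarrow> A i i = H i"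
      "\<And>i. i \<in> {1..<m} \<Longrightarrow> A i (Suc i) = E i" "\<And>i. i \<in> {1..<m} \<Longrightarrow> A (Suc i) i = F i" by auto
    show ?case
    proof (cases "m = 0")
      case True
      then show ?thesis by (intro exI[of _ "\<lambda>_ _. H 1"]) (auto simp: gl_family_def)
    next
      case False
      have FE: "com (F i) (E j) = 0" if "i \<in> {1..<n}" "j \<in> {1..<n}" "i \<noteq> j" for i j
        using EF[of j i] that com_anti[of "E j" "F i"] by simp
      have A1: "A (m - 1) m = E (m - 1)" "A m (m - 1) = F (m - 1)" if "m \<ge> 2"
        using A(3)[of "m - 1"] A(4)[of "m - 1"] that by auto
      have serre: "com (E (m - Suc 0)) (com (E (m - Suc 0)) (E m)) = 0"
        "com (E m) (com (E m) (E (m - Suc 0))) = 0"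
        "com (F (m - Suc 0)) (com (F (m - Suc 0)) (F m)) = 0"
        "com (F m) (com (F m) (F (m - Suc 0))) = 0" if "m \<ge> 2"
      proof -
        have r: "m - Suc 0 \<in> {1..<n}" "m \<in> {1..<n}" "m = (m - Suc 0) + 1" using that Suc.prems by auto
        show "com (E (m - Suc 0)) (com (E (m - Suc 0)) (E m)) = 0"
          "com (E m) (com (E m) (E (m - Suc 0))) = 0"
          "com (F (m - Suc 0)) (com (F (m - Suc 0)) (F m)) = 0"
          "com (F m) (com (F m) (F (m - Suc 0))) = 0"
          using EEE[OF r(1,2)] EEE[OF r(2,1)] FFF[OF r(1,2)] FFF[OF r(2,1)] r(3) by auto
      qed
      obtain A' where A': "gl_family (Suc m) A'" "\<And>i j. i \<in> {1..m} \<Longrightarrow> j \<in> {1..m} \<Longrightarrow> A' i j = A i j"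
        "A' m (Suc m) = E m" "A' (Suc m) m = F m" "A' (Suc m) (Suc m) = H (Suc m)"
        using Suc.prems False
        by (rule_tac gl_family_extend[OF tf A(1), of "E m" "F m" "H (Suc m)"])
          (simp_all add: A A1[simplified] HH HE HF EF FE EE FF serre)
      have "A' i i = H i" if "i \<in> {1..Suc m}" for i
        using that A' A(2)[of i] by (cases "i = Suc m") auto
      moreover have "A' i (i + 1) = E i \<and> A' (i + 1) i = F i" if "i \<in> {1..<Suc m}" for i
        using that A' A(3,4)[of i] by (cases "i = m") auto
      ultimately show ?thesis using A'(1) by blast
    qed
  qed
  from this[of n] show thesis using that by auto
qed


section \<open>Symmetric and exterior squares from extremal weight vectors\<close>

text \<open>
  $S_{ij}$ transforms like $e_ie_j$ in the symmetric square of the natural representation.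
\<close>

definition sym2_family :: "nat \<Rightarrow> (nat \<Rightarrow> nat \<Rightarrow> 'a::ring_1) \<Rightarrow> (nat \<Rightarrow> nat \<Rightarrow> 'a) \<Rightarrow> bool"
  where "sym2_family n A S \<longleftrightarrow> (\<forall>i\<in>{1..n}. \<forall>j\<in>{1..n}. S i j = S j i) \<and>
    (\<forall>k\<in>{1..n}. \<forall>l\<in>{1..n}. \<forall>i\<in>{1..n}. \<forall>j\<in>{1..n}.
      com (A k l) (S i j) = (if l = i then S k j else 0) + (if l = j then S i k else 0))"

text \<open>
  $T_{ij}$ transforms like $e_i\wedge e_j$ in the exterior square of the natural representation.
\<close>

definition alt2_family :: "nat \<Rightarrow> (nat \<Rightarrow> nat \<Rightarrow> 'a::ring_1) \<Rightarrow> (nat \<Rightarrow> nat \<Rightarrow> 'a) \<Rightarrow> bool"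
  where "alt2_family n A T \<longleftrightarrow> (\<forall>i\<in>{1..n}. T i i = 0) \<and> (\<forall>i\<in>{1..n}. \<forall>j\<in>{1..n}. T i j = - T j i) \<and>
    (\<forall>k\<in>{1..n}. \<forall>l\<in>{1..n}. \<forall>i\<in>{1..n}. \<forall>j\<in>{1..n}.
      com (A k l) (T i j) = (if l = i then T k j else 0) + (if l = j then T i k else 0))"

lemma sym2_familyD:
  assumes "sym2_family n A S"
  shows "i \<in> {1..n} \<Longrightarrow> j \<in> {1..n} \<Longrightarrow> S i j = S j i"
    "k \<in> {1..n} \<Longrightarrow> l \<in> {1..n} \<Longrightarrow> i \<in> {1..n} \<Longrightarrow> j \<in> {1..n} \<Longrightarrow>
      com (A k l) (S i j) = (if l = i then S k j else 0) + (if l = j then S i k else 0)"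
  using assms unfolding sym2_family_def by blast+

lemma alt2_familyD:
  assumes "alt2_family n A T"
  shows "i \<in> {1..n} \<Longrightarrow> T i i = 0" "i \<in> {1..n} \<Longrightarrow> j \<in> {1..n} \<Longrightarrow> T i j = - T j i"
    "k \<in> {1..n} \<Longrightarrow> l \<in> {1..n} \<Longrightarrow> i \<in> {1..n} \<Longrightarrow> j \<in> {1..n} \<Longrightarrow>
      com (A k l) (T i j) = (if l = i then T k j else 0) + (if l = j then T i k else 0)"
  using assms unfolding alt2_family_def by blast+

lemma com_swap: "com x y = 0 \<Longrightarrow> com x (com y z) = com y (com x z)"
  by (simp add: com_com[of x y z])

text \<open>
  An element $b$ with the weight and the vanishing properties of $\frac12e_1^2$ generates a symmetric square as soon as $E_{21}^3$
  kills it.  Then $x_j=[A_{j1},b]$ plays the role of $e_1e_j$, and $[A_{i1},x_j]$ that of $e_ie_j$ up to a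
  correction for $j=1$.  The symmetry in $i$ and $j$ is automatic; what has to be shown is that triple products
  $A_{i1}A_{j1}A_{k1}$ kill $b$, and these arise from $E_{21}^3$ by raising one index at a time.
\<close>

lemma sym2_family_highest_weight:
  fixes A :: "nat \<Rightarrow> nat \<Rightarrow> 'a::ring_1"
  assumes tf: "torsion_free TYPE('a)" and gl: "gl_family n A" and n: "1 \<le> n"
    and kill: "\<And>k l. k \<in> {1..n} \<Longrightarrow> l \<in> {2..n} \<Longrightarrow> com (A k l) b = 0"
    and wt: "com (A 1 1) b = b + b"
    and cube: "n \<ge> 2 \<Longrightarrow> com (A 2 1) (com (A 2 1) (com (A 2 1) b)) = 0"
  obtains S where "sym2_family n A S" "S 1 1 = b + b"
    "\<And>k. k \<in> {2..n} \<Longrightarrow> S k 1 = com (A k 1) b"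
proof -
  note AA = gl_familyD[OF gl]
  have one: "1 \<in> {1..n}" using n by simp
  define x where "x j = com (A j 1) b" for j
  define S where "S i j = com (A i 1) (x j) - (if j = 1 then x i else 0)" for i j
  have x1: "x 1 = b + b" using wt by (simp add: x_def)
  have Ab: "com (A k l) b = (if l = 1 then x k else 0)" if "k \<in> {1..n}" "l \<in> {1..n}" for k l
    using kill[of k l] that by (auto simp: x_def)
  have comm: "com (A i 1) (A j 1) = 0" if "i \<in> {2..n}" "j \<in> {2..n}" for i j
    using AA[of i 1 j 1] that n by auto
  have lower: "com (A i 2) (com (A j 1) z) = (if j = 2 then com (A i 1) z else 0) + com (A j 1) (com (A i 2) z)"
    if "i \<in> {3..n}" "j \<in> {2..n}" for i j z
    using AA[of i 2 j 1] that by (auto simp: com_com[of "A i 2"])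
  have c1: "com (A i 1) (com (A 2 1) (com (A 2 1) b)) = 0" if "i \<in> {2..n}" for i
  proof (cases "i = 2")
    case False
    then have "com (A i 2) (com (A 2 1) (com (A 2 1) (com (A 2 1) b))) = 0" using cube that by auto
    then have "com (A i 1) (com (A 2 1) (com (A 2 1) b)) + com (A i 1) (com (A 2 1) (com (A 2 1) b))
      + com (A i 1) (com (A 2 1) (com (A 2 1) b)) = 0"
      using that False comm[of i 2] comm[of 2 i] kill[of i 2]
      by (simp add: lower com_add com_swap[of "A 2 1" "A i 1"] add.assoc del: One_nat_def)
    then show ?thesis by (rule torsion_freeD3[OF tf])
  qed (use cube that in auto)
  \<comment> \<open>The three indices are raised one after the other, at the cost of dividing by three, two and one.\<close>
  have c2: "com (A i 1) (com (A j 1) (com (A 2 1) b)) = 0" if "i \<in> {2..n}" "j \<in> {2..n}" for i j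
  proof (cases "j = 2")
    case False
    then have "com (A j 2) (com (A i 1) (com (A 2 1) (com (A 2 1) b))) = 0" using c1 that by auto
    then have "com (A i 1) (com (A j 1) (com (A 2 1) b)) + com (A i 1) (com (A j 1) (com (A 2 1) b)) = 0"
      using that False comm[of j 2] comm[of 2 j] kill[of j 2] c1[of j]
      by (simp add: lower com_add com_swap[of "A 2 1" "A j 1"] del: One_nat_def split: if_splits)
    then show ?thesis by (rule torsion_freeD2[OF tf])
  qed (use c1 that in auto)
  have c3: "com (A i 1) (com (A j 1) (com (A k 1) b)) = 0" if "i \<in> {2..n}" "j \<in> {2..n}" "k \<in> {2..n}" for i j k
  proof (cases "k = 2")
    case False
    then have "com (A k 2) (com (A i 1) (com (A j 1) (com (A 2 1) b))) = 0" using c2 that by auto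
    then show ?thesis
      using that False kill[of k 2] c2[of i k] c2[of k j]
      by (simp add: lower com_add comm com_swap[of "A j 1" "A k 1"] del: One_nat_def split: if_splits)
  qed (use c2 that in auto)
  have sym: "S i j = S j i" if "i \<in> {1..n}" "j \<in> {1..n}" for i j
  proof -
    have "com (A i 1) (x j) = com (com (A i 1) (A j 1)) b + com (A j 1) (x i)"
      unfolding x_def by (rule com_com)
    also have "com (A i 1) (A j 1) = (if j = 1 then A i 1 else 0) - (if i = 1 then A j 1 else 0)"
      using AA[of i 1 j 1] that n by auto
    finally show ?thesis by (auto simp: S_def com_linear x_def)
  qed
  have act_x: "com (A k l) (x j) = com ((if l = j then A k 1 else 0) - (if k = 1 then A j l else 0)) b
      + com (A j 1) (if l = 1 then x k else 0)" if "k \<in> {1..n}" "l \<in> {1..n}" "j \<in> {1..n}" for k l j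
    unfolding x_def using AA[of k l j 1] Ab[OF that(1,2)] that n by (simp add: com_com[of "A k l"] x_def)
  have Ax: "com (A k l) (x j) = (if l = j then x k else 0)" if "k \<in> {1..n}" "l \<in> {2..n}" "j \<in> {1..n}" for k l j
    using act_x[of k l j] that kill[of j l] by (auto simp: com_linear x_def)
  have Ax1: "com (A k 1) (x j) = S k j + (if j = 1 then x k else 0)" for k j by (simp add: S_def)
  have S1: "S 1 j = x j" if "j \<in> {1..n}" for j
  proof (cases "j = 1")
    case True then show ?thesis using x1 Ab[OF one one] by (simp add: S_def com_add)
  next
    case False
    moreover have "com (A j 1) b = x j" by (simp add: x_def)
    ultimately show ?thesis using act_x[OF one one that] x1 by (simp add: S_def com_linear)
  qed
  have S1': "S j 1 = x j" if "j \<in> {1..n}" for j using S1[OF that] sym[OF that one] by simp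
  have "com (A k l) (S i j) = (if l = i then S k j else 0) + (if l = j then S i k else 0)"
    if that: "k \<in> {1..n}" "l \<in> {1..n}" "i \<in> {1..n}" "j \<in> {1..n}" for k l i j
  proof (cases "l = 1")
    case False
    then have l: "l \<in> {2..n}" using that by auto
    have "com (A k l) (com (A i 1) (x j)) = com (com (A k l) (A i 1)) (x j) + com (A i 1) (com (A k l) (x j))"
      by (rule com_com)
    also have "com (A k l) (A i 1) = (if l = i then A k 1 else 0) - (if k = 1 then A i l else 0)"
      using AA[of k l i 1] that n by auto
    also have "com (A k l) (x j) = (if l = j then x k else 0)" using Ax l that by blast
    finally show ?thesis
      using False Ax[OF that(3) l that(4)] Ax[OF that(1) l that(3)] by (auto simp: S_def com_linear)
  next
    case l: True
    have Axk: "com (A k 1) (S 1 j) = S k j + (if j = 1 then S 1 k else 0)" if "j \<in> {1..n}" for j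
      using S1[OF that] S1[OF \<open>k \<in> {1..n}\<close>] Ax1[of k j] by auto
    consider "i = 1" | "j = 1" | "i \<noteq> 1" "j \<noteq> 1" "k = 1" | "i \<noteq> 1" "j \<noteq> 1" "k \<noteq> 1" by blast
    then show ?thesis
    proof cases
      case 1 then show ?thesis using Axk[OF that(4)] l by auto
    next
      case 2 then show ?thesis using Axk[OF that(3)] l sym[OF that(3,4)] sym[OF that(3,1)] sym[OF that(1,4)] by auto
    next
      case 3
      have "com (A 1 1) (A i 1) = - A i 1" using AA[of 1 1 i 1] that n 3 by auto
      then have "com (A 1 1) (com (A i 1) (x j)) = com (A i 1) (com (A 1 1) (x j)) - com (A i 1) (x j)"
        by (simp add: com_com[of "A (Suc 0) (Suc 0)"] com_linear)
      moreover have "com (A 1 1) (x j) = x j" using Ax1[of 1 j] S1[OF that(4)] 3 by simp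
      ultimately show ?thesis using 3 l by (simp add: S_def)
    next
      case 4 then show ?thesis using c3[of k i j] that l by (simp add: S_def x_def)
    qed
  qed
  then have "sym2_family n A S" unfolding sym2_family_def using sym by blast
  moreover have "S 1 1 = b + b" using S1[OF one] x1 by simp
  moreover have "S k 1 = com (A k 1) b" if "k \<in> {2..n}" for k using S1'[of k] that by (simp add: x_def)
  ultimately show thesis by (rule that)
qed

text \<open>
  An element $v$ with the weight and the vanishing properties of $e_1\wedge e_2$ generates an exterior square as soon as $E_{32}^2$
  kills it.  Then $y_j=[A_{j2},v]$ and $w_j=[A_{j1},v]$ play the roles of $e_1\wedge e_j$ and $e_j\wedge e_2$.
  All products of two lowering operators that ought to kill $v$, and the antisymmetry of $[A_{i1},y_j]$,
  are obtained from $E_{32}^2$ by applying lowering operators to it.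
\<close>

lemma alt2_family_highest_weight:
  fixes A :: "nat \<Rightarrow> nat \<Rightarrow> 'a::ring_1"
  assumes tf: "torsion_free TYPE('a)" and gl: "gl_family n A" and n: "2 \<le> n"
    and kill: "\<And>k l. k \<in> {1..n} \<Longrightarrow> l \<in> {3..n} \<Longrightarrow> com (A k l) v = 0"
    and wt: "com (A 1 1) v = v" "com (A 2 2) v = v" "com (A 1 2) v = 0" "com (A 2 1) v = 0"
    and square: "n \<ge> 3 \<Longrightarrow> com (A 3 2) (com (A 3 2) v) = 0"
  obtains T where "alt2_family n A T" "T 1 2 = v"
proof -
  note AA = gl_familyD[OF gl]
  note wt = wt wt[unfolded One_nat_def]
  have one: "1 \<in> {1..n}" and two: "2 \<in> {1..n}" using n by auto
  define y where "y j = com (A j 2) v" for j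
  define w where "w j = com (A j 1) v" for j
  define T where "T i j = com (A i 1) (y j) - (if j = 1 then y i else 0)" for i j
  have y12: "y (Suc 0) = 0" "y 2 = v" and w12: "w (Suc 0) = v" "w 2 = 0" using wt by (simp_all add: y_def w_def)
  have Av: "com (A k l) v = (if l = 1 then w k else 0) + (if l = 2 then y k else 0)"
    if "k \<in> {1..n}" "l \<in> {1..n}" for k l
    using kill[of k l] that by (auto simp: y_def w_def)
  have q1: "com (A i 2) (com (A 3 2) v) = 0" if "i \<in> {3..n}" for i
  proof (cases "i = 3")
    case False
    then have "com (A i 3) (com (A 3 2) (com (A 3 2) v)) = 0" using square that by auto
    moreover have "com (A i 3) (A 3 2) = A i 2" "com (A 3 2) (A i 2) = 0"
      using AA[of i 3 3 2] AA[of 3 2 i 2] that False by auto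
    ultimately have "com (A i 2) (com (A 3 2) v) + com (A i 2) (com (A 3 2) v) = 0"
      using kill[of i 3] that by (simp add: com_com[of "A i 3"] com_swap[of "A 3 2" "A i 2"])
    then show ?thesis by (rule torsion_freeD2[OF tf])
  qed (use square that in auto)
  \<comment> \<open>Products of two lowering operators on $v$: here and below, the index of one operator is changed by a further one.\<close>
  have q2: "com (A i 2) (com (A j 2) v) = 0" if "i \<in> {3..n}" "j \<in> {3..n}" for i j
  proof (cases "j = 3")
    case False
    then have "com (A j 3) (com (A i 2) (com (A 3 2) v)) = 0" using q1 that by auto
    moreover have "com (A j 3) (A i 2) = (if i = 3 then A j 2 else 0)" "com (A j 3) (A 3 2) = A j 2"
      using AA[of j 3 i 2] AA[of j 3 3 2] that False by auto
    ultimately show ?thesis using kill[of j 3] that q1[of j] by (auto simp: com_com[of "A j 3"] split: if_splits)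
  qed (use q1 that in auto)
  have A21: "com (A 2 1) (A i 2) = - A i 1" "com (A 2 1) (A i 1) = 0" if "i \<in> {3..n}" for i
    using AA[of 2 1 i 2] AA[of 2 1 i 1] that by auto
  have comm: "com (A i 1) (A j 2) = 0" "com (A i 1) (A j 1) = 0" if "i \<in> {3..n}" "j \<in> {3..n}" for i j
    using AA[of i 1 j 2] AA[of i 1 j 1] that by auto
  have q3: "com (A i 1) (com (A j 2) v) + com (A j 1) (com (A i 2) v) = 0" if "i \<in> {3..n}" "j \<in> {3..n}" for i j
  proof -
    have "com (A 2 1) (com (A i 2) (com (A j 2) v)) = 0" using q2 that by simp
    then have *: "- com (A i 1) (com (A j 2) v) - com (A j 1) (com (A i 2) v) = 0"
      using that wt by (simp add: com_com[of "A 2 1"] A21 com_linear com_swap[OF comm(1)] del: One_nat_def)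
    have "com (A i 1) (com (A j 2) v) + com (A j 1) (com (A i 2) v)
        = - (- com (A i 1) (com (A j 2) v) - com (A j 1) (com (A i 2) v))" by simp
    then show ?thesis unfolding * by simp
  qed
  have q4: "com (A i 1) (com (A j 1) v) = 0" if "i \<in> {3..n}" "j \<in> {3..n}" for i j
  proof -
    have "com (A 2 1) (com (A i 1) (com (A j 2) v) + com (A j 1) (com (A i 2) v)) = 0" using q3 that by simp
    then have *: "- com (A i 1) (com (A j 1) v) - com (A i 1) (com (A j 1) v) = 0"
      using that wt by (simp add: com_com[of "A 2 1"] A21 com_linear com_swap[OF comm(2), of j i] del: One_nat_def)
    have "com (A i 1) (com (A j 1) v) + com (A i 1) (com (A j 1) v)
        = - (- com (A i 1) (com (A j 1) v) - com (A i 1) (com (A j 1) v))" by simp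
    then have "com (A i 1) (com (A j 1) v) + com (A i 1) (com (A j 1) v) = 0" unfolding * by simp
    then show ?thesis by (rule torsion_freeD2[OF tf])
  qed
  have act_y: "com (A k l) (y j) = com ((if l = j then A k 2 else 0) - (if k = 2 then A j l else 0)) v
      + com (A j 2) (com (A k l) v)" if "k \<in> {1..n}" "l \<in> {1..n}" "j \<in> {1..n}" for k l j
    unfolding y_def using AA[of k l j 2] that n by (simp add: com_com[of "A k l"])
  have Ay3: "com (A k l) (y j) = (if l = j then y k else 0)" if "k \<in> {1..n}" "l \<in> {3..n}" "j \<in> {1..n}" for k l j
    using act_y[of k l j] that kill[of j l] kill[of k l] by (auto simp: com_linear y_def)
  have Ay1: "com (A k (Suc 0)) (y j) = T k j + (if j = 1 then y k else 0)" for k j by (simp add: T_def)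
  have T_1: "T i (Suc 0) = - y i" for i by (simp add: T_def y12)
  have T1: "T (Suc 0) j = y j" if "j \<in> {1..n}" for j
    using act_y[OF one one that] by (auto simp: T_def y12 com_linear wt) (simp_all add: y_def)
  have T_2: "T i 2 = w i" for i by (simp add: T_def y12 w_def)
  have T2: "T 2 j = - w j" if "j \<in> {1..n}" for j
    using act_y[OF two one that] by (auto simp: T_def y12 com_linear wt w_def)
  have idx: "i = 1 \<or> i = 2 \<or> i \<in> {3..n}" if "i \<in> {1..n}" for i using that by auto
  have anti: "T i j = - T j i" if "i \<in> {1..n}" "j \<in> {1..n}" for i j
  proof -
    note ij = that
    consider "i = 1" | "i = 2" | "j = 1" | "j = 2" | "i \<in> {3..n}" "j \<in> {3..n}" using idx ij by blast
    then show ?thesis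
    proof cases
      case 5 then show ?thesis using q3[of i j] by (simp add: T_def y_def eq_neg_iff_add_eq_0)
    qed (use that in \<open>simp_all add: T_1 T1 T_2 T2\<close>)
  qed
  have diag: "T i i = 0" if "i \<in> {1..n}" for i
    using anti[OF that that] torsion_freeD2[OF tf, of "T i i"] by (simp add: eq_neg_iff_add_eq_0)
  define ok where "ok z k l \<longleftrightarrow> (\<forall>i\<in>{1..n}. \<forall>j\<in>{1..n}.
    com z (T i j) = (if l = i then T k j else 0) + (if l = j then T i k else 0))" for z k l
  have ok3: "ok (A k l) k l" if "k \<in> {1..n}" "l \<in> {3..n}" for k l
    unfolding ok_def
  proof (intro ballI)
    fix i j assume ij: "i \<in> {1..n}" "j \<in> {1..n}"
    have "com (A k l) (com (A i 1) (y j)) = com (com (A k l) (A i 1)) (y j) + com (A i 1) (com (A k l) (y j))"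
      by (rule com_com)
    also have "com (A k l) (A i 1) = (if l = i then A k 1 else 0) - (if k = 1 then A i l else 0)"
      using AA[of k l i 1] that n ij by auto
    also have "com (A k l) (y j) = (if l = j then y k else 0)" using Ay3 ij that by blast
    finally show "com (A k l) (T i j) = (if l = i then T k j else 0) + (if l = j then T i k else 0)"
      using that Ay3[OF ij(1) that(2) ij(2)] Ay3[OF that ij(1)] by (auto simp: T_def com_linear)
  qed
  have ok1: "ok (A k 1) k 1" if k: "k \<in> {1..n}" for k
    unfolding ok_def
  proof (intro ballI)
    fix i j assume ij: "i \<in> {1..n}" "j \<in> {1..n}"
    have first: "com (A k 1) (T 1 j) = T k j + (if 1 = j then T 1 k else 0)" if "j \<in> {1..n}" for j
      using that k by (auto simp: T1 Ay1)
    have second: "com (A k 1) (T 2 j) = 0" if "j \<in> {1..n}" "j \<noteq> 1" for j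
    proof -
      note j = that
      consider "j = 2" | "k = 1" "j \<in> {3..n}" | "k = 2" "j \<in> {3..n}" | "k \<in> {3..n}" "j \<in> {3..n}"
        using idx j k by blast
      then show ?thesis
      proof cases
        case 1 then show ?thesis using T2[OF two] by (simp add: w12)
      next
        case 2
        then have "com (A 1 1) (A j 1) = - A j 1" using AA[of 1 1 j 1] n by auto
        then show ?thesis using 2 T2[OF that(1)] by (simp add: w_def com_com[of "A (Suc 0) (Suc 0)"] com_linear wt)
      next
        case 3 then show ?thesis using T2[OF that(1)] A21 by (simp add: w_def com_com[of "A 2 1"] com_linear wt del: One_nat_def)
      next
        case 4 then show ?thesis using T2[OF that(1)] q4 by (simp add: w_def com_linear)
      qed
    qed
    consider "i = 1" | "j = 1" | "i = 2" "j \<noteq> 1" | "j = 2" "i \<noteq> 1" | "i \<in> {3..n}" "j \<in> {3..n}" using idx ij by blast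
    then show "com (A k 1) (T i j) = (if 1 = i then T k j else 0) + (if 1 = j then T i k else 0)"
    proof cases
      case 1 then show ?thesis using first[OF ij(2)] by auto
    next
      case 2 then show ?thesis
        using first[OF ij(1)] anti[OF ij] anti[OF ij(1) k] anti[OF k one] by (auto simp: com_linear)
    next
      case 3 then show ?thesis using second ij by simp
    next
      case 4 then show ?thesis using second[OF ij(1)] anti[OF ij] by (simp add: com_linear)
    next
      case 5
      consider "k = 1" | "k = 2" | "k \<in> {3..n}" using idx k by blast
      then show ?thesis
      proof cases
        case 1
        have "com (A 1 1) (A i 1) = - A i 1" using AA[of 1 1 i 1] 5 n by auto
        moreover have "com (A 1 1) (y j) = y j" using Ay1[of 1 j] T1[OF ij(2)] 5 by simp
        ultimately show ?thesis using 5 1 by (simp add: T_def com_com[of "A (Suc 0) (Suc 0)"] com_linear)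
      next
        case 2
        have "com (A 2 1) (com (A i 1) (y j)) = com (A i 1) (com (A 2 1) (y j))" using A21 5 by (simp add: com_swap)
        also have "com (A 2 1) (y j) = - w j" using Ay1[of 2 j] T2[OF ij(2)] 5 by simp
        finally show ?thesis using 5 2 q4 by (simp add: T_def com_linear w_def)
      next
        case 3
        then have "com (A k 1) (com (A i 1) (y j)) = 0"
          using 5 comm q4
          by (simp add: y_def com_swap[OF comm(1)[of i j]] com_swap[OF comm(1)[of k j]] del: One_nat_def)
        then show ?thesis using 5 by (simp add: T_def)
      qed
    qed
  qed
  have ok12: "ok (A 1 2) 1 2"
    unfolding ok_def
  proof (intro ballI)
    fix i j assume ij: "i \<in> {1..n}" "j \<in> {1..n}"
    have A12y: "com (A 1 2) (y j) = 0" if "j \<in> {1..n}" for j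
      using act_y[OF one two that] by (simp add: wt)
    have Ai2: "com (A i 2) (y j) = (if 2 = j then y i else 0)"
    proof -
      consider "j = 1" | "j = 2" | "i = 1" | "i = 2" "j \<in> {3..n}" | "i \<in> {3..n}" "j \<in> {3..n}" using idx ij by blast
      then show ?thesis
      proof cases
        case 2 then show ?thesis by (simp add: y12) (simp add: y_def)
      next
        case 3 then show ?thesis using A12y[OF ij(2)] by (simp add: y12)
      next
        case 4 then show ?thesis using act_y[OF two two ij(2)] by (simp add: wt com_linear)
      next
        case 5 then show ?thesis using q2 by (simp add: y_def)
      qed (auto simp: y12)
    qed
    have "com (A 1 2) (A i 1) = (if 2 = i then A 1 1 else 0) - A i 2" using AA[of 1 2 i 1] n ij by auto
    then have "com (A 1 2) (com (A i 1) (y j)) = com ((if 2 = i then A 1 1 else 0) - A i 2) (y j)"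
      using A12y[OF ij(2)] by (simp add: com_com[of "A (Suc 0) 2"])
    then show "com (A 1 2) (T i j) = (if 2 = i then T 1 j else 0) + (if 2 = j then T i 1 else 0)"
      using Ai2 A12y[OF ij(1)] Ay1[of 1 j] by (auto simp: T_def[of i j] com_linear y12 T_1)
  qed
  have ok2: "ok (A k 2) k 2" if k: "k \<in> {1..n}" for k
  proof (cases "k = 1")
    case False
    have br: "A k 2 = com (A k 1) (A 1 2) + (if k = 2 then A 1 1 else 0)" using AA[of k 1 1 2] k n by auto
    show ?thesis
      unfolding ok_def
    proof (intro ballI)
      fix i j assume ij: "i \<in> {1..n}" "j \<in> {1..n}"
      have 1: "com (A k 1) (T i j) = (if 1 = i then T k j else 0) + (if 1 = j then T i k else 0)"
        if "i \<in> {1..n}" "j \<in> {1..n}" for i j using ok1[OF k] that unfolding ok_def by blast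
      have 11: "com (A 1 1) (T i j) = (if 1 = i then T 1 j else 0) + (if 1 = j then T i 1 else 0)"
        if "i \<in> {1..n}" "j \<in> {1..n}" for i j using ok1[OF one] that unfolding ok_def by blast
      have 2: "com (A 1 2) (T i j) = (if 2 = i then T 1 j else 0) + (if 2 = j then T i 1 else 0)"
        if "i \<in> {1..n}" "j \<in> {1..n}" for i j using ok12 that unfolding ok_def by blast
      show "com (A k 2) (T i j) = (if 2 = i then T k j else 0) + (if 2 = j then T i k else 0)"
        unfolding br using ij False k one two by (auto simp: com_add com_jacobi 1 2 11 com_linear com_if simp del: One_nat_def)
    qed
  qed (use ok12 in simp)
  have "ok (A k l) k l" if "k \<in> {1..n}" "l \<in> {1..n}" for k l
    using idx[OF that(2)] ok1[OF that(1)] ok2[OF that(1)] ok3[OF that(1)] by auto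
  then have "alt2_family n A T" unfolding alt2_family_def ok_def using anti diag by blast
  moreover have "T 1 2 = v" using T1[OF two] by (simp add: y12)
  ultimately show thesis by (rule that)
qed


section \<open>The odd brackets of $\mathfrak p(n)$\<close>

text \<open>
  The anticommutators are the image of an equivariant map on the symmetric square of $\mathrm{Sym}^2$, and a
  vanishing value propagates: applying $A_{pq}$ to it shows that a sum of at most four other values vanishes,
  and choosing $p$, $q$ so that all but one of them are known reaches every index quadruple.  For $n\ge2$ the value at
  $(1,2,1,2)$ suffices because $(e_1e_2)^2$ has components in both irreducible summands.
\<close>

lemma sym2_family_acom:
  fixes A :: "nat \<Rightarrow> nat \<Rightarrow> 'a::ring_1"
  assumes tf: "torsion_free TYPE('a)" and S: "sym2_family n A S"
    and base: "n = 1 \<Longrightarrow> acom (S 1 1) (S 1 1) = 0" "n \<ge> 2 \<Longrightarrow> acom (S 1 2) (S 1 2) = 0"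
    and ijkl: "i \<in> {1..n}" "j \<in> {1..n}" "k \<in> {1..n}" "l \<in> {1..n}"
  shows "acom (S i j) (S k l) = 0"
proof (cases "n \<ge> 2")
  case False
  then have "n = 1" "i = 1" "j = 1" "k = 1" "l = 1" using ijkl by auto
  then show ?thesis using base(1) by simp
next
  case n: True
  define Q where "Q i j k l = acom (S i j) (S k l)" for i j k l
  have two: "2 \<in> {1..n}" and one: "1 \<in> {1..n}" using n by auto
  have sym: "Q i j k l = Q k l i j" for i j k l unfolding Q_def by (rule acom_commute)
  have symL: "Q i j k l = Q j i k l" if "i \<in> {1..n}" "j \<in> {1..n}" for i j k l
    unfolding Q_def using sym2_familyD(1)[OF S, of i j] that by simp
  have symR: "Q i j k l = Q i j l k" if "k \<in> {1..n}" "l \<in> {1..n}" for i j k l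
    unfolding Q_def using sym2_familyD(1)[OF S, of k l] that by simp
  have move: "(if q = i then Q p j k l else 0) + (if q = j then Q i p k l else 0)
      + (if q = k then Q i j p l else 0) + (if q = l then Q i j k p else 0) = 0"
    if "Q i j k l = 0" "i \<in> {1..n}" "j \<in> {1..n}" "k \<in> {1..n}" "l \<in> {1..n}" "p \<in> {1..n}" "q \<in> {1..n}"
    for i j k l p q
  proof -
    have "com (A p q) (Q i j k l) = 0" using that by simp
    then show ?thesis
      using that sym2_familyD(2)[OF S, of p q] by (auto simp: Q_def com_acom acom_add add.assoc)
  qed
  have s1: "Q p 2 1 2 = 0" if "p \<in> {1..n}" for p
    using move[of 1 2 1 2 p 1] base(2) n that one two sym[of p 2 1 2]
    by (auto simp: Q_def intro: torsion_freeD2[OF tf])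
  have s2: "Q p 2 r 2 = 0" if "p \<in> {1..n}" "r \<in> {1..n}" for p r
    using move[of p 2 1 2 r 1] s1[of p] s1[of r] that one two sym[of p 2 r 2] by (cases "p = 1") auto
  have s3: "Q p u 2 2 = 0" if "p \<in> {1..n}" "u \<in> {1..n}" for p u
    using move[of p 2 2 2 u 2] s2[of p 2] s2[of p u] s2[of u 2] that two symL[of p u 2 2] symR[of 2 u p 2]
    by (cases "p = 2") auto
  have s4: "Q p u v 2 = 0" if "p \<in> {1..n}" "u \<in> {1..n}" "v \<in> {1..n}" for p u v
  proof -
    consider "p = 2" | "u = 2" | "v = 2" | "p \<noteq> 2" "u \<noteq> 2" "v \<noteq> 2" by blast
    then show ?thesis
    proof cases
      case 4
      then show ?thesis using move[of p u 2 2 v 2] s3[of p u] that two symR[of 2 v p u] torsion_freeD2[OF tf, of "Q p u v 2"]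
        by auto
    qed (use that two s2 s3 symL[of p u v 2] in auto)
  qed
  have "Q p u v w = 0" if "p \<in> {1..n}" "u \<in> {1..n}" "v \<in> {1..n}" "w \<in> {1..n}" for p u v w
  proof -
    consider "p = 2" | "u = 2" | "v = 2" | "p \<noteq> 2" "u \<noteq> 2" "v \<noteq> 2" by blast
    then show ?thesis
    proof cases
      case 1 then show ?thesis using s4[of v w u] that two symL[of p u v w] sym[of v w u 2] by auto
    next
      case 2 then show ?thesis using s4[of v w p] that two sym[of v w p 2] by auto
    next
      case 3 then show ?thesis using s4[of p u w] that two symR[of v w p u] by auto
    next
      case 4 then show ?thesis using move[of p u v 2 w 2] s4[of p u v] that two by auto
    qed
  qed
  then show ?thesis using ijkl unfolding Q_def by blast
qed

text \<open>
  Propagation as for the symmetric square.  Here $(e_1\wedge e_2)^2$ lies in one irreducible summand of the symmetric square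
  of $\Lambda^2$; for $n\ge4$ there is a second summand $\Lambda^4$, for which the other vanishing value is used.
\<close>

lemma alt2_family_acom:
  fixes A :: "nat \<Rightarrow> nat \<Rightarrow> 'a::ring_1"
  assumes tf: "torsion_free TYPE('a)" and T: "alt2_family n A T"
    and base: "n \<ge> 2 \<Longrightarrow> acom (T 1 2) (T 1 2) = 0" "n \<ge> 4 \<Longrightarrow> acom (T 3 4) (T 1 2) = 0"
    and ijkl: "i \<in> {1..n}" "j \<in> {1..n}" "k \<in> {1..n}" "l \<in> {1..n}"
  shows "acom (T i j) (T k l) = 0"
proof (cases "n \<ge> 2")
  case False
  then have "i = 1" "j = 1" using ijkl by auto
  then show ?thesis using alt2_familyD(1)[OF T, of i] ijkl by simp
next
  case n: True
  define Q where "Q i j k l = acom (T i j) (T k l)" for i j k l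
  have two: "2 \<in> {1..n}" and one: "1 \<in> {1..n}" using n by auto
  have sym: "Q i j k l = Q k l i j" for i j k l unfolding Q_def by (rule acom_commute)
  have antiL: "Q i j k l = - Q j i k l" if "i \<in> {1..n}" "j \<in> {1..n}" for i j k l
    unfolding Q_def using alt2_familyD(2)[OF T, of i j] that by (simp add: acom_minus)
  have antiR: "Q i j k l = - Q i j l k" if "k \<in> {1..n}" "l \<in> {1..n}" for i j k l
    unfolding Q_def using alt2_familyD(2)[OF T, of k l] that by (simp add: acom_minus)
  have diag: "Q i i k l = 0" "Q k l i i = 0" if "i \<in> {1..n}" for i k l
    unfolding Q_def using alt2_familyD(1)[OF T that] by simp_all
  have move: "(if q = i then Q p j k l else 0) + (if q = j then Q i p k l else 0)
      + (if q = k then Q i j p l else 0) + (if q = l then Q i j k p else 0) = 0"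
    if "Q i j k l = 0" "i \<in> {1..n}" "j \<in> {1..n}" "k \<in> {1..n}" "l \<in> {1..n}" "p \<in> {1..n}" "q \<in> {1..n}"
    for i j k l p q
  proof -
    have "com (A p q) (Q i j k l) = 0" using that by simp
    then show ?thesis
      using that alt2_familyD(3)[OF T, of p q] by (auto simp: Q_def com_acom acom_add add.assoc)
  qed
  have s1: "Q p 2 1 2 = 0" if "p \<in> {1..n}" for p
    using move[of 1 2 1 2 p 1] base(1) n that one two sym[of p 2 1 2]
    by (auto simp: Q_def intro: torsion_freeD2[OF tf])
  have s2: "Q p 2 r 2 = 0" if "p \<in> {1..n}" "r \<in> {1..n}" for p r
    using move[of p 2 1 2 r 1] s1[of p] s1[of r] that one two sym[of p 2 r 2] by (cases "p = 1") auto
  have s3: "Q p u r 2 = 0" if "p \<in> {1..n}" "u \<in> {1..n}" "r \<in> {1..n}" for p u r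
  proof (cases "n \<ge> 4")
    case True
    then have three: "3 \<in> {1..n}" and four: "4 \<in> {1..n}" by auto
    have t1: "Q p 4 1 2 = 0" if "p \<in> {1..n}" for p
      using move[of 3 4 1 2 p 3] base(2) True that one two three four by (auto simp: Q_def)
    have t2: "Q p q 1 2 = 0" if "p \<in> {1..n}" "q \<in> {1..n}" for p q
      using move[of p 4 1 2 q 4] t1[of p] t1[of q] antiL[of p q 1 2] that one two four by (cases "p = 4") auto
    have t3: "Q p q r 2 = 0" if "p \<in> {1..n}" "q \<in> {1..n}" "q \<noteq> 1" "r \<in> {1..n}" for p q r
      using move[of p q 1 2 r 1] t2[of p q] t2[of r q] that one two by (cases "p = 1") auto
    show ?thesis
    proof (cases "u = 1")
      case True
      show ?thesis
      proof (cases "p = 1")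
        case True then show ?thesis using \<open>u = 1\<close> diag one by simp
      next
        case False then show ?thesis using t3[of u p r] antiL[of p u r 2] that \<open>u = 1\<close> one by simp
      qed
    qed (use t3 that in auto)
  next
    case False
    have aab: "Q p q p 2 = 0" if "p \<in> {1..n}" "q \<in> {1..n}" "p \<noteq> 2" "q \<noteq> 2" for p q
      using move[of p 2 p 2 q 2] s2[of p p] that two sym[of p 2 p q] torsion_freeD2[OF tf, of "Q p q p 2"] by auto
    consider "p = 2" | "u = 2" | "r = 2" | "p = u" | "p = r" "p \<noteq> 2" "u \<noteq> 2" | "u = r" "p \<noteq> 2" "u \<noteq> 2"
      using False \<open>p \<in> {1..n}\<close> \<open>u \<in> {1..n}\<close> \<open>r \<in> {1..n}\<close> by force
    then show ?thesis
    proof cases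
      case 1 then show ?thesis using s2[of u r] antiL[of p u r 2] that two by simp
    next
      case 2 then show ?thesis using s2 that by simp
    next
      case 6 then show ?thesis using aab[of u p] antiL[of p u r 2] that by simp
    qed (use diag aab that two in auto)
  qed
  have "Q p u v w = 0" if "p \<in> {1..n}" "u \<in> {1..n}" "v \<in> {1..n}" "w \<in> {1..n}" for p u v w
  proof -
    consider "p = 2" | "u = 2" | "v = 2" | "p \<noteq> 2" "u \<noteq> 2" "v \<noteq> 2" by blast
    then show ?thesis
    proof cases
      case 1 then show ?thesis using s3[of v w u] that two antiL[of p u v w] sym[of v w u 2] by auto
    next
      case 2 then show ?thesis using s3[of v w p] that two sym[of v w p 2] by auto
    next
      case 3 then show ?thesis using s3[of p u w] that two antiR[of v w p u] by auto
    next
      case 4 then show ?thesis using move[of p u v 2 w 2] s3[of p u v] that two by auto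
    qed
  qed
  then show ?thesis using ijkl unfolding Q_def by blast
qed

text \<open>
  The value in $\mathfrak p(n)$ of the bracket of $E_{i,-j}+E_{j,-i}$ with $E_{-k,l}-E_{-l,k}$, a combination of $A_{ij}=E_{i,j}-E_{-j,-i}$.
\<close>

definition odd_bracket :: "(nat \<Rightarrow> nat \<Rightarrow> 'a::ring_1) \<Rightarrow> nat \<Rightarrow> nat \<Rightarrow> nat \<Rightarrow> nat \<Rightarrow> 'a"
  where "odd_bracket A i j k l =
    (if j = k then A i l else 0) - (if j = l then A i k else 0) +
    (if i = k then A j l else 0) - (if i = l then A j k else 0)"

text \<open>
  The brackets of $\mathfrak p(n)$ in the elements $A_{ij}=E_{i,j}-E_{-j,-i}$, $S_{ij}=E_{i,-j}+E_{j,-i}$ and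
  $T_{ij}=E_{-i,j}-E_{-j,i}$.  The $T_{ij}$ span an exterior square of the dual representation, whence the
  transposed family with a sign.
\<close>

definition pn_family ::
    "nat \<Rightarrow> (nat \<Rightarrow> nat \<Rightarrow> 'a::ring_1) \<Rightarrow> (nat \<Rightarrow> nat \<Rightarrow> 'a) \<Rightarrow> (nat \<Rightarrow> nat \<Rightarrow> 'a) \<Rightarrow> bool"
  where "pn_family n A S T \<longleftrightarrow> gl_family n A \<and> sym2_family n A S \<and>
    alt2_family n (\<lambda>i j. - A j i) T \<and>
    (\<forall>i\<in>{1..n}. \<forall>j\<in>{1..n}. \<forall>k\<in>{1..n}. \<forall>l\<in>{1..n}.
      acom (S i j) (S k l) = 0 \<and> acom (T i j) (T k l) = 0 \<and>
      acom (S i j) (T k l) = odd_bracket A i j k l)"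

lemma pn_familyD:
  assumes "pn_family n A S T"
  shows "i \<in> {1..n} \<Longrightarrow> j \<in> {1..n} \<Longrightarrow> k \<in> {1..n} \<Longrightarrow> l \<in> {1..n} \<Longrightarrow>
      com (A i j) (A k l) = (if j = k then A i l else 0) - (if i = l then A k j else 0)"
    and "i \<in> {1..n} \<Longrightarrow> j \<in> {1..n} \<Longrightarrow> S i j = S j i"
    and "i \<in> {1..n} \<Longrightarrow> T i i = 0"
    and "i \<in> {1..n} \<Longrightarrow> j \<in> {1..n} \<Longrightarrow> T i j = - T j i"
    and "k \<in> {1..n} \<Longrightarrow> l \<in> {1..n} \<Longrightarrow> i \<in> {1..n} \<Longrightarrow> j \<in> {1..n} \<Longrightarrow>
      com (A k l) (S i j) = (if l = i then S k j else 0) + (if l = j then S i k else 0)"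
    and "k \<in> {1..n} \<Longrightarrow> l \<in> {1..n} \<Longrightarrow> i \<in> {1..n} \<Longrightarrow> j \<in> {1..n} \<Longrightarrow>
      com (A k l) (T i j) = - (if k = i then T l j else 0) - (if k = j then T i l else 0)"
    and "i \<in> {1..n} \<Longrightarrow> j \<in> {1..n} \<Longrightarrow> k \<in> {1..n} \<Longrightarrow> l \<in> {1..n} \<Longrightarrow> acom (S i j) (S k l) = 0"
    and "i \<in> {1..n} \<Longrightarrow> j \<in> {1..n} \<Longrightarrow> k \<in> {1..n} \<Longrightarrow> l \<in> {1..n} \<Longrightarrow> acom (T i j) (T k l) = 0"
    and "i \<in> {1..n} \<Longrightarrow> j \<in> {1..n} \<Longrightarrow> k \<in> {1..n} \<Longrightarrow> l \<in> {1..n} \<Longrightarrow>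
      acom (S i j) (T k l) = odd_bracket A i j k l"
proof -
  have gl: "gl_family n A" and S: "sym2_family n A S" and T: "alt2_family n (\<lambda>i j. - A j i) T"
    using assms unfolding pn_family_def by blast+
  show "i \<in> {1..n} \<Longrightarrow> j \<in> {1..n} \<Longrightarrow> k \<in> {1..n} \<Longrightarrow> l \<in> {1..n} \<Longrightarrow>
      com (A i j) (A k l) = (if j = k then A i l else 0) - (if i = l then A k j else 0)"
    by (rule gl_familyD[OF gl])
  show "i \<in> {1..n} \<Longrightarrow> j \<in> {1..n} \<Longrightarrow> S i j = S j i" by (rule sym2_familyD(1)[OF S])
  show "i \<in> {1..n} \<Longrightarrow> T i i = 0" by (rule alt2_familyD(1)[OF T])
  show "i \<in> {1..n} \<Longrightarrow> j \<in> {1..n} \<Longrightarrow> T i j = - T j i" by (rule alt2_familyD(2)[OF T])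
  show "k \<in> {1..n} \<Longrightarrow> l \<in> {1..n} \<Longrightarrow> i \<in> {1..n} \<Longrightarrow> j \<in> {1..n} \<Longrightarrow>
      com (A k l) (S i j) = (if l = i then S k j else 0) + (if l = j then S i k else 0)"
    by (rule sym2_familyD(2)[OF S])
  show "com (A k l) (T i j) = - (if k = i then T l j else 0) - (if k = j then T i l else 0)"
    if "k \<in> {1..n}" "l \<in> {1..n}" "i \<in> {1..n}" "j \<in> {1..n}"
  proof -
    have "- com (A k l) (T i j) = (if k = i then T l j else 0) + (if k = j then T i l else 0)"
      using alt2_familyD(3)[OF T that(2,1,3,4)] by (simp only: com_minus)
    then have "com (A k l) (T i j) = - ((if k = i then T l j else 0) + (if k = j then T i l else 0))"
      by (metis minus_minus)
    then show ?thesis by simp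
  qed
qed (use assms in \<open>auto simp: pn_family_def\<close>)

lemma odd_bracket_invariant:
  assumes gl: "gl_family n A"
    and m: "p \<in> {1..n}" "q \<in> {1..n}" "i \<in> {1..n}" "j \<in> {1..n}" "k \<in> {1..n}" "l \<in> {1..n}"
  shows "com (A p q) (odd_bracket A i j k l) =
    (if q = i then odd_bracket A p j k l else 0) + (if q = j then odd_bracket A i p k l else 0)
    - (if p = k then odd_bracket A i j q l else 0) - (if p = l then odd_bracket A i j k q else 0)"
  using m by (simp add: odd_bracket_def com_linear com_if gl_familyD[OF gl] cong: if_cong)

text \<open>
  Both sides are equivariant, so the difference \<open>err\<close> is moved around by the $A_{pq}$ exactly as in the two
  preceding cases, starting from one vanishing value.
\<close>

lemma pn_family_mixed:
  fixes A :: "nat \<Rightarrow> nat \<Rightarrow> 'a::ring_1"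
  assumes tf: "torsion_free TYPE('a)" and gl: "gl_family n A" and S: "sym2_family n A S"
    and T: "alt2_family n (\<lambda>i j. - A j i) T"
    and base: "n \<ge> 2 \<Longrightarrow> acom (S 1 1) (T 1 2) = A 1 2 + A 1 2"
    and ijkl: "i \<in> {1..n}" "j \<in> {1..n}" "k \<in> {1..n}" "l \<in> {1..n}"
  shows "acom (S i j) (T k l) = odd_bracket A i j k l"
proof -
  define err where "err i j k l = acom (S i j) (T k l) - odd_bracket A i j k l" for i j k l
  have diag: "err i j k k = 0" if "k \<in> {1..n}" for i j k
    using alt2_familyD(1)[OF T that] by (simp add: err_def odd_bracket_def)
  have sym: "err i j k l = err j i k l" if "i \<in> {1..n}" "j \<in> {1..n}" for i j k l
    using sym2_familyD(1)[OF S that] by (simp add: err_def odd_bracket_def)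
  have anti: "err i j k l = - err i j l k" if "k \<in> {1..n}" "l \<in> {1..n}" for i j k l
    using alt2_familyD(2)[OF T that] by (simp add: err_def odd_bracket_def acom_minus)
  have move: "(if q = i then err p j k l else 0) + (if q = j then err i p k l else 0)
      - (if p = k then err i j q l else 0) - (if p = l then err i j k q else 0) = 0"
    if "err i j k l = 0" "i \<in> {1..n}" "j \<in> {1..n}" "k \<in> {1..n}" "l \<in> {1..n}" "p \<in> {1..n}" "q \<in> {1..n}"
    for i j k l p q
  proof -
    have AT: "com (A p q) (T k l) = - ((if p = k then T q l else 0) + (if p = l then T k q else 0))"
      using alt2_familyD(3)[OF T, of q p k l] that unfolding com_minus by (metis minus_minus)
    have "com (A p q) (err i j k l) = acom (com (A p q) (S i j)) (T k l)
        + acom (S i j) (com (A p q) (T k l)) - com (A p q) (odd_bracket A i j k l)"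
      by (simp add: err_def com_diff com_acom)
    also have "\<dots> = (if q = i then err p j k l else 0) + (if q = j then err i p k l else 0)
      - (if p = k then err i j q l else 0) - (if p = l then err i j k q else 0)"
      unfolding AT sym2_familyD(2)[OF S that(6,7,2,3)] odd_bracket_invariant[OF gl that(6,7,2-5)]
      by (simp add: err_def acom_add acom_minus acom_diff)
    finally show ?thesis using that(1) by simp
  qed
  have "err i j k l = 0"
  proof (cases "n \<ge> 2")
    case False
    then have "k = 1" "l = 1" using ijkl by auto
    then show ?thesis using diag ijkl by simp
  next
    case n: True
    then have one: "1 \<in> {1..n}" and two: "2 \<in> {1..n}" by auto
    have e0: "err 1 1 1 2 = 0" using base[OF n] by (simp add: err_def odd_bracket_def)
    have e1: "err p 1 1 2 = 0" if "p \<in> {1..n}" for p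
      using move[OF e0, of p 1] that one two diag[OF one] e0 sym[of 1 p 1 2] torsion_freeD2[OF tf, of "err p 1 1 2"]
      by (auto split: if_splits)
    have e2: "err p q 1 2 = 0" if "p \<in> {1..n}" "q \<in> {1..n}" for p q
      using move[OF e1, of p q 1] that one two diag[OF one] e1[of p] e1[of q] sym[of p q 1 2]
      by (cases "p = 1"; cases "q = 1") (auto split: if_splits)
    have e3: "err p q r 2 = 0" if "p \<in> {1..n}" "q \<in> {1..n}" "r \<in> {1..n}" for p q r
      using move[OF e2, of p q 1 r] that one two e2 by (auto split: if_splits)
    show ?thesis
    proof (cases "k = 2")
      case True then show ?thesis using e3[of i j l] anti[of k l i j] ijkl two by simp
    next
      case False then show ?thesis using move[OF e3, of i j k 2 l] ijkl two e3 by (auto split: if_splits)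
    qed
  qed
  then show ?thesis by (simp add: err_def)
qed


section \<open>Chevalley relations for $\mathfrak p(n)$\<close>

text \<open>
  The relations of $R$ with superbrackets resolved into commutators and anticommutators and multiplicities written as repeated
  summands.  The element $b$ stands for $B_{1,1}$.
\<close>

locale pn_chevalley =
  fixes n :: nat and E F H B C :: "nat \<Rightarrow> 'a::ring_1" and b :: 'a
  assumes tf: "torsion_free TYPE('a)" and n: "n \<ge> 1"
    and HH: "\<And>i j. i \<in> {1..n} \<Longrightarrow> j \<in> {1..n} \<Longrightarrow> com (H i) (H j) = 0"
    and HE: "\<And>i j. i \<in> {1..n} \<Longrightarrow> j \<in> {1..<n} \<Longrightarrow>
      com (H i) (E j) = (if i = j then E j else 0) - (if i = j + 1 then E j else 0)"
    and HF: "\<And>i j. i \<in> {1..n} \<Longrightarrow> j \<in> {1..<n} \<Longrightarrow>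
      com (H i) (F j) = (if i = j + 1 then F j else 0) - (if i = j then F j else 0)"
    and EF: "\<And>i j. i \<in> {1..<n} \<Longrightarrow> j \<in> {1..<n} \<Longrightarrow>
      com (E i) (F j) = (if i = j then H i - H (i + 1) else 0)"
    and EE: "\<And>i j. i \<in> {1..<n} \<Longrightarrow> j \<in> {1..<n} \<Longrightarrow> j \<noteq> i + 1 \<Longrightarrow> i \<noteq> j + 1 \<Longrightarrow> com (E i) (E j) = 0"
    and FF: "\<And>i j. i \<in> {1..<n} \<Longrightarrow> j \<in> {1..<n} \<Longrightarrow> j \<noteq> i + 1 \<Longrightarrow> i \<noteq> j + 1 \<Longrightarrow> com (F i) (F j) = 0"
    and EEE: "\<And>i j. i \<in> {1..<n} \<Longrightarrow> j \<in> {1..<n} \<Longrightarrow> j = i + 1 \<or> i = j + 1 \<Longrightarrow> com (E i) (com (E i) (E j)) = 0"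
    and FFF: "\<And>i j. i \<in> {1..<n} \<Longrightarrow> j \<in> {1..<n} \<Longrightarrow> j = i + 1 \<or> i = j + 1 \<Longrightarrow> com (F i) (com (F i) (F j)) = 0"
    and BB: "\<And>i. i \<in> {1..<n} \<Longrightarrow> acom (B i) (B i) = 0"
    and CC: "\<And>i j. i \<in> {1..<n} \<Longrightarrow> j \<in> {1..<n} \<Longrightarrow> acom (C i) (C j) = 0"
    and HB: "\<And>i j. i \<in> {1..n} \<Longrightarrow> j \<in> {1..<n} \<Longrightarrow>
      com (H i) (B j) = (if i = j then B j else 0) + (if i = j + 1 then B j else 0)"
    and HC: "\<And>i j. i \<in> {1..n} \<Longrightarrow> j \<in> {1..<n} \<Longrightarrow>
      com (H i) (C j) = - (if i = j then C j else 0) - (if i = j + 1 then C j else 0)"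
    and BC: "\<And>i. i \<in> {1..<n} \<Longrightarrow> acom (B i) (C i) = - H i + H (i + 1)"
    and BF: "\<And>i j. i \<in> {1..<n} \<Longrightarrow> j \<in> {1..<n} \<Longrightarrow> j \<noteq> i \<Longrightarrow> j \<noteq> i + 1 \<Longrightarrow> com (B i) (F j) = 0"
    and BE: "\<And>i j. i \<in> {1..<n} \<Longrightarrow> j \<in> {1..<n} \<Longrightarrow> j \<noteq> i \<Longrightarrow> i \<noteq> j + 1 \<Longrightarrow> com (B i) (E j) = 0"
    and BF_BE: "\<And>i. i \<in> {1..<n} \<Longrightarrow> i + 1 \<in> {1..<n} \<Longrightarrow> com (B i) (F (i + 1)) = com (B (i + 1)) (E i)"
    and FC: "\<And>i j. i \<in> {1..<n} \<Longrightarrow> j \<in> {1..<n} \<Longrightarrow> i \<noteq> j + 1 \<Longrightarrow> com (F j) (C i) = 0"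
    and EC: "\<And>i j. i \<in> {1..<n} \<Longrightarrow> j \<in> {1..<n} \<Longrightarrow> j \<noteq> i + 1 \<Longrightarrow> com (E j) (C i) = 0"
    and BFF: "\<And>i j. i \<in> {1..<n} \<Longrightarrow> j \<in> {1..<n} \<Longrightarrow>
      com (com (B i) (F i)) (F j) = (if j = i + 1 then B (i + 1) + B (i + 1) else 0)"
    and BFE: "1 \<in> {1..<n} \<Longrightarrow> com (com (B 1) (F 1)) (E 1) = B 1 + B 1"
    and BEE: "\<And>j. 1 \<in> {1..<n} \<Longrightarrow> j \<in> {1..<n} \<Longrightarrow> com (com (B 1) (E 1)) (E j) = 0"
    and CFF: "\<And>i. i \<in> {1..<n} \<Longrightarrow> i + 1 \<in> {1..<n} \<Longrightarrow> com (com (C (i + 1)) (F i)) (F (i + 1)) = C i"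
    and CFF_0: "\<And>i. i \<in> {1..<n} \<Longrightarrow> i + 1 \<in> {1..<n} \<Longrightarrow> com (com (C (i + 1)) (F i)) (F i) = 0"
    and B11: "1 \<in> {1..<n} \<Longrightarrow> b + b = com (E 1) (B 1)"
    and HB11: "\<And>i. i \<in> {1..n} \<Longrightarrow> com (H i) b = (if i = 1 then b + b else 0)"
    and B11_sq: "b * b = 0"
begin

lemma com_neg_cancel: "com (com x y) z = com z (com y x)"
  by (simp add: com_def algebra_simps)

lemma BFF': "i \<in> {1..<n} \<Longrightarrow> j \<in> {1..<n} \<Longrightarrow>
    com (F j) (com (F i) (B i)) = (if j = i + 1 then B (i + 1) + B (i + 1) else 0)"
  using BFF[of i j] by (simp only: com_neg_cancel)

lemma FE: "i \<in> {1..<n} \<Longrightarrow> j \<in> {1..<n} \<Longrightarrow> com (F j) (E i) = - (if i = j then H i - H (i + 1) else 0)"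
  by (rule com_antiD) (rule EF)

lemma two_cancel: "x + x = y + y \<Longrightarrow> x = (y::'a)"
  using torsion_freeD2[OF tf, of "x - y"] by (simp add: algebra_simps)

lemma E_kills_b: "j \<in> {1..<n} \<Longrightarrow> com (E j) b = 0"
proof -
  assume j: "j \<in> {1..<n}"
  then have "com (E j) (com (E 1) (B 1)) = 0" using BEE[of j] by (auto simp: com_neg_cancel)
  then have "com (E j) b + com (E j) b = 0" using B11 j by (auto simp: com_add[symmetric])
  then show ?thesis by (rule torsion_freeD2[OF tf])
qed

text \<open>
  For $n\ge3$ the presentation does not say that $F_2$ commutes with $B_{1,1}$; the proof extracts it from the representation
  theory of two copies of $\mathfrak{sl}_2$.  For the first, the element $x=[F_2,[F_2,B_1]]$ has weight $2$, is killed by $F_1$ and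
  by the square of $E_1$; a lowest weight vector of positive weight in a finite-dimensional representation vanishes.
  For the second, $y=[F_2,2B_{1,1}]$ is killed by $E_2$ and $F_2$ but has weight $-1$, so it vanishes too.
\<close>

lemma F2_kills_b:
  assumes n3: "n \<ge> 3" shows "com (F 2) b = 0"
proof -
  have i: "1 \<in> {1..<n}" "2 \<in> {1..<n}" "1 \<in> {1..n}" "2 \<in> {1..n}" "3 \<in> {1..n}" using n3 by auto
  have FB: "com (F 2) (B 1) = com (E 1) (B 2)"
    using BF_BE[of 1] i com_antiD[of "B 1" "F 2"] com_anti[of "B 2" "E 1"] by (simp add: numeral_2_eq_2)
  have EF0: "com (E 1) (F 2) = 0" "com (F 2) (E 1) = 0" using EF[of 1 2] FE[of 1 2] i by auto
  define h where "h = H 1 - H 2"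
  define z where "z = com (F 2) (B 2)"
  define x where "x = com (E 1) z"
  have hF1: "com (F 1) (E 1) = - h" using FE[of 1 1] i by (simp add: h_def numeral_2_eq_2)
  have hE1: "com h (E 1) = E 1 + E 1" using HE[of 1 1] HE[of 2 1] i by (simp add: h_def com_diff numeral_2_eq_2)
  have hz: "com h z = 0"
    using HF[of 1 2] HF[of 2 2] HB[of 1 2] HB[of 2 2] i by (simp add: h_def z_def com_com[of _ "F 2"] com_linear)
  have F1z: "com (F 1) z = 0" using BFF'[of 2 1] i by (simp add: z_def)
  \<comment> \<open>The element that has to vanish, rewritten so that its weight and its behaviour under $F_1$ become visible.\<close>
  have x_alt: "x = com (F 2) (com (F 2) (B 1))"
    unfolding x_def z_def using FB EF0 by (simp add: com_swap[of "E (Suc 0)" "F 2"])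
  have E1x: "com (E 1) x = com (F 2) (com (F 2) (com (E 1) (B 1)))"
    unfolding x_alt using EF0 by (simp add: com_swap[of "E (Suc 0)" "F 2"])
  have "com (E 1) (com (E 1) x) = com (F 2) (com (F 2) (com (E 1) (com (E 1) (B 1))))"
    unfolding E1x using EF0 by (simp add: com_swap[of "E (Suc 0)" "F 2"])
  then have E1x2: "com (E 1) (com (E 1) x) = 0" using BEE[of 1] i by (simp add: com_neg_cancel)
  have hx: "com h x = x + x" by (simp add: x_def com_com[of h] hE1 hz com_add del: One_nat_def)
  have F1x: "com (F 1) x = 0" by (simp add: x_def com_com[of "F 1"] hF1 F1z com_minus hz del: One_nat_def)
  define x2 where "x2 = com (E 1) x"
  have F1x2: "com (F 1) x2 = - (x + x)" by (simp add: x2_def com_com[of "F 1"] hF1 F1x com_minus hx del: One_nat_def)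
  have hx2: "com h x2 = x2 + x2 + x2 + x2" by (simp add: x2_def com_com[of h] hE1 hx com_add add.assoc del: One_nat_def)
  have "com (F 1) (com (E 1) x2) = - com h x2 - (com (E 1) x + com (E 1) x)"
    unfolding com_com[of "F 1"] hF1 F1x2 by (simp add: com_linear)
  moreover have "com (E 1) x2 = 0" "com (E 1) x = x2" using E1x2 by (simp_all add: x2_def)
  ultimately have "- ((x2 + x2 + x2) + (x2 + x2 + x2)) = 0" by (simp add: hx2 add.assoc)
  then have "(x2 + x2 + x2) + (x2 + x2 + x2) = 0" by (simp only: neg_equal_0_iff_equal)
  then have "x2 = 0" using torsion_freeD2[OF tf] torsion_freeD3[OF tf] by blast
  then have "- (x + x) = 0" using F1x2 by (simp only: com_0)
  then have "x + x = 0" by (simp only: neg_equal_0_iff_equal)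
  then have F2F2: "com (F 2) (com (F 2) (B 1)) = 0" using torsion_freeD2[OF tf, of x] x_alt by simp
  define y where "y = com (F 2) (b + b)"
  have "y = com (E 1) (com (F 2) (B 1))"
    unfolding y_def using B11 i EF0 by (simp add: com_swap[of "E (Suc 0)" "F 2"])
  then have F2y: "com (F 2) y = 0" using F2F2 EF0 by (simp add: com_swap[of "F 2" "E (Suc 0)"])
  have Hb: "com (H 2) b = 0" "com (H 3) b = 0" using HB11 i by simp_all
  have "com (E 2) (F 2) = H 2 - H 3" using EF[of 2 2] i by simp
  then have E2y: "com (E 2) y = 0"
    unfolding y_def using Hb E_kills_b[of 2] i by (simp add: com_com[of "E 2"] com_linear)
  have Hy: "com (H 2 - H 3) y = - (y + y)"
    using HF[of 2 2] HF[of 3 2] i Hb by (simp add: y_def com_com[of _ "F 2"] com_linear)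
  have "com (com (E 2) (F 2)) y = 0" using E2y F2y by (simp add: com_jacobi)
  then have "com (H 2 - H 3) y = 0" using EF[of 2 2] i by simp
  then have "y + y = 0" unfolding Hy by (simp only: neg_equal_0_iff_equal)
  then have "y = 0" by (rule torsion_freeD2[OF tf])
  then show ?thesis using torsion_freeD2[OF tf, of "com (F 2) b"] by (simp add: y_def com_add)
qed

lemma F_kills_b:
  assumes "j \<in> {2..<n}" shows "com (F j) b = 0"
proof (cases "j = 2")
  case True then show ?thesis using F2_kills_b assms by simp
next
  case False
  then have "com (F j) (com (E 1) (B 1)) = 0"
    using assms FE[of 1 j] com_antiD[OF BF[of 1 j]] by (simp add: com_com[of "F j"])
  then have "com (F j) b + com (F j) b = 0" using B11 assms by (simp add: com_add[symmetric])
  then show ?thesis by (rule torsion_freeD2[OF tf])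
qed

lemma F1_b:
  assumes "n \<ge> 2" shows "com (F 1) b = B 1"
proof -
  have i: "1 \<in> {1..<n}" "1 \<in> {1..n}" "Suc 1 \<in> {1..n}" using assms by auto
  have "com (F 1) (b + b) = com (F 1) (com (E 1) (B 1))" using B11 i by simp
  also have "\<dots> = com (E 1) (com (F 1) (B 1)) - com (H 1 - H (1 + 1)) (B 1)"
    using FE[of 1 1] i by (simp add: com_com[of "F (Suc 0)"] com_diff)
  also have "com (H 1 - H (1 + 1)) (B 1) = 0" using HB[of 1 1] HB[of "1 + 1" 1] i by (simp add: com_diff)
  also have "com (E 1) (com (F 1) (B 1)) = B 1 + B 1" using BFE i by (simp add: com_neg_cancel)
  finally have "com (F 1) b + com (F 1) b = B 1 + B 1" by (simp add: com_add)
  then show ?thesis by (rule two_cancel)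
qed

text \<open>
  The extremal weight constructions apply to $B_{1,1}$ and $C_{n-1}$.  The second one is stated for
  $e_1\wedge e_2$, whereas $C_{n-1}$ has weight $-\varepsilon_{n-1}-\varepsilon_n$; the reversal $i\mapsto n+1-i$ combined with
  minus transposition turns one into the other.  The remaining $B_i$ and $C_i$ are then recognised as
  $S_{i,i+1}$ and $T_{i,i+1}$ by the relations involving two $F$'s.
\<close>

theorem exists_pn_family:
  obtains A S T where "pn_family n A S T" "\<And>i. i \<in> {1..n} \<Longrightarrow> A i i = H i"
    "\<And>i. i \<in> {1..<n} \<Longrightarrow> A i (i + 1) = E i" "\<And>i. i \<in> {1..<n} \<Longrightarrow> A (i + 1) i = F i"
    "S 1 1 = b + b" "\<And>i. i \<in> {1..<n} \<Longrightarrow> S i (i + 1) = B i" "\<And>i. i \<in> {1..<n} \<Longrightarrow> T i (i + 1) = C i"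
proof -
  obtain A where gl: "gl_family n A" and AH: "\<And>i. i \<in> {1..n} \<Longrightarrow> A i i = H i"
    and A_EF: "\<And>i. i \<in> {1..<n} \<Longrightarrow> A i (i + 1) = E i \<and> A (i + 1) i = F i"
    by (rule gl_family_chevalley[where n=n and E=E and F=F and H=H, OF tf])
      (assumption | rule HH HE HF EF EE FF EEE FFF | blast)+
  have AE: "A i (i + 1) = E i" and AF: "A (i + 1) i = F i" if "i \<in> {1..<n}" for i
    using A_EF that by auto
  have mono: "com (A k l) z = 0" if "k \<in> {1..n}" "l \<in> {1..n}"
    "k = l \<Longrightarrow> com (H k) z = 0" "\<And>i. k \<le> i \<Longrightarrow> i < l \<Longrightarrow> com (E i) z = 0"
    "\<And>i. l \<le> i \<Longrightarrow> i < k \<Longrightarrow> com (F i) z = 0" for k l z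
  proof (cases k l rule: linorder_cases)
    case less
    show ?thesis
      by (rule gl_family_upper[OF gl, of k l "\<lambda>x. com x z = 0"])
        (use that less AE com_killed in auto)
  next
    case equal then show ?thesis using that AH by auto
  next
    case greater
    show ?thesis
      by (rule gl_family_lower[OF gl, of l k "\<lambda>x. com x z = 0"])
        (use that greater AF com_killed in auto)
  qed
  have A21: "A 2 1 = F 1" "1 \<in> {1..<n}" if "n \<ge> 2" using AF[of 1] that by (auto simp: numeral_2_eq_2)
  obtain S where S: "sym2_family n A S" "S 1 1 = b + b" "\<And>k. k \<in> {2..n} \<Longrightarrow> S k 1 = com (A k 1) b"
  proof (rule sym2_family_highest_weight[OF tf gl n, of b])
    show "com (A k l) b = 0" if "k \<in> {1..n}" "l \<in> {2..n}" for k l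
      using that HB11 E_kills_b F_kills_b by (intro mono) auto
    show "com (A 1 1) b = b + b" using AH[of 1] HB11[of 1] n by simp
    show "com (A 2 1) (com (A 2 1) (com (A 2 1) b)) = 0" if "n \<ge> 2"
      using A21[OF that] F1_b[OF that] BFF'[of 1 1] by simp
  qed blast
  have SB: "S i (i + 1) = B i" if "i \<in> {1..<n}" for i
    using that
  proof (induction i)
    case (Suc i)
    show ?case
    proof (cases "i = 0")
      case True
      then show ?thesis
        using Suc.prems sym2_familyD(1)[OF S(1), of 1 2] S(3)[of 2] A21 F1_b by (auto simp: numeral_2_eq_2)
    next
      case False
      then have SBi: "S i (i + 1) = B i" using Suc by auto
      have "com (A (i + 1) i) (S i (i + 1)) = S (i + 1) (i + 1)"
        using sym2_familyD(2)[OF S(1), of "i + 1" i i "i + 1"] Suc.prems False by auto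
      moreover have "com (A (i + 2) (i + 1)) (S (i + 1) (i + 1)) = S (i + 1) (i + 2) + S (i + 1) (i + 2)"
        using sym2_familyD(2)[OF S(1), of "i + 2" "i + 1" "i + 1" "i + 1"]
          sym2_familyD(1)[OF S(1), of "i + 2" "i + 1"] Suc.prems False by auto
      ultimately have "com (F (i + 1)) (com (F i) (B i)) = S (i + 1) (i + 2) + S (i + 1) (i + 2)"
        using AF[of i] AF[of "i + 1"] Suc.prems False SBi by auto
      then have "S (i + 1) (i + 2) + S (i + 1) (i + 2) = B (i + 1) + B (i + 1)"
        using BFF'[of i "i + 1"] Suc.prems False by auto
      then show ?thesis using two_cancel[of "S (i + 1) (i + 2)"] by simp
    qed
  qed simp
  obtain T where T: "alt2_family n (\<lambda>i j. - A j i) T" and TC: "\<And>i. i \<in> {1..<n} \<Longrightarrow> T i (i + 1) = C i"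
  proof (cases "n = 1")
    case True
    show ?thesis by (rule that[of "\<lambda>_ _. 0"]) (auto simp: alt2_family_def True)
  next
    case False
    then have n2: "n \<ge> 2" using n by simp
    \<comment> \<open>In the reversed and transposed family, $C_{n-1}$ becomes the extremal vector.\<close>
    define \<sigma> where "\<sigma> i = n + 1 - i" for i
    have \<sigma>: "\<sigma> i \<in> {1..n}" "\<sigma> (\<sigma> i) = i" if "i \<in> {1..n}" for i using that by (auto simp: \<sigma>_def)
    have \<sigma>_eq: "\<sigma> i = \<sigma> j \<longleftrightarrow> i = j" if "i \<in> {1..n}" "j \<in> {1..n}" for i j using that by (auto simp: \<sigma>_def)
    define A' where "A' i j = - A (\<sigma> j) (\<sigma> i)" for i j
    have gl': "gl_family n A'"
      unfolding gl_family_def A'_def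
      by (auto simp: com_minus gl_familyD[OF gl \<sigma>(1) \<sigma>(1) \<sigma>(1) \<sigma>(1)] \<sigma>_eq)
    have C0: "com (A r c) (C (n - 1)) = 0" if "r \<in> {1..n}" "c \<in> {1..n}" "r \<le> n - 2" for r c
      using that n2 by (intro mono) (auto simp: HC EC FC)
    have s12: "\<sigma> 1 = n" "\<sigma> 2 = n - 1" "\<sigma> 3 = n - 2" by (auto simp: \<sigma>_def)
    have nn: "n - 1 \<in> {1..<n}" "Suc (n - 1) = n" "n - 1 \<in> {1..n}" "n \<noteq> n - Suc 0" using n2 by auto
    obtain T' where T': "alt2_family n A' T'" "T' 1 2 = - C (n - 1)"
    proof (rule alt2_family_highest_weight[OF tf gl' n2, of "- C (n - 1)"])
      show "com (A' k l) (- C (n - 1)) = 0" if "k \<in> {1..n}" "l \<in> {3..n}" for k l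
      proof -
        have "\<sigma> l \<le> n - 2" using that by (auto simp: \<sigma>_def)
        then show ?thesis using C0[of "\<sigma> l" "\<sigma> k"] \<sigma>(1)[of l] \<sigma>(1)[of k] that by (auto simp: A'_def com_minus)
      qed
      show "com (A' 1 1) (- C (n - 1)) = - C (n - 1)"
        unfolding A'_def s12 using AH[of n] HC[of n "n - 1"] n nn by (simp add: com_minus)
      show "com (A' 2 2) (- C (n - 1)) = - C (n - 1)"
        unfolding A'_def s12 using AH[of "n - 1"] HC[of "n - 1" "n - 1"] n nn by (simp add: com_minus)
      show "com (A' 1 2) (- C (n - 1)) = 0"
        unfolding A'_def s12 using AE[of "n - 1"] EC[of "n - 1" "n - 1"] nn by (simp add: com_minus)
      show "com (A' 2 1) (- C (n - 1)) = 0"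
        unfolding A'_def s12 using AF[of "n - 1"] FC[of "n - 1" "n - 1"] nn by (simp add: com_minus)
      show "com (A' 3 2) (com (A' 3 2) (- C (n - 1))) = 0" if "n \<ge> 3"
      proof -
        have m: "n - 2 \<in> {1..<n}" "n - 2 + 1 = n - 1" "n - 2 + 1 \<in> {1..<n}" using that by auto
        show ?thesis
          unfolding A'_def s12 using AF[OF m(1)] CFF_0[OF m(1,3)] unfolding m(2)
          by (simp add: com_minus com_neg_cancel)
      qed
    qed blast
    define T where "T i j = T' (\<sigma> i) (\<sigma> j)" for i j
    have fam: "alt2_family n (\<lambda>i j. - A j i) T"
      unfolding alt2_family_def
    proof (intro conjI ballI)
      show "T i i = 0" if "i \<in> {1..n}" for i
        using alt2_familyD(1)[OF T'(1)] \<sigma> that by (simp add: T_def)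
      show "T i j = - T j i" if "i \<in> {1..n}" "j \<in> {1..n}" for i j
        using alt2_familyD(2)[OF T'(1)] \<sigma> that unfolding T_def by blast
      show "com (- A l k) (T i j) = (if l = i then T k j else 0) + (if l = j then T i k else 0)"
        if "k \<in> {1..n}" "l \<in> {1..n}" "i \<in> {1..n}" "j \<in> {1..n}" for k l i j
        using alt2_familyD(3)[OF T'(1), of "\<sigma> k" "\<sigma> l" "\<sigma> i" "\<sigma> j"] \<sigma> \<sigma>_eq that
        unfolding T_def A'_def by simp
    qed
    have actT: "com (A k l) (T i j) = - ((if k = i then T l j else 0) + (if k = j then T i l else 0))"
      if "k \<in> {1..n}" "l \<in> {1..n}" "i \<in> {1..n}" "j \<in> {1..n}" for k l i j
      using alt2_familyD(3)[OF fam that(2,1,3,4)] unfolding com_minus by (metis minus_minus)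
    have "T (n - 1) n = C (n - 1)"
      using alt2_familyD(2)[OF T'(1), of 2 1] T'(2) n2 by (simp add: T_def \<sigma>_def)
    have TC: "T i (i + 1) = C i" if "i \<le> n - 1" "1 \<le> i" for i
      using that
    proof (induction i rule: inc_induct)
      case base then show ?case using \<open>T (n - 1) n = C (n - 1)\<close> n2 by simp
    next
      case (step i)
      have i: "i \<in> {1..<n}" "i + 1 \<in> {1..<n}" using step.hyps step.prems by auto
      have "T (i + 1) (i + 2) = C (i + 1)" using step.IH step.prems by simp
      moreover have "com (A (i + 1) i) (T (i + 1) (i + 2)) = - T i (i + 2)"
        using actT[of "i + 1" i "i + 1" "i + 2"] i by auto
      moreover have "com (A (i + 2) (i + 1)) (T i (i + 2)) = - T i (i + 1)"
        using actT[of "i + 2" "i + 1" i "i + 2"] i by auto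
      ultimately have "com (F (i + 1)) (com (F i) (C (i + 1))) = T i (i + 1)"
        using AF[of i] AF[of "i + 1"] i by (simp add: com_minus)
      then show ?case using CFF[OF i] by (simp add: com_neg_cancel)
    qed
    show ?thesis by (rule that[OF fam]) (use TC in auto)
  qed
  have "acom (S i j) (S k l) = 0" if "i \<in> {1..n}" "j \<in> {1..n}" "k \<in> {1..n}" "l \<in> {1..n}" for i j k l
  proof (rule sym2_family_acom[OF tf S(1)])
    show "acom (S 1 1) (S 1 1) = 0" unfolding S(2) using B11_sq by (simp add: acom_def algebra_simps)
    show "acom (S 1 2) (S 1 2) = 0" if "n \<ge> 2" using SB[of 1] BB[of 1] that by (simp add: numeral_2_eq_2)
  qed (use that in auto)
  moreover have "acom (T i j) (T k l) = 0" if "i \<in> {1..n}" "j \<in> {1..n}" "k \<in> {1..n}" "l \<in> {1..n}" for i j k l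
  proof (rule alt2_family_acom[OF tf T])
    show "acom (T 1 2) (T 1 2) = 0" if "n \<ge> 2" using TC[of 1] CC[of 1 1] that by (simp add: numeral_2_eq_2)
    show "acom (T 3 4) (T 1 2) = 0" if "n \<ge> 4"
      using TC[of 1] TC[of 3] CC[of 3 1] that by (simp add: numeral_2_eq_2)
  qed (use that in auto)
  moreover have "acom (S i j) (T k l) = odd_bracket A i j k l"
    if "i \<in> {1..n}" "j \<in> {1..n}" "k \<in> {1..n}" "l \<in> {1..n}" for i j k l
  proof (rule pn_family_mixed[OF tf gl S(1) T])
    assume n2: "n \<ge> 2"
    then have i: "1 \<in> {1..<n}" "1 \<in> {1..n}" "1 + 1 \<in> {1..n}" by auto
    have "acom (com (E 1) (B 1)) (C 1) = com (E 1) (acom (B 1) (C 1)) - acom (B 1) (com (E 1) (C 1))"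
      by (simp add: com_acom)
    also have "\<dots> = - com (E 1) (H 1) + com (E 1) (H (1 + 1))" using BC[OF i(1)] EC[OF i(1,1)] by (simp add: com_linear)
    also have "\<dots> = E 1 + E 1"
      using com_antiD[OF HE[OF i(2,1)]] com_antiD[OF HE[OF i(3,1)]] by simp
    finally show "acom (S 1 1) (T 1 2) = A 1 2 + A 1 2"
      using S(2) B11[OF i(1)] TC[OF i(1)] AE[OF i(1)] by (simp add: numeral_2_eq_2)
  qed (use that in auto)
  ultimately have "pn_family n A S T" unfolding pn_family_def using gl S(1) T by blast
  then show thesis using AH AE AF S(2) SB TC by (rule that)
qed

end


section \<open>Presented algebras and their representations\<close>

lemma poly_mapping_sum_single:
  fixes x :: "'a \<Rightarrow>\<^sub>0 'b::comm_monoid_add"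
  shows "(\<Sum>w\<in>Poly_Mapping.keys x. Poly_Mapping.single w (Poly_Mapping.lookup x w)) = x"
  by (rule poly_mapping_eqI)
    (simp add: lookup_sum lookup_single when_def sum.delta in_keys_iff cong: if_cong)

lemma poly_mapping_additive_induct [case_names zero single add]:
  fixes x :: "'a \<Rightarrow>\<^sub>0 'b::comm_monoid_add"
  assumes "P 0" "\<And>w c. P (Poly_Mapping.single w c)" "\<And>x y. P x \<Longrightarrow> P y \<Longrightarrow> P (x + y)"
  shows "P x"
proof -
  have "P (\<Sum>w\<in>K. Poly_Mapping.single w (Poly_Mapping.lookup x w))" if "finite K" for K
    using that by (induction K rule: finite_induct) (simp_all add: assms)
  then show ?thesis using poly_mapping_sum_single[of x] by (metis finite_keys)
qed

lemma single_fmon_Cons: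
  "Poly_Mapping.single (Fmon (g # u)) c = fgen g * Poly_Mapping.single (Fmon u) c"
  by (simp add: fgen_def mult_single plus_fmon_def)

lemma single_fmon: "Poly_Mapping.single (Fmon u) c = fconst c * prod_list (map fgen u)"
proof (induction u arbitrary: c)
  case Nil show ?case by (simp add: fconst_def zero_fmon_def)
next
  case (Cons g u)
  have "Poly_Mapping.single (Fmon (g # u)) c = fconst c * Poly_Mapping.single (Fmon (g # u)) 1"
    by (simp add: fconst_def mult_single)
  also have "\<dots> = fconst c * (fgen g * Poly_Mapping.single (Fmon u) 1)" by (simp add: single_fmon_Cons)
  also have "\<dots> = fconst c * prod_list (map fgen (g # u))" by (simp add: Cons fconst_1)
  finally show ?case .
qed

lemma fconst_central: "fconst c * x = x * fconst (c :: 'k::comm_ring_1)"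
proof (induction x rule: poly_mapping_additive_induct)
  case (single w d) show ?case by (simp add: fconst_def mult_single mult.commute)
qed (simp_all add: distrib_left distrib_right)

lemma free_alg_fgen [simp]: "fgen g \<in> free_alg S \<longleftrightarrow> g \<in> S" for S
  by (simp add: free_alg_def fgen_def)

text \<open>
  Operators attached to the generators extend to an action of the free algebra; it factors through a presented algebra when the relations act by zero.
\<close>

locale free_action = vector_space sc for sc :: "'k::field \<Rightarrow> 'v::ab_group_add \<Rightarrow> 'v" +
  fixes \<phi> :: "'g \<Rightarrow> 'v \<Rightarrow> 'v"
  assumes \<phi>_add: "\<phi> g (u + v) = \<phi> g u + \<phi> g v" and \<phi>_scale: "\<phi> g (sc c u) = sc c (\<phi> g u)"
begin

definition act :: "('g fmon \<Rightarrow>\<^sub>0 'k) \<Rightarrow> 'v \<Rightarrow> 'v"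
  where "act x v = (\<Sum>w\<in>Poly_Mapping.keys x. sc (Poly_Mapping.lookup x w) (foldr \<phi> (letters w) v))"

lemma act_superset:
  "finite K \<Longrightarrow> Poly_Mapping.keys x \<subseteq> K \<Longrightarrow>
    act x v = (\<Sum>w\<in>K. sc (Poly_Mapping.lookup x w) (foldr \<phi> (letters w) v))"
  unfolding act_def by (rule sum.mono_neutral_left) (auto simp: in_keys_iff)

lemma act_0 [simp]: "act 0 v = 0" by (simp add: act_def)

lemma act_add: "act (x + y) v = act x v + act y v"
proof -
  let ?K = "Poly_Mapping.keys x \<union> Poly_Mapping.keys y"
  have "act (x + y) v = (\<Sum>w\<in>?K. sc (Poly_Mapping.lookup (x + y) w) (foldr \<phi> (letters w) v))"
    by (rule act_superset) (auto dest: set_mp[OF keys_add])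
  then show ?thesis
    by (simp add: act_superset[of ?K x] act_superset[of ?K y] lookup_add scale_left_distrib sum.distrib)
qed

lemma act_single: "act (Poly_Mapping.single w c) v = sc c (foldr \<phi> (letters w) v)"
  using act_superset[of "{w}" "Poly_Mapping.single w c" v] by simp

lemma act_minus: "act (- x) v = - act x v"
  using act_add[of "- x" x v] by (simp add: eq_neg_iff_add_eq_0)

lemma act_diff: "act (x - y) v = act x v - act y v"
  using act_add[of x "- y" v] by (simp add: act_minus)

lemma act_fgen [simp]: "act (fgen g) v = \<phi> g v" by (simp add: fgen_def act_single)

lemma act_fconst [simp]: "act (fconst c) v = sc c v" by (simp add: fconst_def act_single zero_fmon_def)

lemma act_1 [simp]: "act 1 v = v" using act_fconst[of 1] by (simp add: fconst_1)

lemma foldr_\<phi>_add: "foldr \<phi> gs (u + v) = foldr \<phi> gs u + foldr \<phi> gs v"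
  by (induction gs) (simp_all add: \<phi>_add)

lemma foldr_\<phi>_scale: "foldr \<phi> gs (sc c u) = sc c (foldr \<phi> gs u)"
  by (induction gs) (simp_all add: \<phi>_scale)

lemma act_add_right: "act x (u + v) = act x u + act x v"
  by (simp add: act_def foldr_\<phi>_add scale_right_distrib sum.distrib)

lemma act_mult: "act (x * y) v = act x (act y v)"
proof (induction x arbitrary: v rule: poly_mapping_additive_induct)
  case (single w c)
  show ?case
  proof (induction y arbitrary: v rule: poly_mapping_additive_induct)
    case (single w' c')
    show ?case by (simp add: mult_single act_single foldr_\<phi>_scale foldr_append)
  next
    case (add y z) then show ?case by (simp add: distrib_left act_add act_add_right)
  next
    case zero
    have "act (Poly_Mapping.single w c) 0 = 0" using act_add_right[of "Poly_Mapping.single w c" 0 0] by simp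
    then show ?case by simp
  qed
qed (simp_all add: distrib_right act_add)

lemma act_ideal:
  assumes "\<And>q v. q \<in> Q \<Longrightarrow> act q v = 0" and "x \<in> pres_ideal S Q"
  shows "act x v = 0"
  using assms(2)
proof (induction rule: pres_ideal.induct)
  case (add x q a b)
  have "act a 0 = 0" using act_add_right[of a 0 0] by simp
  then show ?case using add assms(1) by (simp add: act_add act_mult)
qed simp

lemma act_pres_rel:
  assumes "\<And>q v. q \<in> Q \<Longrightarrow> act q v = 0" and "pres_rel S Q x y"
  shows "act x v = act y v"
proof -
  have "act (x - y) v = 0"
    by (rule act_ideal[of Q, OF assms(1)]) (use assms(2) in \<open>auto simp: pres_rel_def\<close>)
  then show ?thesis by (simp add: act_diff)
qed

end

text \<open>
  The special case of left multiplications yields evaluation homomorphisms from the free algebra.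
\<close>

locale unital_algebra = vector_space sc for sc :: "'k::field \<Rightarrow> 'b::ring_1 \<Rightarrow> 'b" +
  assumes scale_mult_left: "sc c (x * y) = sc c x * y" and scale_mult_right: "sc c (x * y) = x * sc c y"
begin

sublocale gen: free_action sc "\<lambda>g v. f g * v" for f :: "'g \<Rightarrow> 'b"
  by unfold_locales (simp_all add: distrib_left scale_mult_right)

definition ev :: "('g \<Rightarrow> 'b) \<Rightarrow> ('g fmon \<Rightarrow>\<^sub>0 'k) \<Rightarrow> 'b"
  where "ev f x = gen.act f x 1"

lemma act_eq_ev: "gen.act f x v = ev f x * v"
  unfolding ev_def
proof (induction x rule: poly_mapping_additive_induct)
  case (single w c)
  have "foldr (\<lambda>g. (*) (f g)) u v = foldr (\<lambda>g. (*) (f g)) u 1 * v" for u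
    by (induction u) (simp_all add: mult.assoc)
  note * = this[of "letters w"]
  show ?case unfolding gen.act_single by (subst *) (rule scale_mult_left)
qed (simp_all add: gen.act_add distrib_right)

lemma ev_0 [simp]: "ev f 0 = 0" and ev_1 [simp]: "ev f 1 = 1" and ev_fgen [simp]: "ev f (fgen g) = f g"
  and ev_fconst: "ev f (fconst c) = sc c 1"
  and ev_add: "ev f (x + y) = ev f x + ev f y" and ev_diff: "ev f (x - y) = ev f x - ev f y"
  and ev_minus: "ev f (- x) = - ev f x"
  by (simp_all add: ev_def gen.act_add gen.act_diff gen.act_minus)

lemma ev_mult: "ev f (x * y) = ev f x * ev f y"
proof -
  have "ev f (x * y) = gen.act f x (ev f y)" by (simp add: ev_def gen.act_mult)
  also have "\<dots> = ev f x * ev f y" by (rule act_eq_ev)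
  finally show ?thesis .
qed

lemma ev_of_nat: "ev f (of_nat m) = of_nat m" by (induction m) (simp_all add: ev_add)

lemma ev_of_int: "ev f (of_int m) = of_int m"
  by (cases m rule: int_cases2) (simp_all add: ev_of_nat ev_minus)

lemma ev_numeral: "ev f (numeral m) = numeral m" using ev_of_nat[of f "numeral m"] by simp

lemma ev_koszul: "ev f (koszul p q) = koszul p q" by (simp add: koszul_def ev_minus)

lemma ev_prod_list: "ev f (prod_list (map fgen u)) = prod_list (map f u)"
  by (induction u) (simp_all add: ev_mult)

lemma ev_pres_rel:
  assumes "\<And>q. q \<in> Q \<Longrightarrow> ev f q = 0" and "pres_rel S Q x y"
  shows "ev f x = ev f y"
  using gen.act_pres_rel[of Q f S x y 1] assms by (simp add: act_eq_ev)

end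

global_interpretation ralg: unital_algebra "scale_ralg :: 'k \<Rightarrow> ('k::field_char_0, 'n::finite) ralg \<Rightarrow> ('k, 'n) ralg"
proof
  fix c :: 'k and x y :: "('k, 'n) ralg"
  show "scale_ralg c (x * y) = scale_ralg c x * y" by (simp add: scale_ralg_def mult.assoc)
  obtain x' where x': "x' \<in> free_alg (rgens CARD('n))" "x = abs_ralg x'" by (rule ralg_exhaust)
  have "abs_ralg (fconst c) * x = x * abs_ralg (fconst c)"
    unfolding x'(2) by (simp add: abs_ralg_mult x'(1) fconst_central)
  then show "scale_ralg c (x * y) = x * scale_ralg c y" by (simp add: scale_ralg_def mult.assoc[symmetric])
qed

global_interpretation upn: unital_algebra "scale_upn :: 'k \<Rightarrow> ('k::field_char_0, 'n::finite) upn \<Rightarrow> ('k, 'n) upn"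
proof
  fix c :: 'k and x y :: "('k, 'n) upn"
  show "scale_upn c (x * y) = scale_upn c x * y" by (simp add: scale_upn_def mult.assoc)
  obtain x' where x': "x' \<in> free_alg (pn CARD('n))" "x = abs_upn x'" by (rule upn_exhaust)
  have "abs_upn (fconst c) * x = x * abs_upn (fconst c)"
    unfolding x'(2) by (simp add: abs_upn_mult x'(1) fconst_central)
  then show "scale_upn c (x * y) = x * scale_upn c y" by (simp add: scale_upn_def mult.assoc[symmetric])
qed

lemma free_alg_induct [consumes 1, case_names zero word add]:
  assumes "x \<in> free_alg S" "P 0" "\<And>u c. set u \<subseteq> S \<Longrightarrow> P (fconst c * prod_list (map fgen u))"
    "\<And>x y. x \<in> free_alg S \<Longrightarrow> y \<in> free_alg S \<Longrightarrow> P x \<Longrightarrow> P y \<Longrightarrow> P (x + y)"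
  shows "P x"
proof -
  have "P (\<Sum>w\<in>K. Poly_Mapping.single w (Poly_Mapping.lookup x w)) \<and>
      (\<Sum>w\<in>K. Poly_Mapping.single w (Poly_Mapping.lookup x w)) \<in> free_alg S"
    if "finite K" "K \<subseteq> Poly_Mapping.keys x" for K
    using that
  proof (induction K rule: finite_induct)
    case (insert w K)
    have "set (letters w) \<subseteq> S" using insert.prems assms(1) by (auto simp: free_alg_def)
    have eq: "Poly_Mapping.single w c = fconst c * prod_list (map fgen (letters w))" for c :: 'b
      using single_fmon[of "letters w" c] by simp
    have "P (Poly_Mapping.single w (Poly_Mapping.lookup x w))" unfolding eq by (rule assms(3)) fact
    moreover have "Poly_Mapping.single w (Poly_Mapping.lookup x w) \<in> free_alg S"
      using \<open>set (letters w) \<subseteq> S\<close> by (simp add: free_alg_def)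
    ultimately show ?case using insert assms(4) by (simp add: free_alg_add)
  qed (simp_all add: assms)
  then show ?thesis using poly_mapping_sum_single[of x] by (metis finite_keys order_refl)
qed

lemma free_alg_prod_list: "set u \<subseteq> S \<Longrightarrow> prod_list (map fgen u) \<in> free_alg S"
  by (induction u) (simp_all add: free_alg_mult)

lemma abs_ralg_prod_list:
  "set u \<subseteq> rgens CARD('n) \<Longrightarrow>
    (abs_ralg (prod_list (map fgen u)) :: ('k::field_char_0, 'n::finite) ralg) = prod_list (map ralg_gen u)"
  by (induction u) (simp_all add: one_ralg_def ralg_gen_def free_alg_prod_list flip: abs_ralg_mult)

lemma abs_ralg_word:
  "set u \<subseteq> rgens CARD('n) \<Longrightarrow>
    (abs_ralg (fconst c * prod_list (map fgen u)) :: ('k::field_char_0, 'n::finite) ralg)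
      = scale_ralg c (prod_list (map ralg_gen u))"
  by (simp add: scale_ralg_def abs_ralg_prod_list free_alg_prod_list flip: abs_ralg_mult)

lemma abs_ralg_eq_ev:
  assumes "x \<in> free_alg (rgens CARD('n))"
  shows "(abs_ralg x :: ('k::field_char_0, 'n::finite) ralg) = ralg.ev ralg_gen x"
  using assms
proof (induction rule: free_alg_induct)
  case (word u c)
  show ?case
    by (simp add: abs_ralg_word[OF word] ralg.ev_mult ralg.ev_fconst ralg.ev_prod_list flip: ralg.scale_mult_left)
qed (simp_all add: ralg.ev_add flip: abs_ralg_add zero_ralg_def)

lemma abs_upn_prod_list:
  "set u \<subseteq> pn CARD('n) \<Longrightarrow>
    (abs_upn (prod_list (map fgen u)) :: ('k::field_char_0, 'n::finite) upn) = prod_list (map upn_iota u)"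
  by (induction u) (simp_all add: one_upn_def upn_iota_def free_alg_prod_list flip: abs_upn_mult)

lemma abs_upn_word:
  "set u \<subseteq> pn CARD('n) \<Longrightarrow>
    (abs_upn (fconst c * prod_list (map fgen u)) :: ('k::field_char_0, 'n::finite) upn)
      = scale_upn c (prod_list (map upn_iota u))"
  by (simp add: scale_upn_def abs_upn_prod_list free_alg_prod_list flip: abs_upn_mult)

text \<open>
  Relations are written with superbrackets whose sign depends on the degree of their arguments; homogeneity makes this sign explicit.
\<close>

definition homog :: "(rgen fmon \<Rightarrow>\<^sub>0 'k::ring_1) \<Rightarrow> bit \<Rightarrow> bool"
  where "homog x p \<longleftrightarrow> (\<forall>w\<in>Poly_Mapping.keys x. sum_list (map rpar (letters w)) = p)"

lemma homog_fgen: "homog (fgen g) (rpar g)" by (simp add: homog_def fgen_def)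

lemma homog_diff: "homog x p \<Longrightarrow> homog y p \<Longrightarrow> homog (x - y) p"
  unfolding homog_def using keys_diff[of x y] by blast

lemma homog_minus: "homog x p \<Longrightarrow> homog (- x) p" by (simp add: homog_def)

lemma homog_mult:
  assumes "homog x p" "homog y q" shows "homog (x * y) (p + q)"
  unfolding homog_def
proof
  fix w assume "w \<in> Poly_Mapping.keys (x * y)"
  then obtain u v where "u \<in> Poly_Mapping.keys x" "v \<in> Poly_Mapping.keys y" "w = u + v"
    using keys_mult[of x y] by blast
  with assms show "sum_list (map rpar (letters w)) = p + q" by (simp add: homog_def)
qed

lemma fdeg_homog:
  assumes "homog x p" "x \<noteq> 0" shows "fdeg x = p"
proof -
  obtain w where "w \<in> Poly_Mapping.keys x" using assms(2) by fastforce
  then show ?thesis using assms(1) by (cases "p = 1") (auto simp: homog_def fdeg_def)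
qed

lemma sbr_homog:
  assumes "homog x p" "homog y q"
  shows "sbr x y = x * y - koszul p q * (y * x)"
proof (cases "x = 0 \<or> y = 0")
  case False
  then have "fdeg x = p" "fdeg y = q" using assms by (auto intro: fdeg_homog)
  then show ?thesis by (simp add: sbr_def)
qed (auto simp: sbr_def)

lemma homog_sbr:
  assumes "homog x p" "homog y q" shows "homog (sbr x y) (p + q)"
proof -
  have yx: "homog (y * x) (p + q)" using homog_mult[OF assms(2,1)] by (simp only: add.commute[of p q])
  have "homog (koszul p q * (y * x)) (p + q)"
  proof (cases "p = 1 \<and> q = 1")
    case True
    then have "koszul p q * (y * x) = - (y * x)" by (simp add: koszul_def)
    then show ?thesis using homog_minus[OF yx] by (simp only:)
  next
    case False
    then have "koszul p q * (y * x) = y * x" by (auto simp: koszul_def)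
    then show ?thesis using yx by (simp only:)
  qed
  then show ?thesis unfolding sbr_homog[OF assms] by (rule homog_diff[OF homog_mult[OF assms]])
qed

text \<open>
  The superbracket of elements that are declared to have parities $p$ and $q$.
\<close>

definition scom :: "bit \<Rightarrow> bit \<Rightarrow> 'a::ring_1 \<Rightarrow> 'a \<Rightarrow> 'a"
  where "scom p q x y = x * y - koszul p q * (y * x)"

lemma scom_simps [simp]: "scom 0 q = com" "scom p 0 = com" "scom 1 1 = acom"
  by (simp_all add: fun_eq_iff scom_def koszul_def com_def acom_def)

context unital_algebra begin

lemma ev_sbr: "homog x p \<Longrightarrow> homog y q \<Longrightarrow> ev f (sbr x y) = scom p q (ev f x) (ev f y)"
  by (simp add: sbr_homog ev_diff ev_mult ev_koszul scom_def)

lemma ev_sbr_gen: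
  "ev f (sbr (fgen a) (fgen b)) = scom (rpar a) (rpar b) (f a) (f b)"
  "ev f (sbr (fgen a) (sbr (fgen b) (fgen c))) = scom (rpar a) (rpar b + rpar c) (f a) (scom (rpar b) (rpar c) (f b) (f c))"
  "ev f (sbr (sbr (fgen a) (fgen b)) (fgen c)) = scom (rpar a + rpar b) (rpar c) (scom (rpar a) (rpar b) (f a) (f b)) (f c)"
  using ev_sbr[OF homog_fgen homog_fgen] ev_sbr[OF homog_fgen homog_sbr[OF homog_fgen homog_fgen]]
    ev_sbr[OF homog_sbr[OF homog_fgen homog_fgen] homog_fgen] by simp_all

end


section \<open>Matrices in $\mathfrak p(n)$\<close>

lemma finite_idx [simp]: "finite (idx n)" by (simp add: idx_def)

lemma uminus_idx [simp]: "- r \<in> idx n \<longleftrightarrow> r \<in> idx n" by (auto simp: idx_def)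

lemma int_idx [simp]: "int i \<in> idx n \<longleftrightarrow> i \<in> {1..n}" by (auto simp: idx_def)

lemma zero_idx [simp]: "0 \<notin> idx n" by (auto simp: idx_def)

text \<open>
  The defining block conditions of $\mathfrak p(n)$ amount to one symmetry under $(r,s)\mapsto(-s,-r)$, with this sign.
\<close>

definition pn_sign :: "int \<Rightarrow> int \<Rightarrow> 'k::ring_1"
  where "pn_sign r s = (if r > 0 \<and> s < 0 then 1 else - 1)"

lemma pn_iff: "X \<in> pn n \<longleftrightarrow> (\<forall>r s. r \<notin> idx n \<or> s \<notin> idx n \<longrightarrow> X r s = 0) \<and>
    (\<forall>r\<in>idx n. \<forall>s\<in>idx n. X (- s) (- r) = pn_sign r s * X r s)" (is "_ \<longleftrightarrow> ?R")
proof
  assume X: "X \<in> pn n"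
  have "X (- s) (- r) = pn_sign r s * X r s" if "r \<in> idx n" "s \<in> idx n" for r s
  proof -
    have i: "r \<in> {1..int n} \<or> - r \<in> {1..int n}" "s \<in> {1..int n} \<or> - s \<in> {1..int n}"
      using that by (auto simp: idx_def)
    have P: "X (- i) (- j) = - X j i" "X i (- j) = X j (- i)" "X (- i) j = - X (- j) i"
      if "i \<in> {1..int n}" "j \<in> {1..int n}" for i j using X that unfolding pn_def by blast+
    from i show ?thesis
      by (elim disjE) (use P[of s r] P[of "- s" r] P[of s "- r"] P[of "- s" "- r"] P[of "-r" "-s"] in \<open>auto simp: pn_sign_def\<close>)
  qed
  then show ?R using X by (auto simp: pn_def)
next
  assume R: ?R
  have "X (- i) (- j) = - X j i \<and> X i (- j) = X j (- i) \<and> X (- i) j = - X (- j) i"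
    if "i \<in> {1..int n}" "j \<in> {1..int n}" for i j
  proof -
    have m: "i \<in> idx n" "j \<in> idx n" "- i \<in> idx n" "- j \<in> idx n" using that by (auto simp: idx_def)
    have R': "X (- s) (- r) = pn_sign r s * X r s" if "r \<in> idx n" "s \<in> idx n" for r s using R that by blast
    show ?thesis using R'[of j i] R'[of j "- i"] R'[of "- j" i] m that by (simp add: pn_sign_def)
  qed
  then show "X \<in> pn n" using R unfolding pn_def by blast
qed

lemma pnD:
  assumes "X \<in> pn n"
  shows "r \<notin> idx n \<Longrightarrow> X r s = 0" "s \<notin> idx n \<Longrightarrow> X r s = 0"
    "r \<in> idx n \<Longrightarrow> s \<in> idx n \<Longrightarrow> X (- s) (- r) = pn_sign r s * X r s"
  using assms unfolding pn_iff by blast+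

lemma pn_partD:
  "X \<in> pn_part n p \<Longrightarrow> X \<in> pn n"
  "X \<in> pn_part n p \<Longrightarrow> X r s \<noteq> 0 \<Longrightarrow> (if (r > 0) = (s > 0) then 0 else 1) = p"
  unfolding pn_part_def by blast+

lemma pn_closed:
  "X \<in> pn n \<Longrightarrow> Y \<in> pn n \<Longrightarrow> mat_add X Y \<in> pn n"
  "X \<in> pn n \<Longrightarrow> mat_scale (c :: 'k::comm_ring_1) X \<in> pn n"
  unfolding pn_iff mat_add_def mat_scale_def by (simp_all add: algebra_simps)

lemma sum_idx_uminus: "(\<Sum>t\<in>idx n. f (- t)) = (\<Sum>t\<in>idx n. f t)"
  by (rule sum.reindex_bij_witness[of _ uminus uminus]) auto

text \<open>
  The symmetry is preserved by brackets because it is, up to sign, an antiautomorphism, and the signs of the three pairs of indices multiply correctly.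
\<close>

lemma pn_mat_bracket:
  fixes X Y :: "'k::comm_ring_1 smat"
  assumes X: "X \<in> pn_part n p" and Y: "Y \<in> pn_part n q"
  shows "mat_bracket n p q X Y \<in> pn n"
proof -
  note X' = pnD[OF pn_partD(1)[OF X]] and Y' = pnD[OF pn_partD(1)[OF Y]]
  let ?Z = "mat_bracket n p q X Y"
  have Z: "?Z r s = (\<Sum>t\<in>idx n. X r t * Y t s - koszul p q * (Y r t * X t s))" for r s
    by (simp add: mat_bracket_def mat_add_def mat_scale_def mat_mult_def sum_subtractf sum_distrib_left sum_negf)
  have "?Z (- s) (- r) = pn_sign r s * ?Z r s" if rs: "r \<in> idx n" "s \<in> idx n" for r s
  proof -
    have "?Z (- s) (- r) = (\<Sum>t\<in>idx n. X (- s) (- t) * Y (- t) (- r) - koszul p q * (Y (- s) (- t) * X (- t) (- r)))"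
      unfolding Z by (rule sum_idx_uminus[symmetric])
    also have "\<dots> = (\<Sum>t\<in>idx n. pn_sign r s * (X r t * Y t s - koszul p q * (Y r t * X t s)))"
    proof (rule sum.cong[OF refl])
      fix t assume t: "t \<in> idx n"
      have kk: "koszul p q * koszul p q = (1 :: 'k)" by (simp add: koszul_def)
      have nz: "r \<noteq> 0" "s \<noteq> 0" "t \<noteq> 0" using rs t by (metis zero_idx)+
      have "(pn_sign t s * pn_sign r t) * (Y r t * X t s) = - (koszul p q * pn_sign r s) * (Y r t * X t s)"
      proof (cases "Y r t = 0 \<or> X t s = 0")
        case False
        then show ?thesis
          using pn_partD(2)[OF Y, of r t] pn_partD(2)[OF X, of t s] nz
          by (auto simp: pn_sign_def koszul_def split: if_splits)
      qed auto
      moreover have "(pn_sign t s * pn_sign r t) * (X r t * Y t s) = - (koszul p q * pn_sign r s) * (X r t * Y t s)"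
      proof (cases "X r t = 0 \<or> Y t s = 0")
        case False
        then show ?thesis
          using pn_partD(2)[OF X, of r t] pn_partD(2)[OF Y, of t s] nz
          by (auto simp: pn_sign_def koszul_def split: if_splits)
      qed auto
      moreover have "X (- s) (- t) * Y (- t) (- r) - koszul p q * (Y (- s) (- t) * X (- t) (- r))
          = (pn_sign t s * pn_sign r t) * (Y r t * X t s) - koszul p q * ((pn_sign t s * pn_sign r t) * (X r t * Y t s))"
        unfolding X'(3)[OF t rs(2)] X'(3)[OF rs(1) t] Y'(3)[OF t rs(2)] Y'(3)[OF rs(1) t]
        by (simp add: algebra_simps)
      ultimately have eq: "X (- s) (- t) * Y (- t) (- r) - koszul p q * (Y (- s) (- t) * X (- t) (- r))
          = (koszul p q * koszul p q) * (pn_sign r s * (X r t * Y t s)) - koszul p q * (pn_sign r s * (Y r t * X t s))"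
        by (simp only:) (simp add: algebra_simps)
      show "X (- s) (- t) * Y (- t) (- r) - koszul p q * (Y (- s) (- t) * X (- t) (- r))
          = pn_sign r s * (X r t * Y t s - koszul p q * (Y r t * X t s))"
        unfolding eq kk by (simp add: algebra_simps)
    qed
    also have "\<dots> = pn_sign r s * ?Z r s" unfolding Z by (simp add: sum_distrib_left)
    finally show ?thesis .
  qed
  moreover have "?Z r s = 0" if "r \<notin> idx n \<or> s \<notin> idx n" for r s
    unfolding Z using that X' Y' by (auto intro!: sum.neutral)
  ultimately show ?thesis unfolding pn_iff by blast
qed

lemma abs_upn_rel:
  assumes "q \<in> upn_rels CARD('n)" "q \<in> free_alg (pn CARD('n))"
  shows "(abs_upn q :: ('k::field_char_0, 'n::finite) upn) = 0"
  unfolding zero_upn_def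
  using assms pres_ideal.add[OF pres_ideal.zero assms(1) free_alg_1 free_alg_1]
  by (subst abs_upn_eq_iff) (simp_all add: pres_rel_def)

lemma upn_iota_add:
  fixes X Y :: "'k::field_char_0 smat"
  assumes X: "X \<in> pn CARD('n::finite)" and Y: "Y \<in> pn CARD('n)"
  shows "(upn_iota (mat_add X Y) :: ('k, 'n) upn) = upn_iota X + upn_iota Y"
  using abs_upn_rel[OF upn_rels.add[OF X Y]] X Y pn_closed(1)[OF X Y]
  by (simp add: upn_iota_def abs_upn_add abs_upn_diff free_alg_add free_alg_diff flip: abs_upn_diff abs_upn_add)

lemma upn_iota_scale:
  fixes X :: "'k::field_char_0 smat"
  assumes X: "X \<in> pn CARD('n::finite)"
  shows "(upn_iota (mat_scale c X) :: ('k, 'n) upn) = scale_upn c (upn_iota X)"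
  using abs_upn_rel[OF upn_rels.scale[OF X, of c]] X pn_closed(2)[OF X, of c]
  by (simp add: upn_iota_def scale_upn_def free_alg_mult free_alg_diff flip: abs_upn_diff abs_upn_mult)

lemma upn_iota_bracket:
  fixes X Y :: "'k::field_char_0 smat"
  assumes X: "X \<in> pn_part CARD('n::finite) p" and Y: "Y \<in> pn_part CARD('n) q"
  shows "scom p q (upn_iota X) (upn_iota Y) = (upn_iota (mat_bracket CARD('n) p q X Y) :: ('k, 'n) upn)"
proof -
  have koszul: "koszul p q = (fconst (koszul p q) :: 'k smat fmon \<Rightarrow>\<^sub>0 'k)"
    by (auto simp: koszul_def fconst_def single_one single_uminus)
  have "(abs_upn (fconst (koszul p q)) :: ('k, 'n) upn) = koszul p q"
    by (auto simp: koszul_def fconst_1 one_upn_def fconst_def single_uminus single_one abs_upn_uminus[OF free_alg_1 free_alg_1, symmetric])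
  then show ?thesis
    using abs_upn_rel[OF upn_rels.bracket[OF X Y]] pn_partD(1)[OF X] pn_partD(1)[OF Y] pn_mat_bracket[OF X Y]
    unfolding koszul
    by (simp add: upn_iota_def scom_def free_alg_mult free_alg_diff flip: abs_upn_diff abs_upn_mult)
qed

text \<open>
  The integral multiple of \<^const>\<open>pb\<close> without the factor $1/2$ on the diagonal.
\<close>

definition ps :: "nat \<Rightarrow> nat \<Rightarrow> 'k::field smat"
  where "ps i j = mat_add (mat_unit (int i) (- int j)) (mat_unit (int j) (- int i))"

lemma pb_eq: "pb i j = mat_scale (if i = j then 1 / 2 else 1) (ps i j)"
  by (simp add: pb_def ps_def)

lemma pn_basis_apply:
  "pa i j r s = (if r = int i \<and> s = int j then 1 else 0) - (if r = - int j \<and> s = - int i then 1 else 0)"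
  "ps i j r s = (if r = int i \<and> s = - int j then 1 else 0) + (if r = int j \<and> s = - int i then 1 else 0)"
  "pc i j r s = (if r = - int i \<and> s = int j then 1 else 0) - (if r = - int j \<and> s = int i then 1 else 0)"
  by (simp_all add: pa_def ps_def pc_def mat_add_def mat_scale_def mat_unit_def)

lemma pn_partI:
  fixes X :: "'k::field smat"
  assumes *: "\<And>r s. X r s \<noteq> 0 \<Longrightarrow> r \<in> idx n \<and> s \<in> idx n \<and>
    (if (r > 0) = (s > 0) then 0 else 1) = p \<and> X (- s) (- r) = pn_sign r s * X r s"
  shows "X \<in> pn_part n p"
proof -
  have "X (- s) (- r) = pn_sign r s * X r s" for r s
  proof (cases "X r s = 0")
    case True
    then show ?thesis using *[of "- s" "- r"] by (cases "X (- s) (- r) = 0") (auto simp: pn_sign_def split: if_splits)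
  qed (use * in blast)
  then show ?thesis using * unfolding pn_part_def pn_iff by blast
qed

lemma indicator_nonzero:
  "(if P then 1 else 0) + (if Q then 1 else (0::'k::field_char_0)) \<noteq> 0 \<Longrightarrow> P \<or> Q"
  "(if P then 1 else 0) - (if Q then 1 else (0::'k::field_char_0)) \<noteq> 0 \<Longrightarrow> P \<or> Q"
  by (cases P; cases Q; simp)+

lemma pn_basis:
  assumes "i \<in> {1..n}" "j \<in> {1..n}"
  shows "(pa i j :: 'k::field_char_0 smat) \<in> pn_part n 0" "(ps i j :: 'k smat) \<in> pn_part n 1" "(pc i j :: 'k smat) \<in> pn_part n 1"
proof -
  have ij: "int i > 0" "int j > 0" using assms by auto
  have mem: "int i \<in> idx n" "int j \<in> idx n" "- int i \<in> idx n" "- int j \<in> idx n" using assms by auto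
  show "(pa i j :: 'k smat) \<in> pn_part n 0"
  proof (rule pn_partI)
    fix r s assume "(pa i j :: 'k smat) r s \<noteq> 0"
    then have "r = int i \<and> s = int j \<or> r = - int j \<and> s = - int i" unfolding pn_basis_apply by (rule indicator_nonzero)
    then show "r \<in> idx n \<and> s \<in> idx n \<and> (if (r > 0) = (s > 0) then 0 else 1) = (0::bit) \<and>
      (pa i j :: 'k smat) (- s) (- r) = pn_sign r s * pa i j r s"
      using mem ij by (cases "i = j") (auto simp add: pn_basis_apply pn_sign_def simp del: int_idx)
  qed
  show "(ps i j :: 'k smat) \<in> pn_part n 1"
  proof (rule pn_partI)
    fix r s assume "(ps i j :: 'k smat) r s \<noteq> 0"
    then have "r = int i \<and> s = - int j \<or> r = int j \<and> s = - int i" unfolding pn_basis_apply by (rule indicator_nonzero)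
    then show "r \<in> idx n \<and> s \<in> idx n \<and> (if (r > 0) = (s > 0) then 0 else 1) = (1::bit) \<and>
      (ps i j :: 'k smat) (- s) (- r) = pn_sign r s * ps i j r s"
      using mem ij by (cases "i = j") (auto simp add: pn_basis_apply pn_sign_def simp del: int_idx)
  qed
  show "(pc i j :: 'k smat) \<in> pn_part n 1"
  proof (rule pn_partI)
    fix r s assume "(pc i j :: 'k smat) r s \<noteq> 0"
    then have "r = - int i \<and> s = int j \<or> r = - int j \<and> s = int i" unfolding pn_basis_apply by (rule indicator_nonzero)
    then show "r \<in> idx n \<and> s \<in> idx n \<and> (if (r > 0) = (s > 0) then 0 else 1) = (1::bit) \<and>
      (pc i j :: 'k smat) (- s) (- r) = pn_sign r s * pc i j r s"
      using mem ij by (cases "i = j") (auto simp add: pn_basis_apply pn_sign_def simp del: int_idx)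
  qed
qed

lemma mat_fun_simps:
  "mat_add X Y = X + Y" "mat_scale (- 1) X = - X" "mat_scale 0 X = 0" "mat_scale 1 X = X"
  "mat_scale (if P then 1 else 0) X = (if P then X else 0)"
  "mat_scale (if P then - 1 else 0) X = (if P then - X else 0)"
  by (auto simp: fun_eq_iff mat_add_def mat_scale_def)

lemma mat_mult_linear:
  "mat_mult n (X + Y) Z = mat_mult n X Z + mat_mult n Y Z"
  "mat_mult n X (Y + Z) = mat_mult n X Y + mat_mult n X Z"
  "mat_mult n (X - Y) Z = mat_mult n X Z - mat_mult n Y Z"
  "mat_mult n X (Y - Z) = mat_mult n X Y - mat_mult n X Z"
  by (simp_all add: fun_eq_iff mat_mult_def algebra_simps sum.distrib sum_subtractf)

lemma mat_mult_unit:
  assumes "b \<in> idx n"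
  shows "mat_mult n (mat_unit a b) (mat_unit c d) = (if b = c then mat_unit a d else 0)"
proof (intro ext)
  fix r s
  have "(\<Sum>t\<in>idx n. mat_unit a b r t * mat_unit c d t s)
      = (\<Sum>t\<in>idx n. if t = b then (if r = a \<and> b = c \<and> s = d then 1 else 0) else 0)"
    by (intro sum.cong) (auto simp: mat_unit_def)
  also have "\<dots> = (if r = a \<and> b = c \<and> s = d then 1 else 0)" using assms by (simp add: sum.delta)
  finally show "mat_mult n (mat_unit a b) (mat_unit c d) r s = (if b = c then mat_unit a d else 0) r s"
    by (auto simp: mat_mult_def mat_unit_def)
qed

lemma pn_basis_unit:
  "pa i j = mat_unit (int i) (int j) - mat_unit (- int j) (- int i)"
  "ps i j = mat_unit (int i) (- int j) + mat_unit (int j) (- int i)"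
  "pc i j = mat_unit (- int i) (int j) - mat_unit (- int j) (int i)"
  by (simp_all add: pa_def ps_def pc_def mat_fun_simps)

lemma mat_bracket_basis:
  assumes "i \<in> {1..n}" "j \<in> {1..n}" "k \<in> {1..n}" "l \<in> {1..n}"
  shows mat_bracket_aa: "mat_bracket n 0 0 (pa i j) (pa k l) =
      (if j = k then pa i l else 0) - (if i = l then pa k j else 0)"
    and mat_bracket_as: "mat_bracket n 0 1 (pa k l) (ps i j) =
      (if l = i then ps k j else 0) + (if l = j then ps i k else 0)"
    and mat_bracket_ac: "mat_bracket n 0 1 (pa k l) (pc i j) =
      - (if k = i then pc l j else 0) - (if k = j then pc i l else 0)"
    and mat_bracket_ss: "mat_bracket n 1 1 (ps i j) (ps k l) = 0"
    and mat_bracket_cc: "mat_bracket n 1 1 (pc i j) (pc k l) = 0"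
    and mat_bracket_sc: "mat_bracket n 1 1 (ps i j) (pc k l) =
      (if j = k then pa i l else 0) - (if j = l then pa i k else 0)
      + (if i = k then pa j l else 0) - (if i = l then pa j k else 0)"
proof -
  have ne: "int x \<noteq> - int y" "- int x \<noteq> int y" if "x \<in> {1..n}" for x y using that by auto
  note ne = ne[OF assms(1)] ne[OF assms(2)] ne[OF assms(3)] ne[OF assms(4)]
  note defs = mat_bracket_def mat_fun_simps koszul_def pn_basis_unit mat_mult_linear mat_mult_unit ne
  have mem: "int i \<in> idx n" "int j \<in> idx n" "int k \<in> idx n" "int l \<in> idx n"
    and nz: "i \<noteq> 0" "j \<noteq> 0" "k \<noteq> 0" "l \<noteq> 0" using assms by auto
  show "mat_bracket n 0 0 (pa i j) (pa k l) = (if j = k then pa i l else 0) - (if i = l then pa k j else 0)"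
    using mem nz by (simp add: defs del: int_idx)
  show "mat_bracket n 0 1 (pa k l) (ps i j) = (if l = i then ps k j else 0) + (if l = j then ps i k else 0)"
    using mem nz by (simp add: defs del: int_idx)
  show "mat_bracket n 0 1 (pa k l) (pc i j) = - (if k = i then pc l j else 0) - (if k = j then pc i l else 0)"
    using mem nz by (simp add: defs del: int_idx)
  show "mat_bracket n 1 1 (ps i j) (ps k l) = 0" using mem nz by (simp add: defs del: int_idx)
  show "mat_bracket n 1 1 (pc i j) (pc k l) = 0" using mem nz by (simp add: defs del: int_idx)
  show "mat_bracket n 1 1 (ps i j) (pc k l) = (if j = k then pa i l else 0) - (if j = l then pa i k else 0)
      + (if i = k then pa j l else 0) - (if i = l then pa j k else 0)"
    using mem nz by (simp add: defs del: int_idx)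
qed


section \<open>The relations hold in the enveloping algebra\<close>

lemma pn_add: "(X :: 'k::comm_ring_1 smat) \<in> pn n \<Longrightarrow> Y \<in> pn n \<Longrightarrow> X + Y \<in> pn n"
  using pn_closed(1)[of X n Y] by (simp add: mat_fun_simps)

lemma pn_uminus: "(X :: 'k::comm_ring_1 smat) \<in> pn n \<Longrightarrow> - X \<in> pn n"
  using pn_closed(2)[of X n "- 1"] by (simp add: mat_fun_simps)

lemma pn_diff: "(X :: 'k::comm_ring_1 smat) \<in> pn n \<Longrightarrow> Y \<in> pn n \<Longrightarrow> X - Y \<in> pn n"
  using pn_add[of X n "- Y"] pn_uminus[of Y n] by simp

lemma pn_zero: "0 \<in> pn n" by (simp add: pn_def)

lemma pn_if: "(P \<Longrightarrow> X \<in> pn n) \<Longrightarrow> (if P then X else 0) \<in> pn n"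
  by (simp add: pn_zero)

lemmas pn_intros = pn_add pn_diff pn_uminus pn_if

lemma upn_iota_plus:
  fixes X Y :: "'k::field_char_0 smat"
  assumes "X \<in> pn CARD('n::finite)" "Y \<in> pn CARD('n)"
  shows "(upn_iota (X + Y) :: ('k, 'n) upn) = upn_iota X + upn_iota Y"
  using upn_iota_add[OF assms] by (simp add: mat_fun_simps)

lemma upn_iota_zero: "(upn_iota 0 :: ('k::field_char_0, 'n::finite) upn) = 0"
  using upn_iota_scale[OF pn_zero, of 0] by (simp add: mat_fun_simps)

lemma upn_iota_uminus:
  fixes X :: "'k::field_char_0 smat"
  assumes "X \<in> pn CARD('n::finite)"
  shows "(upn_iota (- X) :: ('k, 'n) upn) = - upn_iota X"
  using upn_iota_scale[OF assms, of "- 1"] by (simp add: mat_fun_simps)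

lemma upn_iota_diff:
  fixes X Y :: "'k::field_char_0 smat"
  assumes "X \<in> pn CARD('n::finite)" "Y \<in> pn CARD('n)"
  shows "(upn_iota (X - Y) :: ('k, 'n) upn) = upn_iota X - upn_iota Y"
  using upn_iota_plus[OF assms(1) pn_uminus[OF assms(2)]] by (simp add: upn_iota_uminus[OF assms(2)])

lemma upn_iota_if: "(upn_iota (if P then X else 0) :: ('k::field_char_0, 'n::finite) upn) = (if P then upn_iota X else 0)"
  by (simp add: upn_iota_zero)

lemmas upn_iota_linear = upn_iota_plus upn_iota_diff upn_iota_uminus upn_iota_if upn_iota_zero

abbreviation uA :: "nat \<Rightarrow> nat \<Rightarrow> ('k::field_char_0, 'n::finite) upn" where "uA i j \<equiv> upn_iota (pa i j)"
abbreviation uS :: "nat \<Rightarrow> nat \<Rightarrow> ('k::field_char_0, 'n::finite) upn" where "uS i j \<equiv> upn_iota (ps i j)"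
abbreviation uT :: "nat \<Rightarrow> nat \<Rightarrow> ('k::field_char_0, 'n::finite) upn" where "uT i j \<equiv> upn_iota (pc i j)"

lemma upn_pn_family:
  "pn_family CARD('n) uA uS (uT :: nat \<Rightarrow> nat \<Rightarrow> ('k::field_char_0, 'n::finite) upn)"
proof -
  let ?n = "CARD('n)"
  note m = pn_partD(1)[OF pn_basis(1)] pn_partD(1)[OF pn_basis(2)] pn_partD(1)[OF pn_basis(3)]
  note br = upn_iota_bracket[OF pn_basis(1) pn_basis(1)] upn_iota_bracket[OF pn_basis(1) pn_basis(2)]
    upn_iota_bracket[OF pn_basis(1) pn_basis(3)] upn_iota_bracket[OF pn_basis(2) pn_basis(2)]
    upn_iota_bracket[OF pn_basis(3) pn_basis(3)] upn_iota_bracket[OF pn_basis(2) pn_basis(3)]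
  note br = br[unfolded scom_simps]
  have gl: "gl_family ?n (uA :: nat \<Rightarrow> nat \<Rightarrow> ('k, 'n) upn)"
    unfolding gl_family_def by (simp add: br mat_bracket_aa upn_iota_linear pn_intros m)
  have sym: "ps i j = (ps j i :: 'k smat)" for i j by (simp add: ps_def mat_fun_simps add.commute)
  have s2: "sym2_family ?n uA (uS :: nat \<Rightarrow> nat \<Rightarrow> ('k, 'n) upn)"
    unfolding sym2_family_def
  proof (intro conjI ballI)
    show "(uS i j :: ('k, 'n) upn) = uS j i" for i j using sym[of i j] by simp
  qed (simp add: br mat_bracket_as upn_iota_linear pn_intros m)
  have anti: "pc i j = - (pc j i :: 'k smat)" and diag: "pc i i = (0 :: 'k smat)" for i j
    by (simp_all add: pc_def mat_fun_simps)
  have a2: "alt2_family ?n (\<lambda>i j. - uA j i) (uT :: nat \<Rightarrow> nat \<Rightarrow> ('k, 'n) upn)"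
    unfolding alt2_family_def
  proof (intro conjI ballI)
    show "(uT i i :: ('k, 'n) upn) = 0" for i by (simp add: diag upn_iota_zero)
    show "(uT i j :: ('k, 'n) upn) = - uT j i" if "i \<in> {1..?n}" "j \<in> {1..?n}" for i j
      using upn_iota_uminus[OF m(3)[OF that(2,1)]] anti[of i j] by simp
  qed (simp add: com_minus br mat_bracket_ac upn_iota_linear pn_intros m)
  have odd: "acom (uS i j) (uS k l) = (0 :: ('k, 'n) upn)" "acom (uT i j) (uT k l) = (0 :: ('k, 'n) upn)"
    "acom (uS i j) (uT k l) = (odd_bracket uA i j k l :: ('k, 'n) upn)"
    if "i \<in> {1..?n}" "j \<in> {1..?n}" "k \<in> {1..?n}" "l \<in> {1..?n}" for i j k l
    using that
    by (simp_all add: br mat_bracket_ss mat_bracket_cc mat_bracket_sc upn_iota_linear pn_intros m odd_bracket_def)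
  show ?thesis unfolding pn_family_def by (intro conjI ballI gl s2 a2 odd)
qed

lemma torsion_free_cancel2:
  "torsion_free TYPE('a::ring_1) \<Longrightarrow> x + x = y + y \<Longrightarrow> x = (y::'a)"
  using torsion_freeD2[of "x - y"] by (simp add: algebra_simps)

lemma unital_algebra_torsion_free:
  assumes "unital_algebra (sc :: 'k::field_char_0 \<Rightarrow> 'b::ring_1 \<Rightarrow> 'b)"
  shows "torsion_free TYPE('b)"
proof -
  interpret unital_algebra sc by fact
  have of_nat: "of_nat m * x = sc (of_nat m) x" for m and x :: 'b
    by (induction m) (simp_all add: distrib_right scale_left_distrib)
  show ?thesis unfolding torsion_free_def of_nat by simp
qed

fun pn_gens ::
    "(nat \<Rightarrow> nat \<Rightarrow> 'b) \<Rightarrow> (nat \<Rightarrow> nat \<Rightarrow> 'b) \<Rightarrow> (nat \<Rightarrow> nat \<Rightarrow> 'b) \<Rightarrow> 'b \<Rightarrow> rgen \<Rightarrow> 'b" where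
  "pn_gens A S T b (GE i) = A i (i + 1)"
| "pn_gens A S T b (GF i) = A (i + 1) i"
| "pn_gens A S T b (GH i) = A i i"
| "pn_gens A S T b GB11 = b"
| "pn_gens A S T b (GB i) = S i (i + 1)"
| "pn_gens A S T b (GC i) = T i (i + 1)"

lemma ip_eps: "i \<in> {1..n} \<Longrightarrow> ip n (eps i) v = v i"
  by (simp add: ip_def eps_def if_distrib[of "\<lambda>x. x * _"] sum.delta cong: if_cong)

lemma ip_weights:
  assumes "i \<in> {1..n}"
  shows "ip n (eps i) (alpha j) = (if i = j then 1 else 0) - (if i = j + 1 then 1 else 0)"
    "ip n (eps i) (beta j) = (if i = j then 1 else 0) + (if i = j + 1 then 1 else 0)"
    "ip n (eps i) (gamma j) = - (if i = j then 1 else 0) - (if i = j + 1 then 1 else 0)"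
    "ip n (eps i) beta11 = (if i = 1 then 2 else 0)"
  unfolding ip_eps[OF assms] by (simp_all add: alpha_def beta_def gamma_def beta11_def eps_def)

text \<open>
  Every relation of $R$ is an identity between the structure constants of $\mathfrak p(n)$; the relations involving $B_{1,1}$ hold after doubling.
\<close>

lemma pn_family_satisfies_rels:
  assumes alg: "unital_algebra (sc :: 'k::field_char_0 \<Rightarrow> 'b::ring_1 \<Rightarrow> 'b)"
    and fam: "pn_family n A S T" and n: "n \<ge> 1" and b: "b + b = S 1 1" and q: "q \<in> ralg_rels n"
  shows "unital_algebra.ev sc (pn_gens A S T b) q = 0"
proof -
  interpret unital_algebra sc by fact
  note D = pn_familyD[OF fam]
  note tf = unital_algebra_torsion_free[OF alg]
  have Sb: "S (Suc 0) (Suc 0) = b + b" using b by simp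
  have Hb: "com (A i i) b = (if i = 1 then b + b else 0)" if "i \<in> {1..n}" for i
  proof -
    have "com (A i i) (b + b) = (if i = 1 then b + b else 0) + (if i = 1 then b + b else 0)"
      using D(5)[of i i 1 1] that n by (simp add: Sb)
    then have "com (A i i) b + com (A i i) b = (if i = 1 then b + b else 0) + (if i = 1 then b + b else 0)"
      by (simp only: com_add)
    then show ?thesis by (rule torsion_free_cancel2[OF tf])
  qed
  have "acom (b + b) (b + b) = 0" using D(7)[of 1 1 1 1] n by (simp add: Sb)
  then have "((b * b + b * b) + (b * b + b * b)) + ((b * b + b * b) + (b * b + b * b)) = 0"
    by (simp add: acom_def algebra_simps)
  from torsion_freeD2[OF tf torsion_freeD2[OF tf torsion_freeD2[OF tf this]]] have bb: "b * b = 0" .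
  note [simp] = ev_sbr_gen ev_diff ev_add ev_mult ev_of_int ev_minus ip_weights
  show ?thesis
    using q
  proof cases
    case (HH i j) then show ?thesis using D(1)[of i i j j] by simp
  next
    case (HE i j) then show ?thesis using D(1)[of i i j "j + 1"] by auto
  next
    case (HF i j) then show ?thesis using D(1)[of i i "j + 1" j] by auto
  next
    case (EF i j) then show ?thesis using D(1)[of i "i + 1" "j + 1" j] by auto
  next
    case (EE i j) then show ?thesis using D(1)[of i "i + 1" j "j + 1"] by auto
  next
    case (FF i j) then show ?thesis using D(1)[of "i + 1" i "j + 1" j] by auto
  next
    case (EEE i j)
    then show ?thesis
      using D(1)[of i "i + 1" j "j + 1"] D(1)[of i "i + 1" i "j + 1"] D(1)[of i "i + 1" j "i + 1"]
      by (auto simp: com_linear)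
  next
    case (FFF i j)
    then show ?thesis
      using D(1)[of "i + 1" i "j + 1" j] D(1)[of "i + 1" i "i + 1" j] D(1)[of "i + 1" i "j + 1" i]
      by (auto simp: com_linear)
  next
    case (BB i j) then show ?thesis using D(7)[of i "i + 1" j "j + 1"] by simp
  next
    case (CC i j) then show ?thesis using D(8)[of i "i + 1" j "j + 1"] by simp
  next
    case (HB i j) then show ?thesis using D(5)[of i i j "j + 1"] by auto
  next
    case (HC i j) then show ?thesis using D(6)[of i i j "j + 1"] by auto
  next
    case (BC_eq i) then show ?thesis using D(9)[of i "i + 1" i "i + 1"] by (simp add: odd_bracket_def)
  next
    case (BC_pred i j)
    then show ?thesis using D(9)[of i "i + 1" j "j + 1"] D(1)[of i "i - 1" "i + 1" i] by (simp add: odd_bracket_def)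
  next
    case (BC_succ i j)
    then show ?thesis using D(9)[of i "i + 1" j "j + 1"] D(1)[of i "i + 1" "i + 1" "i + 2"] by (simp add: odd_bracket_def)
  next
    case (BC_other i j) then show ?thesis using D(9)[of i "i + 1" j "j + 1"] by (simp add: odd_bracket_def)
  next
    case (BF i j) then show ?thesis using com_antiD[OF D(5)[of "j + 1" j i "i + 1"]] by auto
  next
    case (BE i j) then show ?thesis using com_antiD[OF D(5)[of j "j + 1" i "i + 1"]] by auto
  next
    case (BF_BE i)
    then show ?thesis
      using com_antiD[OF D(5)[of "i + 1" i i "i + 1"]] com_antiD[OF D(5)[of "i + 1" "i + 2" "i + 1" "i + 2"]] by auto
  next
    case (BF_BE' i)
    then show ?thesis
      using com_antiD[OF D(5)[of "i + 2" "i + 1" i "i + 1"]] com_antiD[OF D(5)[of i "i + 1" "i + 1" "i + 2"]] by auto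
  next
    case (FC i j) then show ?thesis using D(6)[of "j + 1" j i "i + 1"] D(3)[of j] by auto
  next
    case (EC i j) then show ?thesis using D(6)[of j "j + 1" i "i + 1"] D(3)[of "j + 1"] by auto
  next
    case (FC_EC i)
    then show ?thesis using D(6)[of "i + 1" i "i + 1" "i + 2"] D(6)[of "i + 1" "i + 2" i "i + 1"] by auto
  next
    case (BFF i j)
    then show ?thesis
      using com_antiD[OF D(5)[of "i + 1" i i "i + 1"]] com_antiD[OF D(5)[of "j + 1" j "i + 1" "i + 1"]]
        D(2)[of "i + 2" "i + 1"]
      by (auto simp: com_linear ev_numeral mult_2)
  next
    case BFE
    then show ?thesis
      using com_antiD[OF D(5)[of 2 1 1 2]] com_antiD[OF D(5)[of 1 2 2 2]] D(2)[of 1 2]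
      by (auto simp: com_linear ev_numeral mult_2 numeral_2_eq_2)
  next
    case (BEE j)
    then show ?thesis
      using com_antiD[OF D(5)[of 1 2 1 2]] com_antiD[OF D(5)[of j "j + 1" 1 1]]
      by (auto simp: com_linear numeral_2_eq_2)
  next
    case (CFF i j)
    then show ?thesis
      using com_antiD[OF D(6)[of "i + 1" i "i + 1" "i + 2"]] com_antiD[OF D(6)[of "i + 2" "i + 1" i "i + 2"]]
      by (auto simp: com_linear)
  next
    case (CFF_0 i j)
    then show ?thesis
      using com_antiD[OF D(6)[of "i + 1" i "i + 1" "i + 2"]] com_antiD[OF D(6)[of "j + 1" j i "i + 2"]] D(3)[of i]
      by (auto simp: com_linear)
  next
    case B11
    then show ?thesis using D(5)[of 1 2 1 2] by (simp add: ev_numeral mult_2 numeral_2_eq_2 Sb)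
  next
    case (HB11 i) then show ?thesis using Hb[of i] by (auto simp: mult_2)
  next
    case B11_sq then show ?thesis using bb by (simp add: power2_eq_square)
  qed
qed

definition rho_gen :: "rgen \<Rightarrow> ('k::field_char_0, 'n::finite) upn"
  where "rho_gen = pn_gens uA uS uT (upn_iota (pb 1 1))"

lemma upn_pb_double: "upn_iota (pb i i) + upn_iota (pb i i) = (uS i i :: ('k::field_char_0, 'n::finite) upn)"
  if "i \<in> {1..CARD('n)}"
proof -
  note m = pn_partD(1)[OF pn_basis(2)[OF that that]]
  have "scale_upn (1/2) x + scale_upn (1/2) x = x" for x :: "('k, 'n) upn"
    by (simp flip: upn.scale_left_distrib)
  then show ?thesis using upn_iota_scale[OF m, of "1/2 :: 'k"] by (simp add: pb_eq)
qed

lemma card_ge_1: "CARD('n::finite) \<ge> 1" by (simp add: Suc_leI)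

lemma rho_gen_rels:
  assumes q: "q \<in> ralg_rels CARD('n)"
  shows "upn.ev (rho_gen :: rgen \<Rightarrow> ('k::field_char_0, 'n::finite) upn) q = 0"
  unfolding rho_gen_def
  using upn.unital_algebra_axioms q card_ge_1 upn_pb_double[of 1]
  by (intro pn_family_satisfies_rels[OF _ upn_pn_family]) auto


section \<open>The homomorphism $\rho$\<close>

lemma gl_family_unique:
  assumes gl: "gl_family n A" and gl': "gl_family n A'"
    and com: "\<And>x y. f (com x y) = com (f x) (f y)"
    and diag: "\<And>i. i \<in> {1..n} \<Longrightarrow> f (A i i) = A' i i"
    and simple: "\<And>i. i \<in> {1..<n} \<Longrightarrow> f (A i (i + 1)) = A' i (i + 1)" "\<And>i. i \<in> {1..<n} \<Longrightarrow> f (A (i + 1) i) = A' (i + 1) i"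
    and "k \<in> {1..n}" "l \<in> {1..n}"
  shows "f (A k l) = A' k l"
proof -
  have up: "f (A k l) = A' k l" if "k < l" "l \<le> n" "1 \<le> k" for k l
    using that
  proof (induction l)
    case (Suc l)
    show ?case
    proof (cases "k = l")
      case True then show ?thesis using simple(1)[of k] Suc.prems by simp
    next
      case False
      have "A k (Suc l) = com (A k l) (A l (Suc l))" "A' k (Suc l) = com (A' k l) (A' l (Suc l))"
        using gl_familyD[OF gl, of k l l "Suc l"] gl_familyD[OF gl', of k l l "Suc l"] Suc.prems False by auto
      then show ?thesis using Suc False simple(1)[of l] com by simp
    qed
  qed simp
  have down: "f (A k l) = A' k l" if "l < k" "k \<le> n" "1 \<le> l" for k l
    using that
  proof (induction k)
    case (Suc k)
    show ?case
    proof (cases "k = l")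
      case True then show ?thesis using simple(2)[of k] Suc.prems by simp
    next
      case False
      have "A (Suc k) l = com (A (Suc k) k) (A k l)" "A' (Suc k) l = com (A' (Suc k) k) (A' k l)"
        using gl_familyD[OF gl, of "Suc k" k k l] gl_familyD[OF gl', of "Suc k" k k l] Suc.prems False by auto
      then show ?thesis using Suc False simple(2)[of k] com by simp
    qed
  qed simp
  show ?thesis using up[of k l] down[of l k] diag[of k] assms(7,8) by (cases k l rule: linorder_cases) auto
qed

text \<open>
  Applied to subspaces of $R$ that are stable under commutators with the $A_{ij}$; $S_{11}$ generates, up to division by two.
\<close>

lemma pn_family_S_closed:
  assumes fam: "pn_family n A S T" and n: "n \<ge> 1"
    and add: "\<And>x y. x \<in> V \<Longrightarrow> y \<in> V \<Longrightarrow> x - y \<in> V"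
    and half: "\<And>x. x + x \<in> V \<Longrightarrow> x \<in> V"
    and com: "\<And>i j x. i \<in> {1..n} \<Longrightarrow> j \<in> {1..n} \<Longrightarrow> x \<in> V \<Longrightarrow> com (A i j) x \<in> V"
    and gen: "S 1 1 \<in> V" and ij: "i \<in> {1..n}" "j \<in> {1..n}"
  shows "S i j \<in> V"
proof -
  note D = pn_familyD[OF fam]
  have one: "1 \<in> {1..n}" using n by simp
  have 1: "S 1 j \<in> V" if "j \<in> {1..n}" for j
    using half[of "S 1 j"] com[OF that one gen] D(5)[OF that one one one] D(2)[OF one that] by auto
  have "S i j = com (A i 1) (S 1 j) - (if j = 1 then S 1 i else 0)"
    using D(5)[OF ij(1) one one ij(2)] by auto
  moreover have "(if j = 1 then S 1 i else 0) \<in> V" using 1 ij gen add[OF gen gen] by simp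
  ultimately show ?thesis using add[OF com[OF ij(1) one 1[OF ij(2)]]] by (simp only:)
qed

text \<open>
  The analogue for the other odd part, generated by $T_{n-1,n}$.
\<close>

lemma pn_family_T_closed:
  assumes fam: "pn_family n A S T" and n: "n \<ge> 2"
    and add: "\<And>x y. x \<in> V \<Longrightarrow> y \<in> V \<Longrightarrow> x - y \<in> V"
    and com: "\<And>i j x. i \<in> {1..n} \<Longrightarrow> j \<in> {1..n} \<Longrightarrow> x \<in> V \<Longrightarrow> com (A i j) x \<in> V"
    and gen: "T (n - 1) n \<in> V" and ij: "i \<in> {1..n}" "j \<in> {1..n}"
  shows "T i j \<in> V"
proof -
  note D = pn_familyD[OF fam]
  have nn: "n - 1 \<in> {1..n}" "n \<in> {1..n}" "n - 1 \<noteq> n" using n by auto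
  have minus: "- x \<in> V" if "x \<in> V" for x using add[OF add[OF that that] that] by simp
  have 1: "T l n \<in> V" if "l \<in> {1..n}" for l
    using minus[OF com[OF nn(1) that gen]] D(6)[OF nn(1) that nn(1,2)] nn(3) by simp
  show ?thesis
  proof (cases "i = n")
    case True then show ?thesis using D(4)[OF ij] minus[OF 1[OF ij(2)]] by simp
  next
    case False
    then show ?thesis
      using minus[OF com[OF nn(2) ij(2) 1[OF ij(1)]]] D(6)[OF nn(2) ij(2) ij(1) nn(2)] by simp
  qed
qed

definition rho_mat :: "rgen \<Rightarrow> 'k::field_char_0 smat"
  where "rho_mat = pn_gens pa ps pc (pb 1 1)"

lemma rho_gen_mat: "rho_gen g = upn_iota (rho_mat g)"
  by (cases g) (simp_all add: rho_gen_def rho_mat_def)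

lemma pn_part_scale: "X \<in> pn_part n p \<Longrightarrow> mat_scale (c :: 'k::comm_ring_1) X \<in> pn_part n p"
  unfolding pn_part_def using pn_closed(2)[of X n c] by (auto simp: mat_scale_def)

lemma rho_mat_part: "g \<in> rgens n \<Longrightarrow> n \<ge> 1 \<Longrightarrow> (rho_mat g :: 'k::field_char_0 smat) \<in> pn_part n (rpar g)"
  by (cases g) (auto simp: rho_mat_def rgens_def pb_eq intro!: pn_basis pn_part_scale)

text \<open>
  The homomorphism induced by the generators; it is the only superalgebra homomorphism with these values, hence equals $\rho$.
\<close>

definition rho0 :: "('k::field_char_0, 'n::finite) ralg \<Rightarrow> ('k, 'n) upn"
  where "rho0 u = upn.ev rho_gen (rep_ralg u)"

lemma rho0_abs:
  assumes "x \<in> free_alg (rgens CARD('n))"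
  shows "rho0 (abs_ralg x :: ('k::field_char_0, 'n::finite) ralg) = upn.ev rho_gen x"
  unfolding rho0_def using rep_abs_ralg[OF assms] rho_gen_rels by (intro upn.ev_pres_rel) auto

lemma rho0_hom:
  fixes x y :: "('k::field_char_0, 'n::finite) ralg"
  shows "rho0 (x + y) = rho0 x + rho0 y" "rho0 (x * y) = rho0 x * rho0 y" "rho0 (1 :: ('k, 'n) ralg) = 1"
    "rho0 (scale_ralg c x) = scale_upn c (rho0 x)"
    "g \<in> rgens CARD('n) \<Longrightarrow> rho0 (ralg_gen g :: ('k, 'n) ralg) = rho_gen g"
proof -
  obtain x' where x: "x' \<in> free_alg (rgens CARD('n))" "x = abs_ralg x'" by (rule ralg_exhaust)
  obtain y' where y: "y' \<in> free_alg (rgens CARD('n))" "y = abs_ralg y'" by (rule ralg_exhaust)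
  show "rho0 (x + y) = rho0 x + rho0 y" "rho0 (x * y) = rho0 x * rho0 y"
    using x y by (simp_all add: abs_ralg_add abs_ralg_mult rho0_abs free_alg_add free_alg_mult upn.ev_add upn.ev_mult)
  show "rho0 (1 :: ('k, 'n) ralg) = 1" by (simp add: one_ralg_def rho0_abs)
  show "rho0 (scale_ralg c x) = scale_upn c (rho0 x)"
    using x by (simp add: scale_ralg_def abs_ralg_mult rho0_abs free_alg_mult upn.ev_mult upn.ev_fconst
        flip: upn.scale_mult_left)
  show "g \<in> rgens CARD('n) \<Longrightarrow> rho0 (ralg_gen g :: ('k, 'n) ralg) = rho_gen g"
    by (simp add: ralg_gen_def rho0_abs)
qed

lemma linear_span_image:
  assumes lin: "Vector_Spaces.linear sa sb f" and "\<And>x. x \<in> B \<Longrightarrow> f x \<in> module.span sb C"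
  shows "f ` module.span sa B \<subseteq> module.span sb C"
proof -
  interpret Vector_Spaces.linear sa sb f by fact
  have "f ` vs1.span B = vs2.span (f ` B)" using span_image by blast
  also have "\<dots> \<subseteq> vs2.span C" using assms(2) by (intro vs2.span_minimal) auto
  finally show ?thesis .
qed

lemma linearI_upn:
  assumes "\<And>x y. f (x + y) = f x + f y" "\<And>c x. f (scale_ralg c x) = scale_upn c (f x)"
  shows "Vector_Spaces.linear scale_ralg scale_upn (f :: ('k::field_char_0, 'n::finite) ralg \<Rightarrow> ('k, 'n) upn)"
  unfolding linear_iff_module_hom module_hom_def module_hom_axioms_def
  using assms ralg.module_axioms upn.module_axioms by auto

lemma rho0_superalg_hom:
  "superalg_hom scale_ralg grade_ralg scale_upn grade_upn (rho0 :: ('k::field_char_0, 'n::finite) ralg \<Rightarrow> ('k, 'n) upn)"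
proof -
  have lin: "Vector_Spaces.linear scale_ralg scale_upn (rho0 :: ('k, 'n) ralg \<Rightarrow> ('k, 'n) upn)"
    by (rule linearI_upn) (simp_all add: rho0_hom)
  have word: "rho0 (prod_list (map ralg_gen gs) :: ('k, 'n) ralg) = prod_list (map upn_iota (map rho_mat gs))"
    if "set gs \<subseteq> rgens CARD('n)" for gs
    using that by (induction gs) (simp_all add: rho0_hom rho_gen_mat)
  have "rho0 ` (grade_ralg p :: ('k, 'n) ralg set) \<subseteq> grade_upn p" for p
    unfolding grade_ralg_def grade_upn_def
  proof (rule linear_span_image[OF lin])
    fix x :: "('k, 'n) ralg"
    assume "x \<in> {prod_list (map ralg_gen gs) | gs. set gs \<subseteq> rgens CARD('n) \<and> sum_list (map rpar gs) = p}"
    then obtain gs where gs: "x = prod_list (map ralg_gen gs)" "set gs \<subseteq> rgens CARD('n)" "sum_list (map rpar gs) = p" by blast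
    have "list_all2 (\<lambda>X q. X \<in> pn_part CARD('n) q) (map rho_mat gs :: 'k smat list) (map rpar gs)"
      using gs(2) by (induction gs) (simp_all add: rho_mat_part card_ge_1)
    then show "rho0 x \<in> upn.span {prod_list (map upn_iota Xs) | Xs ps.
        list_all2 (\<lambda>X q. X \<in> pn_part CARD('n) q) Xs ps \<and> sum_list ps = p}"
      unfolding gs(1) word[OF gs(2)] using gs(3) by (intro upn.span_base) blast
  qed
  then show ?thesis unfolding superalg_hom_def using lin rho0_hom by blast
qed

lemma rho_eq_rho0: "(rho :: ('k::field_char_0, 'n::finite) ralg \<Rightarrow> ('k, 'n) upn) = rho0"
  unfolding rho_def
proof (rule the_equality)
  have mem: "GE i \<in> rgens CARD('n)" "GF i \<in> rgens CARD('n)" "GB i \<in> rgens CARD('n)" "GC i \<in> rgens CARD('n)"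
    if "i \<in> {1..<CARD('n)}" for i using that by (auto simp: rgens_def)
  have mem': "GH i \<in> rgens CARD('n)" if "i \<in> {1..CARD('n)}" for i using that by (auto simp: rgens_def)
  have pb: "(pb i (i + 1) :: 'k smat) = ps i (i + 1)" for i by (simp add: pb_eq mat_fun_simps)
  show "superalg_hom scale_ralg grade_ralg scale_upn grade_upn (rho0 :: ('k, 'n) ralg \<Rightarrow> ('k, 'n) upn) \<and>
    (\<forall>i\<in>{1..<CARD('n)}.
       rho0 (ralg_gen (GE i) :: ('k, 'n) ralg) = upn_iota (pa i (i + 1)) \<and>
       rho0 (ralg_gen (GF i) :: ('k, 'n) ralg) = upn_iota (pa (i + 1) i) \<and>
       rho0 (ralg_gen (GB i) :: ('k, 'n) ralg) = upn_iota (pb i (i + 1)) \<and>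
       rho0 (ralg_gen (GC i) :: ('k, 'n) ralg) = upn_iota (pc i (i + 1))) \<and>
    (\<forall>i\<in>{1..CARD('n)}. rho0 (ralg_gen (GH i) :: ('k, 'n) ralg) = upn_iota (pa i i)) \<and>
    rho0 (ralg_gen GB11 :: ('k, 'n) ralg) = upn_iota (pb 1 1)"
    using rho0_superalg_hom
    by (intro conjI ballI) (simp_all add: rho0_hom mem mem' rgens_def pb[simplified], simp_all add: rho_gen_def pb[simplified])
  fix f :: "('k, 'n) ralg \<Rightarrow> ('k, 'n) upn"
  assume f: "superalg_hom scale_ralg grade_ralg scale_upn grade_upn f \<and>
    (\<forall>i\<in>{1..<CARD('n)}.
       f (ralg_gen (GE i)) = upn_iota (pa i (i + 1)) \<and>
       f (ralg_gen (GF i)) = upn_iota (pa (i + 1) i) \<and>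
       f (ralg_gen (GB i)) = upn_iota (pb i (i + 1)) \<and>
       f (ralg_gen (GC i)) = upn_iota (pc i (i + 1))) \<and>
    (\<forall>i\<in>{1..CARD('n)}. f (ralg_gen (GH i)) = upn_iota (pa i i)) \<and>
    f (ralg_gen GB11) = upn_iota (pb 1 1)"
  then have gen: "f (ralg_gen g) = rho_gen g" if "g \<in> rgens CARD('n)" for g
    using that by (cases g) (auto simp: rgens_def rho_gen_def pb[simplified])
  interpret f: Vector_Spaces.linear scale_ralg scale_upn f using f by (simp add: superalg_hom_def)
  have mult: "f (x * y) = f x * f y" "f 1 = 1" for x y using f by (simp_all add: superalg_hom_def)
  have word: "f (prod_list (map ralg_gen u)) = prod_list (map rho_gen u)" if "set u \<subseteq> rgens CARD('n)" for u
    using that by (induction u) (simp_all add: mult gen)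
  show "f = rho0"
  proof
    fix u :: "('k, 'n) ralg"
    obtain x where x: "x \<in> free_alg (rgens CARD('n))" "u = abs_ralg x" by (rule ralg_exhaust)
    have "f (abs_ralg x) = upn.ev rho_gen x"
      using x(1)
    proof (induction rule: free_alg_induct)
      case (word v c)
      then show ?case
        by (simp add: abs_ralg_word f.scale \<open>\<And>u. set u \<subseteq> rgens CARD('n) \<Longrightarrow> f (prod_list (map ralg_gen u)) = prod_list (map rho_gen u)\<close>
            upn.ev_mult upn.ev_fconst upn.ev_prod_list flip: upn.scale_mult_left)
    qed (simp_all add: f.zero f.add upn.ev_add flip: abs_ralg_add zero_ralg_def)
    then show "f u = rho0 u" using x by (simp add: rho0_abs)
  qed
qed

lemmas rho_hom = rho0_hom[folded rho_eq_rho0]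
lemmas rho_superalg_hom = rho0_superalg_hom[folded rho_eq_rho0]

lemma rho_com: "rho (com x y) = com (rho x) (rho (y :: ('k::field_char_0, 'n::finite) ralg))"
proof -
  have "rho (- z) = - rho (z :: ('k, 'n) ralg)" for z
    using rho_hom(4)[of "- 1" z] by simp
  then have "rho (x - y) = rho x - rho y" for x y :: "('k, 'n) ralg" using rho_hom(1)[of x "- y"] by simp
  then show ?thesis by (simp add: com_def rho_hom)
qed


section \<open>A copy of $\mathfrak p(n)$ in $R$\<close>

lemma free_alg_of_int [simp]: "of_int m \<in> free_alg S"
proof -
  have *: "of_nat k \<in> free_alg S" for k by (induction k) (simp_all add: free_alg_add)
  show ?thesis by (cases m rule: int_cases2) (simp_all add: free_alg_uminus *)
qed

lemma free_alg_numeral [simp]: "numeral m \<in> free_alg S"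
  using free_alg_of_int[of "numeral m" S] by simp

lemma free_alg_sbr: "x \<in> free_alg S \<Longrightarrow> y \<in> free_alg S \<Longrightarrow> sbr x y \<in> free_alg S"
  by (simp add: sbr_def koszul_def free_alg_diff free_alg_mult free_alg_uminus)

lemma ralg_rels_free: "q \<in> ralg_rels n \<Longrightarrow> n \<ge> 1 \<Longrightarrow> q \<in> free_alg (rgens n)"
  by (induction rule: ralg_rels.induct)
    (auto intro!: free_alg_sbr free_alg_add free_alg_diff free_alg_mult free_alg_uminus simp: rgens_def power2_eq_square)

lemma ralg_rel_zero:
  assumes "q \<in> ralg_rels CARD('n)"
  shows "ralg.ev (ralg_gen :: rgen \<Rightarrow> ('k::field_char_0, 'n::finite) ralg) q = 0"
proof -
  have q: "q \<in> free_alg (rgens CARD('n))" using assms card_ge_1 by (rule ralg_rels_free)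
  have "(abs_ralg q :: ('k, 'n) ralg) = abs_ralg 0"
    using q pres_ideal.add[OF pres_ideal.zero assms free_alg_1 free_alg_1]
    by (subst abs_ralg_eq_iff) (simp_all add: pres_rel_def)
  then show ?thesis using q by (simp add: zero_ralg_def flip: abs_ralg_eq_ev)
qed

abbreviation rE :: "nat \<Rightarrow> ('k::field_char_0, 'n::finite) ralg" where "rE i \<equiv> ralg_gen (GE i)"
abbreviation rF :: "nat \<Rightarrow> ('k::field_char_0, 'n::finite) ralg" where "rF i \<equiv> ralg_gen (GF i)"
abbreviation rH :: "nat \<Rightarrow> ('k::field_char_0, 'n::finite) ralg" where "rH i \<equiv> ralg_gen (GH i)"
abbreviation rB :: "nat \<Rightarrow> ('k::field_char_0, 'n::finite) ralg" where "rB i \<equiv> ralg_gen (GB i)"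
abbreviation rC :: "nat \<Rightarrow> ('k::field_char_0, 'n::finite) ralg" where "rC i \<equiv> ralg_gen (GC i)"

lemma ralg_pn_chevalley:
  "pn_chevalley CARD('n) rE rF rH rB rC (ralg_gen GB11 :: ('k::field_char_0, 'n::finite) ralg)"
proof -
  note [simp] = ralg.ev_sbr_gen ralg.ev_diff ralg.ev_add ralg.ev_mult ralg.ev_of_int ralg.ev_minus
    ralg.ev_numeral ip_weights
  note z = ralg_rel_zero[where 'k='k and 'n='n]
  show ?thesis
  proof
    show "torsion_free TYPE(('k, 'n) ralg)" by (rule unital_algebra_torsion_free[OF ralg.unital_algebra_axioms])
    show "CARD('n) \<ge> 1" by (rule card_ge_1)
    fix i j
    show "com (rH i) (rH j) = (0 :: ('k, 'n) ralg)" if "i \<in> {1..CARD('n)}" "j \<in> {1..CARD('n)}"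
      using z[OF ralg_rels.HH[OF that]] by simp
    show "com (rH i) (rE j) = (if i = j then rE j else 0) - (if i = j + 1 then rE j else (0 :: ('k, 'n) ralg))"
      if "i \<in> {1..CARD('n)}" "j \<in> {1..<CARD('n)}"
      using z[OF ralg_rels.HE[OF that]] that by (auto simp: left_diff_distrib)
    show "com (rH i) (rF j) = (if i = j + 1 then rF j else 0) - (if i = j then rF j else (0 :: ('k, 'n) ralg))"
      if "i \<in> {1..CARD('n)}" "j \<in> {1..<CARD('n)}"
      using z[OF ralg_rels.HF[OF that]] that by (auto simp: left_diff_distrib eq_neg_iff_add_eq_0)
    show "com (rE i) (rF j) = (if i = j then rH i - rH (i + 1) else (0 :: ('k, 'n) ralg))"
      if "i \<in> {1..<CARD('n)}" "j \<in> {1..<CARD('n)}"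
      using z[OF ralg_rels.EF[OF that]] by (auto split: if_splits)
    show "com (rE i) (rE j) = (0 :: ('k, 'n) ralg)"
      if "i \<in> {1..<CARD('n)}" "j \<in> {1..<CARD('n)}" "j \<noteq> i + 1" "i \<noteq> j + 1"
      using z[OF ralg_rels.EE[OF that]] by simp
    show "com (rF i) (rF j) = (0 :: ('k, 'n) ralg)"
      if "i \<in> {1..<CARD('n)}" "j \<in> {1..<CARD('n)}" "j \<noteq> i + 1" "i \<noteq> j + 1"
      using z[OF ralg_rels.FF[OF that]] by simp
    show "com (rE i) (com (rE i) (rE j)) = (0 :: ('k, 'n) ralg)"
      if "i \<in> {1..<CARD('n)}" "j \<in> {1..<CARD('n)}" "j = i + 1 \<or> i = j + 1"
      using z[OF ralg_rels.EEE[OF that]] by simp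
    show "com (rF i) (com (rF i) (rF j)) = (0 :: ('k, 'n) ralg)"
      if "i \<in> {1..<CARD('n)}" "j \<in> {1..<CARD('n)}" "j = i + 1 \<or> i = j + 1"
      using z[OF ralg_rels.FFF[OF that]] by simp
    show "acom (rB i) (rB i) = (0 :: ('k, 'n) ralg)" if "i \<in> {1..<CARD('n)}"
      using z[OF ralg_rels.BB[OF that that]] by simp
    show "acom (rC i) (rC j) = (0 :: ('k, 'n) ralg)" if "i \<in> {1..<CARD('n)}" "j \<in> {1..<CARD('n)}"
      using z[OF ralg_rels.CC[OF that]] by simp
    show "com (rH i) (rB j) = (if i = j then rB j else 0) + (if i = j + 1 then rB j else (0 :: ('k, 'n) ralg))"
      if "i \<in> {1..CARD('n)}" "j \<in> {1..<CARD('n)}"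
      using z[OF ralg_rels.HB[OF that]] that by (auto simp: distrib_right)
    show "com (rH i) (rC j) = - (if i = j then rC j else 0) - (if i = j + 1 then rC j else (0 :: ('k, 'n) ralg))"
      if "i \<in> {1..CARD('n)}" "j \<in> {1..<CARD('n)}"
      using z[OF ralg_rels.HC[OF that]] that by (auto simp: left_diff_distrib eq_neg_iff_add_eq_0)
    show "acom (rB i) (rC i) = - rH i + (rH (i + 1) :: ('k, 'n) ralg)" if "i \<in> {1..<CARD('n)}"
      using z[OF ralg_rels.BC_eq[OF that]] by simp
    show "com (rB i) (rF j) = (0 :: ('k, 'n) ralg)"
      if "i \<in> {1..<CARD('n)}" "j \<in> {1..<CARD('n)}" "j \<noteq> i" "j \<noteq> i + 1"
      using z[OF ralg_rels.BF[OF that]] by simp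
    show "com (rB i) (rE j) = (0 :: ('k, 'n) ralg)"
      if "i \<in> {1..<CARD('n)}" "j \<in> {1..<CARD('n)}" "j \<noteq> i" "i \<noteq> j + 1"
      using z[OF ralg_rels.BE[OF that]] by simp
    show "com (rB i) (rF (i + 1)) = com (rB (i + 1)) (rE i :: ('k, 'n) ralg)"
      if "i \<in> {1..<CARD('n)}" "i + 1 \<in> {1..<CARD('n)}"
      using z[OF ralg_rels.BF_BE'[OF that]] by simp
    show "com (rF j) (rC i) = (0 :: ('k, 'n) ralg)"
      if "i \<in> {1..<CARD('n)}" "j \<in> {1..<CARD('n)}" "i \<noteq> j + 1"
      using z[OF ralg_rels.FC[OF that]] by simp
    show "com (rE j) (rC i) = (0 :: ('k, 'n) ralg)"
      if "i \<in> {1..<CARD('n)}" "j \<in> {1..<CARD('n)}" "j \<noteq> i + 1"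
      using z[OF ralg_rels.EC[OF that]] by simp
    show "com (com (rB i) (rF i)) (rF j) = (if j = i + 1 then rB (i + 1) + rB (i + 1) else (0 :: ('k, 'n) ralg))"
      if "i \<in> {1..<CARD('n)}" "j \<in> {1..<CARD('n)}"
      using z[OF ralg_rels.BFF[OF that]] by (auto simp: mult_2 split: if_splits)
    show "com (com (rB 1) (rF 1)) (rE 1) = rB 1 + (rB 1 :: ('k, 'n) ralg)" if "1 \<in> {1..<CARD('n)}"
      using z[OF ralg_rels.BFE[OF that]] by (simp add: mult_2)
    show "com (com (rB 1) (rE 1)) (rE j) = (0 :: ('k, 'n) ralg)" if "1 \<in> {1..<CARD('n)}" "j \<in> {1..<CARD('n)}"
      using z[OF ralg_rels.BEE[OF that]] by simp
    show "com (com (rC (i + 1)) (rF i)) (rF (i + 1)) = (rC i :: ('k, 'n) ralg)"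
      if "i \<in> {1..<CARD('n)}" "i + 1 \<in> {1..<CARD('n)}"
      using z[OF ralg_rels.CFF[OF that(1,2,2)]] by simp
    show "com (com (rC (i + 1)) (rF i)) (rF i) = (0 :: ('k, 'n) ralg)"
      if "i \<in> {1..<CARD('n)}" "i + 1 \<in> {1..<CARD('n)}"
      using z[OF ralg_rels.CFF_0[OF that(1,1,2)]] by simp
    show "ralg_gen GB11 + ralg_gen GB11 = com (rE 1) (rB 1 :: ('k, 'n) ralg)" if "1 \<in> {1..<CARD('n)}"
      using z[OF ralg_rels.B11[OF that]] by (simp add: mult_2)
    show "com (rH i) (ralg_gen GB11) = (if i = 1 then ralg_gen GB11 + ralg_gen GB11 else (0 :: ('k, 'n) ralg))"
      if "i \<in> {1..CARD('n)}"
      using z[OF ralg_rels.HB11[OF that]] that by (auto simp: mult_2 split: if_splits)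
    show "ralg_gen GB11 * ralg_gen GB11 = (0 :: ('k, 'n) ralg)"
      using z[OF ralg_rels.B11_sq] by (simp add: power2_eq_square)
  qed
qed

text \<open>
  Two families with the same even part and the same extremal vectors coincide, since the extremal vectors generate the odd parts.
\<close>

lemma pn_family_unique:
  fixes S' :: "nat \<Rightarrow> nat \<Rightarrow> 'b::ring_1"
  assumes fam: "pn_family n A S T" and fam': "pn_family n A' S' T'"
    and tf: "torsion_free TYPE('b)" and n: "n \<ge> 1"
    and com: "\<And>x y. f (com x y) = com (f x) (f y)" and diff: "\<And>x y. f (x - y) = f x - f y"
    and fA: "\<And>i j. i \<in> {1..n} \<Longrightarrow> j \<in> {1..n} \<Longrightarrow> f (A i j) = A' i j"
    and fS: "f (S 1 1) = S' 1 1" and fT: "n \<ge> 2 \<Longrightarrow> f (T (n - 1) n) = T' (n - 1) n"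
    and ij: "i \<in> {1..n}" "j \<in> {1..n}"
  shows "f (S i j) = S' i j" "f (T i j) = T' i j"
proof -
  note D = pn_familyD[OF fam] and D' = pn_familyD[OF fam']
  have zero: "f 0 = 0" using diff[of 0 0] by simp
  have minus: "f (- x) = - f x" for x using diff[of 0 x] zero by simp
  have plus: "f (x + y) = f x + f y" for x y using diff[of x "- y"] minus[of y] by simp
  have one: "1 \<in> {1..n}" using n by simp
  have 1: "f (S 1 j) = S' 1 j" if "j \<in> {1..n}" for j
  proof -
    have "f (S 1 j) + f (S 1 j) = f (com (A j 1) (S 1 1))"
      using D(5)[OF that one one one] D(2)[OF one that] by (simp add: plus)
    also have "\<dots> = S' 1 j + S' 1 j"
      using D'(5)[OF that one one one] D'(2)[OF one that] fS by (simp add: com fA[OF that one, simplified])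
    finally show ?thesis by (rule torsion_free_cancel2[OF tf])
  qed
  have "S i j = com (A i 1) (S 1 j) - (if j = 1 then S 1 i else 0)"
    "S' i j = com (A' i 1) (S' 1 j) - (if j = 1 then S' 1 i else 0)"
    using D(5)[OF ij(1) one one ij(2)] D'(5)[OF ij(1) one one ij(2)] by auto
  then show "f (S i j) = S' i j" using 1[OF ij(1)] 1[OF ij(2)] fA[OF ij(1) one] by (simp add: diff com zero)
  show "f (T i j) = T' i j"
  proof (cases "n \<ge> 2")
    case False
    then have "i = 1" "j = 1" using ij by auto
    then show ?thesis using D(3)[OF one] D'(3)[OF one] zero by simp
  next
    case True
    then have nn: "n - 1 \<in> {1..n}" "n \<in> {1..n}" "n - 1 \<noteq> n" by auto
    have 1: "f (T l n) = T' l n" if "l \<in> {1..n}" for l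
    proof -
      have "T l n = - com (A (n - 1) l) (T (n - 1) n)" "T' l n = - com (A' (n - 1) l) (T' (n - 1) n)"
        using D(6)[OF nn(1) that nn(1,2)] D'(6)[OF nn(1) that nn(1,2)] nn(3) by simp_all
      then show ?thesis using fT[OF True] fA[OF nn(1) that] by (simp add: minus com)
    qed
    show ?thesis
    proof (cases "i = n")
      case True
      then show ?thesis using D(4)[OF ij] D'(4)[OF ij] 1[OF ij(2)] by (simp add: minus)
    next
      case False
      have "T i j = - com (A n j) (T i n)" "T' i j = - com (A' n j) (T' i n)"
        using D(6)[OF nn(2) ij(2) ij(1) nn(2)] D'(6)[OF nn(2) ij(2) ij(1) nn(2)] False by simp_all
      then show ?thesis using 1[OF ij(1)] fA[OF nn(2) ij(2)] by (simp add: minus com)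
    qed
  qed
qed

text \<open>
  The copy of $\mathfrak p(n)$ in $R$, mapped by $\rho$ to the standard one because both are determined by the same generators.
\<close>

lemma exists_ralg_family:
  obtains A S T :: "nat \<Rightarrow> nat \<Rightarrow> ('k::field_char_0, 'n::finite) ralg"
  where "pn_family CARD('n) A S T" "\<And>i. i \<in> {1..CARD('n)} \<Longrightarrow> A i i = rH i"
    "\<And>i. i \<in> {1..<CARD('n)} \<Longrightarrow> A i (i + 1) = rE i" "\<And>i. i \<in> {1..<CARD('n)} \<Longrightarrow> A (i + 1) i = rF i"
    "S 1 1 = ralg_gen GB11 + ralg_gen GB11"
    "\<And>i. i \<in> {1..<CARD('n)} \<Longrightarrow> S i (i + 1) = rB i" "\<And>i. i \<in> {1..<CARD('n)} \<Longrightarrow> T i (i + 1) = rC i"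
    "\<And>i j. i \<in> {1..CARD('n)} \<Longrightarrow> j \<in> {1..CARD('n)} \<Longrightarrow> rho (A i j) = uA i j"
    "\<And>i j. i \<in> {1..CARD('n)} \<Longrightarrow> j \<in> {1..CARD('n)} \<Longrightarrow> rho (S i j) = uS i j"
    "\<And>i j. i \<in> {1..CARD('n)} \<Longrightarrow> j \<in> {1..CARD('n)} \<Longrightarrow> rho (T i j) = uT i j"
proof -
  let ?n = "CARD('n)"
  obtain A S T :: "nat \<Rightarrow> nat \<Rightarrow> ('k, 'n) ralg" where fam: "pn_family ?n A S T"
    and gens: "\<And>i. i \<in> {1..?n} \<Longrightarrow> A i i = rH i"
    "\<And>i. i \<in> {1..<?n} \<Longrightarrow> A i (i + 1) = rE i" "\<And>i. i \<in> {1..<?n} \<Longrightarrow> A (i + 1) i = rF i"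
    "S 1 1 = ralg_gen GB11 + ralg_gen GB11"
    "\<And>i. i \<in> {1..<?n} \<Longrightarrow> S i (i + 1) = rB i" "\<And>i. i \<in> {1..<?n} \<Longrightarrow> T i (i + 1) = rC i"
    using pn_chevalley.exists_pn_family[OF ralg_pn_chevalley] by blast
  have gl: "gl_family ?n A" and gl': "gl_family ?n (uA :: nat \<Rightarrow> nat \<Rightarrow> ('k, 'n) upn)"
    using fam upn_pn_family[where 'k='k and 'n='n] unfolding pn_family_def by blast+
  have rg: "rho (ralg_gen g :: ('k, 'n) ralg) = rho_gen g" if "g \<in> rgens ?n" for g using that by (rule rho_hom)
  have rA: "rho (A i j) = uA i j" if "i \<in> {1..?n}" "j \<in> {1..?n}" for i j
    by (rule gl_family_unique[OF gl gl' rho_com _ _ _ that])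
      (use gens in \<open>simp_all add: rg rgens_def, simp_all add: rho_gen_def\<close>)
  have rho_diff: "rho (x - y) = rho x - rho y" for x y :: "('k, 'n) ralg"
    using rho_hom(1)[of "x - y" y] by (simp add: algebra_simps)
  have "rho (S 1 1) = rho_gen GB11 + rho_gen GB11"
    unfolding gens(4) by (simp add: rho_hom(1) rg rgens_def)
  also have "\<dots> = uS 1 1" by (simp add: rho_gen_def upn_pb_double)
  finally have rS: "rho (S 1 1) = uS 1 1" .
  have rT: "rho (T (?n - 1) ?n) = uT (?n - 1) ?n" if "?n \<ge> 2"
    using gens(6)[of "?n - 1"] that rg[of "GC (?n - 1)"] by (simp add: rgens_def rho_gen_def)
  note u = pn_family_unique[OF fam upn_pn_family
      unital_algebra_torsion_free[OF upn.unital_algebra_axioms] card_ge_1 rho_com rho_diff rA rS rT]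
  show thesis
    by (rule that[OF fam gens rA]) (use u in auto)
qed


section \<open>Straightening of words\<close>

abbreviation zspan :: "'a::ring_1 set \<Rightarrow> 'a set" where "zspan \<equiv> int_module.span"

lemma of_int_left_commute: "x * (of_int c * y) = of_int c * (x * y :: 'a::ring_1)"
  by (metis mult.assoc mult_of_int_commute)

lemma zspan_mult_left:
  assumes "\<And>y. y \<in> B \<Longrightarrow> x * y \<in> zspan C" and "y \<in> zspan B"
  shows "x * y \<in> zspan C"
  using assms(2)
proof (induction rule: int_module.span_induct_alt)
  case (step c y z)
  have "x * (of_int c * y + z) = of_int c * (x * y) + x * z"
    by (simp add: distrib_left) (metis mult.assoc mult_of_int_commute)
  then show ?case using step assms(1) by (auto intro: int_module.span_add int_module.span_scale)
qed (simp add: int_module.span_zero)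

lemma zspan_mult_right:
  assumes "\<And>x. x \<in> B \<Longrightarrow> x * y \<in> zspan C" and "x \<in> zspan B"
  shows "x * y \<in> zspan C"
  using assms(2)
proof (induction rule: int_module.span_induct_alt)
  case (step c x z)
  have "(of_int c * x + z) * y = of_int c * (x * y) + z * y" by (simp add: distrib_right mult.assoc)
  then show ?case using step assms(1) by (auto intro: int_module.span_add int_module.span_scale)
qed (simp add: int_module.span_zero)

lemma zspan_of_nat_mult: "x \<in> zspan B \<Longrightarrow> of_nat c * x \<in> zspan B"
  using int_module.span_scale[of x B "int c"] by simp

text \<open>
  Letters $v_z(r)$ are to be thought of as divided powers of degree $r$ of the element with index $z$.
\<close>

locale straightening =
  fixes v :: "'z \<Rightarrow> nat \<Rightarrow> 'r::ring_1" and Z :: "'z set"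
  assumes v_0: "z \<in> Z \<Longrightarrow> v z 0 = 1"
begin

definition word :: "('z \<times> nat) list \<Rightarrow> 'r" where "word w = prod_list (map (\<lambda>(z, r). v z r) w)"

definition words :: "('z \<times> nat) list set" where "words = {w. fst ` set w \<subseteq> Z}"

definition deg :: "('z \<times> nat) list \<Rightarrow> nat" where "deg w = sum_list (map snd w)"

definition W :: "nat \<Rightarrow> 'r set" where "W d = zspan {word w | w. w \<in> words \<and> deg w < d}"

lemma word_simps [simp]: "word [] = 1" "word ((z, r) # w) = v z r * word w" "word (u @ w) = word u * word w"
  by (simp_all add: word_def)

lemma deg_simps [simp]: "deg [] = 0" "deg ((z, r) # w) = r + deg w" "deg (u @ w) = deg u + deg w"
  by (simp_all add: deg_def)

lemma words_simps [simp]: "[] \<in> words" "(z, r) # w \<in> words \<longleftrightarrow> z \<in> Z \<and> w \<in> words"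
    "u @ w \<in> words \<longleftrightarrow> u \<in> words \<and> w \<in> words"
  by (auto simp: words_def)

lemma word_in_W: "w \<in> words \<Longrightarrow> deg w < d \<Longrightarrow> word w \<in> W d"
  unfolding W_def by (intro int_module.span_base) blast

lemma v_in_W: "z \<in> Z \<Longrightarrow> r < d \<Longrightarrow> v z r \<in> W d"
  using word_in_W[of "[(z, r)]" d] by simp

lemma W_mono: "c \<le> d \<Longrightarrow> W c \<subseteq> W d"
  unfolding W_def by (rule int_module.span_mono) auto

lemma W_0 [simp]: "0 \<in> W d" and W_add: "x \<in> W d \<Longrightarrow> y \<in> W d \<Longrightarrow> x + y \<in> W d"
  and W_diff: "x \<in> W d \<Longrightarrow> y \<in> W d \<Longrightarrow> x - y \<in> W d" and W_minus: "x \<in> W d \<Longrightarrow> - x \<in> W d"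
  and W_of_int: "x \<in> W d \<Longrightarrow> of_int c * x \<in> W d" and W_of_nat: "x \<in> W d \<Longrightarrow> of_nat m * x \<in> W d"
  and W_sum: "(\<And>i. i \<in> I \<Longrightarrow> f i \<in> W d) \<Longrightarrow> sum f I \<in> W d"
  unfolding W_def
  by (auto intro: int_module.span_add int_module.span_diff int_module.span_neg int_module.span_zero
      int_module.span_scale int_module.span_sum zspan_of_nat_mult)

lemma W_mult:
  assumes "x \<in> W c" "y \<in> W d" "c + d \<le> Suc e" shows "x * y \<in> W e"
proof -
  have w: "word u * word w \<in> W e" if "u \<in> words" "deg u < c" "w \<in> words" "deg w < d" for u w
    using word_in_W[of "u @ w" e] that assms(3) by simp
  have "word u * y \<in> W e" if "u \<in> words" "deg u < c" for u
    using assms(2) w that unfolding W_def by (elim zspan_mult_left[rotated]) auto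
  then show ?thesis using assms(1) unfolding W_def by (elim zspan_mult_right[rotated]) auto
qed

definition ordered :: "'z list \<Rightarrow> ('z \<Rightarrow> nat) \<Rightarrow> 'r"
  where "ordered zs \<mu> = prod_list (map (\<lambda>z. v z (\<mu> z)) zs)"

lemma ordered_word: "ordered zs \<mu> = word (map (\<lambda>z. (z, \<mu> z)) zs)"
  by (simp add: ordered_def word_def comp_def)

lemma deg_ordered: "deg (map (\<lambda>z. (z, \<mu> z)) zs) = (\<Sum>z\<leftarrow>zs. \<mu> z)"
  by (simp add: deg_def comp_def)

lemma ordered_in_W: "set zs \<subseteq> Z \<Longrightarrow> (\<Sum>z\<leftarrow>zs. \<mu> z) < d \<Longrightarrow> ordered zs \<mu> \<in> W d"
  unfolding ordered_word by (rule word_in_W) (auto simp: words_def deg_ordered)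

lemma ordered_cong: "(\<And>z. z \<in> set zs \<Longrightarrow> \<mu> z = \<nu> z) \<Longrightarrow> ordered zs \<mu> = ordered zs \<nu>"
  unfolding ordered_def by (auto intro!: arg_cong[of _ _ prod_list])

context
  assumes merge: "\<And>z r s. z \<in> Z \<Longrightarrow> \<exists>c. v z r * v z s - of_int c * v z (r + s) \<in> W (r + s)"
    and swap: "\<And>z z' r s. z \<in> Z \<Longrightarrow> z' \<in> Z \<Longrightarrow> z \<noteq> z' \<Longrightarrow>
      \<exists>c. v z r * v z' s - of_int c * (v z' s * v z r) \<in> W (r + s)"
begin

text \<open>
  The new letter is moved to the right past larger letters and merged with its own; each step costs terms of lower degree only.
\<close>

lemma insert_letter:
  assumes "distinct zs" "set zs \<subseteq> Z" "z \<in> set zs"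
  shows "\<exists>c. v z r * ordered zs \<mu> - of_int c * ordered zs (\<mu>(z := \<mu> z + r)) \<in> W (r + (\<Sum>z\<leftarrow>zs. \<mu> z))"
  using assms
proof (induction zs)
  case (Cons y zs)
  have y: "y \<in> Z" and zs: "set zs \<subseteq> Z" using Cons.prems by auto
  have rest: "ordered zs \<mu> \<in> W (Suc (\<Sum>z\<leftarrow>zs. \<mu> z))" by (rule ordered_in_W[OF zs]) simp
  show ?case
  proof (cases "z = y")
    case True
    obtain c where c: "v y r * v y (\<mu> y) - of_int c * v y (r + \<mu> y) \<in> W (r + \<mu> y)" using merge[OF y] by blast
    have "(v y r * v y (\<mu> y) - of_int c * v y (r + \<mu> y)) * ordered zs \<mu> \<in> W (r + (\<mu> y + (\<Sum>z\<leftarrow>zs. \<mu> z)))"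
      by (rule W_mult[OF c rest]) simp
    moreover have "ordered zs (\<mu>(y := \<mu> y + r)) = ordered zs \<mu>"
      using Cons.prems(1) by (intro ordered_cong) auto
    ultimately show ?thesis
      using True by (intro exI[of _ c]) (simp add: ordered_def left_diff_distrib mult.assoc add.commute)
  next
    case False
    then have z: "z \<in> Z" "z \<in> set zs" using Cons.prems by auto
    obtain c where c: "v z r * v y (\<mu> y) - of_int c * (v y (\<mu> y) * v z r) \<in> W (r + \<mu> y)"
      using swap[OF z(1) y False] by blast
    obtain c' where c': "v z r * ordered zs \<mu> - of_int c' * ordered zs (\<mu>(z := \<mu> z + r)) \<in> W (r + (\<Sum>z\<leftarrow>zs. \<mu> z))"
    proof -
      have "\<exists>c'. v z r * ordered zs \<mu> - of_int c' * ordered zs (\<mu>(z := \<mu> z + r)) \<in> W (r + (\<Sum>z\<leftarrow>zs. \<mu> z))"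
        by (rule Cons.IH) (use Cons.prems z in auto)
      then show ?thesis using that by blast
    qed
    have 1: "(v z r * v y (\<mu> y) - of_int c * (v y (\<mu> y) * v z r)) * ordered zs \<mu> \<in> W (r + (\<mu> y + (\<Sum>z\<leftarrow>zs. \<mu> z)))"
      by (rule W_mult[OF c rest]) simp
    have "v y (\<mu> y) * (v z r * ordered zs \<mu> - of_int c' * ordered zs (\<mu>(z := \<mu> z + r))) \<in> W (r + (\<mu> y + (\<Sum>z\<leftarrow>zs. \<mu> z)))"
      by (rule W_mult[OF v_in_W[OF y lessI] c']) simp
    from W_of_int[OF this, of c] have "of_int c * (v y (\<mu> y) * (v z r * ordered zs \<mu> - of_int c' * ordered zs (\<mu>(z := \<mu> z + r)))) \<in> W (r + (\<mu> y + (\<Sum>z\<leftarrow>zs. \<mu> z)))" .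
    from W_add[OF 1 this] have "v z r * (v y (\<mu> y) * ordered zs \<mu>) - of_int c * (v y (\<mu> y) * (of_int c' * ordered zs (\<mu>(z := \<mu> z + r))))
        \<in> W (r + (\<mu> y + (\<Sum>z\<leftarrow>zs. \<mu> z)))"
      by (simp add: right_diff_distrib left_diff_distrib mult.assoc)
    moreover have "of_int c * (v y (\<mu> y) * (of_int c' * x)) = of_int (c * c') * (v y (\<mu> y) * x)" for x
      unfolding of_int_left_commute[of "v y (\<mu> y)"] of_int_mult mult.assoc ..
    ultimately show ?thesis using False by (intro exI[of _ "c * c'"]) (simp add: ordered_def)
  qed
qed simp

lemma word_leading:
  assumes zs: "distinct zs" "set zs = Z" and "w \<in> words"
  shows "\<exists>c \<mu>. (\<Sum>z\<leftarrow>zs. \<mu> z) = deg w \<and> word w - of_int c * ordered zs \<mu> \<in> W (deg w)"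
  using assms(3)
proof (induction w)
  case Nil
  have "ordered zs (\<lambda>_. 0) = 1" using zs v_0 by (induction zs arbitrary: Z) (auto simp: ordered_def)
  then show ?case by (intro exI[of _ 1] exI[of _ "\<lambda>_. 0"]) simp
next
  case (Cons a w)
  obtain z r where a: "a = (z, r)" by (cases a)
  then have z: "z \<in> Z" and w: "w \<in> words" using Cons.prems by auto
  obtain c \<mu> where c: "(\<Sum>z\<leftarrow>zs. \<mu> z) = deg w" "word w - of_int c * ordered zs \<mu> \<in> W (deg w)"
    using Cons.IH w by blast
  obtain c' where c': "v z r * ordered zs \<mu> - of_int c' * ordered zs (\<mu>(z := \<mu> z + r)) \<in> W (r + deg w)"
    using insert_letter[of zs z r \<mu>] zs z c(1) by auto
  have "v z r * (word w - of_int c * ordered zs \<mu>) \<in> W (r + deg w)"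
    by (rule W_mult[OF v_in_W[OF z lessI] c(2)]) simp
  from W_add[OF this W_of_int[OF c', of c]]
  have "v z r * word w - of_int (c * c') * ordered zs (\<mu>(z := \<mu> z + r)) \<in> W (r + deg w)"
    unfolding right_diff_distrib of_int_left_commute[of "v z r"] of_int_mult mult.assoc by simp
  moreover have "(\<Sum>y\<leftarrow>zs. (\<mu>(z := \<mu> z + r)) y) = deg (a # w)"
  proof -
    have "finite Z" using zs by auto
    have "(\<Sum>y\<in>Z. (\<mu>(z := \<mu> z + r)) y) = (\<Sum>y\<in>Z. \<mu> y + (if y = z then r else 0))"
      by (intro sum.cong) auto
    also have "\<dots> = sum \<mu> Z + r" using \<open>finite Z\<close> z by (simp add: sum.distrib)
    finally show ?thesis using zs c(1) by (simp add: a sum_list_distinct_conv_sum_set)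
  qed
  ultimately show ?case
    by (intro exI[of _ "c * c'"] exI[of _ "\<mu>(z := \<mu> z + r)"]) (simp add: a del: fun_upd_apply)
qed

text \<open>
  Induction on the degree: a word differs from a multiple of an ordered word by words of smaller degree.
\<close>

theorem word_in_ordered_span:
  assumes zs: "distinct zs" "set zs = Z" and "w \<in> words"
  shows "word w \<in> zspan (range (ordered zs))"
proof -
  have "W d \<subseteq> zspan (range (ordered zs))" for d
  proof (induction d)
    case 0 show ?case by (simp add: W_def int_module.span_zero)
  next
    case (Suc d)
    have "word w \<in> zspan (range (ordered zs))" if "w \<in> words" "deg w < Suc d" for w
    proof -
      note w = that
      obtain c \<mu> where "word w - of_int c * ordered zs \<mu> \<in> W (deg w)" using word_leading[OF zs w(1)] by blast
      then have "word w - of_int c * ordered zs \<mu> \<in> zspan (range (ordered zs))"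
        using Suc.IH W_mono[of "deg w" d] w(2) by auto
      from int_module.span_add[OF this int_module.span_scale[OF int_module.span_base[OF rangeI[of "ordered zs" \<mu>]], of c]]
      show ?thesis by simp
    qed
    then show ?case unfolding W_def by (intro int_module.span_minimal int_module.subspace_span) auto
  qed
  then show ?thesis using word_in_W[OF assms(3), of "Suc (deg w)"] by auto
qed

end

end


section \<open>Divided powers and binomial elements\<close>

lemma ralg_of_nat_scale: "of_nat m * x = scale_ralg (of_nat m) (x :: ('k::field_char_0, 'n::finite) ralg)"
  by (induction m) (simp_all add: distrib_right ralg.scale_left_distrib)

lemma ralg_of_int_scale: "of_int m * x = scale_ralg (of_int m) (x :: ('k::field_char_0, 'n::finite) ralg)"
  by (cases m rule: int_cases2) (simp_all add: ralg_of_nat_scale)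

lemma ralg_cancel_Suc: "of_nat (Suc m) * x = of_nat (Suc m) * y \<Longrightarrow> x = (y :: ('k::field_char_0, 'n::finite) ralg)"
  unfolding ralg_of_nat_scale using of_nat_neq_0[where 'a = 'k] by (simp only: ralg.scale_cancel_left) auto

lemma of_nat_left_commute: "x * (of_nat c * y) = of_nat c * (x * y :: 'a::ring_1)"
  by (metis mult.assoc mult_of_nat_commute)

lemma divpow_0 [simp]: "divpow x 0 = 1" by (simp add: divpow_def)

lemma divpow_1 [simp]: "divpow x (Suc 0) = x" by (simp add: divpow_def)

lemma
  fixes x :: "('k::field_char_0, 'n::finite) ralg"
  shows divpow_Suc: "of_nat (Suc r) * divpow x (Suc r) = x * divpow x r"
    and divpow_Suc': "of_nat (Suc r) * divpow x (Suc r) = divpow x r * x"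
proof -
  have "of_nat (Suc r) * (1 / fact (Suc r)) = (1 / fact r :: 'k)"
    by (simp add: field_simps del: of_nat_Suc)
  then have *: "of_nat (Suc r) * divpow x (Suc r) = scale_ralg (1 / fact r) (x ^ Suc r)"
    unfolding ralg_of_nat_scale divpow_def ralg.scale_scale by simp
  show "of_nat (Suc r) * divpow x (Suc r) = x * divpow x r"
    unfolding * by (simp add: divpow_def ralg.scale_mult_right)
  show "of_nat (Suc r) * divpow x (Suc r) = divpow x r * x"
    unfolding * by (simp only: power_Suc2 divpow_def ralg.scale_mult_left)
qed

lemma divpow_mult:
  fixes x :: "('k::field_char_0, 'n::finite) ralg"
  shows "divpow x r * divpow x s = of_nat ((r + s) choose r) * divpow x (r + s)"
proof -
  have "divpow x r * divpow x s = scale_ralg (1 / fact r * (1 / fact s)) (x ^ (r + s))"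
    by (simp add: divpow_def power_add flip: ralg.scale_mult_left ralg.scale_mult_right)
  also have "1 / fact r * (1 / fact s) = of_nat ((r + s) choose r) * (1 / fact (r + s) :: 'k)"
    using binomial_fact[of r "r + s", where 'a='k] by (simp add: field_simps)
  finally show ?thesis by (simp add: divpow_def ralg_of_nat_scale)
qed

lemma hbinom_0 [simp]: "hbinom h 0 = 1" by (simp add: hbinom_def)

lemma hbinom_Suc:
  fixes h :: "('k::field_char_0, 'n::finite) ralg"
  shows "of_nat (Suc s) * hbinom h (Suc s) = hbinom h s * (h - of_nat s)"
proof -
  have "of_nat (Suc s) * (1 / fact (Suc s)) = (1 / fact s :: 'k)"
    by (simp add: field_simps del: of_nat_Suc)
  then have "of_nat (Suc s) * hbinom h (Suc s)
      = scale_ralg (1 / fact s) (prod_list (map (\<lambda>m. h - of_nat m) [0..<Suc s]))"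
    unfolding ralg_of_nat_scale hbinom_def ralg.scale_scale by simp
  then show ?thesis by (simp add: hbinom_def ralg.scale_mult_left)
qed

lemma hbinom_1 [simp]: "hbinom h (Suc 0) = h" by (simp add: hbinom_def)

lemma hbinom_weight:
  assumes "h * x = x * (h + of_int m)"
  shows "hbinom h s * x = x * hbinom (h + of_int m) s"
proof (induction s)
  case (Suc s)
  have "of_nat (Suc s) * (hbinom h (Suc s) * x) = hbinom h s * ((h - of_nat s) * x)"
    unfolding mult.assoc[symmetric] hbinom_Suc ..
  also have "(h - of_nat s) * x = x * (h + of_int m - of_nat s)"
    by (simp add: left_diff_distrib right_diff_distrib assms mult_of_nat_commute)
  also have "hbinom h s * (x * (h + of_int m - of_nat s)) = x * (hbinom (h + of_int m) s * (h + of_int m - of_nat s))"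
    unfolding mult.assoc[symmetric] Suc ..
  also have "\<dots> = of_nat (Suc s) * (x * hbinom (h + of_int m) (Suc s))"
    unfolding hbinom_Suc[symmetric] by (rule of_nat_left_commute)
  finally show ?case by (rule ralg_cancel_Suc)
qed simp

lemma hbinom_commute: "h * x = x * h \<Longrightarrow> hbinom h s * x = x * hbinom h s"
  using hbinom_weight[of h x 0] by simp

lemma hbinom_add: "hbinom h r * hbinom (h - of_nat r) s = of_nat ((r + s) choose s) * hbinom h (r + s)"
proof (induction s)
  case (Suc s)
  have "of_nat (Suc s) * (hbinom h r * hbinom (h - of_nat r) (Suc s))
      = hbinom h r * hbinom (h - of_nat r) s * (h - of_nat r - of_nat s)"
    unfolding of_nat_left_commute[symmetric] hbinom_Suc by (simp only: mult.assoc)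
  also have "\<dots> = of_nat ((r + s) choose s) * (hbinom h (r + s) * (h - of_nat (r + s)))"
    unfolding Suc by (simp add: mult.assoc diff_diff_eq)
  also have "\<dots> = of_nat (((r + s) choose s) * Suc (r + s)) * hbinom h (r + Suc s)"
    unfolding hbinom_Suc[symmetric] by (simp only: of_nat_mult mult.assoc add_Suc_right)
  also have "((r + s) choose s) * Suc (r + s) = Suc s * ((r + Suc s) choose Suc s)"
    using Suc_times_binomial[of s "r + s"] by (simp add: mult.commute)
  also have "of_nat (Suc s * ((r + Suc s) choose Suc s)) * hbinom h (r + Suc s)
      = of_nat (Suc s) * (of_nat ((r + Suc s) choose Suc s) * hbinom h (r + Suc s))"
    by (simp only: of_nat_mult mult.assoc)
  finally show ?case by (rule ralg_cancel_Suc)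
qed simp

lemma hbinom_top: "of_nat (Suc k) * hbinom (h + 1) (Suc k) = (h + 1) * hbinom h k"
proof (induction k)
  case (Suc k)
  have "of_nat (Suc k) * (of_nat (Suc (Suc k)) * hbinom (h + 1) (Suc (Suc k)))
      = (of_nat (Suc k) * hbinom (h + 1) (Suc k)) * (h - of_nat k)"
    unfolding hbinom_Suc[of "Suc k"] by (simp add: mult.assoc)
  also have "\<dots> = (h + 1) * (of_nat (Suc k) * hbinom h (Suc k))"
    unfolding Suc unfolding hbinom_Suc by (simp only: mult.assoc)
  also have "\<dots> = of_nat (Suc k) * ((h + 1) * hbinom h (Suc k))" by (rule of_nat_left_commute)
  finally show ?case by (rule ralg_cancel_Suc)
qed simp

lemma hbinom_pascal: "hbinom (h + 1) (Suc k) = hbinom h (Suc k) + hbinom h k"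
proof -
  have "of_nat (Suc k) * (hbinom h (Suc k) + hbinom h k) = hbinom h k * (h - of_nat k) + of_nat (Suc k) * hbinom h k"
    by (simp only: distrib_left hbinom_Suc)
  also have "\<dots> = hbinom h k * (h + 1)"
    by (simp add: right_diff_distrib distrib_left distrib_right mult_of_nat_commute[of k "hbinom h k"])
  also have "\<dots> = (h + 1) * hbinom h k" by (rule hbinom_commute) (simp add: algebra_simps)
  also have "\<dots> = of_nat (Suc k) * hbinom (h + 1) (Suc k)" by (rule hbinom_top[symmetric])
  finally show ?thesis by (rule ralg_cancel_Suc[symmetric])
qed

text \<open>
  A filtration by polynomials in $h$ with integral values; integral shifts of $h$ and products respect it.
\<close>

definition hspan :: "('k::field_char_0, 'n::finite) ralg \<Rightarrow> nat \<Rightarrow> ('k, 'n) ralg set"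
  where "hspan h d = zspan {hbinom h j | j. j < d}"

lemma hbinom_in_hspan: "j < d \<Longrightarrow> hbinom h j \<in> hspan h d"
  unfolding hspan_def by (rule int_module.span_base) blast

lemma hspan_mono: "c \<le> d \<Longrightarrow> hspan h c \<subseteq> hspan h d"
  unfolding hspan_def by (rule int_module.span_mono) auto

text \<open>
  Iterated Pascal rule, in both directions.
\<close>

lemma hbinom_shift: "hbinom (h + of_int m) k - hbinom h k \<in> hspan h k"
proof (induction k arbitrary: m)
  case 0 show ?case by (simp add: hspan_def int_module.span_zero)
next
  case (Suc k)
  have low: "hbinom (h + of_int m) k \<in> hspan h (Suc k)" for m
  proof -
    have "hbinom (h + of_int m) k - hbinom h k \<in> hspan h (Suc k)" using Suc hspan_mono[of k "Suc k" h] by auto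
    from int_module.span_add[OF this[unfolded hspan_def] hbinom_in_hspan[OF lessI, of h k, unfolded hspan_def]]
    show ?thesis by (simp add: hspan_def)
  qed
  show ?case
  proof (induction m rule: int_induct[where k = 0])
    case base show ?case by (simp add: hspan_def int_module.span_zero)
  next
    case (step1 i)
    have eq: "hbinom (h + of_int (i + 1)) (Suc k) - hbinom h (Suc k)
        = (hbinom (h + of_int i) (Suc k) - hbinom h (Suc k)) + hbinom (h + of_int i) k"
      using hbinom_pascal[of "h + of_int i" k] by (simp add: add.assoc)
    show ?case using step1(2) low[of i] unfolding eq hspan_def by (rule int_module.span_add)
  next
    case (step2 i)
    have eq: "hbinom (h + of_int (i - 1)) (Suc k) - hbinom h (Suc k)
        = (hbinom (h + of_int i) (Suc k) - hbinom h (Suc k)) - hbinom (h + of_int (i - 1)) k"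
      using hbinom_pascal[of "h + of_int (i - 1)" k] by (simp add: add.assoc)
    show ?case using step2(2) low[of "i - 1"] unfolding eq hspan_def by (rule int_module.span_diff)
  qed
qed

lemma hbinom_shift_in_hspan: "hbinom (h + of_int m) k \<in> hspan h (Suc k)"
proof -
  have "hbinom (h + of_int m) k - hbinom h k \<in> hspan h (Suc k)" using hbinom_shift hspan_mono[of k "Suc k" h] by auto
  from int_module.span_add[OF this[unfolded hspan_def] hbinom_in_hspan[OF lessI, of h k, unfolded hspan_def]]
  show ?thesis by (simp add: hspan_def)
qed

lemma hbinom_mult: "hbinom h r * hbinom h s - of_nat ((r + s) choose s) * hbinom h (r + s) \<in> hspan h (r + s)"
proof -
  have "hbinom h s - hbinom (h - of_nat r) s \<in> hspan (h - of_nat r) s"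
    using hbinom_shift[of "h - of_nat r" "int r" s] by simp
  then have "hbinom h r * (hbinom h s - hbinom (h - of_nat r) s) \<in> hspan h (r + s)"
    unfolding hspan_def
  proof (elim zspan_mult_left[rotated], elim CollectE exE conjE)
    fix y j assume y: "y = hbinom (h - of_nat r) j" "j < s"
    show "hbinom h r * y \<in> zspan {hbinom h j | j. j < r + s}"
      unfolding y(1) hbinom_add by (rule zspan_of_nat_mult[OF int_module.span_base]) (use y(2) in auto)
  qed
  then show ?thesis by (simp add: right_diff_distrib hbinom_add)
qed

lemma hspan_mult:
  assumes "x \<in> hspan h c" "y \<in> hspan h d" "c + d \<le> Suc e" shows "x * y \<in> hspan h e"
proof -
  have b: "hbinom h i * hbinom h j \<in> hspan h e" if "i < c" "j < d" for i j
  proof -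
    have "hbinom h i * hbinom h j - of_nat ((i + j) choose j) * hbinom h (i + j) \<in> hspan h e"
      using hbinom_mult[of h i j] hspan_mono[of "i + j" e h] that assms(3) by auto
    moreover have "of_nat ((i + j) choose j) * hbinom h (i + j) \<in> hspan h e"
      unfolding hspan_def by (rule zspan_of_nat_mult[OF int_module.span_base]) (use that assms(3) in auto)
    ultimately show ?thesis unfolding hspan_def using int_module.span_add by fastforce
  qed
  have "hbinom h i * y \<in> hspan h e" if "i < c" for i
    using assms(2) b that unfolding hspan_def by (elim zspan_mult_left[rotated]) auto
  then show ?thesis using assms(1) unfolding hspan_def by (elim zspan_mult_right[rotated]) auto
qed

text \<open>
  The Chu-Vandermonde identity for commuting elements, proved by induction on $k$ after multiplication by $k$.
\<close>

lemma hbinom_vandermonde: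
  fixes h g :: "('k::field_char_0, 'n::finite) ralg"
  assumes "h * g = g * h"
  shows "hbinom (h + g) k = (\<Sum>a\<le>k. hbinom h a * hbinom g (k - a))"
proof (induction k)
  case (Suc k)
  let ?V = "\<lambda>k. \<Sum>a\<le>k. hbinom h a * hbinom g (k - a)"
  have split: "of_nat (Suc k) * (hbinom h a * hbinom g (Suc k - a))
      = of_nat a * (hbinom h a * hbinom g (Suc k - a)) + of_nat (Suc k - a) * (hbinom h a * hbinom g (Suc k - a))"
    if "a \<le> Suc k" for a
    using that by (simp add: distrib_right[symmetric] of_nat_add[symmetric] del: of_nat_add of_nat_Suc)
  have hg: "h * hbinom g b = hbinom g b * h" for b using hbinom_commute[of g h b] assms by simp
  have "of_nat (Suc k) * ?V (Suc k) = (\<Sum>a\<le>Suc k. of_nat a * (hbinom h a * hbinom g (Suc k - a)))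
      + (\<Sum>a\<le>Suc k. of_nat (Suc k - a) * (hbinom h a * hbinom g (Suc k - a)))"
    unfolding sum_distrib_left sum.distrib[symmetric] by (rule sum.cong) (use split in auto)
  also have "(\<Sum>a\<le>Suc k. of_nat a * (hbinom h a * hbinom g (Suc k - a)))
      = (\<Sum>a\<le>k. (of_nat (Suc a) * hbinom h (Suc a)) * hbinom g (k - a))"
    by (subst sum.atMost_Suc_shift) (simp add: mult.assoc)
  also have "\<dots> = (\<Sum>a\<le>k. hbinom h a * hbinom g (k - a) * (h - of_nat a))"
    unfolding hbinom_Suc by (simp add: mult.assoc left_diff_distrib right_diff_distrib hg mult_of_nat_commute)
  also have "(\<Sum>a\<le>Suc k. of_nat (Suc k - a) * (hbinom h a * hbinom g (Suc k - a)))
      = (\<Sum>a\<le>k. of_nat (Suc k - a) * (hbinom h a * hbinom g (Suc k - a)))" by simp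
  also have "\<dots> = (\<Sum>a\<le>k. hbinom h a * hbinom g (k - a) * (g - of_nat (k - a)))"
  proof (rule sum.cong[OF refl])
    fix a assume "a \<in> {..k}"
    then have "Suc k - a = Suc (k - a)" by auto
    then show "of_nat (Suc k - a) * (hbinom h a * hbinom g (Suc k - a)) = hbinom h a * hbinom g (k - a) * (g - of_nat (k - a))"
      by (simp only: of_nat_left_commute[symmetric] hbinom_Suc mult.assoc)
  qed
  also have "(\<Sum>a\<le>k. hbinom h a * hbinom g (k - a) * (h - of_nat a))
      + (\<Sum>a\<le>k. hbinom h a * hbinom g (k - a) * (g - of_nat (k - a))) = ?V k * (h + g - of_nat k)"
    unfolding sum_distrib_right sum.distrib[symmetric] distrib_left[symmetric]
    by (rule sum.cong) (auto simp: of_nat_diff add_diff_eq)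
  also have "\<dots> = of_nat (Suc k) * hbinom (h + g) (Suc k)" unfolding hbinom_Suc Suc ..
  finally show ?case by (rule ralg_cancel_Suc[symmetric])
qed simp

text \<open>
  Vandermonde for $h+(-h)=0$ expresses the binomial of $-h$ through those of $h$ and smaller ones of $-h$.
\<close>

lemma hbinom_uminus_in_hspan: "hbinom (- h) k \<in> hspan h (Suc k)"
proof (induction k rule: less_induct)
  case (less k)
  show ?case
  proof (cases k)
    case 0 then show ?thesis using hbinom_in_hspan[of 0 "Suc 0" h] by simp
  next
    case (Suc m)
    have "hbinom (0 :: ('a, 'b) ralg) k = 0"
      using hbinom_top[of m "- 1 :: ('a, 'b) ralg"] ralg_cancel_Suc[of m "hbinom (0 :: ('a, 'b) ralg) k" 0] by (simp add: Suc)
    then have "0 = (\<Sum>a\<le>k. hbinom h a * hbinom (- h) (k - a))"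
      using hbinom_vandermonde[of h "- h" k] by simp
    also have "\<dots> = hbinom (- h) k + (\<Sum>a\<le>m. hbinom h (Suc a) * hbinom (- h) (m - a))"
      unfolding Suc by (subst sum.atMost_Suc_shift) simp
    finally have "hbinom (- h) k = - (\<Sum>a\<le>m. hbinom h (Suc a) * hbinom (- h) (m - a))"
      by (simp add: eq_neg_iff_add_eq_0)
    moreover have "(\<Sum>a\<le>m. hbinom h (Suc a) * hbinom (- h) (m - a)) \<in> hspan h (Suc k)"
      unfolding hspan_def
    proof (rule int_module.span_sum)
      fix a assume "a \<in> {..m}"
      then show "hbinom h (Suc a) * hbinom (- h) (m - a) \<in> zspan {hbinom h j | j. j < Suc k}"
        using hspan_mult[OF hbinom_in_hspan[OF lessI] less[of "m - a"], of "Suc a" "Suc k"] Suc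
        by (simp add: hspan_def)
    qed
    ultimately show ?thesis unfolding hspan_def by (simp add: int_module.span_neg)
  qed
qed

text \<open>
  Binomials of $h_i-h_j+m$ occur in the $\mathfrak{sl}_2$-formula; this expands them integrally in the binomials of $h_i$ and $h_j$.
\<close>

lemma hbinom_diff_expand:
  assumes "h * g = g * h"
  shows "hbinom (h - g + of_int m) k \<in> zspan {hbinom h a * hbinom g b | a b. a + b \<le> k}"
proof -
  have "h * (- g + of_int m) = (- g + of_int m) * h" using assms by (simp add: left_diff_distrib right_diff_distrib mult_of_int_commute)
  from hbinom_vandermonde[OF this] have "hbinom (h - g + of_int m) k = (\<Sum>a\<le>k. hbinom h a * hbinom (- g + of_int m) (k - a))"
    by (simp add: algebra_simps)
  also have "\<dots> \<in> zspan {hbinom h a * hbinom g b | a b. a + b \<le> k}"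
  proof (rule int_module.span_sum)
    fix a assume a: "a \<in> {..k}"
    have "hspan (- g) (Suc (k - a)) \<subseteq> hspan g (Suc (k - a))"
      unfolding hspan_def[of "- g"]
    proof (rule int_module.span_minimal)
      show "{hbinom (- g) j | j. j < Suc (k - a)} \<subseteq> hspan g (Suc (k - a))"
      proof clarify
        fix j assume "j < Suc (k - a)"
        then show "hbinom (- g) j \<in> hspan g (Suc (k - a))"
          using hbinom_uminus_in_hspan[of g j] hspan_mono[of "Suc j" "Suc (k - a)" g] by auto
      qed
    qed (simp add: hspan_def)
    then have "hbinom (- g + of_int m) (k - a) \<in> hspan g (Suc (k - a))" using hbinom_shift_in_hspan by blast
    then show "hbinom h a * hbinom (- g + of_int m) (k - a) \<in> zspan {hbinom h a * hbinom g b | a b. a + b \<le> k}"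
      unfolding hspan_def
    proof (elim zspan_mult_left[rotated], elim CollectE exE conjE)
      fix y j assume "y = hbinom g j" "j < Suc (k - a)"
      then show "hbinom h a * y \<in> zspan {hbinom h a * hbinom g b | a b. a + b \<le> k}"
        using a by (intro int_module.span_base CollectI exI[of _ a] exI[of _ j]) auto
    qed
  qed
  finally show ?thesis .
qed

text \<open>
  The exponential of $\mathrm{ad}\,x$, with the divided powers $\frac1{k!}(\mathrm{ad}\,x)^k(y_0)=y_k$ given in advance.
\<close>

lemma divpow_ad:
  assumes "\<And>k. com x (y k) = of_nat (Suc k) * y (Suc k)"
  shows "divpow x r * y 0 = (\<Sum>k\<le>r. y k * divpow x (r - k))"
proof (induction r)
  case (Suc r)
  have xy: "x * y k = y k * x + of_nat (Suc k) * y (Suc k)" for k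
    using assms[of k] by (simp only: com_def) (simp add: algebra_simps)
  have "of_nat (Suc r) * (divpow x (Suc r) * y 0) = x * (divpow x r * y 0)"
    by (simp only: mult.assoc[symmetric] divpow_Suc)
  also have "\<dots> = (\<Sum>k\<le>r. y k * (x * divpow x (r - k))) + (\<Sum>k\<le>r. of_nat (Suc k) * (y (Suc k) * divpow x (r - k)))"
    unfolding Suc sum_distrib_left sum.distrib[symmetric]
    by (rule sum.cong[OF refl]) (simp only: mult.assoc[symmetric] xy distrib_right)
  also have "(\<Sum>k\<le>r. y k * (x * divpow x (r - k))) = (\<Sum>k\<le>r. of_nat (Suc r - k) * (y k * divpow x (Suc r - k)))"
  proof (rule sum.cong[OF refl])
    fix k assume "k \<in> {..r}"
    then have "Suc r - k = Suc (r - k)" by auto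
    then show "y k * (x * divpow x (r - k)) = of_nat (Suc r - k) * (y k * divpow x (Suc r - k))"
      by (simp only: of_nat_left_commute[symmetric] divpow_Suc)
  qed
  also have "\<dots> = (\<Sum>k\<le>Suc r. of_nat (Suc r - k) * (y k * divpow x (Suc r - k)))" by simp
  also have "(\<Sum>k\<le>r. of_nat (Suc k) * (y (Suc k) * divpow x (r - k)))
      = (\<Sum>k\<le>Suc r. of_nat k * (y k * divpow x (Suc r - k)))" by (subst sum.atMost_Suc_shift) simp
  also have "(\<Sum>k\<le>Suc r. of_nat (Suc r - k) * (y k * divpow x (Suc r - k)))
      + (\<Sum>k\<le>Suc r. of_nat k * (y k * divpow x (Suc r - k))) = of_nat (Suc r) * (\<Sum>k\<le>Suc r. y k * divpow x (Suc r - k))"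
    unfolding sum_distrib_left sum.distrib[symmetric]
    by (rule sum.cong[OF refl]) (simp add: distrib_right[symmetric] of_nat_add[symmetric] del: of_nat_add of_nat_Suc)
  finally show ?case by (rule ralg_cancel_Suc)
qed simp

lemma divpow_weight:
  assumes "h * x = x * (h + of_int m)"
  shows "h * divpow x r = divpow x r * (h + of_int (int r * m))"
proof (induction r)
  case (Suc r)
  have "of_nat (Suc r) * (h * divpow x (Suc r)) = h * divpow x r * x"
    by (simp only: of_nat_left_commute[symmetric] divpow_Suc' mult.assoc)
  also have "\<dots> = divpow x r * (h * x + of_int (int r * m) * x)" unfolding Suc by (simp only: mult.assoc distrib_right)
  also have "\<dots> = divpow x r * (x * (h + of_int m + of_int (int r * m)))"
    unfolding assms mult_of_int_commute[of _ x] by (simp only: distrib_left)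
  also have "h + of_int m + of_int (int r * m) = h + of_int (int (Suc r) * m)" by (simp add: algebra_simps)
  also have "divpow x r * (x * (h + of_int (int (Suc r) * m))) = of_nat (Suc r) * (divpow x (Suc r) * (h + of_int (int (Suc r) * m)))"
    by (simp only: mult.assoc[symmetric] divpow_Suc')
  finally show ?case by (rule ralg_cancel_Suc)
qed simp

lemma divpow_raise:
  assumes "com x y = z" "z * y = y * z"
  shows "com x (divpow y (Suc m)) = divpow y m * z"
proof (induction m)
  case 0 show ?case using assms by simp
next
  case (Suc m)
  have zd: "z * divpow y k = divpow y k * z" for k
  proof (induction k)
    case (Suc k)
    have "of_nat (Suc k) * (z * divpow y (Suc k)) = (z * divpow y k) * y"
      by (simp only: of_nat_left_commute[symmetric] divpow_Suc' mult.assoc)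
    also have "\<dots> = of_nat (Suc k) * (divpow y (Suc k) * z)"
      unfolding Suc by (simp only: mult.assoc assms(2)) (simp only: mult.assoc[symmetric] divpow_Suc')
    finally show ?case by (rule ralg_cancel_Suc)
  qed simp
  have "of_nat (Suc (Suc m)) * com x (divpow y (Suc (Suc m))) = com x (divpow y (Suc m) * y)"
    by (simp only: com_of_nat[symmetric] divpow_Suc')
  also have "\<dots> = com x (divpow y (Suc m)) * y + divpow y (Suc m) * z"
    using assms(1) by (simp add: com_def algebra_simps)
  also have "com x (divpow y (Suc m)) * y = (divpow y m * y) * z"
    unfolding Suc by (simp only: mult.assoc assms(2))
  also have "\<dots> = of_nat (Suc m) * (divpow y (Suc m) * z)"
    by (simp only: divpow_Suc'[symmetric] mult.assoc)
  also have "\<dots> + divpow y (Suc m) * z = of_nat (Suc (Suc m)) * (divpow y (Suc m) * z)"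
    by (simp add: algebra_simps)
  finally show ?case by (rule ralg_cancel_Suc)
qed

lemma divpow_commute: "x * y = y * x \<Longrightarrow> divpow x r * divpow y s = divpow y s * divpow x r"
proof -
  assume xy: "x * y = y * x"
  have "x ^ r * y ^ s = y ^ s * x ^ r"
    by (metis xy power_commuting_commutes)
  then show ?thesis
    unfolding divpow_def ralg.scale_mult_left[symmetric] ralg.scale_mult_right[symmetric] ralg.scale_scale
    by (simp only: mult.commute)
qed

text \<open>
  Normal ordering in the Heisenberg algebra $[x,y]=z$ with $z$ central; it applies to $A_{ij}$, $A_{jl}$ and $A_{il}$.
\<close>

lemma divpow_heisenberg:
  assumes "com x y = z" "com x z = 0" "z * y = y * z"
  shows "divpow x r * divpow y s =
    (\<Sum>k\<le>r. (if k \<le> s then divpow y (s - k) * divpow z k else 0) * divpow x (r - k))"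
proof -
  define f where "f k = (if k \<le> s then divpow y (s - k) * divpow z k else 0)" for k
  have xz: "x * z = z * x" using assms(2) by (simp add: com_def)
  have "com x (f k) = of_nat (Suc k) * f (Suc k)" for k
  proof -
    have xz_k: "com x (divpow z k) = 0" using divpow_commute[OF xz, of "Suc 0" k] by (simp add: com_def)
    have prod: "com x (divpow y m * divpow z k) = com x (divpow y m) * divpow z k" for m
      using xz_k by (simp add: com_def algebra_simps)
    consider "k < s" | "k = s" | "k > s" by linarith
    then show ?thesis
    proof cases
      case 1
      then have s: "s - k = Suc (s - Suc k)" by auto
      have "com x (f k) = divpow y (s - Suc k) * (z * divpow z k)"
        using 1 unfolding f_def by (simp add: prod s divpow_raise[OF assms(1,3)] mult.assoc)
      also have "\<dots> = of_nat (Suc k) * f (Suc k)"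
        using 1 by (simp only: divpow_Suc[symmetric] of_nat_left_commute f_def Suc_le_eq if_True)
      finally show ?thesis .
    next
      case 2 then show ?thesis using xz_k by (simp add: f_def)
    qed (simp add: f_def)
  qed
  from divpow_ad[of x f, OF this] show ?thesis by (simp add: f_def)
qed

text \<open>
  Kostant's commutation formula for the divided powers of $e$ and $f$; induction on $r$, after multiplication by $r+1$.
\<close>

lemma divpow_sl2:
  assumes ef: "com e f = h" and he: "h * e = e * (h + 2)" and hf: "h * f = f * (h - 2)"
  shows "divpow e r * divpow f s = (\<Sum>k\<le>r. (if k \<le> s then divpow f (s - k) else 0)
    * hbinom (h + of_int (2 * int k - int r - int s)) k * divpow e (r - k))"
proof -
  define g where "g k = (if k \<le> s then divpow f (s - k) else 0)" for k
  \<comment> \<open>The case of a single $e$.\<close>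
  have e_f: "e * divpow f (Suc m) = divpow f (Suc m) * e + divpow f m * (h - of_nat m)" for m
  proof (induction m)
    case 0 show ?case using ef by (simp add: com_def algebra_simps)
  next
    case (Suc m)
    have "of_nat (Suc (Suc m)) * (e * divpow f (Suc (Suc m))) = e * divpow f (Suc m) * f"
      by (simp only: of_nat_left_commute[symmetric] divpow_Suc' mult.assoc)
    also have "\<dots> = divpow f (Suc m) * (e * f) + divpow f m * ((h - of_nat m) * f)"
      unfolding Suc by (simp only: distrib_right mult.assoc)
    also have "e * f = f * e + h" using ef by (simp add: com_def algebra_simps)
    also have "(h - of_nat m) * f = f * (h - 2 - of_nat m)"
      by (simp add: left_diff_distrib right_diff_distrib hf mult_of_nat_commute)
    also have "divpow f (Suc m) * (f * e + h) + divpow f m * (f * (h - 2 - of_nat m))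
        = of_nat (Suc (Suc m)) * (divpow f (Suc (Suc m)) * e) + (divpow f (Suc m) * h
          + of_nat (Suc m) * (divpow f (Suc m) * (h - 2 - of_nat m)))"
      by (simp only: distrib_left mult.assoc[symmetric] divpow_Suc' add.assoc)
    also have "divpow f (Suc m) * h + of_nat (Suc m) * (divpow f (Suc m) * (h - 2 - of_nat m))
        = of_nat (Suc (Suc m)) * (divpow f (Suc m) * (h - of_nat (Suc m)))"
    proof -
      have "h + of_nat (Suc m) * (h - 2 - of_nat m) = of_nat (Suc (Suc m)) * (h - of_nat (Suc m))"
        by (simp add: algebra_simps mult_2_right)
      then have "divpow f (Suc m) * (h + of_nat (Suc m) * (h - 2 - of_nat m))
          = divpow f (Suc m) * (of_nat (Suc (Suc m)) * (h - of_nat (Suc m)))" by (simp only:)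
      then show ?thesis by (simp only: distrib_left of_nat_left_commute[of "divpow f (Suc m)"])
    qed
    finally have "of_nat (Suc (Suc m)) * (e * divpow f (Suc (Suc m)))
        = of_nat (Suc (Suc m)) * (divpow f (Suc (Suc m)) * e + divpow f (Suc m) * (h - of_nat (Suc m)))"
      by (simp only: distrib_left)
    then show ?case by (rule ralg_cancel_Suc)
  qed
  have e_g: "e * g k = g k * e + g (Suc k) * (h + of_int (int k + 1 - int s))" for k
  proof -
    consider "k < s" | "k = s" | "k > s" by linarith
    then show ?thesis
    proof cases
      case 1
      then have s: "s - k = Suc (s - Suc k)" by auto
      have "h - of_nat (s - Suc k) = h + of_int (int k + 1 - int s)" using 1 by (simp add: of_nat_diff)
      then show ?thesis using 1 e_f[of "s - Suc k"] unfolding g_def by (simp add: s Suc_le_eq of_nat_diff algebra_simps)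
    qed (simp_all add: g_def)
  qed
  have e_h: "e * hbinom (h + of_int c) k = hbinom (h + of_int (c - 2)) k * e" for c k
  proof -
    have "(h + of_int (c - 2)) * e = e * (h + of_int (c - 2) + of_int 2)"
      by (simp add: distrib_left distrib_right left_diff_distrib right_diff_distrib he mult_of_int_commute mult_2 mult_2_right)
    from hbinom_weight[OF this, of k] show ?thesis by simp
  qed
  \<comment> \<open>The recursion that the coefficients of the formula have to satisfy when $r$ increases by one.\<close>
  have key: "of_nat (Suc r - k) * hbinom N k + (if k = 0 then 0 else (N + of_int (int r - int k + 2)) * hbinom N (k - 1))
      = of_nat (Suc r) * hbinom (N + 1) k" if "k \<le> Suc r" for N k r
  proof (cases k)
    case (Suc j)
    have *: "N * hbinom N j = hbinom N j * N" by (rule hbinom_commute[symmetric]) simp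
    have "of_nat (Suc r) * hbinom (N + 1) (Suc j) = of_nat (Suc r) * hbinom N (Suc j) + of_nat (Suc r) * hbinom N j"
      by (simp only: hbinom_pascal distrib_left)
    also have "of_nat (Suc r) * hbinom N (Suc j) = of_nat (r - j) * hbinom N (Suc j) + of_nat (Suc j) * hbinom N (Suc j)"
      using that Suc by (simp only: distrib_right[symmetric] of_nat_add[symmetric]) simp
    also have "of_nat (Suc j) * hbinom N (Suc j) = hbinom N j * (N - of_nat j)" by (rule hbinom_Suc)
    finally show ?thesis
      using that Suc * by (simp add: of_nat_diff algebra_simps mult_of_nat_commute[of j "hbinom N j"])
  qed simp
  show ?thesis
    unfolding g_def[symmetric]
  proof (induction r)
    case 0 show ?case by (simp add: g_def)
  next
    case (Suc r)
    define N where "N k = h + of_int (2 * int k - int r - int s - 2)" for k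
    have Neq: "N (Suc k) + of_int (int r - int (Suc k) + 2) = h + of_int (int k + 1 - int s)" for k
    proof -
      have eq: "2 * int (Suc k) - int r - int s - 2 + (int r - int (Suc k) + 2) = int k + 1 - int s" by simp
      show ?thesis unfolding N_def add.assoc[of h] of_int_add[symmetric] eq ..
    qed
    have "of_nat (Suc r) * (divpow e (Suc r) * divpow f s) = e * (divpow e r * divpow f s)"
      by (simp only: mult.assoc[symmetric] divpow_Suc)
    also have "\<dots> = (\<Sum>k\<le>r. e * g k * hbinom (h + of_int (2 * int k - int r - int s)) k * divpow e (r - k))"
      unfolding Suc sum_distrib_left by (simp only: mult.assoc)
    also have "\<dots> = (\<Sum>k\<le>r. g k * (hbinom (N k) k * (e * divpow e (r - k))))
        + (\<Sum>k\<le>r. g (Suc k) * ((h + of_int (int k + 1 - int s)) * hbinom (N (Suc k)) k * divpow e (r - k)))"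
      unfolding sum.distrib[symmetric]
    proof (rule sum.cong[OF refl])
      fix k
      have "e * g k * hbinom (h + of_int (2 * int k - int r - int s)) k * divpow e (r - k)
          = g k * (e * hbinom (h + of_int (2 * int k - int r - int s)) k) * divpow e (r - k)
            + g (Suc k) * ((h + of_int (int k + 1 - int s)) * hbinom (h + of_int (2 * int k - int r - int s)) k * divpow e (r - k))"
        unfolding e_g by (simp only: distrib_right mult.assoc)
      moreover have "h + of_int (2 * int k - int r - int s) = N (Suc k)" "h + of_int (2 * int k - int r - int s - 2) = N k"
        by (simp_all add: N_def algebra_simps)
      ultimately show "e * g k * hbinom (h + of_int (2 * int k - int r - int s)) k * divpow e (r - k)
          = g k * (hbinom (N k) k * (e * divpow e (r - k)))
            + g (Suc k) * ((h + of_int (int k + 1 - int s)) * hbinom (N (Suc k)) k * divpow e (r - k))"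
        unfolding e_h by (simp only: mult.assoc)
    qed
    also have "(\<Sum>k\<le>r. g k * (hbinom (N k) k * (e * divpow e (r - k))))
        = (\<Sum>k\<le>r. g k * (of_nat (Suc r - k) * hbinom (N k) k * divpow e (Suc r - k)))"
    proof (rule sum.cong[OF refl])
      fix k assume "k \<in> {..r}"
      then have k: "Suc r - k = Suc (r - k)" by auto
      have "hbinom (N k) k * (e * divpow e (r - k)) = hbinom (N k) k * (of_nat (Suc r - k) * divpow e (Suc r - k))"
        unfolding k divpow_Suc ..
      also have "\<dots> = of_nat (Suc r - k) * hbinom (N k) k * divpow e (Suc r - k)"
        by (simp only: of_nat_left_commute mult.assoc)
      finally show "g k * (hbinom (N k) k * (e * divpow e (r - k)))
          = g k * (of_nat (Suc r - k) * hbinom (N k) k * divpow e (Suc r - k))" by (simp only:)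
    qed
    also have "\<dots> = (\<Sum>k\<le>Suc r. g k * (of_nat (Suc r - k) * hbinom (N k) k * divpow e (Suc r - k)))" by simp
    also have "(\<Sum>k\<le>r. g (Suc k) * ((h + of_int (int k + 1 - int s)) * hbinom (N (Suc k)) k * divpow e (r - k)))
        = (\<Sum>k\<le>Suc r. g k * ((if k = 0 then 0 else (N k + of_int (int r - int k + 2)) * hbinom (N k) (k - 1)) * divpow e (Suc r - k)))"
      by (subst sum.atMost_Suc_shift)
        (simp only: simp_thms if_True nat.simps if_False Neq diff_Suc_1 diff_Suc_Suc mult_zero_left mult_zero_right add_0_left)
    also have "(\<Sum>k\<le>Suc r. g k * (of_nat (Suc r - k) * hbinom (N k) k * divpow e (Suc r - k)))
        + (\<Sum>k\<le>Suc r. g k * ((if k = 0 then 0 else (N k + of_int (int r - int k + 2)) * hbinom (N k) (k - 1)) * divpow e (Suc r - k)))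
        = (\<Sum>k\<le>Suc r. g k * (of_nat (Suc r) * hbinom (N k + 1) k * divpow e (Suc r - k)))"
      unfolding sum.distrib[symmetric]
      by (rule sum.cong[OF refl]) (simp only: distrib_left[symmetric] distrib_right[symmetric] key atMost_iff)
    also have "\<dots> = of_nat (Suc r) * (\<Sum>k\<le>Suc r. g k * hbinom (h + of_int (2 * int k - int (Suc r) - int s)) k * divpow e (Suc r - k))"
      unfolding sum_distrib_left
    proof (rule sum.cong[OF refl])
      fix k
      have "N k + 1 = h + of_int (2 * int k - int (Suc r) - int s)" by (simp add: N_def algebra_simps)
      then show "g k * (of_nat (Suc r) * hbinom (N k + 1) k * divpow e (Suc r - k))
          = of_nat (Suc r) * (g k * hbinom (h + of_int (2 * int k - int (Suc r) - int s)) k * divpow e (Suc r - k))"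
        by (simp only: of_nat_left_commute mult.assoc)
    qed
    finally show ?case by (rule ralg_cancel_Suc)
  qed
qed


section \<open>Straightening of Kostant monomials\<close>

text \<open>
  Besides the roots, the symbols \<^term>\<open>Diff i i\<close> are admitted; they index the elements $H_i$, so that all Kostant letters are treated alike.
\<close>

definition roots :: "nat \<Rightarrow> root set"
  where "roots n = {Diff i j | i j. i \<in> {1..n} \<and> j \<in> {1..n}} \<union> Phi_m1 n \<union> Phi_1 n"

lemma roots_simps [simp]:
  "Diff i j \<in> roots n \<longleftrightarrow> i \<in> {1..n} \<and> j \<in> {1..n}"
  "Plus i j \<in> roots n \<longleftrightarrow> i \<in> {1..n} \<and> j \<in> {1..n} \<and> i \<le> j"
  "Minus i j \<in> roots n \<longleftrightarrow> i \<in> {1..n} \<and> j \<in> {1..n} \<and> i < j"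
  by (auto simp: roots_def Phi_m1_def Phi_1_def)

fun pn_vec :: "(nat \<Rightarrow> nat \<Rightarrow> ('k::field_char_0, 'n::finite) ralg) \<Rightarrow> (nat \<Rightarrow> nat \<Rightarrow> ('k, 'n) ralg) \<Rightarrow>
    (nat \<Rightarrow> nat \<Rightarrow> ('k, 'n) ralg) \<Rightarrow> root \<Rightarrow> ('k, 'n) ralg" where
  "pn_vec A S T (Diff i j) = A i j"
| "pn_vec A S T (Plus i j) = (if i = j then scale_ralg (1 / 2) (S i i) else S i j)"
| "pn_vec A S T (Minus i j) = T i j"

fun kostant_letter :: "(root \<Rightarrow> ('k::field_char_0, 'n::finite) ralg) \<Rightarrow> root \<Rightarrow> nat \<Rightarrow> ('k, 'n) ralg" where
  "kostant_letter X (Diff i j) r = (if i = j then hbinom (X (Diff i i)) r else divpow (X (Diff i j)) r)"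
| "kostant_letter X z r = X z ^ r"

definition odd_root :: "root \<Rightarrow> bool" where "odd_root z \<longleftrightarrow> (\<forall>i j. z \<noteq> Diff i j)"

locale ralg_family =
  fixes n :: nat and A S T :: "nat \<Rightarrow> nat \<Rightarrow> ('k::field_char_0, 'n::finite) ralg"
  assumes fam: "pn_family n A S T"
begin

abbreviation "X \<equiv> pn_vec A S T"

sublocale straightening "kostant_letter X" "roots n"
proof
  show "kostant_letter X z 0 = 1" for z by (cases z) auto
qed

lemmas D = pn_familyD[OF fam]

lemma A_in_W: "i \<in> {1..n} \<Longrightarrow> j \<in> {1..n} \<Longrightarrow> A i j \<in> W 2"
  using v_in_W[of "Diff i j" 1 2] by (auto split: if_splits)

lemma divpow_in_W: "i \<in> {1..n} \<Longrightarrow> j \<in> {1..n} \<Longrightarrow> i \<noteq> j \<Longrightarrow> r < d \<Longrightarrow> divpow (A i j) r \<in> W d"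
  using v_in_W[of "Diff i j" r d] by auto

lemma hbinom_in_W: "i \<in> {1..n} \<Longrightarrow> r < d \<Longrightarrow> hbinom (A i i) r \<in> W d"
  using v_in_W[of "Diff i i" r d] by auto

lemma hspan_in_W: "i \<in> {1..n} \<Longrightarrow> hspan (A i i) d \<subseteq> W d"
  unfolding hspan_def W_def
  by (intro int_module.span_minimal int_module.subspace_span subsetI) (use hbinom_in_W in \<open>auto simp: W_def\<close>)

lemma S_in_W: "i \<in> {1..n} \<Longrightarrow> j \<in> {1..n} \<Longrightarrow> i \<noteq> j \<Longrightarrow> S i j \<in> W 2"
proof -
  assume ij: "i \<in> {1..n}" "j \<in> {1..n}" "i \<noteq> j"
  then have "S i j = S (min i j) (max i j)" using D(2)[OF ij(1,2)] by (auto simp: min_def max_def)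
  moreover have "S (min i j) (max i j) \<in> W 2"
    using v_in_W[of "Plus (min i j) (max i j)" 1 2] ij by (auto simp: min_def max_def split: if_splits)
  ultimately show ?thesis by simp
qed

lemma half_S_in_W: "i \<in> {1..n} \<Longrightarrow> scale_ralg (1 / 2) (S i i) \<in> W 2"
  using v_in_W[of "Plus i i" 1 2] by auto

lemma half_double: "scale_ralg (1 / 2) x + scale_ralg (1 / 2) x = (x :: ('k, 'n) ralg)"
  by (simp flip: ralg.scale_left_distrib)

lemma S_diag_in_W: "i \<in> {1..n} \<Longrightarrow> S i i \<in> W 2"
  using W_add[OF half_S_in_W half_S_in_W, of i i] by (simp add: half_double)

lemma S_any_in_W: "i \<in> {1..n} \<Longrightarrow> j \<in> {1..n} \<Longrightarrow> S i j \<in> W 2"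
  using S_in_W S_diag_in_W by (cases "i = j") auto

lemma T_in_W: "i \<in> {1..n} \<Longrightarrow> j \<in> {1..n} \<Longrightarrow> T i j \<in> W 2"
proof -
  assume ij: "i \<in> {1..n}" "j \<in> {1..n}"
  consider "i < j" | "i = j" | "j < i" by linarith
  then show ?thesis
  proof cases
    case 1 then show ?thesis using v_in_W[of "Minus i j" 1 2] ij by auto
  next
    case 2 then show ?thesis using D(3)[OF ij(1)] by simp
  next
    case 3 then show ?thesis using v_in_W[of "Minus j i" 1 2] ij D(4)[OF ij] W_minus by auto
  qed
qed

lemma com_scale: "com x (scale_ralg c y) = scale_ralg c (com x (y :: ('k, 'n) ralg))"
  by (simp add: com_def ralg.scale_right_diff_distrib flip: ralg.scale_mult_left ralg.scale_mult_right)

lemma acom_scale: "acom (scale_ralg c x) y = scale_ralg c (acom x (y :: ('k, 'n) ralg))"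
  "acom x (scale_ralg c y) = scale_ralg c (acom x y)"
  by (simp_all add: acom_def ralg.scale_right_distrib flip: ralg.scale_mult_left ralg.scale_mult_right)

lemma odd_root_cases:
  assumes "odd_root z" "z \<in> roots n"
  obtains i where "z = Plus i i" "i \<in> {1..n}" | i j where "z = Plus i j" "i \<in> {1..n}" "j \<in> {1..n}" "i < j"
  | i j where "z = Minus i j" "i \<in> {1..n}" "j \<in> {1..n}" "i < j"
  using assms by (cases z) (auto simp: odd_root_def le_less)

lemma odd_letter: "odd_root z \<Longrightarrow> kostant_letter X z r = X z ^ r"
  by (cases z) (auto simp: odd_root_def)

lemma odd_in_W: "odd_root z \<Longrightarrow> z \<in> roots n \<Longrightarrow> X z \<in> W 2"
  using v_in_W[of z 1 2] odd_letter[of z 1] by auto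

lemma odd_acom: "odd_root z \<Longrightarrow> odd_root z' \<Longrightarrow> z \<in> roots n \<Longrightarrow> z' \<in> roots n \<Longrightarrow> acom (X z) (X z') \<in> W 2"
proof -
  have AA: "(if P then A i j else 0) \<in> W 2" if "i \<in> {1..n}" "j \<in> {1..n}" for P i j using A_in_W that by simp
  have ST: "acom (S i j) (T k l) \<in> W 2" if "i \<in> {1..n}" "j \<in> {1..n}" "k \<in> {1..n}" "l \<in> {1..n}" for i j k l
    unfolding D(9)[OF that] odd_bracket_def using that by (intro W_add W_diff AA)
  have hST: "scale_ralg (1/2) (acom (S i i) (T k l)) \<in> W 2" if "i \<in> {1..n}" "k \<in> {1..n}" "l \<in> {1..n}" for i k l
  proof -
    have "acom (S i i) (T k l) = ((if i = k then A i l else 0) - (if i = l then A i k else 0))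
        + ((if i = k then A i l else 0) - (if i = l then A i k else 0))"
      unfolding D(9)[OF that(1,1,2,3)] by (simp add: odd_bracket_def)
    then have "scale_ralg (1/2) (acom (S i i) (T k l)) = (if i = k then A i l else 0) - (if i = l then A i k else 0)"
      using half_double by (simp only: ralg.scale_right_distrib)
    then show ?thesis using that by (simp only:) (intro W_diff AA)
  qed
  have TS: "acom (T k l) (S i j) \<in> W 2" if "i \<in> {1..n}" "j \<in> {1..n}" "k \<in> {1..n}" "l \<in> {1..n}" for i j k l
    using ST[OF that] by (simp only: acom_commute)
  have ThS: "scale_ralg (1/2) (acom (T k l) (S i i)) \<in> W 2" if "i \<in> {1..n}" "k \<in> {1..n}" "l \<in> {1..n}" for i k l
    using hST[OF that] by (simp only: acom_commute)
  assume z: "odd_root z" "odd_root z'" "z \<in> roots n" "z' \<in> roots n"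
  show ?thesis
    by (rule odd_root_cases[OF z(1,3)]; rule odd_root_cases[OF z(2,4)])
      (simp_all add: ST hST TS ThS D(7,8) acom_scale)
qed

lemma odd_square: "odd_root z \<Longrightarrow> z \<in> roots n \<Longrightarrow> X z * X z = 0"
proof -
  have sq: "x * x = 0" if "acom x x = 0" for x :: "('k, 'n) ralg"
    using that torsion_freeD2[OF unital_algebra_torsion_free[OF ralg.unital_algebra_axioms]] by (simp add: acom_def)
  assume z: "odd_root z" "z \<in> roots n"
  show ?thesis by (rule odd_root_cases[OF z]; rule sq) (simp_all add: D(7,8) acom_scale)
qed

text \<open>
  In consequence, odd letters contribute with exponents $0$ and $1$ only.
\<close>

lemma odd_power: "odd_root z \<Longrightarrow> z \<in> roots n \<Longrightarrow> r \<ge> 2 \<Longrightarrow> X z ^ r = 0"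
proof -
  assume z: "odd_root z" "z \<in> roots n" and "r \<ge> 2"
  then obtain m where "r = Suc (Suc m)" by (metis add_2_eq_Suc le_Suc_ex)
  then show ?thesis using odd_square[OF z] by (simp flip: mult.assoc)
qed

text \<open>
  Commutation of two letters modulo lower degree; only pairs of odd roots will need a sign.
\<close>

definition swaps :: "root \<Rightarrow> root \<Rightarrow> bool"
  where "swaps z z' \<longleftrightarrow> (\<forall>r s. kostant_letter X z r * kostant_letter X z' s
    - kostant_letter X z' s * kostant_letter X z r \<in> W (r + s))"

lemma swaps_sym: "swaps z z' \<Longrightarrow> swaps z' z"
  unfolding swaps_def using W_minus by (metis add.commute minus_diff_eq)

lemma swaps_hbinom:
  assumes i: "i \<in> {1..n}" and y: "A i i * y = y * (A i i + of_int m)" "y \<in> W (Suc s)"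
  shows "hbinom (A i i) r * y - y * hbinom (A i i) r \<in> W (r + s)"
proof -
  have "hbinom (A i i + of_int m) r - hbinom (A i i) r \<in> W r" using hbinom_shift hspan_in_W[OF i] by blast
  from W_mult[OF y(2) this, of "r + s"] show ?thesis
    using hbinom_weight[OF y(1), of r] by (simp add: right_diff_distrib)
qed

lemma weight_of_com: "com h x = of_int m * x \<Longrightarrow> h * x = x * (h + of_int m :: ('k, 'n) ralg)"
  by (simp add: com_def distrib_left mult_of_int_commute diff_eq_eq)

lemma H_weight_A: "i \<in> {1..n} \<Longrightarrow> k \<in> {1..n} \<Longrightarrow> l \<in> {1..n} \<Longrightarrow>
    com (A i i) (A k l) = of_int ((if i = k then 1 else 0) - (if i = l then 1 else 0)) * A k l"
  using D(1)[of i i k l] by auto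

lemma swaps_H_odd:
  assumes i: "i \<in> {1..n}" and z: "odd_root z" "z \<in> roots n"
  shows "swaps (Diff i i) z"
proof -
  obtain m where m: "com (A i i) (X z) = of_int m * X z"
  proof (rule odd_root_cases[OF z])
    fix k assume k: "z = Plus k k" "k \<in> {1..n}"
    have "com (A i i) (X z) = of_int (if i = k then 2 else 0) * X z"
      using D(5)[OF i i k(2,2)] k by (simp add: com_scale ralg.scale_right_distrib mult_2)
    then show ?thesis by (rule that)
  next
    fix k l assume k: "z = Plus k l" "k \<in> {1..n}" "l \<in> {1..n}" "k < l"
    have "com (A i i) (X z) = of_int ((if i = k then 1 else 0) + (if i = l then 1 else 0)) * X z"
      using D(5)[OF i i k(2,3)] k by auto
    then show ?thesis by (rule that)
  next
    fix k l assume k: "z = Minus k l" "k \<in> {1..n}" "l \<in> {1..n}" "k < l"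
    have "com (A i i) (X z) = of_int (- (if i = k then 1 else 0) - (if i = l then 1 else 0)) * X z"
      using D(6)[OF i i k(2,3)] k by auto
    then show ?thesis by (rule that)
  qed
  show ?thesis
    unfolding swaps_def
  proof (intro allI)
    fix r s :: nat
    consider "s = 0" | "s = 1" | "s \<ge> 2" by linarith
    then show "kostant_letter X (Diff i i) r * kostant_letter X z s
        - kostant_letter X z s * kostant_letter X (Diff i i) r \<in> W (r + s)"
    proof cases
      case 2
      then show ?thesis
        using swaps_hbinom[OF i weight_of_com[OF m], of 1 r] odd_in_W[OF z] z by (simp add: odd_letter numeral_2_eq_2)
    qed (use odd_power[OF z] z in \<open>simp_all add: odd_letter\<close>)
  qed
qed

text \<open>
  For an odd root vector at most two applications of $\mathrm{ad}\,A_{ij}$ are nonzero, and half of the second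
  is again an integral combination of root vectors.
\<close>

lemma swaps_divpow_odd:
  assumes ij: "i \<in> {1..n}" "j \<in> {1..n}" "i \<noteq> j" and z: "odd_root z" "z \<in> roots n"
    and y: "com (A i j) (X z) = y1" "com (A i j) y1 = y2 + y2" "com (A i j) y2 = 0" "y1 \<in> W 2" "y2 \<in> W 2"
  shows "swaps (Diff i j) z"
  unfolding swaps_def
proof (intro allI)
  fix r s :: nat
  define f where "f k = (if k = 0 then X z else if k = 1 then y1 else if k = 2 then y2 else 0)" for k :: nat
  have f: "com (A i j) (f k) = of_nat (Suc k) * f (Suc k)" for k
  proof -
    consider "k = 0" | "k = 1" | "k = 2" | "k > 2" by linarith
    then show ?thesis by cases (use y in \<open>simp_all add: f_def mult_2\<close>)
  qed
  have fW: "f k \<in> W 2" for k using y odd_in_W[OF z] by (simp add: f_def)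
  have one: "divpow (A i j) r * f 0 - f 0 * divpow (A i j) r \<in> W (r + 1)"
  proof -
    have "divpow (A i j) r * f 0 - f 0 * divpow (A i j) r = (\<Sum>k\<in>{..r} - {0}. f k * divpow (A i j) (r - k))"
      unfolding divpow_ad[of "A i j" f, OF f] by (subst sum.remove[of _ 0]) auto
    moreover have "(\<Sum>k\<in>{..r} - {0}. f k * divpow (A i j) (r - k)) \<in> W (r + 1)"
      by (rule W_sum, rule W_mult[OF fW divpow_in_W[OF ij lessI]]) auto
    ultimately show ?thesis by (simp only:)
  qed
  consider "s = 0" | "s = 1" | "s \<ge> 2" by linarith
  then show "kostant_letter X (Diff i j) r * kostant_letter X z s
      - kostant_letter X z s * kostant_letter X (Diff i j) r \<in> W (r + s)"
    by cases (use one odd_power[OF z] z ij in \<open>simp_all add: odd_letter f_def\<close>)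
qed

lemma swaps_even_odd:
  assumes i: "i \<in> {1..n}" "j \<in> {1..n}" and z: "odd_root z" "z \<in> roots n"
  shows "swaps (Diff i j) z"
proof (cases "i = j")
  case True then show ?thesis using swaps_H_odd i z by simp
next
  case False
  note ij = i False
  show ?thesis
  proof (rule odd_root_cases[OF z])
    fix k assume k: "z = Plus k k" "k \<in> {1..n}"
    show ?thesis
      by (rule swaps_divpow_odd[OF ij z, of "if j = k then S i k else 0" "if j = k then scale_ralg (1/2) (S i i) else 0"])
        (use k ij D(5)[OF ij(1,2) k(2,2)] D(2)[OF ij(1) k(2)] D(5)[OF ij(1,2,1) k(2)] D(5)[OF ij(1,2,1,1)] in
          \<open>auto simp: com_scale ralg.scale_right_distrib half_double half_S_in_W S_in_W\<close>)
  next
    fix k l assume k: "z = Plus k l" "k \<in> {1..n}" "l \<in> {1..n}" "k < l"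
    show ?thesis
      by (rule swaps_divpow_odd[OF ij z, of "(if j = k then S i l else 0) + (if j = l then S k i else 0)" 0])
        (use k ij D(5)[OF ij(1,2) k(2,3)] D(5)[OF ij(1,2,1) k(3)] D(5)[OF ij(1,2) k(2) ij(1)] in
          \<open>auto simp: S_any_in_W split: if_splits\<close>)
  next
    fix k l assume k: "z = Minus k l" "k \<in> {1..n}" "l \<in> {1..n}" "k < l"
    show ?thesis
      by (rule swaps_divpow_odd[OF ij z, of "- (if i = k then T j l else 0) - (if i = l then T k j else 0)" 0])
        (use k ij D(6)[OF ij(1,2) k(2,3)] D(6)[OF ij(1,2,2) k(3)] D(6)[OF ij(1,2) k(2) ij(2)] D(3)[OF ij(2)] in
          \<open>auto simp: T_in_W com_minus W_minus split: if_splits\<close>)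
  qed
qed

lemma swaps_H_A:
  assumes i: "i \<in> {1..n}" and kl: "k \<in> {1..n}" "l \<in> {1..n}" "k \<noteq> l"
  shows "swaps (Diff i i) (Diff k l)"
  unfolding swaps_def
proof (intro allI)
  fix r s
  show "kostant_letter X (Diff i i) r * kostant_letter X (Diff k l) s
      - kostant_letter X (Diff k l) s * kostant_letter X (Diff i i) r \<in> W (r + s)"
    using swaps_hbinom[OF i divpow_weight[OF weight_of_com[OF H_weight_A[OF i kl(1,2)]]] divpow_in_W[OF kl lessI]] kl(3)
    by simp
qed

lemma swaps_H_H:
  assumes i: "i \<in> {1..n}" "k \<in> {1..n}"
  shows "swaps (Diff i i) (Diff k k)"
  unfolding swaps_def
proof (intro allI)
  fix r s
  have "A i i * A k k = A k k * A i i" using D(1)[OF i(1,1) i(2,2)] by (auto simp: com_def split: if_splits)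
  from hbinom_commute[OF hbinom_commute[OF this[symmetric], symmetric], of r s]
  show "kostant_letter X (Diff i i) r * kostant_letter X (Diff k k) s
      - kostant_letter X (Diff k k) s * kostant_letter X (Diff i i) r \<in> W (r + s)" by simp
qed

lemma swaps_heisenberg:
  assumes ij: "i \<in> {1..n}" "j \<in> {1..n}" "i \<noteq> j" and l: "l \<in> {1..n}" "j \<noteq> l" "i \<noteq> l"
  shows "swaps (Diff i j) (Diff j l)"
  unfolding swaps_def
proof (intro allI)
  fix r s
  have c: "com (A i j) (A j l) = A i l" "com (A i j) (A i l) = 0" "com (A i l) (A j l) = 0"
    using D(1)[OF ij(1,2,2) l(1)] D(1)[OF ij(1,2,1) l(1)] D(1)[OF ij(1) l(1) ij(2) l(1)] ij l by auto
  let ?f = "\<lambda>k. (if k \<le> s then divpow (A j l) (s - k) * divpow (A i l) k else 0) * divpow (A i j) (r - k)"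
  have eq: "divpow (A i j) r * divpow (A j l) s - divpow (A j l) s * divpow (A i j) r = sum ?f ({..r} - {0})"
    using divpow_heisenberg[OF c(1,2)] c(3) by (subst divpow_heisenberg[OF c(1,2)]) (auto simp: com_def sum.remove[of "{..r}" 0])
  have fW: "?f k \<in> W (r + s)" if "k \<in> {..r} - {0}" for k
  proof (cases "k \<le> s")
    case True
    have "divpow (A j l) (s - k) * divpow (A i l) k \<in> W (Suc s)"
      by (rule W_mult[OF divpow_in_W[OF ij(2) l(1,2) lessI] divpow_in_W[OF ij(1) l(1,3) lessI]]) (use True in auto)
    from W_mult[OF this divpow_in_W[OF ij lessI, of "r - k"], of "r + s"] show ?thesis using that True by auto
  qed simp
  have "sum ?f ({..r} - {0}) \<in> W (r + s)" by (rule W_sum) (rule fW)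
  from this[folded eq] show "kostant_letter X (Diff i j) r * kostant_letter X (Diff j l) s
      - kostant_letter X (Diff j l) s * kostant_letter X (Diff i j) r \<in> W (r + s)"
    using ij l by simp
qed

lemma swaps_sl2:
  assumes ij: "i \<in> {1..n}" "j \<in> {1..n}" "i \<noteq> j"
  shows "swaps (Diff i j) (Diff j i)"
  unfolding swaps_def
proof (intro allI)
  fix r s
  let ?h = "A i i - A j j"
  have ef: "com (A i j) (A j i) = ?h" using D(1)[OF ij(1,2,2,1)] by simp
  have "com ?h (A i j) = of_int 2 * A i j" "com ?h (A j i) = of_int (- 2) * A j i"
    using H_weight_A ij by (simp_all add: com_diff mult_2)
  from this[THEN weight_of_com] have he: "?h * A i j = A i j * (?h + 2)" and hf: "?h * A j i = A j i * (?h - 2)"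
    by simp_all
  have comm: "A i i * A j j = A j j * A i i" using D(1)[OF ij(1,1,2,2)] ij(3) by (simp add: com_def)
  have hW: "hbinom (?h + of_int m) k \<in> W (Suc k)" for m k
  proof -
    have "zspan {hbinom (A i i) a * hbinom (A j j) b | a b. a + b \<le> k} \<subseteq> W (Suc k)"
    proof -
      have "hbinom (A i i) a * hbinom (A j j) b \<in> W (Suc k)" if "a + b \<le> k" for a b
        by (rule W_mult[OF hbinom_in_W[OF ij(1) lessI] hbinom_in_W[OF ij(2) lessI]]) (use that in simp)
      then show ?thesis unfolding W_def by (intro int_module.span_minimal int_module.subspace_span) auto
    qed
    then show ?thesis using hbinom_diff_expand[OF comm] by blast
  qed
  let ?f = "\<lambda>k. (if k \<le> s then divpow (A j i) (s - k) else 0)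
    * hbinom (?h + of_int (2 * int k - int r - int s)) k * divpow (A i j) (r - k)"
  have eq: "divpow (A i j) r * divpow (A j i) s - divpow (A j i) s * divpow (A i j) r = sum ?f ({..r} - {0})"
    unfolding divpow_sl2[OF ef he hf] by (subst sum.remove[of _ 0]) auto
  have fW: "?f k \<in> W (r + s)" if "k \<in> {..r} - {0}" for k
  proof (cases "k \<le> s")
    case True
    have "divpow (A j i) (s - k) * hbinom (?h + of_int (2 * int k - int r - int s)) k \<in> W (Suc s)"
      by (rule W_mult[OF divpow_in_W[OF ij(2,1) ij(3)[symmetric] lessI] hW]) (use True in auto)
    from W_mult[OF this divpow_in_W[OF ij lessI, of "r - k"], of "r + s"] show ?thesis using that True by auto
  qed simp
  have "sum ?f ({..r} - {0}) \<in> W (r + s)" by (rule W_sum) (rule fW)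
  from this[folded eq] show "kostant_letter X (Diff i j) r * kostant_letter X (Diff j i) s
      - kostant_letter X (Diff j i) s * kostant_letter X (Diff i j) r \<in> W (r + s)"
    using ij by simp
qed

lemma swaps_even:
  assumes "i \<in> {1..n}" "j \<in> {1..n}" "k \<in> {1..n}" "l \<in> {1..n}" "Diff i j \<noteq> Diff k l"
  shows "swaps (Diff i j) (Diff k l)"
proof -
  consider "i = j" "k = l" | "i = j" "k \<noteq> l" | "i \<noteq> j" "k = l" | "i \<noteq> j" "k \<noteq> l" "j = k" "i = l"
    | "i \<noteq> j" "k \<noteq> l" "j = k" "i \<noteq> l" | "i \<noteq> j" "k \<noteq> l" "j \<noteq> k" "i = l" | "i \<noteq> j" "k \<noteq> l" "j \<noteq> k" "i \<noteq> l" by blast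
  then show ?thesis
  proof cases
    case 1 then show ?thesis using swaps_H_H assms by simp
  next
    case 2 then show ?thesis using swaps_H_A assms by simp
  next
    case 3 then show ?thesis using swaps_sym[OF swaps_H_A] assms by simp
  next
    case 4 then show ?thesis using swaps_sl2 assms by simp
  next
    case 5 then show ?thesis using swaps_heisenberg[of i j l] assms by simp
  next
    case 6 then show ?thesis using swaps_sym[OF swaps_heisenberg[of k l j]] assms by auto
  next
    case 7
    have "A i j * A k l = A k l * A i j" using D(1)[OF assms(1-4)] 7 by (simp add: com_def)
    from divpow_commute[OF this] show ?thesis using 7 by (simp add: swaps_def)
  qed
qed

lemma odd_swap:
  assumes z: "odd_root z" "z \<in> roots n" and z': "odd_root z'" "z' \<in> roots n"
  shows "\<exists>c. kostant_letter X z r * kostant_letter X z' s - of_int c * (kostant_letter X z' s * kostant_letter X z r) \<in> W (r + s)"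
proof -
  consider "r = 0 \<or> s = 0" | "r \<ge> 2" | "s \<ge> 2" | "r = 1" "s = 1" by linarith
  then show ?thesis
  proof cases
    case 1 then show ?thesis using z z' by (intro exI[of _ 1]) (auto simp: odd_letter)
  next
    case 4
    then show ?thesis
      using odd_acom[OF z(1) z'(1) z(2) z'(2)] z z'
      by (intro exI[of _ "- 1"]) (simp add: odd_letter acom_def numeral_2_eq_2)
  qed (use z z' odd_power in \<open>auto simp: odd_letter intro!: exI[of _ 1]\<close>)
qed

lemma kostant_swap:
  assumes "z \<in> roots n" "z' \<in> roots n" "z \<noteq> z'"
  shows "\<exists>c. kostant_letter X z r * kostant_letter X z' s - of_int c * (kostant_letter X z' s * kostant_letter X z r) \<in> W (r + s)"
proof (cases "odd_root z \<and> odd_root z'")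
  case True then show ?thesis using odd_swap assms by blast
next
  case False
  have even: "\<exists>i j. w = Diff i j" if "\<not> odd_root w" for w using that by (auto simp: odd_root_def)
  have "swaps z z'"
  proof (cases "odd_root z")
    case True
    with False obtain i j where "z' = Diff i j" using even by blast
    then show ?thesis using swaps_sym[OF swaps_even_odd] assms True by simp
  next
    case False
    then obtain i j where z: "z = Diff i j" using even by blast
    show ?thesis
    proof (cases "odd_root z'")
      case True then show ?thesis using swaps_even_odd assms z by simp
    next
      case False
      then obtain k l where "z' = Diff k l" using even by blast
      then show ?thesis using swaps_even[of i j k l] assms z by simp
    qed
  qed
  then show ?thesis unfolding swaps_def by (intro exI[of _ 1]) simp
qed

lemma kostant_merge:
  assumes "z \<in> roots n"
  shows "\<exists>c. kostant_letter X z r * kostant_letter X z s - of_int c * kostant_letter X z (r + s) \<in> W (r + s)"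
proof (cases "odd_root z")
  case True then show ?thesis by (intro exI[of _ 1]) (simp add: odd_letter power_add)
next
  case False
  then obtain i j where z: "z = Diff i j" by (auto simp: odd_root_def)
  show ?thesis
  proof (cases "i = j")
    case True
    have "hbinom (A i i) r * hbinom (A i i) s - of_nat ((r + s) choose s) * hbinom (A i i) (r + s) \<in> W (r + s)"
      using hbinom_mult[of "A i i" r s] hspan_in_W[of i "r + s"] assms z by auto
    then show ?thesis using z True by (intro exI[of _ "int ((r + s) choose s)"]) simp
  next
    case False then show ?thesis
      using z by (intro exI[of _ "int ((r + s) choose r)"]) (simp add: divpow_mult)
  qed
qed

theorem kostant_word_in_ordered_span:
  assumes "distinct zs" "set zs = roots n" "w \<in> words"
  shows "word w \<in> zspan (range (ordered zs))"
  by (rule word_in_ordered_span[OF kostant_merge kostant_swap assms])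

end


section \<open>Coproduct with the defining representation\<close>

definition idx_sign :: "int \<Rightarrow> 'k::field_char_0" where "idx_sign r = (if r > 0 then 1 else - 1)"

text \<open>
  The splitting of a matrix into its diagonal and off-diagonal blocks allows an action to be defined for all matrices, homogeneous or not.
\<close>

definition even_part :: "'k::field_char_0 smat \<Rightarrow> 'k smat"
  where "even_part X = (\<lambda>r s. if (r > 0) = (s > 0) then X r s else 0)"

definition odd_part :: "'k::field_char_0 smat \<Rightarrow> 'k smat"
  where "odd_part X = (\<lambda>r s. if (r > 0) = (s > 0) then 0 else X r s)"

lemma parts_pn:
  assumes "X \<in> pn n" shows "even_part X \<in> pn n" "odd_part X \<in> pn n"
proof -
  have "(- s > 0) = (- r > 0) \<longleftrightarrow> (r > 0) = (s > 0)" if "r \<in> idx n" "s \<in> idx n" for r s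
    using that by (auto simp: idx_def)
  then show "even_part X \<in> pn n" "odd_part X \<in> pn n"
    using assms unfolding pn_iff even_part_def odd_part_def by auto
qed

lemma parts_linear:
  "even_part (mat_add X Y) = mat_add (even_part X) (even_part Y)"
  "odd_part (mat_add X Y) = mat_add (odd_part X) (odd_part Y)"
  "even_part (mat_scale c X) = mat_scale c (even_part X)"
  "odd_part (mat_scale c X) = mat_scale c (odd_part X)"
  by (auto simp: even_part_def odd_part_def mat_add_def mat_scale_def fun_eq_iff)

lemma parts_homogeneous:
  "X \<in> pn_part n 0 \<Longrightarrow> even_part X = X" "X \<in> pn_part n 0 \<Longrightarrow> odd_part X = 0"
  "X \<in> pn_part n 1 \<Longrightarrow> even_part X = 0" "X \<in> pn_part n 1 \<Longrightarrow> odd_part X = X"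
  by (auto simp: even_part_def odd_part_def fun_eq_iff dest: pn_partD(2))

lemma mat_bracket_apply:
  "mat_bracket n p q X Y r s = (\<Sum>t\<in>idx n. X r t * Y t s) - koszul p q * (\<Sum>t\<in>idx n. Y r t * X t s)"
  by (simp add: mat_bracket_def mat_add_def mat_scale_def mat_mult_def)

lemma pn_part_mat_bracket:
  fixes X Y :: "'k::comm_ring_1 smat"
  assumes X: "X \<in> pn_part n p" and Y: "Y \<in> pn_part n q"
  shows "mat_bracket n p q X Y \<in> pn_part n (p + q)"
proof -
  have zero: "mat_bracket n p q X Y r s = 0" if "(if (r > 0) = (s > 0) then 0 else 1) \<noteq> p + q" for r s
  proof -
    have "X r t * Y t s = 0" "Y r t * X t s = 0" for t
      using pn_partD(2)[OF X, of r t] pn_partD(2)[OF Y, of t s] pn_partD(2)[OF Y, of r t] pn_partD(2)[OF X, of t s] that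
      by (cases "X r t = 0"; cases "Y t s = 0"; cases "Y r t = 0"; cases "X t s = 0"; auto split: if_splits)+
    then show ?thesis by (simp add: mat_bracket_apply)
  qed
  then show ?thesis using pn_mat_bracket[OF X Y] unfolding pn_part_def by blast
qed

lemma mat_apply: "mat_add X Y r s = X r s + Y r s" "mat_scale c X r s = c * X r s"
  by (simp_all add: mat_add_def mat_scale_def)

definition fscale :: "'k \<Rightarrow> (int \<Rightarrow> ('k::field_char_0, 'n::finite) upn) \<Rightarrow> int \<Rightarrow> ('k, 'n) upn"
  where "fscale c v = (\<lambda>r. scale_upn c (v r))"

text \<open>
  A function on the index set is an element of $V\otimes U$, where $V$ is the defining representation.  An element $X$ of
  $\mathfrak p(n)$ acts by $X\otimes1+1\otimes X$ with the sign rule for odd $X$; replacing the parity automorphism of $V$ by its negative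
  also gives a representation, and $\varepsilon=\pm1$ records this choice.
\<close>

definition coact :: "'k \<Rightarrow> 'k smat \<Rightarrow> (int \<Rightarrow> ('k::field_char_0, 'n::finite) upn) \<Rightarrow> int \<Rightarrow> ('k, 'n) upn"
  where "coact \<epsilon> X v = (\<lambda>r. (\<Sum>s\<in>idx CARD('n). scale_upn (X r s) (v s)) +
    upn_iota (even_part X) * v r + scale_upn (\<epsilon> * idx_sign r) (upn_iota (odd_part X) * v r))"

interpretation coact: free_action fscale "coact \<epsilon>" for \<epsilon> :: "'k::field_char_0"
proof
  fix a b :: 'k and u v :: "int \<Rightarrow> ('k, 'n::finite) upn" and X :: "'k smat"
  show "fscale a (u + v) = fscale a u + fscale a v" by (simp add: fscale_def fun_eq_iff upn.scale_right_distrib)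
  show "fscale (a + b) u = fscale a u + fscale b u" by (simp add: fscale_def fun_eq_iff upn.scale_left_distrib)
  show "fscale a (fscale b u) = fscale (a * b) u" by (simp add: fscale_def)
  show "fscale 1 u = u" by (simp add: fscale_def)
  show "coact \<epsilon> X (u + v) = coact \<epsilon> X u + coact \<epsilon> X v"
    by (simp add: coact_def fun_eq_iff upn.scale_right_distrib sum.distrib distrib_left)
  show "coact \<epsilon> X (fscale a u) = fscale a (coact \<epsilon> X u)"
    by (simp add: coact_def fscale_def fun_eq_iff upn.scale_right_distrib upn.scale_sum_right mult.commute
        flip: upn.scale_mult_right)
qed

text \<open>
  The sign with which an operator of parity $p$ passes the $r$-th basis vector.
\<close>

definition chi :: "'k::field_char_0 \<Rightarrow> bit \<Rightarrow> int \<Rightarrow> 'k"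
  where "chi \<epsilon> p r = (if p = 1 then \<epsilon> * idx_sign r else 1)"

lemma chi_add: "\<epsilon> * \<epsilon> = 1 \<Longrightarrow> chi \<epsilon> p r * chi \<epsilon> q r = chi \<epsilon> (p + q) r"
  by (auto simp: chi_def idx_sign_def)

lemma chi_koszul:
  "X \<in> pn_part n p \<Longrightarrow> X r s * chi \<epsilon> q s = koszul p q * chi \<epsilon> q r * (X r s :: 'k::field_char_0)"
  using pn_partD(2)[of X n p r s] by (cases "X r s = 0") (auto simp: chi_def idx_sign_def koszul_def split: if_splits)

lemma coact_homogeneous:
  fixes X :: "'k::field_char_0 smat" and v :: "int \<Rightarrow> ('k, 'n::finite) upn"
  assumes "X \<in> pn_part CARD('n) p"
  shows "coact \<epsilon> X v r = (\<Sum>s\<in>idx CARD('n). scale_upn (X r s) (v s)) + scale_upn (chi \<epsilon> p r) (upn_iota X * v r)"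
proof (cases "p = 0")
  case True then show ?thesis using assms by (simp add: coact_def parts_homogeneous upn_iota_zero chi_def)
next
  case False
  then have "p = 1" by simp
  then show ?thesis using assms by (simp add: coact_def parts_homogeneous upn_iota_zero chi_def)
qed

lemma coact_coact:
  fixes X Y :: "'k::field_char_0 smat" and v :: "int \<Rightarrow> ('k, 'n::finite) upn"
  assumes X: "X \<in> pn_part CARD('n) p" and Y: "Y \<in> pn_part CARD('n) q"
  shows "coact \<epsilon> X (coact \<epsilon> Y v) r =
    (\<Sum>t\<in>idx CARD('n). scale_upn (\<Sum>s\<in>idx CARD('n). X r s * Y s t) (v t)) +
    (\<Sum>s\<in>idx CARD('n). scale_upn (X r s * chi \<epsilon> q s) (upn_iota Y * v s)) +
    (\<Sum>s\<in>idx CARD('n). scale_upn (chi \<epsilon> p r * Y r s) (upn_iota X * v s)) +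
    scale_upn (chi \<epsilon> p r * chi \<epsilon> q r) (upn_iota X * upn_iota Y * v r)"
proof -
  have "(\<Sum>s\<in>idx CARD('n). scale_upn (X r s) (\<Sum>t\<in>idx CARD('n). scale_upn (Y s t) (v t)))
      = (\<Sum>t\<in>idx CARD('n). scale_upn (\<Sum>s\<in>idx CARD('n). X r s * Y s t) (v t))"
    unfolding upn.scale_sum_right upn.scale_sum_left upn.scale_scale by (rule sum.swap)
  then show ?thesis
    unfolding coact_homogeneous[OF X] coact_homogeneous[OF Y]
    by (simp add: upn.scale_right_distrib sum.distrib distrib_left sum_distrib_left upn.scale_sum_right mult.assoc
        add.assoc flip: upn.scale_mult_right)
qed

text \<open>
  The defining relations of $U(\mathfrak p(n))$ hold on $V\otimes U$; for the bracket relation the mixed terms cancel by the sign rule.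
\<close>

lemma coact_rels:
  fixes v :: "int \<Rightarrow> ('k::field_char_0, 'n::finite) upn"
  assumes e: "\<epsilon> * \<epsilon> = 1" and q: "q \<in> upn_rels CARD('n)"
  shows "coact.act \<epsilon> q v = 0"
  using q
proof cases
  case (add X Y)
  note p = parts_pn[OF add(2)] parts_pn[OF add(3)]
  show ?thesis
    unfolding add(1) coact.act_diff coact.act_add coact.act_fgen
    by (simp add: coact_def fun_eq_iff parts_linear upn_iota_add[OF p(1,3)] upn_iota_add[OF p(2,4)]
        mat_apply upn.scale_left_distrib upn.scale_right_distrib sum.distrib distrib_right)
next
  case (scale X c)
  note p = parts_pn[OF scale(2)]
  show ?thesis
    unfolding scale(1) coact.act_diff coact.act_mult coact.act_fconst coact.act_fgen
    by (simp add: coact_def fscale_def fun_eq_iff parts_linear upn_iota_scale[OF p(1)] upn_iota_scale[OF p(2)]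
        mat_apply upn.scale_right_distrib upn.scale_sum_right mult.commute flip: upn.scale_mult_left)
next
  case (bracket X p Y q')
  let ?n = "CARD('n)" and ?\<kappa> = "koszul p q' :: 'k"
  have act_koszul: "coact.act \<epsilon> (koszul p q' * w) v = fscale ?\<kappa> (coact.act \<epsilon> w v)" for w
    by (auto simp: koszul_def coact.act_minus fscale_def fun_eq_iff)
  have kk: "koszul q' p = ?\<kappa>" by (auto simp: koszul_def)
  let ?Z = "mat_bracket ?n p q' X Y"
  have br: "upn_iota ?Z = upn_iota X * upn_iota Y - scale_upn ?\<kappa> (upn_iota Y * upn_iota X :: ('k, 'n) upn)"
    unfolding upn_iota_bracket[OF bracket(2,3), symmetric] by (auto simp: scom_def koszul_def)
  have "coact \<epsilon> X (coact \<epsilon> Y v) r - scale_upn ?\<kappa> (coact \<epsilon> Y (coact \<epsilon> X v) r) = coact \<epsilon> ?Z v r" for r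
  proof -
    have c1: "X r s * chi \<epsilon> q' s = ?\<kappa> * (chi \<epsilon> q' r * X r s)" for s
      using chi_koszul[OF bracket(2), of r s \<epsilon> q'] by (simp add: mult.assoc)
    have c2: "?\<kappa> * (Y r s * chi \<epsilon> p s) = chi \<epsilon> p r * Y r s" for s
      using chi_koszul[OF bracket(3), of r s \<epsilon> p] kk by (auto simp: koszul_def)
    have "scale_upn ?\<kappa> (coact \<epsilon> Y (coact \<epsilon> X v) r) =
      (\<Sum>t\<in>idx ?n. scale_upn (?\<kappa> * (\<Sum>s\<in>idx ?n. Y r s * X s t)) (v t)) +
      (\<Sum>s\<in>idx ?n. scale_upn (chi \<epsilon> p r * Y r s) (upn_iota X * v s)) +
      (\<Sum>s\<in>idx ?n. scale_upn (X r s * chi \<epsilon> q' s) (upn_iota Y * v s)) +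
      scale_upn (chi \<epsilon> p r * chi \<epsilon> q' r) (scale_upn ?\<kappa> (upn_iota Y * upn_iota X) * v r)"
      unfolding coact_coact[OF bracket(3,2)] upn.scale_right_distrib upn.scale_sum_right upn.scale_scale c1 c2
      by (simp add: mult.commute mult.left_commute flip: upn.scale_mult_left)
    then show ?thesis
      unfolding coact_coact[OF bracket(2,3)] coact_homogeneous[OF pn_part_mat_bracket[OF bracket(2,3)]] br
        mat_bracket_apply chi_add[OF e, symmetric]
      by (simp add: upn.scale_left_diff_distrib sum_subtractf left_diff_distrib upn.scale_right_diff_distrib)
  qed
  then show ?thesis
    unfolding bracket(1) coact.act_diff act_koszul unfolding coact.act_mult coact.act_fgen
    by (simp add: fun_eq_iff fscale_def)
qed

text \<open>
  The matrix coefficients, in the first factor, of the homomorphism $U\to\mathrm{End}(V)\otimes U$ afforded by $V\otimes U$.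
\<close>

definition comult :: "'k \<Rightarrow> int \<Rightarrow> int \<Rightarrow> ('k::field_char_0, 'n::finite) upn \<Rightarrow> ('k, 'n) upn"
  where "comult \<epsilon> r s u = coact.act \<epsilon> (rep_upn u) (\<lambda>t. if t = s then 1 else 0) r"

context
  fixes \<epsilon> :: "'k::field_char_0"
  assumes e: "\<epsilon> * \<epsilon> = 1"
begin

lemma comult_abs:
  assumes "x \<in> free_alg (pn CARD('n))"
  shows "comult \<epsilon> r s (abs_upn x :: ('k, 'n::finite) upn) = coact.act \<epsilon> x (\<lambda>t. if t = s then 1 else 0) r"
proof -
  have "coact.act \<epsilon> (rep_upn (abs_upn x :: ('k, 'n) upn)) v = coact.act \<epsilon> x v" for v :: "int \<Rightarrow> ('k, 'n) upn"
    by (rule coact.act_pres_rel[OF _ rep_abs_upn[OF assms]]) (rule coact_rels[OF e])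
  then show ?thesis by (simp add: comult_def)
qed

lemma comult_add: "comult \<epsilon> r s (u + v) = comult \<epsilon> r s u + comult \<epsilon> r s (v :: ('k, 'n::finite) upn)"
proof -
  obtain x where x: "x \<in> free_alg (pn CARD('n))" "u = abs_upn x" by (rule upn_exhaust)
  obtain y where y: "y \<in> free_alg (pn CARD('n))" "v = abs_upn y" by (rule upn_exhaust)
  show ?thesis using x y by (simp add: abs_upn_add comult_abs free_alg_add coact.act_add)
qed

lemma comult_scale: "comult \<epsilon> r s (scale_upn c u) = scale_upn c (comult \<epsilon> r s (u :: ('k, 'n::finite) upn))"
proof -
  obtain x where x: "x \<in> free_alg (pn CARD('n))" "u = abs_upn x" by (rule upn_exhaust)
  have "scale_upn c u = abs_upn (fconst c * x)" using x by (simp add: scale_upn_def abs_upn_mult)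
  then show ?thesis using x by (simp add: comult_abs free_alg_mult coact.act_mult fscale_def)
qed

lemma comult_1: "comult \<epsilon> r s (1 :: ('k, 'n::finite) upn) = (if r = s then 1 else 0)"
  by (simp add: one_upn_def comult_abs)

lemma comult_iota_mult:
  assumes X: "X \<in> pn_part CARD('n) p"
  shows "comult \<epsilon> r s (upn_iota X * u :: ('k, 'n::finite) upn) =
    (\<Sum>t\<in>idx CARD('n). scale_upn (X r t) (comult \<epsilon> t s u)) + scale_upn (chi \<epsilon> p r) (upn_iota X * comult \<epsilon> r s u)"
proof -
  obtain x where x: "x \<in> free_alg (pn CARD('n))" "u = abs_upn x" by (rule upn_exhaust)
  show ?thesis
    using x pn_partD(1)[OF X]
    by (simp add: upn_iota_def[of X] abs_upn_mult comult_abs free_alg_mult coact.act_mult)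
      (simp add: coact_homogeneous[OF X] upn_iota_def)
qed

end

definition root_mat :: "root \<Rightarrow> 'k::field_char_0 smat"
  where "root_mat z = (case z of Diff i j \<Rightarrow> pa i j | Plus i j \<Rightarrow> pb i j | Minus i j \<Rightarrow> pc i j)"

definition root_parity :: "root \<Rightarrow> bit"
  where "root_parity z = (case z of Diff i j \<Rightarrow> 0 | Plus i j \<Rightarrow> 1 | Minus i j \<Rightarrow> 1)"

lemma root_mat_part: "z \<in> roots n \<Longrightarrow> (root_mat z :: 'k::field_char_0 smat) \<in> pn_part n (root_parity z)"
  by (cases z) (auto simp: root_mat_def root_parity_def pb_eq intro!: pn_basis pn_part_scale)

definition uword :: "root list \<Rightarrow> ('k::field_char_0, 'n::finite) upn"
  where "uword w = prod_list (map (\<lambda>z. upn_iota (root_mat z)) w)"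

definition word_parity :: "root list \<Rightarrow> bit" where "word_parity w = sum_list (map root_parity w)"

lemma uword_simps [simp]: "uword [] = 1" "uword (z # w) = upn_iota (root_mat z) * uword w"
    "uword (u @ w) = uword u * uword w"
  and word_parity_simps [simp]: "word_parity [] = 0" "word_parity (z # w) = root_parity z + word_parity w"
  by (simp_all add: uword_def word_parity_def)

text \<open>
  The standard filtration of $U$, shifted by one so that the zeroth member is zero.
\<close>

definition Fil :: "nat \<Rightarrow> ('k::field_char_0, 'n::finite) upn set"
  where "Fil d = upn.span {uword w | w. set w \<subseteq> roots CARD('n) \<and> length w < d}"

lemma uword_in_Fil: "set w \<subseteq> roots CARD('n) \<Longrightarrow> length w < d \<Longrightarrow> (uword w :: ('k::field_char_0, 'n::finite) upn) \<in> Fil d"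
  unfolding Fil_def by (intro upn.span_base) blast

lemma Fil_mono: "c \<le> d \<Longrightarrow> Fil c \<subseteq> Fil d"
  unfolding Fil_def by (rule upn.span_mono) auto

lemma Fil_zero [simp]: "0 \<in> Fil d" and Fil_add: "x \<in> Fil d \<Longrightarrow> y \<in> Fil d \<Longrightarrow> x + y \<in> Fil d"
  and Fil_diff: "x \<in> Fil d \<Longrightarrow> y \<in> Fil d \<Longrightarrow> x - y \<in> Fil d"
  and Fil_scale: "x \<in> Fil d \<Longrightarrow> scale_upn c x \<in> Fil d"
  and Fil_sum: "(\<And>i. i \<in> I \<Longrightarrow> f i \<in> Fil d) \<Longrightarrow> sum f I \<in> Fil d"
  unfolding Fil_def
  by (auto intro: upn.span_add upn.span_diff upn.span_zero upn.span_scale upn.span_sum)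

lemma Fil_0: "x \<in> Fil 0 \<Longrightarrow> x = 0"
  by (simp add: Fil_def)

lemma Fil_induct [consumes 1, case_names zero add]:
  assumes "x \<in> Fil d" "P 0"
    "\<And>c w x. set w \<subseteq> roots CARD('n) \<Longrightarrow> length w < d \<Longrightarrow> P x \<Longrightarrow> P (scale_upn c (uword w) + (x :: ('k::field_char_0, 'n::finite) upn))"
  shows "P x"
  using assms(1) unfolding Fil_def by (induction rule: upn.span_induct_alt) (use assms(2,3) in auto)

lemma Fil_mult:
  assumes "x \<in> Fil c" "y \<in> Fil d" "c + d \<le> Suc e"
  shows "x * y \<in> (Fil e :: ('k::field_char_0, 'n::finite) upn set)"
proof -
  have w: "uword u * y \<in> (Fil e :: ('k, 'n) upn set)" if u: "set u \<subseteq> roots CARD('n)" "length u < c" for u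
    using assms(2)
  proof (induction rule: Fil_induct)
    case (add c' w y)
    have "uword (u @ w) \<in> (Fil e :: ('k, 'n) upn set)" by (rule uword_in_Fil) (use add u assms(3) in auto)
    then show ?case using add by (simp add: distrib_left Fil_add Fil_scale flip: upn.scale_mult_right)
  qed simp
  show ?thesis
    using assms(1)
  proof (induction rule: Fil_induct)
    case (add c' u x) then show ?case using w by (simp add: distrib_right Fil_add Fil_scale flip: upn.scale_mult_left)
  qed simp
qed

text \<open>
  The part of the coproduct in which exactly one letter of the word acts on $V$.
\<close>

fun comult_lin :: "'k::field_char_0 \<Rightarrow> int \<Rightarrow> int \<Rightarrow> root list \<Rightarrow> ('k, 'n::finite) upn" where
  "comult_lin \<epsilon> r s [] = 0"
| "comult_lin \<epsilon> r s (z # w) = scale_upn (root_mat z r s * chi \<epsilon> (word_parity w) s) (uword w)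
    + scale_upn (chi \<epsilon> (root_parity z) r) (upn_iota (root_mat z) * comult_lin \<epsilon> r s w)"

lemma iota_in_Fil: "z \<in> roots CARD('n) \<Longrightarrow> (upn_iota (root_mat z) :: ('k::field_char_0, 'n::finite) upn) \<in> Fil 2"
  using uword_in_Fil[of "[z]" 2] by simp

lemma comult_lin_in_Fil:
  "set w \<subseteq> roots CARD('n) \<Longrightarrow> (comult_lin \<epsilon> r s w :: ('k::field_char_0, 'n::finite) upn) \<in> Fil (length w)"
proof (induction w)
  case (Cons z w)
  have "upn_iota (root_mat z) * comult_lin \<epsilon> r s w \<in> (Fil (length (z # w)) :: ('k, 'n) upn set)"
    by (rule Fil_mult[OF iota_in_Fil Cons.IH]) (use Cons.prems in auto)
  moreover have "uword w \<in> (Fil (length (z # w)) :: ('k, 'n) upn set)" by (rule uword_in_Fil) (use Cons.prems in auto)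
  ultimately show ?case by (simp add: Fil_add Fil_scale)
qed simp

text \<open>
  Expanding the product, the terms in which no letter acts on $V$ give a diagonal matrix of signs,
  and those in which two or more letters act on $V$ have degree smaller by two.
\<close>

lemma comult_uword:
  fixes \<epsilon> :: "'k::field_char_0"
  assumes e: "\<epsilon> * \<epsilon> = 1" and s: "s \<in> idx CARD('n)" and w: "set w \<subseteq> roots CARD('n)"
  shows "comult \<epsilon> r s (uword w) - scale_upn (if r = s then chi \<epsilon> (word_parity w) r else 0) (uword w) - comult_lin \<epsilon> r s w
    \<in> (Fil (length w - 1) :: ('k, 'n::finite) upn set)"
  using w
proof (induction w arbitrary: r)
  case Nil show ?case by (simp add: comult_1[OF e] chi_def)
next
  case (Cons z w)
  let ?x = "upn_iota (root_mat z) :: ('k, 'n) upn" and ?X = "root_mat z :: 'k smat"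
  let ?w = "uword w :: ('k, 'n) upn"
  define L where "L t = comult \<epsilon> t s ?w - scale_upn (if t = s then chi \<epsilon> (word_parity w) t else 0) ?w - comult_lin \<epsilon> t s w" for t
  have z: "z \<in> roots CARD('n)" and w: "set w \<subseteq> roots CARD('n)" using Cons.prems by auto
  have L: "L t \<in> Fil (length w - 1)" for t unfolding L_def by (rule Cons.IH[OF w])
  then have L': "L t \<in> Fil (length w)" for t using Fil_mono[of "length w - 1" "length w"] by auto
  have c: "comult \<epsilon> t s ?w = scale_upn (if t = s then chi \<epsilon> (word_parity w) t else 0) ?w + comult_lin \<epsilon> t s w + L t" for t
    by (simp add: L_def)
  have chi: "chi \<epsilon> (word_parity (z # w)) r = chi \<epsilon> (root_parity z) r * chi \<epsilon> (word_parity w) r"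
    by (simp only: word_parity_simps chi_add[OF e])
  have "(\<Sum>t\<in>idx CARD('n). scale_upn (?X r t) (comult \<epsilon> t s ?w))
      = (\<Sum>t\<in>idx CARD('n). scale_upn (?X r t) (scale_upn (if t = s then chi \<epsilon> (word_parity w) t else 0) ?w))
        + (\<Sum>t\<in>idx CARD('n). scale_upn (?X r t) (comult_lin \<epsilon> t s w + L t))"
    unfolding c add.assoc by (simp add: upn.scale_right_distrib sum.distrib)
  also have "(\<Sum>t\<in>idx CARD('n). scale_upn (?X r t) (scale_upn (if t = s then chi \<epsilon> (word_parity w) t else 0) ?w))
      = (\<Sum>t\<in>idx CARD('n). if t = s then scale_upn (?X r s * chi \<epsilon> (word_parity w) s) ?w else 0)"
    by (intro sum.cong) auto
  also have "\<dots> = scale_upn (?X r s * chi \<epsilon> (word_parity w) s) ?w" using s by (simp add: sum.delta)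
  finally have "comult \<epsilon> r s (uword (z # w)) = scale_upn (?X r s * chi \<epsilon> (word_parity w) s) ?w
      + (\<Sum>t\<in>idx CARD('n). scale_upn (?X r t) (comult_lin \<epsilon> t s w + L t))
      + scale_upn (chi \<epsilon> (root_parity z) r) (?x * (scale_upn (if r = s then chi \<epsilon> (word_parity w) r else 0) ?w + comult_lin \<epsilon> r s w + L r))"
    using comult_iota_mult[OF e root_mat_part[OF z], of r s ?w] c[of r] by simp
  also have "\<dots> = scale_upn (if r = s then chi \<epsilon> (word_parity (z # w)) r else 0) (uword (z # w)) + comult_lin \<epsilon> r s (z # w)
      + ((\<Sum>t\<in>idx CARD('n). scale_upn (?X r t) (comult_lin \<epsilon> t s w + L t)) + scale_upn (chi \<epsilon> (root_parity z) r) (?x * L r))"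
    unfolding chi by (simp add: distrib_left upn.scale_right_distrib flip: upn.scale_mult_right)
  finally have eq: "comult \<epsilon> r s (uword (z # w)) - scale_upn (if r = s then chi \<epsilon> (word_parity (z # w)) r else 0) (uword (z # w))
      - comult_lin \<epsilon> r s (z # w) = (\<Sum>t\<in>idx CARD('n). scale_upn (?X r t) (comult_lin \<epsilon> t s w + L t))
        + scale_upn (chi \<epsilon> (root_parity z) r) (?x * L r)" by (simp only: add_diff_cancel_left' diff_diff_eq)
  have xL: "?x * L r \<in> Fil (length w)"
  proof (cases w)
    case Nil
    then have "L r = 0" using L[of r] Fil_0 by simp
    then show ?thesis by simp
  qed (rule Fil_mult[OF iota_in_Fil[OF z] L], simp)
  have "(\<Sum>t\<in>idx CARD('n). scale_upn (?X r t) (comult_lin \<epsilon> t s w + L t)) + scale_upn (chi \<epsilon> (root_parity z) r) (?x * L r) \<in> Fil (length w)"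
    by (intro Fil_add Fil_sum Fil_scale comult_lin_in_Fil[OF w] L' xL)
  then show ?case unfolding eq by simp
qed


section \<open>Independence of ordered words in the enveloping algebra\<close>

text \<open>
  The matrix entry at which the root vector of $z$ is the only root vector with a nonzero value selects the terms in which
  the letter $z$ acts on $V$.  For $z$ on the diagonal the sign term of the preceding lemma interferes.  It cancels in
  the combination chosen for even $z$: the entries at $(i,i)$ and $(-i,-i)$ agree for even words,
  and for odd words they change sign with $\varepsilon$.  The terms selected do not cancel, because the entries of
  $A_{ij}$ at $(i,j)$ and $(-j,-i)$ are opposite.
\<close>

definition root_deriv :: "root \<Rightarrow> ('k::field_char_0, 'n::finite) upn \<Rightarrow> ('k, 'n) upn"
  where "root_deriv z u = (case z of
      Diff i j \<Rightarrow> comult 1 (int i) (int j) u - comult 1 (- int j) (- int i) u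
        + comult (- 1) (int i) (int j) u - comult (- 1) (- int j) (- int i) u
    | Plus i j \<Rightarrow> comult 1 (int i) (- int j) u
    | Minus i j \<Rightarrow> comult 1 (- int i) (int j) u)"

text \<open>
  The leading term of the derivative of a word.
\<close>

definition root_deriv_lin :: "root \<Rightarrow> root list \<Rightarrow> ('k::field_char_0, 'n::finite) upn"
  where "root_deriv_lin z w = (case z of
      Diff i j \<Rightarrow> comult_lin 1 (int i) (int j) w - comult_lin 1 (- int j) (- int i) w
        + comult_lin (- 1) (int i) (int j) w - comult_lin (- 1) (- int j) (- int i) w
    | Plus i j \<Rightarrow> comult_lin 1 (int i) (- int j) w
    | Minus i j \<Rightarrow> comult_lin 1 (- int i) (int j) w)"

lemma square_one: "(1 :: 'k::field_char_0) * 1 = 1" "(- 1 :: 'k) * (- 1) = 1" by simp_all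

lemma root_deriv_add: "root_deriv z (u + v) = root_deriv z u + root_deriv z (v :: ('k::field_char_0, 'n::finite) upn)"
  by (cases z) (simp_all add: root_deriv_def comult_add[OF square_one(1)] comult_add[OF square_one(2)])

lemma root_deriv_scale: "root_deriv z (scale_upn c u) = scale_upn c (root_deriv z (u :: ('k::field_char_0, 'n::finite) upn))"
  by (cases z) (simp_all add: root_deriv_def comult_scale[OF square_one(1)] comult_scale[OF square_one(2)]
      upn.scale_right_distrib upn.scale_right_diff_distrib)

lemma root_deriv_uword:
  assumes z: "z \<in> roots CARD('n)" and w: "set w \<subseteq> roots CARD('n)"
  shows "root_deriv z (uword w) - root_deriv_lin z w \<in> (Fil (length w - 1) :: ('k::field_char_0, 'n::finite) upn set)"
proof (cases z)
  case (Diff i j)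
  have ij: "int i \<in> idx CARD('n)" "int j \<in> idx CARD('n)" "- int i \<in> idx CARD('n)" "- int j \<in> idx CARD('n)"
    and pos: "i > 0" "j > 0" using z Diff by auto
  define g :: "'k \<Rightarrow> int \<Rightarrow> int \<Rightarrow> ('k, 'n) upn"
    where "g \<epsilon> r s = comult \<epsilon> r s (uword w) - scale_upn (if r = s then chi \<epsilon> (word_parity w) r else 0) (uword w) - comult_lin \<epsilon> r s w" for \<epsilon> r s
  have g: "g \<epsilon> r s \<in> (Fil (length w - 1) :: ('k, 'n) upn set)" if "\<epsilon> * \<epsilon> = 1" "s \<in> idx CARD('n)" for \<epsilon> r s
    unfolding g_def by (rule comult_uword[OF that w])
  have c: "comult \<epsilon> r s (uword w) = scale_upn (if r = s then chi \<epsilon> (word_parity w) r else 0) (uword w) + comult_lin \<epsilon> r s w + g \<epsilon> r s" for \<epsilon> r s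
    by (simp add: g_def)
  let ?m = "\<lambda>\<epsilon> r s. scale_upn (if r = s then chi \<epsilon> (word_parity w) r else (0::'k)) (uword w :: ('k, 'n) upn)"
  have "?m 1 (int i) (int j) - ?m 1 (- int j) (- int i) + ?m (- 1) (int i) (int j) - ?m (- 1) (- int j) (- int i) = 0"
    using pos by (auto simp: chi_def idx_sign_def)
  then have "root_deriv z (uword w) - root_deriv_lin z w = g 1 (int i) (int j) - g 1 (- int j) (- int i) + g (- 1) (int i) (int j) - g (- 1) (- int j) (- int i)"
    unfolding root_deriv_def root_deriv_lin_def Diff root.case c by (simp add: algebra_simps)
  also have "\<dots> \<in> Fil (length w - 1)" using ij by (intro Fil_add Fil_diff g) simp_all
  finally show ?thesis .
next
  case (Plus i j)
  then have "- int j \<in> idx CARD('n)" "int i \<noteq> - int j" using z by auto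
  then show ?thesis using comult_uword[OF square_one(1) _ w, of "- int j" "int i"] Plus by (simp add: root_deriv_def root_deriv_lin_def)
next
  case (Minus i j)
  then have "int j \<in> idx CARD('n)" "- int i \<noteq> int j" using z by auto
  then show ?thesis using comult_uword[OF square_one(1) _ w, of "int j" "- int i"] Minus by (simp add: root_deriv_def root_deriv_lin_def)
qed

lemma root_deriv_lin_in_Fil: "set w \<subseteq> roots CARD('n) \<Longrightarrow> (root_deriv_lin z w :: ('k::field_char_0, 'n::finite) upn) \<in> Fil (length w)"
  by (cases z) (auto simp: root_deriv_lin_def intro!: Fil_add Fil_diff comult_lin_in_Fil)

lemma root_deriv_Fil: "z \<in> roots CARD('n) \<Longrightarrow> u \<in> Fil d \<Longrightarrow> root_deriv z u \<in> (Fil (d - 1) :: ('k::field_char_0, 'n::finite) upn set)"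
proof -
  assume z: "z \<in> roots CARD('n)" and "u \<in> Fil d"
  from this(2) show ?thesis
  proof (induction rule: Fil_induct)
    case zero show ?case using root_deriv_scale[of z 0 "0 :: ('k, 'n) upn"] by simp
  next
    case (add c w x)
    have d: "length w - 1 \<le> d - 1" "length w \<le> d - 1" using add.hyps(2) by simp_all
    have "root_deriv z (uword w) - root_deriv_lin z w \<in> (Fil (d - 1) :: ('k, 'n) upn set)"
      by (rule subsetD[OF Fil_mono[OF d(1)] root_deriv_uword[OF z add.hyps(1)]])
    moreover have "root_deriv_lin z w \<in> (Fil (d - 1) :: ('k, 'n) upn set)"
      by (rule subsetD[OF Fil_mono[OF d(2)] root_deriv_lin_in_Fil[OF add.hyps(1)]])
    ultimately have "root_deriv z (uword w) - root_deriv_lin z w + root_deriv_lin z w \<in> (Fil (d - 1) :: ('k, 'n) upn set)"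
      by (rule Fil_add)
    then have "root_deriv z (uword w) \<in> (Fil (d - 1) :: ('k, 'n) upn set)" by simp
    then show ?case using add.IH by (simp add: root_deriv_add root_deriv_scale Fil_add Fil_scale)
  qed
qed

lemma pb_apply: "pb k l r s = (if k = l then 1 / 2 else 1) * ps k l r s"
  by (simp add: pb_eq mat_apply)

lemma int_neq_uminus: "i > 0 \<Longrightarrow> int i \<noteq> - int j" "i > 0 \<Longrightarrow> - int j \<noteq> int i" by simp_all

lemma root_mat_Plus_entry:
  assumes "Plus i j \<in> roots n" "y \<in> roots n"
  shows "(root_mat y :: 'k::field_char_0 smat) (int i) (- int j) = (if y = Plus i j then 1 else 0)"
proof -
  have ij: "i > 0" "j > 0" "i \<le> j" using assms(1) by auto
  show ?thesis
  proof (cases y)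
    case (Diff k l)
    then have "k > 0" "l > 0" using assms(2) by auto
    with ij show ?thesis by (simp add: Diff root_mat_def pn_basis_apply int_neq_uminus)
  next
    case (Plus k l)
    then have "k \<le> l" using assms(2) by auto
    then have swap: "i = l \<and> j = k \<longleftrightarrow> (k = i \<and> l = j) \<and> k = l" using ij by auto
    have "(root_mat y :: 'k smat) (int i) (- int j) = (if k = l then 1 / 2 else 1) *
        ((if k = i \<and> l = j then 1 else 0) + (if (k = i \<and> l = j) \<and> k = l then 1 else 0))"
      unfolding Plus root_mat_def pn_basis_apply pb_apply root.case swap[symmetric]
      by (simp only: neg_equal_iff_equal of_nat_eq_iff eq_commute[of i k] eq_commute[of j l])
    then show ?thesis by (cases "k = i \<and> l = j"; cases "k = l") (simp_all add: Plus)
  next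
    case (Minus k l)
    then have "k > 0" "l > 0" using assms(2) by auto
    with ij show ?thesis by (simp add: Minus root_mat_def pn_basis_apply int_neq_uminus)
  qed
qed

lemma root_mat_Minus_entry:
  assumes "Minus i j \<in> roots n" "y \<in> roots n"
  shows "(root_mat y :: 'k::field_char_0 smat) (- int i) (int j) = (if y = Minus i j then 1 else 0)"
proof -
  have ij: "i > 0" "j > 0" "i < j" using assms(1) by auto
  show ?thesis
  proof (cases y)
    case (Diff k l)
    then have "k > 0" "l > 0" using assms(2) by auto
    with ij show ?thesis by (simp add: Diff root_mat_def pn_basis_apply int_neq_uminus)
  next
    case (Plus k l)
    then have "k > 0" "l > 0" using assms(2) by auto
    with ij show ?thesis by (simp add: Plus root_mat_def pn_basis_apply pb_apply int_neq_uminus)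
  next
    case (Minus k l)
    then have "k < l" using assms(2) by auto
    then have swap: "(i = l \<and> j = k) = False" using ij by auto
    have "(root_mat y :: 'k smat) (- int i) (int j) = (if k = i \<and> l = j then 1 else 0) - 0"
      unfolding Minus root_mat_def pn_basis_apply root.case neg_equal_iff_equal of_nat_eq_iff swap
      by (simp only: eq_commute[of i k] eq_commute[of j l] if_False)
    then show ?thesis by (simp add: Minus)
  qed
qed

lemma root_mat_Diff_entry:
  assumes "Diff i j \<in> roots n" "Diff k l \<in> roots n"
  shows "(root_mat (Diff k l) :: 'k::field_char_0 smat) (int i) (int j) = (if Diff k l = Diff i j then 1 else 0)"
    "(root_mat (Diff k l) :: 'k::field_char_0 smat) (- int j) (- int i) = - (if Diff k l = Diff i j then 1 else 0)"
proof -
  have "i > 0" "j > 0" "k > 0" "l > 0" using assms by auto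
  then show "(root_mat (Diff k l) :: 'k smat) (int i) (int j) = (if Diff k l = Diff i j then 1 else 0)"
    "(root_mat (Diff k l) :: 'k smat) (- int j) (- int i) = - (if Diff k l = Diff i j then 1 else 0)"
    by (auto simp: root_mat_def pn_basis_apply int_neq_uminus)
qed

lemma comult_lin_zero: "(\<And>y. y \<in> set w \<Longrightarrow> root_mat y r s = (0 :: 'k::field_char_0)) \<Longrightarrow> comult_lin \<epsilon> r s w = (0 :: ('k, 'n::finite) upn)"
  by (induction w) simp_all

lemma comult_lin_single:
  assumes "\<And>y. y \<in> set u \<union> set u' \<Longrightarrow> root_mat y r s = (0 :: 'k::field_char_0)" "root_mat z r s = (1 :: 'k)" "\<epsilon> \<noteq> 0"
  obtains c where "c \<noteq> 0" "comult_lin \<epsilon> r s (u @ z # u') = scale_upn c (uword (u @ u') :: ('k, 'n::finite) upn)"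
proof -
  have chi: "chi \<epsilon> p q \<noteq> 0" for p q using assms(3) by (simp add: chi_def idx_sign_def)
  have "\<exists>c. c \<noteq> 0 \<and> comult_lin \<epsilon> r s (u @ z # u') = scale_upn c (uword (u @ u') :: ('k, 'n) upn)"
    using assms(1)
  proof (induction u)
    case Nil
    have "comult_lin \<epsilon> r s u' = (0 :: ('k, 'n) upn)" by (rule comult_lin_zero) (use Nil in auto)
    then show ?case using assms(2) chi by (auto intro!: exI[of _ "chi \<epsilon> (word_parity u') s"])
  next
    case (Cons y u)
    then obtain c where "c \<noteq> 0" "comult_lin \<epsilon> r s (u @ z # u') = scale_upn c (uword (u @ u') :: ('k, 'n) upn)" by auto
    then show ?case
      using Cons.prems[of y] chi
      by (intro exI[of _ "chi \<epsilon> (root_parity y) r * c"]) (simp flip: upn.scale_mult_right)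
  qed
  then show thesis using that by blast
qed

lemma odd_root_simps [simp]: "\<not> odd_root (Diff i j)" "odd_root (Plus i j)" "odd_root (Minus i j)"
  by (simp_all add: odd_root_def)

lemma odd_root_iff_parity: "odd_root z \<longleftrightarrow> root_parity z = 1"
  by (cases z) (simp_all add: root_parity_def)

text \<open>
  The signs picked up by an odd derivative combine to a single nonzero scalar because the letter $z$ occurs at most once.
\<close>

lemma root_deriv_lin_odd:
  assumes z: "odd_root z" "z \<in> roots CARD('n)"
  shows "set w \<subseteq> roots CARD('n) - {z} \<Longrightarrow> root_deriv_lin z w = (0 :: ('k::field_char_0, 'n::finite) upn)"
    and "set u \<union> set u' \<subseteq> roots CARD('n) - {z} \<Longrightarrow>
      \<exists>c. c \<noteq> 0 \<and> root_deriv_lin z (u @ z # u') = scale_upn c (uword (u @ u') :: ('k::field_char_0, 'n::finite) upn)"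
proof -
  obtain r s where rs: "root_deriv_lin z = (comult_lin 1 r s :: root list \<Rightarrow> ('k, 'n) upn)"
    and entry: "\<And>y. y \<in> roots CARD('n) \<Longrightarrow> (root_mat y :: 'k smat) r s = (if y = z then 1 else 0)"
  proof (cases z)
    case (Plus i j) then show ?thesis using root_mat_Plus_entry[where 'k='k, of i j "CARD('n)"] z that[of "int i" "- int j"] by (simp add: root_deriv_lin_def fun_eq_iff)
  next
    case (Minus i j) then show ?thesis using root_mat_Minus_entry[where 'k='k, of i j "CARD('n)"] z that[of "- int i" "int j"] by (simp add: root_deriv_lin_def fun_eq_iff)
  qed (use z in simp)
  show "set w \<subseteq> roots CARD('n) - {z} \<Longrightarrow> root_deriv_lin z w = (0 :: ('k, 'n) upn)"
    unfolding rs by (rule comult_lin_zero, subst entry) auto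
  have entry0: "V \<subseteq> roots CARD('n) - {z} \<Longrightarrow> y \<in> V \<Longrightarrow> (root_mat y :: 'k smat) r s = 0" for V y
    by (subst entry) auto
  show "\<exists>c. c \<noteq> 0 \<and> root_deriv_lin z (u @ z # u') = scale_upn c (uword (u @ u') :: ('k, 'n) upn)"
    if "set u \<union> set u' \<subseteq> roots CARD('n) - {z}"
    unfolding rs
    by (rule comult_lin_single[of u u' r s z 1, where 'n='n, OF entry0[OF that]]) (use entry[OF z(2)] in auto)
qed

lemma comult_lin_even_append:
  assumes "\<And>y. y \<in> set (u @ w) \<Longrightarrow> \<not> odd_root y"
  shows "comult_lin \<epsilon> r s (u @ w) = comult_lin \<epsilon> r s u * uword w + uword u * (comult_lin \<epsilon> r s w :: ('k::field_char_0, 'n::finite) upn)"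
proof -
  have root_parity: "root_parity y = 0" if "y \<in> set (u @ w)" for y using assms[OF that] by (simp add: odd_root_iff_parity)
  then have chi: "chi \<epsilon> (word_parity v) q = 1" if "set v \<subseteq> set (u @ w)" for v q
    using that by (induction v) (auto simp: chi_def)
  show ?thesis
    using root_parity chi
  proof (induction u)
    case (Cons y u)
    have "chi \<epsilon> (word_parity (u @ w)) s = 1" "chi \<epsilon> (word_parity u) s = 1"
      using Cons.prems(2)[of "u @ w" s] Cons.prems(2)[of u s] by auto
    moreover have "chi \<epsilon> (root_parity y) r = 1" using Cons.prems(1)[of y] by (simp add: chi_def)
    moreover have "comult_lin \<epsilon> r s (u @ w) = comult_lin \<epsilon> r s u * uword w + uword u * (comult_lin \<epsilon> r s w :: ('k, 'n) upn)"
      by (rule Cons.IH) (rule Cons.prems(1), simp, rule Cons.prems(2), auto)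
    ultimately show ?case by (simp add: distrib_left distrib_right mult.assoc flip: upn.scale_mult_left)
  qed simp
qed

text \<open>
  On words in even letters there are no signs, and the Leibniz rule holds as it stands.
\<close>

lemma root_deriv_lin_even_append:
  assumes "\<And>y. y \<in> set (u @ w) \<Longrightarrow> \<not> odd_root y" "\<not> odd_root z"
  shows "root_deriv_lin z (u @ w) = root_deriv_lin z u * uword w + uword u * (root_deriv_lin z w :: ('k::field_char_0, 'n::finite) upn)"
proof (cases z)
  case (Diff i j)
  have "comult_lin \<epsilon> r s (u @ w) = comult_lin \<epsilon> r s u * uword w + uword u * (comult_lin \<epsilon> r s w :: ('k, 'n) upn)" for \<epsilon> :: 'k and r s
    by (rule comult_lin_even_append) (rule assms(1))
  then show ?thesis by (simp add: Diff root_deriv_lin_def algebra_simps)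
qed (use assms(2) in simp_all)

text \<open>
  Each of the four summands of the even derivative contributes one.
\<close>

lemma root_deriv_lin_even_single:
  assumes "Diff i j \<in> roots n" "y \<in> roots n" "\<not> odd_root y"
  shows "root_deriv_lin (Diff i j) [y] = (scale_upn (if y = Diff i j then 4 else 0) 1 :: ('k::field_char_0, 'n::finite) upn)"
proof (cases y)
  case (Diff k l)
  have four: "scale_upn 4 1 = (1 + 1 + 1 + 1 :: ('k, 'n) upn)"
  proof -
    have "(4 :: 'k) = 1 + 1 + 1 + 1" by simp
    then show ?thesis by (simp only: upn.scale_left_distrib upn.scale_one)
  qed
  have "root_deriv_lin (Diff i j) [y] = (if y = Diff i j then scale_upn 4 1 else (0 :: ('k, 'n) upn))"
    using root_mat_Diff_entry[OF assms(1), of k l, where 'k='k] assms(2) unfolding Diff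
    by (simp add: root_deriv_lin_def root_parity_def chi_def four del: one_add_one)
  then show ?thesis by simp
qed (use assms(3) in simp_all)

lemma root_deriv_lin_even_zero:
  assumes "\<not> odd_root z" "z \<in> roots n" "\<And>y. y \<in> set w \<Longrightarrow> \<not> odd_root y \<and> y \<in> roots n \<and> y \<noteq> z"
  shows "root_deriv_lin z w = (0 :: ('k::field_char_0, 'n::finite) upn)"
proof -
  obtain i j where z: "z = Diff i j" using assms(1) by (cases z) auto
  show ?thesis
    using assms(3)
  proof (induction w)
    case Nil show ?case by (simp add: z root_deriv_lin_def)
  next
    case (Cons y w)
    have "root_deriv_lin z ([y] @ w) = root_deriv_lin z [y] * uword w + uword [y] * (root_deriv_lin z w :: ('k, 'n) upn)"
      by (rule root_deriv_lin_even_append) (use Cons.prems assms in auto)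
    then show ?case using Cons root_deriv_lin_even_single[of i j n y, where 'k='k and 'n='n] assms(2) by (simp add: z)
  qed
qed

lemma root_deriv_lin_even_replicate:
  assumes "\<not> odd_root z" "z \<in> roots n"
  shows "root_deriv_lin z (replicate m z) = scale_upn (of_nat (4 * m)) (uword (replicate (m - 1) z) :: ('k::field_char_0, 'n::finite) upn)"
proof -
  obtain i j where z: "z = Diff i j" using assms(1) by (cases z) auto
  show ?thesis
  proof (induction m)
    case 0 show ?case by (simp add: z root_deriv_lin_def)
  next
    case (Suc m)
    have "root_deriv_lin z ([z] @ replicate m z) = root_deriv_lin z [z] * uword (replicate m z) + uword [z] * (root_deriv_lin z (replicate m z) :: ('k, 'n) upn)"
      by (rule root_deriv_lin_even_append) (use assms in auto)
    also have "root_deriv_lin z [z] = scale_upn 4 (1 :: ('k, 'n) upn)"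
      using root_deriv_lin_even_single[of i j n z, where 'k='k and 'n='n] assms by (simp add: z)
    also have "uword [z] * (root_deriv_lin z (replicate m z) :: ('k, 'n) upn) = scale_upn (of_nat (4 * m)) (uword (replicate m z))"
      unfolding Suc by (cases m) (simp_all flip: upn.scale_mult_right)
    finally show ?case by (simp add: upn.scale_left_distrib flip: upn.scale_mult_left)
  qed
qed

definition sorted_word :: "root list \<Rightarrow> (root \<Rightarrow> nat) \<Rightarrow> root list"
  where "sorted_word zs \<mu> = concat (map (\<lambda>z. replicate (\<mu> z) z) zs)"

lemma sorted_word_simps [simp]: "sorted_word [] \<mu> = []"
    "sorted_word (z # zs) \<mu> = replicate (\<mu> z) z @ sorted_word zs \<mu>"
    "sorted_word (zs @ zs') \<mu> = sorted_word zs \<mu> @ sorted_word zs' \<mu>"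
  by (simp_all add: sorted_word_def)

lemma length_sorted_word: "length (sorted_word zs \<mu>) = (\<Sum>z\<leftarrow>zs. \<mu> z)"
  by (induction zs) simp_all

lemma set_sorted_word: "set (sorted_word zs \<mu>) = {z \<in> set zs. \<mu> z \<noteq> 0}"
  by (intro set_eqI) (auto simp: sorted_word_def)

lemma sorted_word_cong: "(\<And>z. z \<in> set zs \<Longrightarrow> \<mu> z = \<nu> z) \<Longrightarrow> sorted_word zs \<mu> = sorted_word zs \<nu>"
  unfolding sorted_word_def by (intro arg_cong[of _ _ concat] map_cong) auto

text \<open>
  On sorted words the derivative acts as $\partial/\partial X_z$ up to a scalar.  The even case is restricted to
  purely even words, where the Leibniz rule is free of signs; this is enough, since odd derivatives can be used first.
\<close>

lemma root_deriv_lin_sorted_word: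
  assumes zs: "distinct zs" "set zs \<subseteq> roots CARD('n)" and z: "z \<in> set zs"
    and adm: "odd_root z \<and> \<mu> z \<le> 1 \<or> \<not> odd_root z \<and> (\<forall>y\<in>set zs. odd_root y \<longrightarrow> \<mu> y = 0)"
  obtains c where "c = 0 \<longleftrightarrow> \<mu> z = 0"
    "root_deriv_lin z (sorted_word zs \<mu>) = scale_upn c (uword (sorted_word zs (\<mu>(z := \<mu> z - 1))) :: ('k::field_char_0, 'n::finite) upn)"
proof -
  obtain zs1 zs2 where split: "zs = zs1 @ z # zs2" using z by (meson split_list)
  define u u' where "u = sorted_word zs1 \<mu>" and "u' = sorted_word zs2 \<mu>"
  have zr: "z \<in> roots CARD('n)" using zs z by auto
  have u: "sorted_word zs1 (\<mu>(z := \<mu> z - 1)) = u" "sorted_word zs2 (\<mu>(z := \<mu> z - 1)) = u'"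
    unfolding u_def u'_def using zs(1) split by (auto intro!: sorted_word_cong)
  have w: "sorted_word zs \<mu> = u @ replicate (\<mu> z) z @ u'"
    and w': "sorted_word zs (\<mu>(z := \<mu> z - 1)) = u @ replicate (\<mu> z - 1) z @ u'"
    unfolding split sorted_word_simps u by (simp_all add: u_def u'_def)
  have sub: "set u \<union> set u' \<subseteq> roots CARD('n) - {z}"
    using zs split by (auto simp: u_def u'_def set_sorted_word)
  show thesis
  proof (cases "odd_root z")
    case True
    then consider "\<mu> z = 0" | "\<mu> z = 1" using adm by linarith
    then show thesis
    proof cases
      case 1
      have "root_deriv_lin z (sorted_word zs \<mu>) = (0 :: ('k, 'n) upn)"
        by (rule root_deriv_lin_odd(1)[OF True zr]) (use sub 1 w in auto)
      then show thesis using that[of 0] 1 by simp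
    next
      case 2
      obtain c :: 'k where c: "c \<noteq> 0" "root_deriv_lin z (u @ z # u') = scale_upn c (uword (u @ u') :: ('k, 'n) upn)"
        using root_deriv_lin_odd(2)[OF True zr sub] by blast
      have "root_deriv_lin z (sorted_word zs \<mu>) = scale_upn c (uword (sorted_word zs (\<mu>(z := \<mu> z - 1))) :: ('k, 'n) upn)"
        unfolding w w' using c(2) 2 by simp
      then show thesis using c(1) 2 by (intro that[of c]) simp_all
    qed
  next
    case False
    have even: "\<not> odd_root y" if "y \<in> set u \<union> set u' \<union> {z}" for y
      using that False adm split by (auto simp: u_def u'_def set_sorted_word)
    have zero: "root_deriv_lin z u = (0 :: ('k, 'n) upn)" "root_deriv_lin z u' = (0 :: ('k, 'n) upn)"
      by (rule root_deriv_lin_even_zero[OF False zr]; use even sub in auto)+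
    have "root_deriv_lin z (u @ replicate (\<mu> z) z @ u') = root_deriv_lin z u * uword (replicate (\<mu> z) z @ u')
        + uword u * (root_deriv_lin z (replicate (\<mu> z) z @ u') :: ('k, 'n) upn)"
      by (rule root_deriv_lin_even_append) (use even False in auto)
    also have "root_deriv_lin z (replicate (\<mu> z) z @ u') = root_deriv_lin z (replicate (\<mu> z) z) * uword u'
        + uword (replicate (\<mu> z) z) * (root_deriv_lin z u' :: ('k, 'n) upn)"
      by (rule root_deriv_lin_even_append) (use even False in auto)
    finally have "root_deriv_lin z (sorted_word zs \<mu>)
        = scale_upn (of_nat (4 * \<mu> z)) (uword (sorted_word zs (\<mu>(z := \<mu> z - 1))) :: ('k, 'n) upn)"
      unfolding w w' zero root_deriv_lin_even_replicate[OF False zr]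
      by (simp flip: upn.scale_mult_left upn.scale_mult_right)
    then show thesis using that[of "of_nat (4 * \<mu> z)"] by simp
  qed
qed

text \<open>
  Exponents of ordered monomials, made unique by requiring the value zero outside the list.
\<close>

definition exponents :: "root list \<Rightarrow> (root \<Rightarrow> nat) set"
  where "exponents zs = {\<mu>. (\<forall>z. z \<notin> set zs \<longrightarrow> \<mu> z = 0) \<and> (\<forall>z. odd_root z \<longrightarrow> \<mu> z \<le> 1)}"

lemma sum_list_decrement:
  "distinct zs \<Longrightarrow> z \<in> set zs \<Longrightarrow> \<mu> z > 0 \<Longrightarrow> Suc (\<Sum>y\<leftarrow>zs. (\<mu>(z := \<mu> z - 1)) y) = (\<Sum>y\<leftarrow>zs. \<mu> y)"
  for \<mu> :: "root \<Rightarrow> nat"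
proof (induction zs)
  case (Cons y zs)
  show ?case
  proof (cases "y = z")
    case True
    have "map (\<mu>(z := \<mu> z - 1)) zs = map \<mu> zs" by (rule map_cong) (use True Cons.prems in auto)
    then have "(\<Sum>y\<leftarrow>zs. (\<mu>(z := \<mu> z - 1)) y) = (\<Sum>y\<leftarrow>zs. \<mu> y)" by (simp only:)
    then show ?thesis using True Cons.prems by (simp only: list.map sum_list.Cons) simp
  qed (use Cons in auto)
qed simp

text \<open>
  Differentiate a relation of degree $d+1$ with respect to an odd root: the derivative is a relation of degree $d$,
  so by induction no exponent with a nonzero coefficient involves that root.  Hence the relation involves purely even
  words only, and then even derivatives can be applied in the same way.
\<close>

lemma sorted_words_independent:
  assumes zs: "distinct zs" "set zs \<subseteq> roots CARD('n)"
    and "finite F" "F \<subseteq> exponents zs" "\<And>\<mu>. \<mu> \<in> F \<Longrightarrow> (\<Sum>z\<leftarrow>zs. \<mu> z) = d"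
    and "(\<Sum>\<mu>\<in>F. scale_upn (a \<mu>) (uword (sorted_word zs \<mu>))) \<in> (Fil d :: ('k::field_char_0, 'n::finite) upn set)"
    and "\<mu> \<in> F"
  shows "a \<mu> = 0"
  using assms(3-)
proof (induction d arbitrary: F a \<mu>)
  case 0
  have "\<nu> = (\<lambda>_. 0)" if "\<nu> \<in> F" for \<nu>
    using 0(2,3) that by (force simp: exponents_def)
  then have F: "F = {\<mu>}" using 0(5) by blast
  have "(\<Sum>z\<leftarrow>zs. \<mu> z) = 0" using 0(3,5) by blast
  then have "sorted_word zs \<mu> = []" unfolding length_sorted_word[symmetric] by simp
  then have "scale_upn (a \<mu>) (1 :: ('k, 'n) upn) = 0" using 0(4) by (intro Fil_0) (simp add: F)
  then show ?case by simp
next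
  case (Suc d)
  \<comment> \<open>Coefficients that vanish are discarded, so that the conclusion becomes a statement about exponents.\<close>
  define F0 where "F0 = {\<nu> \<in> F. a \<nu> \<noteq> 0}"
  have F0: "finite F0" "F0 \<subseteq> F" using Suc(2) by (auto simp: F0_def)
  let ?w = "\<lambda>\<nu>. uword (sorted_word zs \<nu>) :: ('k, 'n) upn"
  have "(\<Sum>\<nu>\<in>F. scale_upn (a \<nu>) (?w \<nu>)) = (\<Sum>\<nu>\<in>F0. scale_upn (a \<nu>) (?w \<nu>))"
    by (rule sum.mono_neutral_right) (use Suc(2) in \<open>auto simp: F0_def\<close>)
  then have top: "(\<Sum>\<nu>\<in>F0. scale_upn (a \<nu>) (?w \<nu>)) \<in> Fil (Suc d)" using Suc(5) by simp
  have key: "\<nu> z = 0" if z: "z \<in> set zs" and \<nu>: "\<nu> \<in> F0"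
    and adm: "\<And>\<nu>. \<nu> \<in> F0 \<Longrightarrow> odd_root z \<and> \<nu> z \<le> 1 \<or> \<not> odd_root z \<and> (\<forall>y\<in>set zs. odd_root y \<longrightarrow> \<nu> y = 0)" for z \<nu>
  proof (rule ccontr)
    assume nz: "\<nu> z \<noteq> 0"
    define down up where "down \<nu> = \<nu>(z := \<nu> z - 1)" and "up \<nu> = \<nu>(z := \<nu> z + 1)" for \<nu> :: "root \<Rightarrow> nat"
    have "\<exists>c :: 'k. (c = 0 \<longleftrightarrow> \<nu> z = 0) \<and> root_deriv_lin z (sorted_word zs \<nu>) = scale_upn c (?w (down \<nu>))" if "\<nu> \<in> F0" for \<nu>
      using root_deriv_lin_sorted_word[OF zs z adm[OF that], where 'k='k] unfolding down_def by blast
    then obtain c :: "(root \<Rightarrow> nat) \<Rightarrow> 'k" where c: "\<And>\<nu>. \<nu> \<in> F0 \<Longrightarrow> c \<nu> = 0 \<longleftrightarrow> \<nu> z = 0"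
      and root_deriv_lin: "\<And>\<nu>. \<nu> \<in> F0 \<Longrightarrow> root_deriv_lin z (sorted_word zs \<nu>) = scale_upn (c \<nu>) (?w (down \<nu>))" by metis
    define F1 where "F1 = {\<nu> \<in> F0. \<nu> z \<noteq> 0}"
    have zr: "z \<in> roots CARD('n)" using z zs by auto
    have dsum: "root_deriv z (\<Sum>\<nu>\<in>G. scale_upn (a \<nu>) (?w \<nu>)) = (\<Sum>\<nu>\<in>G. scale_upn (a \<nu>) (root_deriv z (?w \<nu>)))"
      if "finite G" for G
      using that by (induction G) (use root_deriv_scale[of z 0 "0 :: ('k, 'n) upn"] in \<open>simp_all add: root_deriv_add root_deriv_scale\<close>)
    have low: "root_deriv z (?w \<nu>) - scale_upn (c \<nu>) (?w (down \<nu>)) \<in> Fil d" if "\<nu> \<in> F0" for \<nu>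
    proof -
      have "length (sorted_word zs \<nu>) - 1 = d" using Suc(4) F0 that by (auto simp: length_sorted_word)
      moreover have "set (sorted_word zs \<nu>) \<subseteq> roots CARD('n)" using zs by (auto simp: set_sorted_word)
      ultimately show ?thesis using root_deriv_uword[OF zr, of "sorted_word zs \<nu>", where 'k='k] root_deriv_lin[OF that] by simp
    qed
    have "(\<Sum>\<nu>\<in>F0. scale_upn (a \<nu>) (root_deriv z (?w \<nu>)))
        - (\<Sum>\<nu>\<in>F0. scale_upn (a \<nu>) (root_deriv z (?w \<nu>) - scale_upn (c \<nu>) (?w (down \<nu>)))) \<in> Fil d"
      by (rule Fil_diff[OF _ Fil_sum[OF Fil_scale[OF low]]]) (use root_deriv_Fil[OF zr top] in \<open>simp add: dsum[OF F0(1)]\<close>)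
    also have "(\<Sum>\<nu>\<in>F0. scale_upn (a \<nu>) (root_deriv z (?w \<nu>)))
        - (\<Sum>\<nu>\<in>F0. scale_upn (a \<nu>) (root_deriv z (?w \<nu>) - scale_upn (c \<nu>) (?w (down \<nu>))))
      = (\<Sum>\<nu>\<in>F0. scale_upn (a \<nu> * c \<nu>) (?w (down \<nu>)))"
      by (simp add: sum_subtractf[symmetric] upn.scale_right_diff_distrib)
    also have "\<dots> = (\<Sum>\<nu>\<in>F1. scale_upn (a \<nu> * c \<nu>) (?w (down \<nu>)))"
      by (rule sum.mono_neutral_right) (use F0 c in \<open>auto simp: F1_def\<close>)
    also have "\<dots> = (\<Sum>\<nu>\<in>down ` F1. scale_upn (a (up \<nu>) * c (up \<nu>)) (?w \<nu>))"
    proof (rule sum.reindex_cong[symmetric, of down F1])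
      have ud: "up (down \<nu>) = \<nu>" if "\<nu> \<in> F1" for \<nu>
        using that by (auto simp: up_def down_def F1_def fun_eq_iff)
      then show "inj_on down F1" by (metis inj_onI)
      show "scale_upn (a (up (down \<nu>)) * c (up (down \<nu>))) (?w (down \<nu>)) = scale_upn (a \<nu> * c \<nu>) (?w (down \<nu>))"
        if "\<nu> \<in> F1" for \<nu> by (simp only: ud[OF that])
    qed simp
    finally have rel: "(\<Sum>\<nu>\<in>down ` F1. scale_upn (a (up \<nu>) * c (up \<nu>)) (?w \<nu>)) \<in> Fil d" .
    have \<nu>1: "\<nu> \<in> F1" using \<nu> nz by (simp add: F1_def)
    have "a (up (down \<nu>)) * c (up (down \<nu>)) = 0"
    proof (rule Suc.IH[OF _ _ _ rel])
      show "finite (down ` F1)" using F0 by (simp add: F1_def)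
      have "down \<kappa> \<in> exponents zs" if "\<kappa> \<in> exponents zs" for \<kappa>
        using that z unfolding exponents_def down_def by (auto intro: order_trans[OF diff_le_self])
      then show "down ` F1 \<subseteq> exponents zs" using Suc(3) F0 by (auto simp: F1_def)
      show "(\<Sum>y\<leftarrow>zs. \<kappa> y) = d" if \<kappa>: "\<kappa> \<in> down ` F1" for \<kappa>
      proof -
        obtain \<nu>' where "\<kappa> = down \<nu>'" "\<nu>' \<in> F1" using \<kappa> by blast
        then have \<nu>': "\<kappa> = down \<nu>'" "\<nu>' \<in> F0" "\<nu>' z > 0" by (simp_all add: F1_def)
        then show ?thesis
          using sum_list_decrement[of zs z \<nu>', OF zs(1) z \<nu>'(3)] Suc(4)[OF subsetD[OF F0(2) \<nu>'(2)]]
          unfolding \<nu>'(1) down_def by (simp only: nat.inject)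
      qed
      show "down \<nu> \<in> down ` F1" using \<nu>1 by simp
    qed
    moreover have "up (down \<nu>) = \<nu>" using nz by (auto simp: up_def down_def fun_eq_iff)
    ultimately show False using \<nu> nz c by (auto simp: F0_def)
  qed
  have odd: "\<nu> y = 0" if "\<nu> \<in> F0" "y \<in> set zs" "odd_root y" for \<nu> y
    by (rule key[OF that(2,1)]) (use Suc(3) F0 that(3) in \<open>auto simp: exponents_def\<close>)
  have all: "\<nu> y = 0" if "\<nu> \<in> F0" "y \<in> set zs" for \<nu> y
  proof (cases "odd_root y")
    case False
    show ?thesis by (rule key[OF that(2,1)]) (intro disjI2 conjI ballI impI False odd)
  qed (rule odd[OF that])
  show "a \<mu> = 0"
  proof (rule ccontr)
    assume "a \<mu> \<noteq> 0"
    then have "\<mu> \<in> F0" using Suc(6) by (simp add: F0_def)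
    then have "map \<mu> zs = map (\<lambda>_. 0) zs" using all by auto
    then have "(\<Sum>z\<leftarrow>zs. \<mu> z) = (\<Sum>z\<leftarrow>zs. 0)" by (simp only:)
    then show False using Suc(4)[OF Suc(6)] by simp
  qed
qed

text \<open>
  In a nontrivial relation, the part of highest degree would be a relation between sorted words modulo lower degree.
\<close>

lemma leading_terms_independent:
  assumes zs: "distinct zs" "set zs \<subseteq> roots CARD('n)" and F: "finite F" "F \<subseteq> exponents zs"
    and lead: "\<And>\<mu>. \<mu> \<in> F \<Longrightarrow> k \<mu> \<noteq> 0 \<and>
      M \<mu> - scale_upn (k \<mu>) (uword (sorted_word zs \<mu>)) \<in> (Fil (\<Sum>z\<leftarrow>zs. \<mu> z) :: ('k::field_char_0, 'n::finite) upn set)"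
    and rel: "(\<Sum>\<mu>\<in>F. scale_upn (a \<mu>) (M \<mu>)) = 0" and \<mu>: "\<mu> \<in> F"
  shows "a \<mu> = 0"
proof (rule ccontr)
  assume nz: "a \<mu> \<noteq> 0"
  let ?w = "\<lambda>\<nu>. uword (sorted_word zs \<nu>) :: ('k, 'n) upn"
  define deg where "deg \<nu> = (\<Sum>z\<leftarrow>zs. \<nu> z)" for \<nu> :: "root \<Rightarrow> nat"
  define F0 where "F0 = {\<nu> \<in> F. a \<nu> \<noteq> 0}"
  define d where "d = Max (deg ` F0)"
  define Fd where "Fd = {\<nu> \<in> F0. deg \<nu> = d}"
  have F0: "finite F0" "\<mu> \<in> F0" "F0 \<subseteq> F" using F \<mu> nz by (auto simp: F0_def)
  have "d \<in> deg ` F0" unfolding d_def using F0 by (intro Max_in) auto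
  then obtain \<nu> where \<nu>: "\<nu> \<in> Fd" by (auto simp: Fd_def)
  have le: "deg \<nu> \<le> d" if "\<nu> \<in> F0" for \<nu> unfolding d_def using F0 that by simp
  have low: "M \<kappa> - scale_upn (k \<kappa>) (if \<kappa> \<in> Fd then ?w \<kappa> else 0) \<in> Fil d" if "\<kappa> \<in> F0" for \<kappa>
  proof -
    have l: "M \<kappa> - scale_upn (k \<kappa>) (?w \<kappa>) \<in> Fil (deg \<kappa>)" using lead that F0 by (auto simp: deg_def)
    show ?thesis
    proof (cases "\<kappa> \<in> Fd")
      case False
      then have deg: "deg \<kappa> < d" using le[OF that] that by (auto simp: Fd_def)
      then have "?w \<kappa> \<in> Fil d"
        using zs by (intro uword_in_Fil) (auto simp: set_sorted_word length_sorted_word deg_def)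
      moreover have "M \<kappa> - scale_upn (k \<kappa>) (?w \<kappa>) \<in> Fil d"
        by (rule subsetD[OF Fil_mono l]) (use deg in simp)
      ultimately have "M \<kappa> - scale_upn (k \<kappa>) (?w \<kappa>) + scale_upn (k \<kappa>) (?w \<kappa>) \<in> Fil d" by (intro Fil_add Fil_scale)
      then show ?thesis using False by simp
    qed (use l in \<open>simp add: Fd_def\<close>)
  qed
  have "(\<Sum>\<kappa>\<in>Fd. scale_upn (a \<kappa> * k \<kappa>) (?w \<kappa>)) = (\<Sum>\<kappa>\<in>F0. scale_upn (a \<kappa> * k \<kappa>) (if \<kappa> \<in> Fd then ?w \<kappa> else 0))"
    by (rule sum.mono_neutral_cong_left) (use F0 in \<open>auto simp: Fd_def\<close>)
  also have "\<dots> = (\<Sum>\<kappa>\<in>F0. scale_upn (a \<kappa>) (M \<kappa>))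
      - (\<Sum>\<kappa>\<in>F0. scale_upn (a \<kappa>) (M \<kappa> - scale_upn (k \<kappa>) (if \<kappa> \<in> Fd then ?w \<kappa> else 0)))"
    by (simp only: sum_subtractf[symmetric] upn.scale_right_diff_distrib upn.scale_scale) simp
  also have "(\<Sum>\<kappa>\<in>F0. scale_upn (a \<kappa>) (M \<kappa>)) = (\<Sum>\<kappa>\<in>F. scale_upn (a \<kappa>) (M \<kappa>))"
    by (rule sum.mono_neutral_left) (use F in \<open>auto simp: F0_def\<close>)
  finally have "(\<Sum>\<kappa>\<in>Fd. scale_upn (a \<kappa> * k \<kappa>) (?w \<kappa>))
      = 0 - (\<Sum>\<kappa>\<in>F0. scale_upn (a \<kappa>) (M \<kappa> - scale_upn (k \<kappa>) (if \<kappa> \<in> Fd then ?w \<kappa> else 0)))"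
    by (simp only: rel)
  also have "\<dots> \<in> Fil d" by (rule Fil_diff[OF Fil_zero Fil_sum], rule Fil_scale, rule low)
  finally have "(\<Sum>\<kappa>\<in>Fd. scale_upn (a \<kappa> * k \<kappa>) (?w \<kappa>)) \<in> Fil d" .
  then have "a \<nu> * k \<nu> = 0"
    by (rule sorted_words_independent[OF zs, where F = Fd, rotated 3])
      (use F F0 \<nu> in \<open>auto simp: Fd_def deg_def\<close>)
  then show False using lead[of \<nu>] \<nu> F0(3) by (auto simp: Fd_def F0_def)
qed

lemma uword_replicate: "uword (replicate r z) = (upn_iota (root_mat z) ^ r :: ('k::field_char_0, 'n::finite) upn)"
  by (induction r) simp_all

lemma scalar_in_Fil: "scale_upn c 1 \<in> (Fil 1 :: ('k::field_char_0, 'n::finite) upn set)"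
  using Fil_scale[OF uword_in_Fil[of "[]" 1]] by simp

lemma of_nat_in_Fil: "of_nat m \<in> (Fil 1 :: ('k::field_char_0, 'n::finite) upn set)"
proof (induction m)
  case (Suc m) then show ?case using Fil_add[OF scalar_in_Fil[of 1] Suc] by simp
qed simp

lemma falling_factorial_leading:
  assumes "z \<in> roots CARD('n)"
  defines "h \<equiv> upn_iota (root_mat z) :: ('k::field_char_0, 'n::finite) upn"
  shows "prod_list (map (\<lambda>m. h - of_nat m) [0..<r]) - uword (replicate r z) \<in> Fil r"
proof (induction r)
  case (Suc r)
  let ?P = "prod_list (map (\<lambda>m. h - of_nat m) [0..<r])"
  have h: "h \<in> Fil 2" unfolding h_def by (rule iota_in_Fil[OF assms(1)])
  have w: "uword (replicate r z) \<in> (Fil (Suc r) :: ('k, 'n) upn set)" by (rule uword_in_Fil) (use assms(1) in auto)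
  have "?P - uword (replicate r z) \<in> Fil (Suc r)" by (rule subsetD[OF Fil_mono Suc]) simp
  then have "?P - uword (replicate r z) + uword (replicate r z) \<in> Fil (Suc r)" using w by (rule Fil_add)
  then have P: "?P \<in> Fil (Suc r)" by simp
  have "(?P - uword (replicate r z)) * h - ?P * of_nat r \<in> Fil (Suc r)"
    by (rule Fil_diff[OF Fil_mult[OF Suc h] Fil_mult[OF P of_nat_in_Fil]]) simp_all
  also have "(?P - uword (replicate r z)) * h - ?P * of_nat r
      = prod_list (map (\<lambda>m. h - of_nat m) [0..<Suc r]) - uword (replicate (Suc r) z)"
    by (simp add: uword_replicate power_commutes algebra_simps flip: h_def)
  finally show ?case .
qed simp

lemma product_leading:
  assumes "set zs \<subseteq> roots CARD('n)"
    and "\<And>z. z \<in> set zs \<Longrightarrow> k z \<noteq> 0 \<and> L z - scale_upn (k z) (uword (replicate (\<mu> z) z)) \<in> Fil (\<mu> z)"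
  shows "\<exists>c. c \<noteq> 0 \<and> prod_list (map L zs) - scale_upn c (uword (sorted_word zs \<mu>))
    \<in> (Fil (\<Sum>z\<leftarrow>zs. \<mu> z) :: ('k::field_char_0, 'n::finite) upn set)"
  using assms
proof (induction zs)
  case Nil show ?case by (intro exI[of _ 1]) simp
next
  case (Cons z zs)
  let ?d = "\<Sum>z\<leftarrow>zs. \<mu> z" and ?x = "L z" and ?y = "prod_list (map L zs)"
  let ?u = "uword (replicate (\<mu> z) z) :: ('k, 'n) upn" and ?v = "uword (sorted_word zs \<mu>) :: ('k, 'n) upn"
  obtain c where c: "c \<noteq> 0" "?y - scale_upn c ?v \<in> Fil ?d" using Cons by auto
  have k: "k z \<noteq> 0" "?x - scale_upn (k z) ?u \<in> Fil (\<mu> z)" using Cons.prems by auto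
  have v: "?v \<in> Fil (Suc ?d)"
    using Cons.prems(1) by (intro uword_in_Fil) (auto simp: set_sorted_word length_sorted_word)
  have u: "?u \<in> Fil (Suc (\<mu> z))" using Cons.prems(1) by (intro uword_in_Fil) auto
  have "?y - scale_upn c ?v + scale_upn c ?v \<in> Fil (Suc ?d)"
    by (rule Fil_add[OF subsetD[OF Fil_mono c(2)] Fil_scale[OF v]]) simp
  then have y: "?y \<in> Fil (Suc ?d)" by simp
  have "(?x - scale_upn (k z) ?u) * ?y + scale_upn (k z) ?u * (?y - scale_upn c ?v) \<in> Fil (\<mu> z + ?d)"
    by (rule Fil_add[OF Fil_mult[OF k(2) y] Fil_mult[OF Fil_scale[OF u] c(2)]]) simp_all
  also have "(?x - scale_upn (k z) ?u) * ?y + scale_upn (k z) ?u * (?y - scale_upn c ?v)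
      = ?x * ?y - scale_upn (k z * c) (?u * ?v)"
    by (simp add: algebra_simps flip: upn.scale_mult_left upn.scale_mult_right)
  finally show ?case using c k by (intro exI[of _ "k z * c"]) simp
qed


section \<open>Decomposition of matrices along the root basis\<close>

lemma upn_iota_sum:
  fixes f :: "'i \<Rightarrow> 'k::field_char_0 smat"
  assumes "\<And>i. i \<in> I \<Longrightarrow> f i \<in> pn CARD('n::finite)"
  shows "sum f I \<in> pn CARD('n)" "upn_iota (sum f I) = (\<Sum>i\<in>I. upn_iota (f i) :: ('k, 'n) upn)"
proof -
  have "sum f I \<in> pn CARD('n) \<and> upn_iota (sum f I) = (\<Sum>i\<in>I. upn_iota (f i) :: ('k, 'n) upn)"
    using assms
  proof (induction I rule: infinite_finite_induct)
    case (insert i I)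
    then have i: "f i \<in> pn CARD('n)" and I: "sum f I \<in> pn CARD('n)" by simp_all
    have IH: "upn_iota (sum f I) = (\<Sum>i\<in>I. upn_iota (f i) :: ('k, 'n) upn)" using insert by simp
    show ?case unfolding sum.insert[OF insert(1,2)] upn_iota_plus[OF i I] IH
      by (intro conjI pn_add[OF i I] refl)
  qed (simp_all add: pn_zero upn_iota_zero)
  then show "sum f I \<in> pn CARD('n)" "upn_iota (sum f I) = (\<Sum>i\<in>I. upn_iota (f i) :: ('k, 'n) upn)" by blast+
qed

lemma mat_sum_apply: "(\<Sum>i\<in>I. f i :: 'k::comm_ring_1 smat) r s = (\<Sum>i\<in>I. f i r s)"
  by (induction I rule: infinite_finite_induct) simp_all

lemma sum_pair_delta:
  fixes f :: "nat \<Rightarrow> nat \<Rightarrow> 'k::comm_ring_1"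
  assumes "a \<in> {1..n}" "b \<in> {1..n}"
  shows "(\<Sum>p\<in>{1..n} \<times> {1..n}. f (fst p) (snd p) * (if a = fst p \<and> b = snd p then 1 else 0)) = f a b"
    "(\<Sum>p\<in>{1..n} \<times> {1..n}. f (fst p) (snd p) * (if a = snd p \<and> b = fst p then 1 else 0)) = f b a"
proof -
  have "(\<Sum>p\<in>{1..n} \<times> {1..n}. f (fst p) (snd p) * (if a = fst p \<and> b = snd p then 1 else 0))
      = (\<Sum>p\<in>{1..n} \<times> {1..n}. if p = (a, b) then f a b else 0)"
    by (rule sum.cong) (auto split: if_splits)
  then show "(\<Sum>p\<in>{1..n} \<times> {1..n}. f (fst p) (snd p) * (if a = fst p \<and> b = snd p then 1 else 0)) = f a b"
    using assms by simp
  have "(\<Sum>p\<in>{1..n} \<times> {1..n}. f (fst p) (snd p) * (if a = snd p \<and> b = fst p then 1 else 0))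
      = (\<Sum>p\<in>{1..n} \<times> {1..n}. if p = (b, a) then f b a else 0)"
    by (rule sum.cong) (auto split: if_splits)
  then show "(\<Sum>p\<in>{1..n} \<times> {1..n}. f (fst p) (snd p) * (if a = snd p \<and> b = fst p then 1 else 0)) = f b a"
    using assms by simp
qed

lemma basis_sum_entries:
  fixes f :: "nat \<Rightarrow> nat \<Rightarrow> 'k::field_char_0"
  assumes ij: "i \<in> {1..n}" "j \<in> {1..n}"
  defines "a \<equiv> \<Sum>p\<in>{1..n} \<times> {1..n}. mat_scale (f (fst p) (snd p)) (pa (fst p) (snd p))"
    and "s \<equiv> \<Sum>p\<in>{1..n} \<times> {1..n}. mat_scale (f (fst p) (snd p)) (ps (fst p) (snd p))"
    and "c \<equiv> \<Sum>p\<in>{1..n} \<times> {1..n}. mat_scale (f (fst p) (snd p)) (pc (fst p) (snd p))"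
  shows "a (int i) (int j) = f i j" "a (int i) (- int j) = 0" "a (- int i) (int j) = 0"
    "s (int i) (int j) = 0" "s (int i) (- int j) = f i j + f j i" "s (- int i) (int j) = 0"
    "c (int i) (int j) = 0" "c (int i) (- int j) = 0" "c (- int i) (int j) = f i j - f j i"
proof -
  have ne: "int i = - int l \<longleftrightarrow> False" "int j = - int l \<longleftrightarrow> False" "- int i = int l \<longleftrightarrow> False" "- int j = int l \<longleftrightarrow> False" for l
    using ij by auto
  note simps = mat_sum_apply mat_apply pn_basis_apply ne neg_equal_iff_equal of_nat_eq_iff simp_thms if_False
    distrib_left right_diff_distrib sum.distrib sum_subtractf sum_pair_delta[OF ij]
  show "a (int i) (int j) = f i j" "a (int i) (- int j) = 0" "a (- int i) (int j) = 0"
    unfolding a_def by (simp_all only: simps) simp_all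
  show "s (int i) (int j) = 0" "s (int i) (- int j) = f i j + f j i" "s (- int i) (int j) = 0"
    unfolding s_def by (simp_all only: simps) simp_all
  show "c (int i) (int j) = 0" "c (int i) (- int j) = 0" "c (- int i) (int j) = f i j - f j i"
    unfolding c_def by (simp_all only: simps) simp_all
qed

lemma pn_ext:
  assumes "X \<in> pn n" "Y \<in> pn n"
    and "\<And>i j. i \<in> {1..n} \<Longrightarrow> j \<in> {1..n} \<Longrightarrow> X (int i) (int j) = Y (int i) (int j) \<and>
      X (int i) (- int j) = Y (int i) (- int j) \<and> X (- int i) (int j) = Y (- int i) (int j)"
  shows "X = Y"
proof (intro ext)
  fix r s
  have cases: "(\<exists>i\<in>{1..n}. r = int i) \<or> (\<exists>i\<in>{1..n}. r = - int i)" if "r \<in> idx n" for r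
  proof (cases "r > 0")
    case True then show ?thesis using that by (intro disjI1 bexI[of _ "nat r"]) (auto simp: idx_def)
  next
    case False then show ?thesis using that by (intro disjI2 bexI[of _ "nat (- r)"]) (auto simp: idx_def)
  qed
  show "X r s = Y r s"
  proof (cases "r \<in> idx n \<and> s \<in> idx n")
    case False then show ?thesis using pnD(1,2)[OF assms(1)] pnD(1,2)[OF assms(2)] by metis
  next
    case True
    then consider i j where "r = int i" "s = int j" "i \<in> {1..n}" "j \<in> {1..n}"
      | i j where "r = int i" "s = - int j" "i \<in> {1..n}" "j \<in> {1..n}"
      | i j where "r = - int i" "s = int j" "i \<in> {1..n}" "j \<in> {1..n}"
      | i j where "r = - int i" "s = - int j" "i \<in> {1..n}" "j \<in> {1..n}" using cases by metis
    then show ?thesis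
    proof cases
      case 4
      have "X r s = pn_sign (- s) (- r) * X (- s) (- r)" "Y r s = pn_sign (- s) (- r) * Y (- s) (- r)"
        using pnD(3)[OF assms(1), of "- s" "- r"] pnD(3)[OF assms(2), of "- s" "- r"] True by simp_all
      then show ?thesis using assms(3)[of j i] 4 by simp
    qed (use assms(3) in auto)
  qed
qed

text \<open>
  The $S_{ij}$ and $T_{ij}$ are summed over all ordered pairs, which accounts for the factor $1/2$.
\<close>

lemma pn_expansion:
  fixes X :: "'k::field_char_0 smat"
  assumes X: "X \<in> pn n"
  shows "X = (\<Sum>p\<in>{1..n} \<times> {1..n}. mat_scale (X (int (fst p)) (int (snd p))) (pa (fst p) (snd p)))
    + (\<Sum>p\<in>{1..n} \<times> {1..n}. mat_scale (X (int (fst p)) (- int (snd p)) / 2) (ps (fst p) (snd p)))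
    + (\<Sum>p\<in>{1..n} \<times> {1..n}. mat_scale (X (- int (fst p)) (int (snd p)) / 2) (pc (fst p) (snd p)))" (is "X = ?a + ?s + ?c")
proof (rule pn_ext[OF X])
  have m: "mat_scale c (pa k l) \<in> pn n" "mat_scale c (ps k l) \<in> pn n" "mat_scale c (pc k l) \<in> pn n"
    if "k \<in> {1..n}" "l \<in> {1..n}" for k l and c :: 'k
    using that by (auto intro!: pn_closed pn_partD(1)[OF pn_basis(1)] pn_partD(1)[OF pn_basis(2)] pn_partD(1)[OF pn_basis(3)])
  have sum_pn: "sum f I \<in> pn n" if "\<And>p. p \<in> I \<Longrightarrow> f p \<in> pn n" for f :: "nat \<times> nat \<Rightarrow> 'k smat" and I
    using that
  proof (induction I rule: infinite_finite_induct)
    case (insert i I) then show ?case unfolding sum.insert[OF insert(1,2)] by (intro pn_add) simp_all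
  qed (simp_all add: pn_zero)
  show "?a + ?s + ?c \<in> pn n" by (intro pn_add sum_pn m) auto
  fix i j assume ij: "i \<in> {1..n}" "j \<in> {1..n}"
  have "X (int i) (- int j) = X (int j) (- int i)" "X (- int i) (int j) = - X (- int j) (int i)"
    using pnD(3)[OF X, of "int j" "- int i"] pnD(3)[OF X, of "- int j" "int i"] ij by (auto simp: pn_sign_def)
  then show "X (int i) (int j) = (?a + ?s + ?c) (int i) (int j) \<and> X (int i) (- int j) = (?a + ?s + ?c) (int i) (- int j) \<and>
      X (- int i) (int j) = (?a + ?s + ?c) (- int i) (int j)"
    unfolding plus_fun_apply
      basis_sum_entries[OF ij, where f = "\<lambda>k l. X (int k) (int l)"]
      basis_sum_entries[OF ij, where f = "\<lambda>k l. X (int k) (- int l) / 2"]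
      basis_sum_entries[OF ij, where f = "\<lambda>k l. X (- int k) (int l) / 2"]
    by simp
qed

text \<open>
  A homogeneous matrix is a combination of those basis matrices that have the same parity.
\<close>

lemma iota_in_subspace:
  fixes V :: "('k::field_char_0, 'n::finite) upn set"
  assumes V: "upn.subspace V" and X: "X \<in> pn_part CARD('n) q"
    and A: "\<And>i j. q = 0 \<Longrightarrow> i \<in> {1..CARD('n)} \<Longrightarrow> j \<in> {1..CARD('n)} \<Longrightarrow> uA i j \<in> V"
    and S: "\<And>i j. q = 1 \<Longrightarrow> i \<in> {1..CARD('n)} \<Longrightarrow> j \<in> {1..CARD('n)} \<Longrightarrow> uS i j \<in> V"
    and T: "\<And>i j. q = 1 \<Longrightarrow> i \<in> {1..CARD('n)} \<Longrightarrow> j \<in> {1..CARD('n)} \<Longrightarrow> uT i j \<in> V"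
  shows "upn_iota X \<in> V"
proof -
  let ?I = "{1..CARD('n)} \<times> {1..CARD('n)}"
  have pn: "b (fst p) (snd p) \<in> pn CARD('n)" if "p \<in> ?I" "b \<in> {pa, ps, pc}" for p and b :: "nat \<Rightarrow> nat \<Rightarrow> 'k smat"
    using that by (cases p) (auto intro!: pn_partD(1)[OF pn_basis(1)] pn_partD(1)[OF pn_basis(2)] pn_partD(1)[OF pn_basis(3)])
  have part: "(\<Sum>p\<in>?I. mat_scale (f p) (b (fst p) (snd p))) \<in> pn CARD('n)"
    "upn_iota (\<Sum>p\<in>?I. mat_scale (f p) (b (fst p) (snd p))) \<in> V"
    if b: "b \<in> {pa, ps, pc}" and "\<And>p. p \<in> ?I \<Longrightarrow> f p \<noteq> 0 \<Longrightarrow> upn_iota (b (fst p) (snd p)) \<in> V"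
    for b :: "nat \<Rightarrow> nat \<Rightarrow> 'k smat" and f
  proof -
    have m: "mat_scale (f p) (b (fst p) (snd p)) \<in> pn CARD('n)" if "p \<in> ?I" for p by (rule pn_closed(2)[OF pn[OF that b]])
    then show "(\<Sum>p\<in>?I. mat_scale (f p) (b (fst p) (snd p))) \<in> pn CARD('n)" by (rule upn_iota_sum(1))
    have mV: "upn_iota (mat_scale (f p) (b (fst p) (snd p))) \<in> V" if "p \<in> ?I" for p
      unfolding upn_iota_scale[OF pn[OF that b]] using V \<open>\<And>p. p \<in> ?I \<Longrightarrow> f p \<noteq> 0 \<Longrightarrow> upn_iota (b (fst p) (snd p)) \<in> V\<close>[OF that]
      by (cases "f p = 0") (auto intro: upn.subspace_scale upn.subspace_0)
    have "upn_iota (\<Sum>p\<in>?I. mat_scale (f p) (b (fst p) (snd p)))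
        = (\<Sum>p\<in>?I. upn_iota (mat_scale (f p) (b (fst p) (snd p))) :: ('k, 'n) upn)"
      by (rule upn_iota_sum(2)) (rule m)
    also have "\<dots> \<in> V" by (rule upn.subspace_sum[OF V mV])
    finally show "upn_iota (\<Sum>p\<in>?I. mat_scale (f p) (b (fst p) (snd p))) \<in> V" .
  qed
  have q: "q = 0 \<or> q = 1" by (cases q) auto
  have pX: "X r s \<noteq> 0 \<Longrightarrow> (if (r > 0) = (s > 0) then 0 else 1) = q" for r s by (rule pn_partD(2)[OF X])
  have a: "uA (fst p) (snd p) \<in> V" if "p \<in> ?I" "X (int (fst p)) (int (snd p)) \<noteq> 0" for p
    using that pX[OF that(2)] by (intro A) (auto split: if_splits)
  have s: "uS (fst p) (snd p) \<in> V" if "p \<in> ?I" "X (int (fst p)) (- int (snd p)) / 2 \<noteq> 0" for p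
    using that pX[of "int (fst p)" "- int (snd p)"] by (intro S) (auto split: if_splits)
  have c: "uT (fst p) (snd p) \<in> V" if "p \<in> ?I" "X (- int (fst p)) (int (snd p)) / 2 \<noteq> 0" for p
    using that pX[of "- int (fst p)" "int (snd p)"] by (intro T) (auto split: if_splits)
  have pa: "(\<Sum>p\<in>?I. mat_scale (X (int (fst p)) (int (snd p))) (pa (fst p) (snd p))) \<in> pn CARD('n)"
      "upn_iota (\<Sum>p\<in>?I. mat_scale (X (int (fst p)) (int (snd p))) (pa (fst p) (snd p))) \<in> V"
    by (rule part; use a in simp)+
  have ps: "(\<Sum>p\<in>?I. mat_scale (X (int (fst p)) (- int (snd p)) / 2) (ps (fst p) (snd p))) \<in> pn CARD('n)"
      "upn_iota (\<Sum>p\<in>?I. mat_scale (X (int (fst p)) (- int (snd p)) / 2) (ps (fst p) (snd p))) \<in> V"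
    by (rule part; use s in simp)+
  have pc: "(\<Sum>p\<in>?I. mat_scale (X (- int (fst p)) (int (snd p)) / 2) (pc (fst p) (snd p))) \<in> pn CARD('n)"
      "upn_iota (\<Sum>p\<in>?I. mat_scale (X (- int (fst p)) (int (snd p)) / 2) (pc (fst p) (snd p))) \<in> V"
    by (rule part; use c in simp)+
  show ?thesis
    unfolding arg_cong[of _ _ upn_iota, OF pn_expansion[OF pn_partD(1)[OF X]]]
      upn_iota_plus[OF pn_add[OF pa(1) ps(1)] pc(1)] upn_iota_plus[OF pa(1) ps(1)]
    by (intro upn.subspace_add[OF V] pa(2) ps(2) pc(2))
qed


section \<open>Spanning sets and the behaviour of $\rho$\<close>

lemma grade_ralg_subspace: "ralg.subspace (grade_ralg p)" and grade_upn_subspace: "upn.subspace (grade_upn p)"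
  unfolding grade_ralg_def grade_upn_def by (rule ralg.subspace_span upn.subspace_span)+

lemma grade_ralg_one: "(1 :: ('k::field_char_0, 'n::finite) ralg) \<in> grade_ralg 0"
  unfolding grade_ralg_def by (intro ralg.span_base CollectI exI[of _ "[]"]) simp

lemma grade_ralg_gen: "g \<in> rgens CARD('n) \<Longrightarrow> (ralg_gen g :: ('k::field_char_0, 'n::finite) ralg) \<in> grade_ralg (rpar g)"
  unfolding grade_ralg_def by (intro ralg.span_base CollectI exI[of _ "[g]"]) simp

lemma ralg_span_mult:
  assumes "x \<in> ralg.span B" "y \<in> ralg.span C" "\<And>b c. b \<in> B \<Longrightarrow> c \<in> C \<Longrightarrow> b * c \<in> ralg.span D"
  shows "x * y \<in> (ralg.span D :: ('k::field_char_0, 'n::finite) ralg set)"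
proof -
  have 1: "b * y \<in> ralg.span D" if "b \<in> B" for b
    using assms(2)
  proof (induction rule: ralg.span_induct_alt)
    case (step c z y) then show ?case using assms(3)[OF that]
      by (simp add: distrib_left ralg.span_add ralg.span_scale flip: ralg.scale_mult_right)
  qed (simp add: ralg.span_zero)
  show ?thesis
    using assms(1)
  proof (induction rule: ralg.span_induct_alt)
    case (step c z x) then show ?case using 1
      by (simp add: distrib_right ralg.span_add ralg.span_scale flip: ralg.scale_mult_left)
  qed (simp add: ralg.span_zero)
qed

lemma grade_ralg_mult: "x \<in> grade_ralg p \<Longrightarrow> y \<in> grade_ralg q \<Longrightarrow> x * y \<in> (grade_ralg (p + q) :: ('k::field_char_0, 'n::finite) ralg set)"
  unfolding grade_ralg_def
proof (rule ralg_span_mult)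
  fix b c :: "('k, 'n) ralg"
  assume "b \<in> {prod_list (map ralg_gen gs) |gs. set gs \<subseteq> rgens CARD('n) \<and> sum_list (map rpar gs) = p}"
    "c \<in> {prod_list (map ralg_gen gs) |gs. set gs \<subseteq> rgens CARD('n) \<and> sum_list (map rpar gs) = q}"
  then obtain gs hs where "b = prod_list (map ralg_gen gs)" "set gs \<subseteq> rgens CARD('n)" "sum_list (map rpar gs) = p"
    "c = prod_list (map ralg_gen hs)" "set hs \<subseteq> rgens CARD('n)" "sum_list (map rpar hs) = q" by auto
  then show "b * c \<in> ralg.span {prod_list (map ralg_gen gs) |gs. set gs \<subseteq> rgens CARD('n) \<and> sum_list (map rpar gs) = p + q}"
    by (intro ralg.span_base CollectI exI[of _ "gs @ hs"]) simp
qed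

lemma ralg_subspace_half:
  assumes "ralg.subspace V" "x + x \<in> V" shows "x \<in> (V :: ('k::field_char_0, 'n::finite) ralg set)"
proof -
  have "scale_ralg (1 / 2) (x + x) \<in> V" by (rule ralg.subspace_scale[OF assms])
  also have "scale_ralg (1 / 2) (x + x) = x" by (simp add: ralg.scale_right_distrib flip: ralg.scale_left_distrib)
  finally show ?thesis .
qed

lemma ralg_span_words:
  "ralg.span {prod_list (map ralg_gen gs) | gs. set gs \<subseteq> rgens CARD('n)} = (UNIV :: ('k::field_char_0, 'n::finite) ralg set)"
proof -
  have "u \<in> ralg.span {prod_list (map ralg_gen gs) | gs. set gs \<subseteq> rgens CARD('n)}" for u :: "('k, 'n) ralg"
  proof -
    obtain x where x: "x \<in> free_alg (rgens CARD('n))" "u = abs_ralg x" by (rule ralg_exhaust)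
    show ?thesis
      unfolding x(2) using x(1)
    proof (induction rule: free_alg_induct)
      case zero show ?case by (simp add: ralg.span_zero flip: zero_ralg_def)
    next
      case (word u c)
      then show ?case unfolding abs_ralg_word[OF word] by (intro ralg.span_scale ralg.span_base) auto
    next
      case (add x y) then show ?case by (simp add: ralg.span_add flip: abs_ralg_add)
    qed
  qed
  then show ?thesis by auto
qed

lemma upn_span_words:
  "upn.span {prod_list (map upn_iota Xs) | Xs. set Xs \<subseteq> pn CARD('n)} = (UNIV :: ('k::field_char_0, 'n::finite) upn set)"
proof -
  have "u \<in> upn.span {prod_list (map upn_iota Xs) | Xs. set Xs \<subseteq> pn CARD('n)}" for u :: "('k, 'n) upn"
  proof -
    obtain x where x: "x \<in> free_alg (pn CARD('n))" "u = abs_upn x" by (rule upn_exhaust)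
    show ?thesis
      unfolding x(2) using x(1)
    proof (induction rule: free_alg_induct)
      case zero show ?case by (simp add: upn.span_zero flip: zero_upn_def)
    next
      case (word u c)
      then show ?case unfolding abs_upn_word[OF word] by (intro upn.span_scale upn.span_base) auto
    next
      case (add x y) then show ?case by (simp add: upn.span_add flip: abs_upn_add)
    qed
  qed
  then show ?thesis by auto
qed

lemma rho_linear: "Vector_Spaces.linear scale_ralg scale_upn (rho :: ('k::field_char_0, 'n::finite) ralg \<Rightarrow> ('k, 'n) upn)"
  by (rule linearI_upn) (rule rho_hom)+

lemma rho_prod_list: "rho (prod_list xs) = prod_list (map rho (xs :: ('k::field_char_0, 'n::finite) ralg list))"
  by (induction xs) (simp_all add: rho_hom)

lemma rho_power: "rho (x ^ r) = rho (x :: ('k::field_char_0, 'n::finite) ralg) ^ r"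
  by (induction r) (simp_all add: rho_hom)

lemma rho_diff: "rho (x - y) = rho x - rho (y :: ('k::field_char_0, 'n::finite) ralg)"
  using rho_hom(1)[of "x - y" y] by (simp add: eq_diff_eq)

lemma rho_zero: "rho (0 :: ('k::field_char_0, 'n::finite) ralg) = 0"
  using rho_diff[of 0 "0 :: ('k, 'n) ralg"] by simp

lemma rho_of_nat: "rho (of_nat m :: ('k::field_char_0, 'n::finite) ralg) = of_nat m"
  by (induction m) (simp_all add: rho_hom rho_zero)

lemma rho_sum: "rho (sum f I) = (\<Sum>i\<in>I. rho (f i :: ('k::field_char_0, 'n::finite) ralg))"
  by (induction I rule: infinite_finite_induct) (simp_all add: rho_hom rho_zero)

text \<open>
  A copy of $\mathfrak p(n)$ in $R$ that extends the generators and is mapped by $\rho$ to the standard one.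
\<close>

locale ralg_model = ralg_family "CARD('n)" A S T
  for A S T :: "nat \<Rightarrow> nat \<Rightarrow> ('k::field_char_0, 'n::finite) ralg" +
  assumes A_diag: "i \<in> {1..CARD('n)} \<Longrightarrow> A i i = rH i"
    and A_up: "i \<in> {1..<CARD('n)} \<Longrightarrow> A i (i + 1) = rE i" and A_down: "i \<in> {1..<CARD('n)} \<Longrightarrow> A (i + 1) i = rF i"
    and S_11: "S 1 1 = ralg_gen GB11 + ralg_gen GB11"
    and S_simple: "i \<in> {1..<CARD('n)} \<Longrightarrow> S i (i + 1) = rB i" and T_simple: "i \<in> {1..<CARD('n)} \<Longrightarrow> T i (i + 1) = rC i"
    and rho_A: "i \<in> {1..CARD('n)} \<Longrightarrow> j \<in> {1..CARD('n)} \<Longrightarrow> rho (A i j) = uA i j"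
    and rho_S: "i \<in> {1..CARD('n)} \<Longrightarrow> j \<in> {1..CARD('n)} \<Longrightarrow> rho (S i j) = uS i j"
    and rho_T: "i \<in> {1..CARD('n)} \<Longrightarrow> j \<in> {1..CARD('n)} \<Longrightarrow> rho (T i j) = uT i j"
begin

lemma gl: "gl_family CARD('n) A" using fam by (simp add: pn_family_def)

lemma rho_X: "z \<in> roots CARD('n) \<Longrightarrow> rho (X z) = upn_iota (root_mat z)"
proof (cases z)
  case (Plus i j)
  assume z: "z \<in> roots CARD('n)"
  then have "(ps i j :: 'k smat) \<in> pn CARD('n)" using Plus by (intro pn_partD(1)[OF pn_basis(2)]) auto
  then show ?thesis
    using Plus z by (auto simp: root_mat_def pb_eq rho_hom rho_S mat_fun_simps upn_iota_scale[where 'n='n])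
qed (auto simp: root_mat_def rho_A rho_T)

lemma letter_leading:
  assumes z: "z \<in> roots CARD('n)"
  shows "\<exists>c. c \<noteq> 0 \<and> rho (kostant_letter X z r) - scale_upn c (uword (replicate r z)) \<in> Fil r"
proof -
  consider "odd_root z" | i j where "z = Diff i j" "i \<noteq> j" | i where "z = Diff i i"
    by (cases z) auto
  then show ?thesis
  proof cases
    case 1
    then show ?thesis
      using odd_letter[of z r] z by (intro exI[of _ 1]) (simp add: rho_power rho_X uword_replicate)
  next
    case 2
    then show ?thesis
      using z rho_X[OF z] by (intro exI[of _ "1 / fact r"]) (simp add: divpow_def rho_hom rho_power uword_replicate)
  next
    case 3
    have "rho (kostant_letter X z r)
        = scale_upn (1 / fact r) (prod_list (map (\<lambda>m. upn_iota (root_mat z) - of_nat m) [0..<r]))"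
      using rho_X[OF z] 3 by (simp add: hbinom_def rho_hom rho_prod_list comp_def rho_diff rho_of_nat)
    then show ?thesis
      using Fil_scale[OF falling_factorial_leading[OF z, of r], of "1 / fact r"]
      by (intro exI[of _ "1 / fact r"]) (simp add: upn.scale_right_diff_distrib)
  qed
qed

lemma rho_ordered_independent:
  assumes zs: "distinct zs" "set zs = roots CARD('n)" and F: "finite F" "F \<subseteq> exponents zs"
    and rel: "rho (\<Sum>\<mu>\<in>F. scale_ralg (a \<mu>) (ordered zs \<mu>)) = 0" and \<mu>: "\<mu> \<in> F"
  shows "a \<mu> = 0"
proof -
  have "\<exists>c. c \<noteq> 0 \<and> rho (ordered zs \<nu>) - scale_upn c (uword (sorted_word zs \<nu>)) \<in> (Fil (\<Sum>z\<leftarrow>zs. \<nu> z) :: ('k, 'n) upn set)" for \<nu>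
  proof -
    obtain c :: "root \<Rightarrow> 'k" where c: "\<And>z. z \<in> roots CARD('n) \<Longrightarrow>
        c z \<noteq> 0 \<and> rho (kostant_letter X z (\<nu> z)) - scale_upn (c z) (uword (replicate (\<nu> z) z)) \<in> Fil (\<nu> z)"
      using bchoice[of "roots CARD('n)" "\<lambda>z c. c \<noteq> 0 \<and>
          rho (kostant_letter X z (\<nu> z)) - scale_upn c (uword (replicate (\<nu> z) z)) \<in> Fil (\<nu> z)"]
        letter_leading by blast
    show ?thesis
      unfolding ordered_def rho_prod_list map_map comp_def
      by (rule product_leading[of zs c]) (use c zs in auto)
  qed
  then obtain k where "\<And>\<nu>. k \<nu> \<noteq> 0 \<and> rho (ordered zs \<nu>) - scale_upn (k \<nu>) (uword (sorted_word zs \<nu>))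
      \<in> (Fil (\<Sum>z\<leftarrow>zs. \<nu> z) :: ('k, 'n) upn set)" by metis
  then show ?thesis
    using rel zs \<mu> F
    by (intro leading_terms_independent[of zs F k "\<lambda>\<mu>. rho (ordered zs \<mu>)" a \<mu>]) (auto simp: rho_sum rho_hom)
qed

end


section \<open>The basis of ordered monomials\<close>

context ralg_model
begin

lemma rpar_gens: "rpar (GE i) = 0" "rpar (GF i) = 0" "rpar (GH i) = 0" "rpar GB11 = 1" "rpar (GB i) = 1" "rpar (GC i) = 1"
  by simp_all

lemma gens_mem: "i \<in> {1..<CARD('n)} \<Longrightarrow> GE i \<in> rgens CARD('n)" "i \<in> {1..<CARD('n)} \<Longrightarrow> GF i \<in> rgens CARD('n)"
  "i \<in> {1..<CARD('n)} \<Longrightarrow> GC i \<in> rgens CARD('n)" "i \<in> {1..CARD('n)} \<Longrightarrow> GH i \<in> rgens CARD('n)" "GB11 \<in> rgens CARD('n)"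
  by (simp_all add: rgens_def)

lemma A_in_subspace:
  assumes V: "ralg.subspace V" "\<And>x y. x \<in> V \<Longrightarrow> y \<in> V \<Longrightarrow> x * y \<in> V"
    and gens: "\<And>i. i \<in> {1..<CARD('n)} \<Longrightarrow> rE i \<in> V" "\<And>i. i \<in> {1..<CARD('n)} \<Longrightarrow> rF i \<in> V"
      "\<And>i. i \<in> {1..CARD('n)} \<Longrightarrow> rH i \<in> V"
    and ij: "i \<in> {1..CARD('n)}" "j \<in> {1..CARD('n)}"
  shows "A i j \<in> V"
proof (rule gl_family_generated[OF gl ij])
  show "A k k \<in> V" if "k \<in> {1..CARD('n)}" for k using gens(3) A_diag that by simp
  show "A k (k + 1) \<in> V \<and> A (k + 1) k \<in> V" if "1 \<le> k" "k < CARD('n)" for k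
    using gens(1,2)[of k] A_up[of k] A_down[of k] that by simp
  show "com x y \<in> V" if "x \<in> V" "y \<in> V" for x y
    unfolding com_def using ralg.subspace_diff[OF V(1)] V(2) that by blast
qed

lemma A_even: "i \<in> {1..CARD('n)} \<Longrightarrow> j \<in> {1..CARD('n)} \<Longrightarrow> A i j \<in> grade_ralg 0"
proof (rule A_in_subspace[OF grade_ralg_subspace])
  show "x * y \<in> grade_ralg 0" if "x \<in> grade_ralg 0" "y \<in> grade_ralg 0" for x y :: "('k, 'n) ralg"
    using grade_ralg_mult[OF that] by simp
qed (use grade_ralg_gen gens_mem rpar_gens in metis)+

lemma odd_com: "i \<in> {1..CARD('n)} \<Longrightarrow> j \<in> {1..CARD('n)} \<Longrightarrow> x \<in> grade_ralg 1 \<Longrightarrow> com (A i j) x \<in> grade_ralg 1"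
  using grade_ralg_mult[OF A_even, of i j x 1] grade_ralg_mult[of x 1 "A i j" 0, OF _ A_even]
  by (auto simp: com_def intro: ralg.subspace_diff[OF grade_ralg_subspace])

lemma S_in_subspace:
  assumes V: "ralg.subspace V" and com: "\<And>i j x. i \<in> {1..CARD('n)} \<Longrightarrow> j \<in> {1..CARD('n)} \<Longrightarrow> x \<in> V \<Longrightarrow> com (A i j) x \<in> V"
    and gen: "ralg_gen GB11 \<in> V" and ij: "i \<in> {1..CARD('n)}" "j \<in> {1..CARD('n)}"
  shows "S i j \<in> V"
proof (rule pn_family_S_closed[OF fam card_ge_1 _ _ _ _ ij])
  show "S 1 1 \<in> V" unfolding S_11 by (intro ralg.subspace_add[OF V] gen)
qed (fact ralg.subspace_diff[OF V] ralg_subspace_half[OF V] com)+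

lemma T_in_subspace:
  assumes V: "ralg.subspace V" and com: "\<And>i j x. i \<in> {1..CARD('n)} \<Longrightarrow> j \<in> {1..CARD('n)} \<Longrightarrow> x \<in> V \<Longrightarrow> com (A i j) x \<in> V"
    and n: "CARD('n) \<ge> 2" and gen: "rC (CARD('n) - 1) \<in> V" and ij: "i \<in> {1..CARD('n)}" "j \<in> {1..CARD('n)}"
  shows "T i j \<in> V"
proof (rule pn_family_T_closed[OF fam n _ _ _ ij])
  show "T (CARD('n) - 1) CARD('n) \<in> V" using T_simple[of "CARD('n) - 1"] gen n by simp
qed (fact ralg.subspace_diff[OF V] com)+

lemma S_odd: "i \<in> {1..CARD('n)} \<Longrightarrow> j \<in> {1..CARD('n)} \<Longrightarrow> S i j \<in> grade_ralg 1"
  by (rule S_in_subspace[OF grade_ralg_subspace odd_com]) (use grade_ralg_gen[OF gens_mem(5)] in simp_all)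

lemma T_odd:
  assumes "i \<in> {1..CARD('n)}" "j \<in> {1..CARD('n)}" shows "T i j \<in> grade_ralg 1"
proof (cases "CARD('n) \<ge> 2")
  case True
  then have "CARD('n) - 1 \<in> {1..<CARD('n)}" by auto
  from grade_ralg_gen[OF gens_mem(3)[OF this]] have "rC (CARD('n) - 1) \<in> (grade_ralg 1 :: ('k, 'n) ralg set)" by simp
  then show ?thesis by (intro T_in_subspace[OF grade_ralg_subspace odd_com] True assms)
next
  case False
  then have "i = j" using assms by auto
  then show ?thesis using D(3)[OF assms(1)] ralg.subspace_0[OF grade_ralg_subspace] by simp
qed

lemma rho_image_subspace: "ralg.subspace V \<Longrightarrow> upn.subspace (rho ` V)"
  by (rule module_hom.subspace_image[OF rho_linear[unfolded linear_iff_module_hom]])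

text \<open>
  Homogeneous elements of $\mathfrak p(n)$ have preimages of the same parity; this yields surjectivity and the gradedness of the inverse.
\<close>

lemma iota_in_rho_image:
  assumes M: "M \<in> pn_part CARD('n) q"
  shows "upn_iota M \<in> rho ` (grade_ralg q :: ('k, 'n) ralg set)"
proof (rule iota_in_subspace[OF rho_image_subspace[OF grade_ralg_subspace] M])
  fix i j assume ij: "i \<in> {1..CARD('n)}" "j \<in> {1..CARD('n)}"
  show "q = 0 \<Longrightarrow> uA i j \<in> rho ` (grade_ralg q :: ('k, 'n) ralg set)"
    using A_even[OF ij] rho_A[OF ij] by (metis imageI)
  show "q = 1 \<Longrightarrow> uS i j \<in> rho ` (grade_ralg q :: ('k, 'n) ralg set)"
    using S_odd[OF ij] rho_S[OF ij] by (metis imageI)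
  show "q = 1 \<Longrightarrow> uT i j \<in> rho ` (grade_ralg q :: ('k, 'n) ralg set)"
    using T_odd[OF ij] rho_T[OF ij] by (metis imageI)
qed

lemma grade_upn_image: "grade_upn p \<subseteq> rho ` (grade_ralg p :: ('k, 'n) ralg set)"
  unfolding grade_upn_def
proof (rule upn.span_minimal[OF _ rho_image_subspace[OF grade_ralg_subspace]], clarify)
  fix Ms :: "'k smat list" and ps
  assume "list_all2 (\<lambda>M q. M \<in> pn_part CARD('n) q) Ms ps"
  then show "prod_list (map upn_iota Ms) \<in> rho ` (grade_ralg (sum_list ps) :: ('k, 'n) ralg set)"
  proof (induction rule: list_all2_induct)
    case Nil
    show ?case using grade_ralg_one rho_hom(3) by (metis imageI list.map(1) prod_list.Nil sum_list.Nil)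
  next
    case (Cons M Ms q qs)
    then obtain x y :: "('k, 'n) ralg" where "x \<in> grade_ralg q" "upn_iota M = rho x"
      "y \<in> grade_ralg (sum_list qs)" "prod_list (map upn_iota Ms) = rho y" using iota_in_rho_image by blast
    then have "prod_list (map upn_iota (M # Ms)) = rho (x * y)" "x * y \<in> grade_ralg (sum_list (q # qs))"
      using grade_ralg_mult by (simp_all only: list.map prod_list.Cons sum_list.Cons rho_hom(2))
    then show ?case by blast
  qed
qed

lemma iota_in_range: "M \<in> pn CARD('n) \<Longrightarrow> upn_iota M \<in> range (rho :: ('k, 'n) ralg \<Rightarrow> _)"
proof -
  assume M: "M \<in> pn CARD('n)"
  note p = parts_pn[OF M]
  have "even_part M \<in> pn_part CARD('n) 0" "odd_part M \<in> pn_part CARD('n) 1"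
    using p by (auto simp: pn_part_def even_part_def odd_part_def)
  then obtain x y :: "('k, 'n) ralg" where "upn_iota (even_part M) = rho x" "upn_iota (odd_part M) = rho y"
    using iota_in_rho_image by (metis imageE)
  moreover have "M = even_part M + odd_part M" by (auto simp: even_part_def odd_part_def fun_eq_iff)
  ultimately have "upn_iota M = rho (x + y)" using upn_iota_plus[OF p] by (simp add: rho_hom)
  then show ?thesis by blast
qed

lemma rho_surj: "surj (rho :: ('k, 'n) ralg \<Rightarrow> _)"
proof -
  have "prod_list (map upn_iota Ms) \<in> range (rho :: ('k, 'n) ralg \<Rightarrow> _)" if "set Ms \<subseteq> pn CARD('n)" for Ms
    using that
  proof (induction Ms)
    case Nil show ?case using rho_hom(3) by (metis list.map(1) prod_list.Nil rangeI)
  next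
    case (Cons M Ms)
    then obtain x y :: "('k, 'n) ralg" where "upn_iota M = rho x" "prod_list (map upn_iota Ms) = rho y"
      using iota_in_range by (metis imageE insert_subset list.set(2))
    then show ?case by (simp flip: rho_hom(2))
  qed
  then have "upn.span {prod_list (map upn_iota Ms) | Ms. set Ms \<subseteq> pn CARD('n)} \<subseteq> range (rho :: ('k, 'n) ralg \<Rightarrow> _)"
    by (intro upn.span_minimal rho_image_subspace ralg.subspace_UNIV) auto
  then show ?thesis unfolding upn_span_words by auto
qed

definition basis_of :: "root list \<Rightarrow> ('k, 'n) ralg set"
  where "basis_of zs = ordered zs ` exponents zs"

context
  fixes zs :: "root list"
  assumes zs: "distinct zs" "set zs = roots CARD('n)"
begin

abbreviation "basis \<equiv> basis_of zs"

lemma inj_ordered: "inj_on (ordered zs) (exponents zs)"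
proof (rule inj_onI, rule ccontr)
  fix \<mu> \<nu> assume mn: "\<mu> \<in> exponents zs" "\<nu> \<in> exponents zs" "ordered zs \<mu> = ordered zs \<nu>" "\<mu> \<noteq> \<nu>"
  then have "(\<Sum>\<kappa>\<in>{\<mu>, \<nu>}. scale_ralg (if \<kappa> = \<mu> then 1 else - 1) (ordered zs \<kappa>)) = 0" by auto
  then have "(if \<mu> = \<mu> then 1 else - 1 :: 'k) = 0"
    using mn by (intro rho_ordered_independent[OF zs, of "{\<mu>, \<nu>}" "\<lambda>\<kappa>. if \<kappa> = \<mu> then 1 else - 1"]) (simp_all add: rho_zero)
  then show False by simp
qed

lemma basis_rho_independent:
  assumes B: "finite B" "B \<subseteq> basis" and rel: "rho (\<Sum>x\<in>B. scale_ralg (a x) x) = 0" and x: "x \<in> B"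
  shows "a x = 0"
proof -
  obtain F where F: "F \<subseteq> exponents zs" "finite F" "B = ordered zs ` F"
    using finite_subset_image[OF B(1)] B(2) unfolding basis_of_def by metis
  have "(\<Sum>x\<in>B. scale_ralg (a x) x) = (\<Sum>\<mu>\<in>F. scale_ralg (a (ordered zs \<mu>)) (ordered zs \<mu>))"
    unfolding F(3) using inj_on_subset[OF inj_ordered F(1)] by (simp add: sum.reindex)
  then have "a (ordered zs \<mu>) = 0" if "\<mu> \<in> F" for \<mu>
    using rho_ordered_independent[OF zs F(2,1), of "\<lambda>\<mu>. a (ordered zs \<mu>)"] rel that by simp
  then show ?thesis using x F(3) by auto
qed

lemma basis_independent: "ralg.independent basis"
  unfolding ralg.independent_explicit_module
proof (intro allI impI)
  fix B :: "('k, 'n) ralg set" and a :: "('k, 'n) ralg \<Rightarrow> 'k" and x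
  assume B: "finite B" "B \<subseteq> basis" "(\<Sum>v\<in>B. scale_ralg (a v) v) = 0" "x \<in> B"
  show "a x = 0" by (rule basis_rho_independent[OF B(1,2) _ B(4)]) (simp only: B(3) rho_zero)
qed

text \<open>
  The embedding of the integers into the field reduces integral to linear independence.
\<close>

lemma basis_int_independent: "int_module.independent basis"
  unfolding int_module.independent_explicit_module
proof (intro allI impI)
  fix B :: "('k, 'n) ralg set" and a :: "('k, 'n) ralg \<Rightarrow> int" and x
  assume B: "finite B" "B \<subseteq> basis" "(\<Sum>v\<in>B. of_int (a v) * v) = 0" "x \<in> B"
  then have "rho (\<Sum>v\<in>B. scale_ralg (of_int (a v)) v) = 0" by (simp add: rho_zero ralg_of_int_scale)
  then have "(of_int (a x) :: 'k) = 0" by (rule basis_rho_independent[OF B(1,2) _ B(4)])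
  then show "a x = 0" by simp
qed

text \<open>
  If an exponent of an odd root exceeds one, the product vanishes; otherwise it is brought into normal form by resetting the exponents outside the list.
\<close>

lemma ordered_in_basis: "ordered zs \<mu> \<in> insert 0 basis"
proof (cases "\<exists>z\<in>set zs. odd_root z \<and> \<mu> z \<ge> 2")
  case True
  then obtain z where z: "z \<in> set zs" "odd_root z" "\<mu> z \<ge> 2" by blast
  then have "kostant_letter X z (\<mu> z) = 0"
    using odd_power[of z "\<mu> z"] odd_letter[of z "\<mu> z"] zs(2) by simp
  then have "0 \<in> set (map (\<lambda>z. kostant_letter X z (\<mu> z)) zs)" using z(1) by force
  moreover have "0 \<in> set xs \<Longrightarrow> prod_list xs = 0" for xs :: "('k, 'n) ralg list" by (induction xs) auto
  ultimately show ?thesis by (simp add: ordered_def)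
next
  case False
  define \<nu> where "\<nu> z = (if z \<in> set zs then \<mu> z else 0)" for z
  have "\<nu> z \<le> 1" if "odd_root z" for z using False that by (cases "z \<in> set zs") (force simp: \<nu>_def)+
  then have "\<nu> \<in> exponents zs" by (simp add: exponents_def \<nu>_def)
  moreover have "ordered zs \<mu> = ordered zs \<nu>"
    unfolding ordered_def by (rule arg_cong[of _ _ prod_list], rule map_cong) (simp_all add: \<nu>_def)
  ultimately show ?thesis by (simp add: basis_of_def)
qed

lemma word_in_basis_span: "w \<in> words \<Longrightarrow> word w \<in> zspan basis"
proof -
  assume w: "w \<in> words"
  have "ordered zs \<mu> \<in> zspan basis" for \<mu>
  proof (cases "ordered zs \<mu> = 0")
    case True show ?thesis unfolding True by (rule int_module.span_zero)
  next
    case False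
    then show ?thesis using ordered_in_basis[of \<mu>] by (intro int_module.span_base) simp
  qed
  then have "zspan (range (ordered zs)) \<subseteq> zspan basis"
    by (intro int_module.span_minimal int_module.subspace_span image_subsetI)
  then show ?thesis using kostant_word_in_ordered_span[OF zs w] by blast
qed

lemma zspan_in_span: "zspan B \<subseteq> ralg.span B" for B :: "('k, 'n) ralg set"
proof
  fix x assume "x \<in> zspan B"
  then show "x \<in> ralg.span B"
    by (induction rule: int_module.span_induct_alt)
      (auto simp: ralg_of_int_scale ralg.span_zero intro: ralg.span_add ralg.span_scale ralg.span_base)
qed

lemma gen_is_letter:
  assumes g: "g \<in> rgens CARD('n)"
  obtains z where "z \<in> roots CARD('n)" "ralg_gen g = kostant_letter X z 1"
proof -
  from g consider i where "g = GE i" "i \<in> {1..<CARD('n)}" | i where "g = GF i" "i \<in> {1..<CARD('n)}"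
    | i where "g = GH i" "i \<in> {1..CARD('n)}" | "g = GB11"
    | i where "g = GB i" "i \<in> {1..<CARD('n)}" | i where "g = GC i" "i \<in> {1..<CARD('n)}"
    unfolding rgens_def by blast
  then show thesis
  proof cases
    case (1 i) then show thesis using that[of "Diff i (i + 1)"] A_up[of i] by simp
  next
    case (2 i) then show thesis using that[of "Diff (i + 1) i"] A_down[of i] by simp
  next
    case (3 i) then show thesis using that[of "Diff i i"] A_diag[of i] by simp
  next
    case 4
    have "scale_ralg (1 / 2) (S 1 1) = ralg_gen GB11"
      unfolding S_11 by (simp add: ralg.scale_right_distrib flip: ralg.scale_left_distrib)
    then show thesis using 4 that[of "Plus 1 1"] card_ge_1[where 'n='n] by simp
  next
    case (5 i) then show thesis using that[of "Plus i (i + 1)"] S_simple[of i] by simp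
  next
    case (6 i) then show thesis using that[of "Minus i (i + 1)"] T_simple[of i] by simp
  qed
qed

lemma basis_span: "ralg.span basis = UNIV"
proof -
  have "\<exists>w\<in>words. prod_list (map ralg_gen gs) = word w" if "set gs \<subseteq> rgens CARD('n)" for gs
    using that
  proof (induction gs)
    case Nil show ?case by (intro bexI[of _ "[]"]) simp_all
  next
    case (Cons g gs)
    then obtain w where w: "w \<in> words" "prod_list (map ralg_gen gs) = word w" by auto
    obtain z where "z \<in> roots CARD('n)" "ralg_gen g = kostant_letter X z 1" using Cons.prems by (auto elim: gen_is_letter)
    then show ?case using w by (intro bexI[of _ "(z, 1) # w"]) simp_all
  qed
  then have "prod_list (map ralg_gen gs) \<in> ralg.span basis" if gs: "set gs \<subseteq> rgens CARD('n)" for gs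
    using gs subsetD[OF zspan_in_span word_in_basis_span] by force
  then have "ralg.span {prod_list (map ralg_gen gs) | gs. set gs \<subseteq> rgens CARD('n)} \<subseteq> ralg.span basis"
    by (intro ralg.span_minimal ralg.subspace_span) auto
  then show ?thesis unfolding ralg_span_words by auto
qed

text \<open>
  An element of the kernel is a combination of ordered monomials, whose images are independent.
\<close>

lemma rho_inj: "inj (rho :: ('k, 'n) ralg \<Rightarrow> _)"
proof (rule injI)
  fix x y :: "('k, 'n) ralg" assume "rho x = rho y"
  then have zero: "rho (x - y) = 0" by (simp add: rho_diff)
  have "x - y \<in> ralg.span basis" by (simp add: basis_span)
  then obtain B a where B: "finite B" "B \<subseteq> basis" "x - y = (\<Sum>v\<in>B. scale_ralg (a v) v)"
    unfolding ralg.span_explicit by blast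
  have "a v = 0" if "v \<in> B" for v using basis_rho_independent[OF B(1,2), of a v] zero that B(3) by simp
  then have "x - y = 0" using B(3) by simp
  then show "x = y" by simp
qed

end

end


section \<open>Identification of the root vectors and of the integral form\<close>

lemma enumeration_of_roots:
  assumes "enumerates om1 (Phi_m1 n)" "enumerates o0m (Phi_0m n)" "enumerates o0p (Phi_0p n)" "enumerates o1 (Phi_1 n)"
  shows "distinct (om1 @ o0m @ map (\<lambda>i. Diff i i) [1..<n + 1] @ o0p @ o1)"
    "set (om1 @ o0m @ map (\<lambda>i. Diff i i) [1..<n + 1] @ o0p @ o1) = roots n"
proof -
  have s: "set om1 = Phi_m1 n" "set o0m = Phi_0m n" "set o0p = Phi_0p n" "set o1 = Phi_1 n"
    and d: "distinct om1" "distinct o0m" "distinct o0p" "distinct o1" using assms by (auto simp: enumerates_def)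
  show "distinct (om1 @ o0m @ map (\<lambda>i. Diff i i) [1..<n + 1] @ o0p @ o1)"
    using d by (auto simp: s Phi_m1_def Phi_0m_def Phi_0p_def Phi_1_def distinct_map inj_on_def)
  show "set (om1 @ o0m @ map (\<lambda>i. Diff i i) [1..<n + 1] @ o0p @ o1) = roots n"
  proof (intro set_eqI)
    fix z show "z \<in> set (om1 @ o0m @ map (\<lambda>i. Diff i i) [1..<n + 1] @ o0p @ o1) \<longleftrightarrow> z \<in> roots n"
      by (cases z) (auto simp: s Phi_m1_def Phi_0m_def Phi_0p_def Phi_1_def)
  qed
qed

context ralg_model
begin

context
  fixes om1 o0m o0p o1 :: "root list"
  assumes om1: "enumerates om1 (Phi_m1 CARD('n))" and o0m: "enumerates o0m (Phi_0m CARD('n))"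
    and o0p: "enumerates o0p (Phi_0p CARD('n))" and o1: "enumerates o1 (Phi_1 CARD('n))"
begin

definition "zs = om1 @ o0m @ map (\<lambda>i. Diff i i) [1..<CARD('n) + 1] @ o0p @ o1"

lemma zs: "distinct zs" "set zs = roots CARD('n)"
  unfolding zs_def by (rule enumeration_of_roots[OF om1 o0m o0p o1])+

lemmas rho_injective = rho_inj[OF zs]

text \<open>
  Injectivity turns the definite descriptions of the root vectors into mere membership statements.
\<close>

lemma the_rho_preimage: "x \<in> V \<Longrightarrow> rho x = u \<Longrightarrow> (THE x. x \<in> V \<and> rho x = u) = (x :: ('k, 'n) ralg)"
  using rho_injective by (auto intro!: the_equality dest: injD)

lemma vec_A_eq:
  assumes ij: "i \<in> {1..CARD('n)}" "j \<in> {1..CARD('n)}"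
  shows "vec_A i j = A i j"
  unfolding vec_A_def
proof (rule the_rho_preimage[OF _ rho_A[OF ij]])
  show "A i j \<in> ralg_0"
    unfolding ralg_0_def hull_def
    by (rule InterI, rule A_in_subspace[OF _ _ _ _ _ ij]) auto
qed

lemma ad_stable_com: "ad_stable V \<Longrightarrow> i \<in> {1..CARD('n)} \<Longrightarrow> j \<in> {1..CARD('n)} \<Longrightarrow> x \<in> V \<Longrightarrow> com (A i j) x \<in> V"
  unfolding ad_stable_def com_def using vec_A_eq by metis

lemma vec_B_eq:
  assumes "Plus i j \<in> roots CARD('n)"
  shows "vec_B i j = X (Plus i j)"
  unfolding vec_B_def
proof (rule the_rho_preimage)
  show "rho (X (Plus i j)) = upn_iota (pb i j)" using rho_X[OF assms] by (simp only: root_mat_def root.case)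
  show "X (Plus i j) \<in> ralg_1"
    unfolding ralg_1_def hull_def
  proof (rule InterI)
    fix V :: "('k, 'n) ralg set"
    assume "V \<in> {t. (ralg.subspace t \<and> ad_stable t) \<and> {ralg_gen GB11} \<subseteq> t}"
    then have V: "ralg.subspace V" "ad_stable V" "ralg_gen GB11 \<in> V" by auto
    have "S k l \<in> V" if "k \<in> {1..CARD('n)}" "l \<in> {1..CARD('n)}" for k l
      by (rule S_in_subspace[OF V(1) ad_stable_com[OF V(2)] V(3) that])
    then show "X (Plus i j) \<in> V" using assms ralg.subspace_scale[OF V(1)] by auto
  qed
qed

lemma vec_C_eq:
  assumes "Minus i j \<in> roots CARD('n)"
  shows "vec_C i j = X (Minus i j)"
  unfolding vec_C_def
proof (rule the_rho_preimage)
  show "rho (X (Minus i j)) = upn_iota (pc i j)" using rho_X[OF assms] by (simp only: root_mat_def root.case)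
  have ij: "i \<in> {1..CARD('n)}" "j \<in> {1..CARD('n)}" and n: "CARD('n) \<ge> 2" using assms by auto
  show "X (Minus i j) \<in> ralg_m1"
    unfolding ralg_m1_def hull_def
  proof (rule InterI)
    fix V :: "('k, 'n) ralg set"
    assume "V \<in> {t. (ralg.subspace t \<and> ad_stable t) \<and> (if CARD('n) = 1 then {} else {ralg_gen (GC (CARD('n) - 1))}) \<subseteq> t}"
    then have V: "ralg.subspace V" "ad_stable V" "rC (CARD('n) - 1) \<in> V" using n by auto
    show "X (Minus i j) \<in> V"
      using T_in_subspace[OF V(1) ad_stable_com[OF V(2)] n V(3) ij] by simp
  qed
qed

lemma root_vec_eq: "z \<in> roots CARD('n) \<Longrightarrow> root_vec z = X z"
  by (cases z) (simp_all only: roots_simps vec_A_eq vec_B_eq vec_C_eq root_vec.simps pn_vec.simps(1) simp_thms)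

text \<open>
  The factors of Kostant monomials are the letters of the straightening argument, with odd exponents bounded by one.
\<close>

lemma factors_are_letters: "kostant_factors = {kostant_letter X z r | z r. z \<in> roots CARD('n) \<and> (odd_root z \<longrightarrow> r \<le> 1)}"
    (is "_ = ?L")
proof (intro set_eqI iffI)
  fix x :: "('k, 'n) ralg" assume "x \<in> kostant_factors"
  then consider \<delta> d where "x = root_vec \<delta> ^ d" "\<delta> \<in> Phi_m1 CARD('n) \<union> Phi_1 CARD('n)" "d \<in> {0, 1}"
    | \<alpha> r where "x = divpow (root_vec \<alpha>) r" "\<alpha> \<in> Phi_0p CARD('n) \<union> Phi_0m CARD('n)"
    | i s where "x = hbinom (rH i) s" "i \<in> {1..CARD('n)}" unfolding kostant_factors_def by blast
  then show "x \<in> ?L"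
  proof cases
    case (1 \<delta> d)
    then have \<delta>: "\<delta> \<in> roots CARD('n)" "odd_root \<delta>" by (auto simp: Phi_m1_def Phi_1_def)
    then have "x = kostant_letter X \<delta> d" using 1(1) odd_letter[of \<delta> d] root_vec_eq by simp
    then show ?thesis using \<delta> 1(3) by auto
  next
    case (2 \<alpha> r)
    then obtain i j where ij: "\<alpha> = Diff i j" "i \<noteq> j" "\<alpha> \<in> roots CARD('n)" by (auto simp: Phi_0p_def Phi_0m_def)
    have "root_vec \<alpha> = A i j" using root_vec_eq[OF ij(3)] unfolding ij(1) by simp
    then have "x = kostant_letter X \<alpha> r" using 2(1) ij(1,2) by simp
    then show ?thesis using ij(1,3) odd_root_simps(1) by blast
  next
    case (3 i s)
    then have "x = kostant_letter X (Diff i i) s" using A_diag by simp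
    then show ?thesis using 3(2) odd_root_simps(1) roots_simps(1) by blast
  qed
next
  fix x :: "('k, 'n) ralg" assume "x \<in> ?L"
  then obtain z r where x: "x = kostant_letter X z r" and z: "z \<in> roots CARD('n)" and r: "odd_root z \<longrightarrow> r \<le> 1" by blast
  consider "odd_root z" | i where "z = Diff i i" | i j where "z = Diff i j" "i \<noteq> j" by (cases z) auto
  then show "x \<in> kostant_factors"
  proof cases
    case 1
    then have "z \<in> Phi_m1 CARD('n) \<union> Phi_1 CARD('n)" "r \<in> {0, 1}" using z r by (auto simp: roots_def)
    moreover have "x = root_vec z ^ r" using x odd_letter[of z r] 1 root_vec_eq[OF z] by simp
    ultimately show ?thesis unfolding kostant_factors_def by blast
  next
    case (2 i)
    then have "x = hbinom (rH i) r" "i \<in> {1..CARD('n)}" using x z A_diag by auto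
    then show ?thesis unfolding kostant_factors_def by blast
  next
    case (3 i j)
    then have "z \<in> Phi_0p CARD('n) \<union> Phi_0m CARD('n)" using z by (auto simp: Phi_0p_def Phi_0m_def)
    moreover have "x = divpow (root_vec z) r" unfolding root_vec_eq[OF z] using x 3 by simp
    ultimately show ?thesis unfolding kostant_factors_def by blast
  qed
qed

lemma ordered_monomial_eq:
  assumes \<mu>: "\<And>z. z \<in> set om1 \<Longrightarrow> d z = \<mu> z" "\<And>z. z \<in> set o1 \<Longrightarrow> d z = \<mu> z"
    "\<And>z. z \<in> set o0m \<Longrightarrow> r z = \<mu> z" "\<And>z. z \<in> set o0p \<Longrightarrow> r z = \<mu> z"
    "\<And>i. i \<in> {1..CARD('n)} \<Longrightarrow> s i = \<mu> (Diff i i)"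
  shows "ordered_monomial om1 o0m o0p o1 d r s = ordered zs \<mu>"
proof -
  have sets: "set om1 = Phi_m1 CARD('n)" "set o0m = Phi_0m CARD('n)" "set o0p = Phi_0p CARD('n)" "set o1 = Phi_1 CARD('n)"
    using om1 o0m o0p o1 by (auto simp: enumerates_def)
  have odd: "root_vec z ^ m = kostant_letter X z m" if "z \<in> Phi_m1 CARD('n) \<union> Phi_1 CARD('n)" for z m
  proof -
    have "z \<in> roots CARD('n)" "odd_root z" using that by (auto simp: Phi_m1_def Phi_1_def)
    then show ?thesis using odd_letter[of z m] root_vec_eq by simp
  qed
  have even: "divpow (root_vec z) m = kostant_letter X z m" if z: "z \<in> Phi_0p CARD('n) \<union> Phi_0m CARD('n)" for z m
  proof -
    obtain i j where ij: "z = Diff i j" "i \<noteq> j" "z \<in> roots CARD('n)" using z by (auto simp: Phi_0p_def Phi_0m_def)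
    have "root_vec z = A i j" using root_vec_eq[OF ij(3)] unfolding ij(1) by simp
    then show ?thesis using ij by simp
  qed
  have 1: "map (\<lambda>z. root_vec z ^ d z) om1 = map (\<lambda>z. kostant_letter X z (\<mu> z)) om1"
    "map (\<lambda>z. root_vec z ^ d z) o1 = map (\<lambda>z. kostant_letter X z (\<mu> z)) o1"
    using \<mu>(1,2) odd sets by simp_all
  have 2: "map (\<lambda>z. divpow (root_vec z) (r z)) o0m = map (\<lambda>z. kostant_letter X z (\<mu> z)) o0m"
    "map (\<lambda>z. divpow (root_vec z) (r z)) o0p = map (\<lambda>z. kostant_letter X z (\<mu> z)) o0p"
    using \<mu>(3,4) even sets by simp_all
  have 3: "map (\<lambda>i. hbinom (rH i) (s i)) [1..<CARD('n) + 1]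
      = map (\<lambda>z. kostant_letter X z (\<mu> z)) (map (\<lambda>i. Diff i i) [1..<CARD('n) + 1])"
    unfolding map_map by (rule map_cong) (use \<mu>(5) A_diag in auto)
  show ?thesis
    unfolding ordered_monomial_def 1 2 3 ordered_def zs_def by (simp add: mult.assoc)
qed

lemma ordered_monomials_eq: "ordered_monomials om1 o0m o0p o1 = basis_of zs"
proof (intro set_eqI iffI)
  have sets: "set om1 = Phi_m1 CARD('n)" "set o0m = Phi_0m CARD('n)" "set o0p = Phi_0p CARD('n)" "set o1 = Phi_1 CARD('n)"
    using om1 o0m o0p o1 by (auto simp: enumerates_def)
  fix x :: "('k, 'n) ralg"
  { assume "x \<in> ordered_monomials om1 o0m o0p o1"
    then obtain d r s where x: "x = ordered_monomial om1 o0m o0p o1 d r s" and d: "\<And>\<delta>. d \<delta> \<in> {0, 1}"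
      unfolding ordered_monomials_def by blast
    define \<mu> where "\<mu> z = (if z \<in> set zs then (case z of Diff i j \<Rightarrow> if i = j then s i else r z | _ \<Rightarrow> d z) else 0)" for z
    have "\<mu> z \<le> 1" if "odd_root z" for z
      using d[of z] that by (cases z) (auto simp: \<mu>_def)
    then have mem: "\<mu> \<in> exponents zs" by (simp add: exponents_def \<mu>_def)
    have eq: "x = ordered zs \<mu>"
      unfolding x by (rule ordered_monomial_eq)
        (auto simp: \<mu>_def zs(2) sets Phi_m1_def Phi_1_def Phi_0m_def Phi_0p_def)
    show "x \<in> basis_of zs" unfolding basis_of_def using eq mem by blast }
  assume "x \<in> basis_of zs"
  then obtain \<mu> where \<mu>: "\<mu> \<in> exponents zs" and x: "x = ordered zs \<mu>" unfolding basis_of_def by blast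
  define d where "d z = (if odd_root z then \<mu> z else 0)" for z
  have "x = ordered_monomial om1 o0m o0p o1 d \<mu> (\<lambda>i. \<mu> (Diff i i))"
    unfolding x by (rule ordered_monomial_eq[symmetric]) (auto simp: d_def sets Phi_m1_def Phi_1_def)
  moreover have "d z \<in> {0, 1}" for z
  proof -
    have "d z \<le> 1" using \<mu> by (simp add: d_def exponents_def)
    then show ?thesis by auto
  qed
  ultimately show "x \<in> ordered_monomials om1 o0m o0p o1" unfolding ordered_monomials_def by blast
qed

lemma basis_zspan: "zspan (basis_of zs) = ralg_Z"
proof
  have "ordered zs \<mu> \<in> kostant_monomials" if \<mu>: "\<mu> \<in> exponents zs" for \<mu>
  proof -
    have "set (map (\<lambda>z. kostant_letter X z (\<mu> z)) zs) \<subseteq> kostant_factors"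
    proof
      fix x assume "x \<in> set (map (\<lambda>z. kostant_letter X z (\<mu> z)) zs)"
      then obtain z where "x = kostant_letter X z (\<mu> z)" "z \<in> roots CARD('n)" unfolding set_map zs(2) by blast
      moreover have "odd_root z \<longrightarrow> \<mu> z \<le> 1" using \<mu> by (simp add: exponents_def)
      ultimately show "x \<in> kostant_factors" unfolding factors_are_letters by blast
    qed
    then show ?thesis unfolding ordered_def kostant_monomials_def by blast
  qed
  then show "zspan (basis_of zs) \<subseteq> ralg_Z"
    unfolding ralg_Z_def basis_of_def by (intro int_module.span_mono) blast
  have "\<exists>w\<in>words. prod_list xs = word w" if "set xs \<subseteq> kostant_factors" for xs
    using that
  proof (induction xs)
    case Nil show ?case by (intro bexI[of _ "[]"]) simp_all
  next
    case (Cons x xs)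
    then obtain w where w: "w \<in> words" "prod_list xs = word w" by auto
    obtain z r where "z \<in> roots CARD('n)" "x = kostant_letter X z r"
      using Cons.prems unfolding factors_are_letters by auto
    then show ?case using w by (intro bexI[of _ "(z, r) # w"]) simp_all
  qed
  then have "kostant_monomials \<subseteq> zspan (basis_of zs)"
    using word_in_basis_span[OF zs] unfolding kostant_monomials_def by force
  then show "ralg_Z \<subseteq> zspan (basis_of zs)"
    unfolding ralg_Z_def by (intro int_module.span_minimal int_module.subspace_span)
qed

lemma rho_iso: "superalg_iso scale_ralg grade_ralg scale_upn grade_upn (rho :: ('k, 'n) ralg \<Rightarrow> _)"
proof -
  have bij: "bij (rho :: ('k, 'n) ralg \<Rightarrow> _)" using rho_injective rho_surj by (simp add: bij_def)
  let ?i = "inv (rho :: ('k, 'n) ralg \<Rightarrow> _)"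
  have r: "rho (?i u) = u" for u using bij by (simp add: bij_inv_eq_iff[symmetric, of _ u] bij_is_surj surj_f_inv_f)
  have eq: "?i u = x" if "rho x = u" for u x using rho_injective that by (auto simp: inv_f_f)
  have "Vector_Spaces.linear scale_upn scale_ralg ?i"
    unfolding linear_iff_module_hom module_hom_def module_hom_axioms_def
    using upn.module_axioms ralg.module_axioms by (auto intro!: eq simp: rho_hom r)
  moreover have "?i 1 = 1" "?i (u * v) = ?i u * ?i v" for u v by (auto intro!: eq simp: rho_hom r)
  moreover have "?i ` grade_upn p \<subseteq> grade_ralg p" for p
    using grade_upn_image[of p] eq by fastforce
  ultimately show ?thesis
    unfolding superalg_iso_def using rho_superalg_hom bij by (simp add: superalg_hom_def)
qed

theorem kostant_basis:
  "int_module.independent (ordered_monomials om1 o0m o0p o1 :: ('k, 'n) ralg set)"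
  "int_module.span (ordered_monomials om1 o0m o0p o1) = (ralg_Z :: ('k, 'n) ralg set)"
  "ralg.independent (ordered_monomials om1 o0m o0p o1 :: ('k, 'n) ralg set)"
  "ralg.span (ordered_monomials om1 o0m o0p o1) = (UNIV :: ('k, 'n) ralg set)"
  unfolding ordered_monomials_eq
  using basis_int_independent[OF zs] basis_zspan basis_independent[OF zs] basis_span[OF zs] by simp_all

end

end

theorem theorem3p7p2:
  fixes om1 o0m o0p o1 :: "root list"
  assumes "enumerates om1 (Phi_m1 CARD('n::finite))"
    and "enumerates o0m (Phi_0m CARD('n))"
    and "enumerates o0p (Phi_0p CARD('n))"
    and "enumerates o1 (Phi_1 CARD('n))"
  defines "K \<equiv> (ordered_monomials om1 o0m o0p o1 ::
      ('k::{alg_closed_field, field_char_0}, 'n) ralg set)"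
  shows "(int_module.independent K \<and> int_module.span K = ralg_Z) \<and>
    (ralg.independent K \<and> ralg.span K = UNIV) \<and>
    superalg_iso scale_ralg grade_ralg scale_upn grade_upn
      (rho :: ('k, 'n) ralg \<Rightarrow> ('k, 'n) upn)"
proof -
  obtain A S T :: "nat \<Rightarrow> nat \<Rightarrow> ('k, 'n) ralg" where "ralg_model A S T"
  proof (rule exists_ralg_family)
    fix A S T :: "nat \<Rightarrow> nat \<Rightarrow> ('k, 'n) ralg"
    assume "pn_family CARD('n) A S T" "\<And>i. i \<in> {1..CARD('n)} \<Longrightarrow> A i i = rH i"
      "\<And>i. i \<in> {1..<CARD('n)} \<Longrightarrow> A i (i + 1) = rE i" "\<And>i. i \<in> {1..<CARD('n)} \<Longrightarrow> A (i + 1) i = rF i"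
      "S 1 1 = ralg_gen GB11 + ralg_gen GB11"
      "\<And>i. i \<in> {1..<CARD('n)} \<Longrightarrow> S i (i + 1) = rB i" "\<And>i. i \<in> {1..<CARD('n)} \<Longrightarrow> T i (i + 1) = rC i"
      "\<And>i j. i \<in> {1..CARD('n)} \<Longrightarrow> j \<in> {1..CARD('n)} \<Longrightarrow> rho (A i j) = uA i j"
      "\<And>i j. i \<in> {1..CARD('n)} \<Longrightarrow> j \<in> {1..CARD('n)} \<Longrightarrow> rho (S i j) = uS i j"
      "\<And>i j. i \<in> {1..CARD('n)} \<Longrightarrow> j \<in> {1..CARD('n)} \<Longrightarrow> rho (T i j) = uT i j"
    then have "ralg_model A S T" unfolding ralg_model_def ralg_model_axioms_def ralg_family_def by blast
    then show thesis by (rule that)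
  qed
  then interpret ralg_model A S T .
  show ?thesis
    unfolding K_def using kostant_basis[OF assms(1-4)] rho_iso[OF assms(1-4)] by blast
qed

end
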